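(* Let $\epsilon>0$ be arbitrary. Then for all $v$ large enough there exists a Borel set $G_\epsilon(-v)\subseteq\mathbb{R}\times\mathbb{M}$ such that with probability at least $1-\epsilon$, $$\frac{\mathcal{E}\big([-v,\infty)\,;\ G_\epsilon(-v)\big)}{\mathcal{E}\big([-v,\infty)\big)}\ge1-\epsilon\qquad\text{and}\qquad\frac{\mathcal{E}^*\big([-v,\infty)\,;\ G_\epsilon(-v)\big)}{\mathcal{E}^*\big([-v,\infty)\big)}<\epsilon .$$ The same holds for all $t$ large enough (depending on $v$ and $\epsilon$) if $\mathcal{E}$ and $\mathcal{E}^*$ are replaced by $\mathcal{E}_t$ and $\mathcal{E}^*_t$ respectively.
   Context: Branching Brownian motion (BBM). $L_t$ is the set of particles alive at time $t\ge0$ in a continuous-time Galton–Watson process started from one particle, with binary branching at rate $1$; $T=\bigcup_{t\ge0}L_t$. The genealogical distance is, for $x\in L_t$, $x'\in L_{t'}$, $\mathrm{d}(x,x')=\inf\{\frac{(t-s)+(t'-s)}{2}: s\ge0,\ x,x'\text{ share a common ancestor in }L_s\}$. Conditionally on $(T,\mathrm{d})$, $h=(h(x):x\in T)$ is a mean-zero Gaussian process with $\mathbb{E}\,h(x)h(x')=(t+t')/2-\mathrm{d}(x,x')$ for $x\in L_t,x'\in L_{t'}$ (i.e. the largest time at which $x,x'$ share a common ancestor). $h_t$ is the restriction of $h$ to particles born up to time $t$; for $x\in L_t$, $h_t(x)=h(x)$ is the height of $x$. Set $m_t=\sqrt2 t-\frac{3}{2\sqrt2}\log^+t$ with $\log^+t=\log(t\vee1)$.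 Clusters. For $x\in L_t$, $r>0$: $\mathrm{B}_r(x)=\{y\in L_t:\mathrm{d}(x,y)<r\}$ and $\mathcal{C}_{t,r}(x)=\sum_{y\in \mathrm{B}_r(x)}\delta_{h_t(y)-h_t(x)}$. Fix a positive function $t\mapsto r_t$ with $r_t\to\infty$ and $t-r_t\to\infty$ as $t\to\infty$. Let $L_t^*=\{x\in L_t: h_t(x)\ge h_t(y)\ \forall y\in \mathrm{B}_{r_t}(x)\}$ and $\widehat{\mathcal{E}}_t=\sum_{x\in L_t^*}\delta_{h_t(x)-m_t}\otimes\delta_{\mathcal{C}_{t,r_t}(x)}$, a point process on $\mathbb{R}\times\mathbb{M}$, where $\mathbb{M}$ is the space of point measures on $(-\infty,0]$. Limits. Let $Z_t=C_\diamond\sum_{x\in L_t}(\sqrt2t-h_t(x))e^{\sqrt2(h_t(x)-\sqrt2t)}$ for the properly chosen constant $C_\diamond>0$, and let $Z$ be its almost sure limit as $t\to\infty$. It is known (Aïdékon–Berestycki–Brunet–Shi; Arguin–Bovier–Kistler) that $(\widehat{\mathcal{E}}_t,Z_t)\Rightarrow(\widehat{\mathcal{E}},Z)$ as $t\to\infty$, where, conditionally on $Z$, $\widehat{\mathcal{E}}$ is a Poisson point process with intensity $Ze^{-\sqrt2u}\,du\otimes\nu$, for a deterministic probability distribution $\nu$ on $\mathbb{M}$ (the cluster distribution). Derived processes. $\mathcal{E}_t=\sum_{x\in L_t}\delta_{h_t(x)-m_t}$, $\mathcal{E}=\sum_{(u,\mathcal{C})\in\widehat{\mathcal{E}}}\mathcal{C}(\cdot-u)$,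 $\mathcal{E}_t^*=\sum_{x\in L_t^*}\delta_{h_t(x)-m_t}$, $\mathcal{E}^*=\sum_{(u,\mathcal{C})\in\widehat{\mathcal{E}}}\delta_u$. For Borel $B\subseteq\mathbb{R}\times\mathbb{M}$, $$\mathcal{E}(\cdot\,;B)=\sum_{(u,\mathcal{C})\in\widehat{\mathcal{E}}}\mathcal{C}(\cdot-u)1_{\{(u,\mathcal{C})\in B\}},\qquad \mathcal{E}^*(\cdot\,;B)=\sum_{(u,\mathcal{C})\in\widehat{\mathcal{E}}}\delta_u1_{\{(u,\mathcal{C})\in B\}},$$ and $\mathcal{E}_t(\cdot\,;B)$, $\mathcal{E}_t^*(\cdot\,;B)$ are defined in the same way with $\widehat{\mathcal{E}}_t$ in place of $\widehat{\mathcal{E}}$. *)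

theory Defs
  imports "HOL-Probability.Probability" "HOL-Library.Sublist"
begin

section \<open>Branching Brownian motion\<close>

text \<open>
  Particles carry Ulam--Harris labels: the root is \<^term>\<open>[]\<close> and the two children of \<open>u\<close> are
  \<open>u @ [False]\<close> and \<open>u @ [True]\<close>. A realization of the tree is given by the lifetimes
  \<open>\<tau> u\<close> of all labels, and a particle at time \<open>t\<close> is represented by its label together
  with \<open>t\<close>. A realization of the heights is a function \<open>h\<close>, where \<open>h t u\<close> is the height at time
  \<open>t\<close> of the particle \<open>u\<close>; it is meaningful only when \<open>u\<close> is alive at time \<open>t\<close>.
\<close>

type_synonym particle = "bool list"

definition birth_time :: "(particle \<Rightarrow> real) \<Rightarrow> particle \<Rightarrow> real" where
  "birth_time \<tau> u = (\<Sum>w | strict_prefix w u. \<tau> w)"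

definition alive :: "(particle \<Rightarrow> real) \<Rightarrow> real \<Rightarrow> particle set" where
  "alive \<tau> t = {u. birth_time \<tau> u \<le> t \<and> t < birth_time \<tau> u + \<tau> u}"

definition gdist :: "(particle \<Rightarrow> real) \<Rightarrow> real \<Rightarrow> particle \<Rightarrow> real \<Rightarrow> particle \<Rightarrow> real" where
  "gdist \<tau> t x t' x' =
     Inf {((t - s) + (t' - s)) / 2 | s.
            0 \<le> s \<and> s \<le> t \<and> s \<le> t' \<and> (\<exists>w\<in>alive \<tau> s. prefix w x \<and> prefix w x')}"

text \<open>The law \<open>N(0, v)\<close>; for \<open>v = 0\<close> this is the Dirac mass at 0.\<close>

definition centred_gaussian :: "real \<Rightarrow> real measure" where
  "centred_gaussian v = distr std_normal_distribution borel (\<lambda>z. sqrt v * z)"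

definition tree_sigma :: "'w measure \<Rightarrow> ('w \<Rightarrow> particle \<Rightarrow> real) \<Rightarrow> 'w measure" where
  "tree_sigma M \<tau> = vimage_algebra (space M) \<tau> (Pi\<^sub>M UNIV (\<lambda>_. borel))"

text \<open>
  Strict positivity of the lifetimes and absence of explosion hold almost surely in any case;
  imposing them surely amounts to discarding a null set of \<open>M\<close>. Conditionally on the tree, \<open>h\<close> is
  centred Gaussian: every finite linear combination of heights of living particles has conditional
  law \<open>N(0, v)\<close>, with \<open>v\<close> computed from the covariances \<open>(t + t') / 2 - d(x, x')\<close>.
  As usual for Brownian motion, the trajectory along every ancestral line is continuous; without
  this the limit of the derivative martingale along real times would depend on the chosen version.
\<close>

definition branching_brownian_motion ::
    "'w measure \<Rightarrow> ('w \<Rightarrow> particle \<Rightarrow> real) \<Rightarrow> ('w \<Rightarrow> real \<Rightarrow> particle \<Rightarrow> real) \<Rightarrow> bool" where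
  "branching_brownian_motion M \<tau> h \<longleftrightarrow>
     prob_space M \<and>
     prob_space.indep_vars M (\<lambda>_. borel) (\<lambda>u \<omega>. \<tau> \<omega> u) UNIV \<and>
     (\<forall>u. distributed M lborel (\<lambda>\<omega>. \<tau> \<omega> u) (exponential_density 1)) \<and>
     (\<forall>\<omega>\<in>space M. (\<forall>u. 0 < \<tau> \<omega> u) \<and> (\<forall>t\<ge>0. finite (alive (\<tau> \<omega>) t))) \<and>
     (\<forall>t\<ge>0. \<forall>u. (\<lambda>\<omega>. h \<omega> t u) \<in> borel_measurable M) \<and>
     (\<forall>(I :: (real \<times> particle) set) (c :: real \<times> particle \<Rightarrow> real). \<forall>A\<in>sets borel.
        finite I \<and> (\<forall>(t, x)\<in>I. 0 \<le> t) \<longrightarrow>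
        (AE \<omega> in M. (\<forall>(t, x)\<in>I. x \<in> alive (\<tau> \<omega>) t) \<longrightarrow>
           real_cond_exp M (tree_sigma M \<tau>)
             (indicator {\<omega>'\<in>space M. (\<Sum>(t, x)\<in>I. c (t, x) * h \<omega>' t x) \<in> A}) \<omega> =
           measure (centred_gaussian
             (\<Sum>(t, x)\<in>I. \<Sum>(t', x')\<in>I.
                c (t, x) * c (t', x') * ((t + t') / 2 - gdist (\<tau> \<omega>) t x t' x'))) A)) \<and>
     (AE \<omega> in M. \<forall>t\<ge>0. \<forall>x\<in>alive (\<tau> \<omega>) t. \<exists>\<gamma>. continuous_on {0..t} \<gamma> \<and>
        (\<forall>s\<in>{0..t}. \<forall>w\<in>alive (\<tau> \<omega>) s. prefix w x \<longrightarrow> h \<omega> s w = \<gamma> s))"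

definition m_centre :: "real \<Rightarrow> real" where
  "m_centre t = sqrt 2 * t - 3 / (2 * sqrt 2) * ln (max t 1)"

definition deriv_mart ::
    "real \<Rightarrow> (particle \<Rightarrow> real) \<Rightarrow> (real \<Rightarrow> particle \<Rightarrow> real) \<Rightarrow> real \<Rightarrow> real" where
  "deriv_mart C \<tau> h t =
     C * (\<Sum>x\<in>alive \<tau> t. (sqrt 2 * t - h t x) * exp (sqrt 2 * (h t x - sqrt 2 * t)))"


section \<open>Point measures and vague topologies\<close>

text \<open>
  A sum of Dirac masses \<open>\<Sum>i\<in>I. \<delta>\<^bsub>f i\<^esub>\<close> on the measurable space \<open>S\<close> is
  \<^term>\<open>distr (count_space I) S f\<close>. Below, \<open>S\<close> is the measurable space, \<open>X\<close> the set where the atoms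
  may lie and \<open>\<B>\<close> a family of sets on which only finitely many atoms (with multiplicity) are allowed.
\<close>

definition point_measures :: "'a measure \<Rightarrow> 'a set \<Rightarrow> 'a set set \<Rightarrow> 'a measure set" where
  "point_measures S X \<B> =
     {distr (count_space I) S f | (I :: nat set) f. f ` I \<subseteq> X \<and> (\<forall>B\<in>\<B>. finite {i\<in>I. f i \<in> B})}"

definition vague_topology :: "'a measure set \<Rightarrow> ('a \<Rightarrow> real) set \<Rightarrow> 'a measure topology" where
  "vague_topology P F =
     topology_generated_by {{\<mu>\<in>P. integral\<^sup>L \<mu> f \<in> U} | f U. f \<in> F \<and> open U}"

definition borel_of_topology :: "'a topology \<Rightarrow> 'a measure" where
  "borel_of_topology T = sigma (topspace T) {U. openin T U}"

text \<open>
  The space \<open>\<M>\<close> of locally finite point measures on \<open>(-\<infinity>, 0]\<close>, realized as measures on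
  the real line. Every continuous, compactly supported function on \<open>(-\<infinity>, 0]\<close> extends to one
  on the line, so the topology is the vague topology of \<open>(-\<infinity>, 0]\<close>.
\<close>

definition cluster_space :: "real measure set" where
  "cluster_space = point_measures borel {..0} (range atLeast)"

definition cluster_topology :: "real measure topology" where
  "cluster_topology =
     vague_topology cluster_space {f. continuous_on UNIV f \<and> (\<exists>a. \<forall>x. a < \<bar>x\<bar> \<longrightarrow> f x = 0)}"

definition cluster_borel :: "real measure measure" where
  "cluster_borel = borel_of_topology cluster_topology"

text \<open>
  The Borel sets of \<open>\<real> \<times> \<M>\<close>; both factors are separable metrizable, so these are the sets of
  the product \<open>\<sigma>\<close>-algebra.
\<close>

definition marked_borel :: "(real \<times> real measure) measure" where
  "marked_borel = borel \<Otimes>\<^sub>M cluster_borel"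

text \<open>
  Point measures on \<open>\<real> \<times> \<M>\<close>. Since \<open>\<M>\<close> is not locally compact, a localizing family
  has to be fixed: the sets contained in some \<open>[a, \<infinity>) \<times> \<M>\<close>, on which the intensity
  \<open>Z exp(-\<surd>2 u) du \<otimes> \<nu>\<close> is finite. The test functions of the vague topology are the bounded
  continuous functions supported in such a set.
\<close>

definition marked_point_space :: "(real \<times> real measure) measure set" where
  "marked_point_space =
     point_measures marked_borel (UNIV \<times> cluster_space) (range (\<lambda>a. {a..} \<times> cluster_space))"

definition marked_point_topology :: "(real \<times> real measure) measure topology" where
  "marked_point_topology =
     vague_topology marked_point_space
       {f. continuous_map (prod_topology euclideanreal cluster_topology) euclideanreal f \<and>
           (\<exists>K. \<forall>u. \<forall>C\<in>cluster_space. \<bar>f (u, C)\<bar> \<le> K) \<and>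
           (\<exists>a. \<forall>u<a. \<forall>C\<in>cluster_space. f (u, C) = 0)}"

definition weakly_converges ::
    "'w measure \<Rightarrow> 'a topology \<Rightarrow> (real \<Rightarrow> 'w \<Rightarrow> 'a) \<Rightarrow> ('w \<Rightarrow> 'a) \<Rightarrow> bool" where
  "weakly_converges M T X Y \<longleftrightarrow>
     (\<forall>F. continuous_map T euclideanreal F \<and> (\<exists>K. \<forall>x\<in>topspace T. \<bar>F x\<bar> \<le> K) \<longrightarrow>
        ((\<lambda>t. \<integral>\<omega>. F (X t \<omega>) \<partial>M) \<longlongrightarrow> (\<integral>\<omega>. F (Y \<omega>) \<partial>M)) at_top)"

text \<open>
  Conditionally on the \<open>\<sigma>\<close>-algebra \<open>G\<close>, the random measure \<open>X\<close> on \<open>S\<close> is a Poisson point process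
  with (\<open>G\<close>-measurable, random) intensity \<open>\<Lambda>\<close>: on disjoint sets of finite intensity the counts are
  conditionally independent Poisson variables with means given by \<open>\<Lambda>\<close>.
\<close>

definition conditionally_poisson_process ::
    "'w measure \<Rightarrow> 'w measure \<Rightarrow> 'a measure \<Rightarrow> ('w \<Rightarrow> 'a measure) \<Rightarrow> ('w \<Rightarrow> 'a measure) \<Rightarrow> bool" where
  "conditionally_poisson_process M G S X \<Lambda> \<longleftrightarrow>
     (\<forall>(k :: nat) (A :: nat \<Rightarrow> 'a set) (n :: nat \<Rightarrow> nat).
        (\<forall>i<k. A i \<in> sets S) \<and> disjoint_family_on A {..<k} \<longrightarrow>
        (AE \<omega> in M. (\<forall>i<k. emeasure (\<Lambda> \<omega>) (A i) < \<infinity>) \<longrightarrow>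
           real_cond_exp M G
             (indicator {\<omega>'\<in>space M. \<forall>i<k. emeasure (X \<omega>') (A i) = of_nat (n i)}) \<omega> =
           (\<Prod>i<k. measure (\<Lambda> \<omega>) (A i) ^ n i / fact (n i) * exp (- measure (\<Lambda> \<omega>) (A i)))))"

definition limit_intensity :: "real measure measure \<Rightarrow> real \<Rightarrow> (real \<times> real measure) measure" where
  "limit_intensity \<nu> z =
     scale_measure (ennreal z) (density lborel (\<lambda>u. ennreal (exp (- sqrt 2 * u))) \<Otimes>\<^sub>M \<nu>)"


section \<open>Extremal processes\<close>

definition genealogical_ball ::
    "(particle \<Rightarrow> real) \<Rightarrow> real \<Rightarrow> real \<Rightarrow> particle \<Rightarrow> particle set" where
  "genealogical_ball \<tau> t r x = {y\<in>alive \<tau> t. gdist \<tau> t x t y < r}"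

definition cluster ::
    "(particle \<Rightarrow> real) \<Rightarrow> (real \<Rightarrow> particle \<Rightarrow> real) \<Rightarrow> real \<Rightarrow> real \<Rightarrow> particle \<Rightarrow> real measure" where
  "cluster \<tau> h t r x = distr (count_space (genealogical_ball \<tau> t r x)) borel (\<lambda>y. h t y - h t x)"

definition local_maxima ::
    "(particle \<Rightarrow> real) \<Rightarrow> (real \<Rightarrow> particle \<Rightarrow> real) \<Rightarrow> real \<Rightarrow> real \<Rightarrow> particle set" where
  "local_maxima \<tau> h t r = {x\<in>alive \<tau> t. \<forall>y\<in>genealogical_ball \<tau> t r x. h t y \<le> h t x}"

definition marked_process ::
    "(particle \<Rightarrow> real) \<Rightarrow> (real \<Rightarrow> particle \<Rightarrow> real) \<Rightarrow> real \<Rightarrow> real \<Rightarrow> (real \<times> real measure) measure" where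
  "marked_process \<tau> h t r =
     distr (count_space (local_maxima \<tau> h t r)) marked_borel
       (\<lambda>x. (h t x - m_centre t, cluster \<tau> h t r x))"

definition level_process ::
    "(particle \<Rightarrow> real) \<Rightarrow> (real \<Rightarrow> particle \<Rightarrow> real) \<Rightarrow> real \<Rightarrow> real measure" where
  "level_process \<tau> h t = distr (count_space (alive \<tau> t)) borel (\<lambda>x. h t x - m_centre t)"

definition level_process_star ::
    "(particle \<Rightarrow> real) \<Rightarrow> (real \<Rightarrow> particle \<Rightarrow> real) \<Rightarrow> real \<Rightarrow> real \<Rightarrow> real measure" where
  "level_process_star \<tau> h t r =
     distr (count_space (local_maxima \<tau> h t r)) borel (\<lambda>x. h t x - m_centre t)"

text \<open>
  For a point measure \<open>X\<close> on \<open>\<real> \<times> \<M>\<close>, the sums over the atoms \<open>(u, C)\<close> of \<open>X\<close> lying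
  in \<open>B\<close> of \<open>C(A - u)\<close> and of \<open>\<delta>\<^sub>u(A)\<close>, respectively, written as integrals against \<open>X\<close>. The
  preimage of \<open>A\<close> under \<open>(+) u\<close> is \<open>A - u\<close>. The unrestricted sums are obtained with \<open>B = UNIV\<close>.
\<close>

definition cluster_level :: "(real \<times> real measure) measure \<Rightarrow> real set \<Rightarrow> (real \<times> real measure) set \<Rightarrow> ennreal" where
  "cluster_level X A B = (\<integral>\<^sup>+(u, C). emeasure C ((+) u -` A) * indicator B (u, C) \<partial>X)"

definition max_level :: "(real \<times> real measure) measure \<Rightarrow> real set \<Rightarrow> (real \<times> real measure) set \<Rightarrow> ennreal" where
  "max_level X A B = (\<integral>\<^sup>+(u, C). indicator A u * indicator B (u, C) \<partial>X)"

end

theory Submission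
  imports Defs "HOL-Real_Asymp.Real_Asymp"
begin

text \<open>
 On the event \<open>Z > 0\<close> the number of points \<open>(u, C)\<close> of \<open>\<E>\<close> whose cluster has at least \<open>j\<close>
 particles above \<open>- v\<close> is asymptotic to \<open>Z exp (\<surd>2 v) p\<^sub>j\<close> as \<open>v \<rightarrow> \<infinity>\<close>. Let \<open>G\<close> consist of the points
 whose cluster has at least \<open>K\<close> such particles. Up to shifts of \<open>v\<close>, which are needed to pass to
 continuous functionals and hence to time \<open>t\<close>, the claim amounts to \<open>p\<^sub>K\<close> being small and
 \<open>\<Sum>\<^sub>j p\<^sub>j\<close> being infinite.

 If \<open>\<Sum>\<^sub>j p\<^sub>j\<close> were finite, then the particles near the front at time \<open>t\<close> would have descendants near
 the front at time \<open>t + s\<close> with probability of order \<open>\<integral> exp (\<surd>2 y - 2 s) P(max h\<^sub>s \<ge> y) dy\<close>, uniformly in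
 \<open>t\<close>. This integral vanishes as \<open>s \<rightarrow> \<infinity>\<close>, because the maximum is at \<open>\<surd>2 s - O(log s)\<close> and so the
 quadratic term of the KPP equation does not cease to act. Particles far below the front do not
 matter either, and the limit law of the maximum would be degenerate.

 Finally \<open>P(Z = 0)\<close> is a fixed point of \<open>p \<mapsto> p\<^sup>2\<close> by the branching property, and it is not \<open>1\<close> by
 comparison of the KPP equation with a subsolution moving at speed \<open>\<surd>2\<close>.
\<close>

section \<open>Genealogical distances\<close>

text \<open>The heights are given only by conditional laws of linear combinations, and the limit
  only by bounded continuous functionals. Hence two tools: expectations of products over living
  particles, which satisfy the KPP equation in mild form at the first split, and integrals of
  Lipschitz test functions. Functionals of the process at time \<open>t\<close> need not be
  measurable a priori, so one-sided integral bounds are used there and counts are measured by hand.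

  The divergence of the sum is decisive because the intensity is exponential: a shift by
  \<open>v\<close> multiplies all rates by \<open>exp (sqrt 2 * v)\<close>, and given
  \<open>Z\<close> the counts obey a law of large numbers. Clusters with \<open>j\<close> particles
  thus contribute in fixed proportions, and the thresholds up to \<open>K\<close> are outweighed by
  those up to a large \<open>K'\<close>. Unit shifts of the level cost only factors
  \<open>exp (sqrt 2)\<close>, absorbed in the choice of \<open>K\<close> and \<open>K'\<close>.

  The weight \<open>exp (sqrt 2 * y - 2 * s)\<close> is the one conserved by the linearised
  equation. Its mass is lost through the quadratic term alone, and the linear flow keeps spreading a
  fixed fraction of it to where that term is bounded below.\<close>

lemma finite_strict_prefixes: "finite {w. strict_prefix w u}"
 by (rule finite_subset[of _ "set (prefixes u)"]) (auto simp: strict_prefix_def)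

lemma birth_time_Nil [simp]: "birth_time \<tau> [] = 0"
 by (simp add: birth_time_def)

lemma strict_prefixes_Cons:
 "{w. strict_prefix w (b # u)} = insert [] ((#) b ` {w. strict_prefix w u})"
proof (intro set_eqI iffI)
 fix w assume "w \<in> {w. strict_prefix w (b # u)}"
 then show "w \<in> insert [] ((#) b ` {w. strict_prefix w u})"
  by (cases w) (auto simp: strict_prefix_def)
qed (auto simp: strict_prefix_def)

lemma birth_time_Cons: "birth_time \<tau> (b # u) = \<tau> [] + birth_time (\<lambda>w. \<tau> (b # w)) u"
 unfolding birth_time_def strict_prefixes_Cons
 by (subst sum.insert) (auto simp: finite_strict_prefixes sum.reindex)

lemma birth_time_nonneg: "(\<And>u. 0 < \<tau> u) \<Longrightarrow> 0 \<le> birth_time \<tau> u"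
 unfolding birth_time_def by (intro sum_nonneg) (auto intro: less_imp_le)

lemma strict_prefix_trans': "prefix a b \<Longrightarrow> strict_prefix b c \<Longrightarrow> strict_prefix a c"
 by (meson prefix_order.le_less_trans)

lemma death_time_eq: "birth_time \<tau> w + \<tau> w = (\<Sum>v | prefix v w. \<tau> v)"
proof -
 have "{v. prefix v w} = insert w {v. strict_prefix v w}"
  by (auto simp: strict_prefix_def)
 then show ?thesis unfolding birth_time_def
  by (simp add: finite_strict_prefixes)
qed

lemma birth_time_strict_prefix:
 assumes "\<And>u. 0 < \<tau> u" "strict_prefix w u"
 shows "birth_time \<tau> w + \<tau> w \<le> birth_time \<tau> u"
 unfolding death_time_eq unfolding birth_time_def
 using assms by (intro sum_mono2) (auto simp: finite_strict_prefixes less_imp_le intro: strict_prefix_trans')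

lemma death_time_prefix:
 assumes "\<And>u. 0 < \<tau> u" "prefix w u"
 shows "birth_time \<tau> w + \<tau> w \<le> birth_time \<tau> u + \<tau> u"
proof (cases "w = u")
 case False
 then have "birth_time \<tau> w + \<tau> w \<le> birth_time \<tau> u"
  using assms by (intro birth_time_strict_prefix) (auto simp: strict_prefix_def)
 then show ?thesis using assms(1)[of u] by linarith
qed simp

text \<open>A label dies exactly when its children are born, so the lifetimes along the ancestral
  line of \<open>u\<close> cover all times from 0 to the death of \<open>u\<close>; the induction
  removes the last letter.\<close>

lemma alive_prefix_exists:
 assumes "0 \<le> s" "s < birth_time \<tau> u + \<tau> u"
 shows "\<exists>w. prefix w u \<and> w \<in> alive \<tau> s"
 using assms(2)
proof (induction u rule: rev_induct)
 case Nil
 then show ?case using assms(1) by (auto simp: alive_def intro!: exI[of _ "[]"])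
next
 case (snoc b u)
 have *: "{w. strict_prefix w (u @ [b])} = {w. prefix w u}"
  by (auto simp: strict_prefix_def)
 show ?case
 proof (cases "birth_time \<tau> (u @ [b]) \<le> s")
  case True
  then show ?thesis using snoc.prems by (auto simp: alive_def intro!: exI[of _ "u @ [b]"])
 next
  case False
  then have "s < birth_time \<tau> u + \<tau> u"
   unfolding death_time_eq by (simp add: birth_time_def *)
  then show ?thesis using snoc.IH by (auto intro: prefix_order.trans)
 qed
qed

lemma alive_prefix_eq:
 assumes pos: "\<And>u. 0 < \<tau> u" and "x \<in> alive \<tau> t" "y \<in> alive \<tau> t" "prefix x y"
 shows "x = y"
proof (rule ccontr)
 assume "x \<noteq> y"
 then have "birth_time \<tau> x + \<tau> x \<le> birth_time \<tau> y"
  using assms by (intro birth_time_strict_prefix) (auto simp: strict_prefix_def)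
 then show False using assms by (auto simp: alive_def)
qed

lemma alive_before:
 assumes "\<And>u. 0 < \<tau> u" "0 \<le> t" "t < \<tau> []"
 shows "alive \<tau> t = {[]}"
proof -
 have "[] \<in> alive \<tau> t" using assms by (simp add: alive_def)
 then show ?thesis using alive_prefix_eq[of \<tau> "[]" t, OF assms(1)] by auto
qed

lemma alive_after:
 assumes "\<tau> [] \<le> t"
 shows "alive \<tau> t = (\<Union>b. (#) b ` alive (\<lambda>w. \<tau> (b # w)) (t - \<tau> []))"
proof (intro set_eqI)
 fix x show "x \<in> alive \<tau> t \<longleftrightarrow> x \<in> (\<Union>b. (#) b ` alive (\<lambda>w. \<tau> (b # w)) (t - \<tau> []))"
  using assms by (cases x) (auto simp: alive_def birth_time_Cons image_iff algebra_simps)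
qed

text \<open>For two distinct living particles this is the death time of their last common ancestor,
  that is, the time at which their lines separate. For \<open>x = y\<close> it is the birth time
  instead, hence the separate \<open>gdist_same\<close>.\<close>

definition shared_time :: "(particle \<Rightarrow> real) \<Rightarrow> particle \<Rightarrow> particle \<Rightarrow> real" where
 "shared_time \<tau> x y = (\<Sum>w | strict_prefix w x \<and> strict_prefix w y. \<tau> w)"

lemma gdist_same:
 assumes "\<And>u. 0 < \<tau> u" "0 \<le> t" "x \<in> alive \<tau> t"
 shows "gdist \<tau> t x t x = 0"
 unfolding gdist_def using assms
 by (intro cInf_eq_minimum) (auto intro!: exI[of _ t] bexI[of _ x])

lemma gdist_distinct:
 assumes pos: "\<And>u. 0 < \<tau> u" and x: "x \<in> alive \<tau> t" and y: "y \<in> alive \<tau> t" and ne: "x \<noteq> y"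
 shows "gdist \<tau> t x t y = t - shared_time \<tau> x y"
proof -
 define p where "p = longest_common_prefix x y"
 have np: "\<not> prefix x y" "\<not> prefix y x"
  using alive_prefix_eq[of \<tau>, OF pos x y] alive_prefix_eq[of \<tau>, OF pos y x] ne by auto
 have p: "strict_prefix p x" "strict_prefix p y"
  using np longest_common_prefix_prefix1[of x y] longest_common_prefix_prefix2[of x y]
  by (auto simp: strict_prefix_def p_def)
 have pp: "prefix w p \<longleftrightarrow> prefix w x \<and> prefix w y" for w
  using p longest_common_prefix_max_prefix[of w x y]
  by (auto simp: p_def strict_prefix_def intro: prefix_order.trans)
 have sp: "{w. strict_prefix w x \<and> strict_prefix w y} = {w. prefix w p}"
  using p pp np by (auto simp: strict_prefix_def)
 define D where "D = birth_time \<tau> p + \<tau> p"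
 have D: "shared_time \<tau> x y = D"
  unfolding shared_time_def sp D_def death_time_eq ..
 have Dpos: "0 < D" using birth_time_nonneg[of \<tau> p, OF pos] pos[of p] by (simp add: D_def)
 have Dt: "D \<le> t" using birth_time_strict_prefix[of \<tau> p x, OF pos p(1)] x
  by (auto simp: D_def alive_def)
 \<comment> \<open>Intervals of life are half-open: \<open>p\<close> is alive up to, but not at, its
   death time \<open>D\<close>. Common ancestors therefore exist at times \<open>s < D\<close> only,
   and the infimum is not attained.\<close>
 have "{((t - s) + (t - s)) / 2 | s. 0 \<le> s \<and> s \<le> t \<and> s \<le> t \<and> (\<exists>w\<in>alive \<tau> s. prefix w x \<and> prefix w y)}
   = {t - D<..t}" (is "?L = ?R")
 proof (intro set_eqI iffI)
  fix r assume "r \<in> ?L"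
  then obtain s w where "r = ((t - s) + (t - s)) / 2" "0 \<le> s" "s \<le> t" "w \<in> alive \<tau> s" "prefix w p"
   using pp by blast
  moreover have "r = t - s" using calculation(1) by simp
  moreover have "s < D" using death_time_prefix[of \<tau> w p, OF pos] calculation
   by (auto simp: D_def alive_def)
  ultimately show "r \<in> ?R" by auto
 next
  fix r assume r: "r \<in> ?R"
  then have "0 \<le> t - r" "t - r < D" using Dt by auto
  from alive_prefix_exists[of "t - r" \<tau> p] this obtain w where "prefix w p" "w \<in> alive \<tau> (t - r)"
   by (auto simp: D_def)
  then show "r \<in> ?L" using r Dt Dpos pp \<open>0 \<le> t - r\<close>
   by (auto intro!: exI[of _ "t - r"])
 qed
 then show ?thesis unfolding gdist_def D using Dpos by simp
qed

lemma shared_time_le: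
 assumes "\<And>u. 0 < \<tau> u" "x \<in> alive \<tau> t" shows "shared_time \<tau> x y \<le> t"
proof -
 have "shared_time \<tau> x y \<le> birth_time \<tau> x" unfolding shared_time_def birth_time_def
  using assms by (intro sum_mono2) (auto simp: less_imp_le finite_strict_prefixes)
 then show ?thesis using assms(2) by (simp add: alive_def)
qed

lemma gdist_commute: "gdist \<tau> t x t y = gdist \<tau> t y t x"
 unfolding gdist_def by (intro arg_cong[where f=Inf]) (auto; metis)

text \<open>The common ancestries \<open>x \<inter> y\<close> and \<open>y \<inter> z\<close> are both initial segments of the line of \<open>y\<close>,
 hence comparable.\<close>

lemma gdist_ultrametric:
 assumes pos: "\<And>u. 0 < \<tau> u" and t: "0 \<le> t" and x: "x \<in> alive \<tau> t" and y: "y \<in> alive \<tau> t" and z: "z \<in> alive \<tau> t"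
 shows "gdist \<tau> t x t z \<le> max (gdist \<tau> t x t y) (gdist \<tau> t y t z)"
proof -
 have nn: "0 \<le> gdist \<tau> t a t b" if "a \<in> alive \<tau> t" "b \<in> alive \<tau> t" for a b
 proof (cases "a = b")
  case True then show ?thesis using gdist_same[of \<tau> t a] pos t that by simp
 next
  case False
  then show ?thesis
   using gdist_distinct[of \<tau> a t b] shared_time_le[of \<tau> a t b] pos that by simp
 qed
 consider "x = y" | "y = z" | "x = z" | "x \<noteq> y" "y \<noteq> z" "x \<noteq> z" by auto
 then show ?thesis
 proof cases
  case 3
  then show ?thesis using gdist_same[of \<tau> t x] nn[OF x y] pos t x by auto
 next
  case 4
  let ?P = "\<lambda>a b. {w. strict_prefix w a \<and> strict_prefix w b}"
  have "?P x y \<subseteq> ?P y z \<or> ?P y z \<subseteq> ?P x y"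
  proof (rule ccontr)
   assume "\<not> ?thesis"
   then obtain v w where v: "strict_prefix v x" "strict_prefix v y" "\<not> strict_prefix v z"
    and w: "strict_prefix w z" "strict_prefix w y" "\<not> strict_prefix w x" by auto
   then have "prefix v w \<or> prefix w v"
    by (meson prefix_same_cases strict_prefix_def)
   then show False using v w strict_prefix_trans' by blast
  qed
  then have "?P x y \<subseteq> ?P x z \<or> ?P y z \<subseteq> ?P x z" by auto
  then have "shared_time \<tau> x y \<le> shared_time \<tau> x z \<or> shared_time \<tau> y z \<le> shared_time \<tau> x z"
  proof (elim disjE)
   assume "?P x y \<subseteq> ?P x z"
   then have "shared_time \<tau> x y \<le> shared_time \<tau> x z" unfolding shared_time_def
    using pos by (intro sum_mono2 finite_subset[OF _ finite_strict_prefixes[of x]]) (auto simp: less_imp_le)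
   then show ?thesis ..
  next
   assume "?P y z \<subseteq> ?P x z"
   then have "shared_time \<tau> y z \<le> shared_time \<tau> x z" unfolding shared_time_def
    using pos by (intro sum_mono2 finite_subset[OF _ finite_strict_prefixes[of x]]) (auto simp: less_imp_le)
   then show ?thesis ..
  qed
  then show ?thesis using 4 gdist_distinct[of \<tau>, OF pos] x y z by auto
 qed auto
qed

section \<open>Laws determined by linear combinations\<close>

lemma integrable_bounded_real:
 fixes f :: "'a \<Rightarrow> real"
 assumes "finite_measure M" "f \<in> borel_measurable M" "\<And>x. \<bar>f x\<bar> \<le> K"
 shows "integrable M f"
 using assms by (intro finite_measure.integrable_const_bound[of M f K]) auto

text \<open>A bounded weight of positive mass is normalised to a probability, so that Levy's
  uniqueness theorem for probability laws applies to weighted expectations.\<close>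

lemma weighted_law:
 fixes X W :: "'a \<Rightarrow> real" and f :: "real \<Rightarrow> 'b :: {banach, second_countable_topology}"
 assumes "finite_measure M" and [measurable]: "X \<in> borel_measurable M" "W \<in> borel_measurable M"
  and W: "\<And>x. 0 \<le> W x" "\<And>x. W x \<le> K" and m: "0 < (LINT x|M. W x)"
 defines "D \<equiv> distr (density M (\<lambda>x. ennreal (W x / (LINT x|M. W x)))) borel X"
 shows "real_distribution D"
  and "f \<in> borel_measurable borel \<Longrightarrow> (LINT y|D. f y) = inverse (LINT x|M. W x) *\<^sub>R (LINT x|M. W x *\<^sub>R f (X x))"
proof -
 let ?m = "LINT x|M. W x"
 have i: "integrable M W" using W by (intro integrable_bounded_real[where K=K] assms) (auto intro: order_trans)
 have "(\<integral>\<^sup>+x. ennreal (W x / ?m) \<partial>M) = 1"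
  using i W m by (subst nn_integral_eq_integral) auto
 then have "prob_space (density M (\<lambda>x. ennreal (W x / ?m)))"
  by (intro prob_spaceI) (simp add: emeasure_density cong: nn_integral_cong)
 then have "prob_space D" unfolding D_def by (rule prob_space.prob_space_distr) simp
 then show "real_distribution D" by (simp add: real_distribution_def real_distribution_axioms_def D_def)
 assume [measurable]: "f \<in> borel_measurable borel"
 have "(LINT y|D. f y) = (LINT x|M. (W x / ?m) *\<^sub>R f (X x))"
  unfolding D_def using W m by (simp add: integral_distr integral_density)
 also have "\<dots> = inverse ?m *\<^sub>R (LINT x|M. W x *\<^sub>R f (X x))"
  by (simp add: divide_inverse_commute flip: scaleR_scaleR)
 finally show "(LINT y|D. f y) = inverse ?m *\<^sub>R (LINT x|M. W x *\<^sub>R f (X x))" .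
qed

lemma weighted_law_unique:
 fixes X1 :: "'a \<Rightarrow> real" and X2 :: "'b \<Rightarrow> real"
 assumes fin: "finite_measure M1" "finite_measure M2"
  and meas [measurable]: "X1 \<in> borel_measurable M1" "X2 \<in> borel_measurable M2"
   "W1 \<in> borel_measurable M1" "W2 \<in> borel_measurable M2"
  and W: "\<And>x. 0 \<le> W1 x" "\<And>x. W1 x \<le> K" "\<And>x. 0 \<le> W2 x" "\<And>x. W2 x \<le> K"
  and c: "\<And>s. (LINT x|M1. W1 x *\<^sub>R cis (s * X1 x)) = (LINT x|M2. W2 x *\<^sub>R cis (s * X2 x))"
  and g [measurable]: "g \<in> borel_measurable borel"
 shows "(LINT x|M1. W1 x * g (X1 x)) = (LINT x|M2. W2 x * g (X2 x) :: real)"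
proof -
 have iW: "integrable M1 W1" "integrable M2 W2"
  using W by (auto intro!: integrable_bounded_real[of _ _ K] fin intro: order_trans)
 have m: "(LINT x|M1. W1 x) = (LINT x|M2. W2 x)"
  using c[of 0] by (simp add: scaleR_conv_of_real)
 show ?thesis
 proof (cases "(LINT x|M1. W1 x) = 0")
  \<comment> \<open>A nonnegative weight of mass 0 cannot be normalised, but it vanishes almost
    everywhere and both integrals are 0.\<close>
  case True
  then have "AE x in M1. W1 x = 0" "AE x in M2. W2 x = 0"
   using m iW W by (simp_all add: integral_nonneg_eq_0_iff_AE[symmetric])
  then have "(LINT x|M1. W1 x * g (X1 x)) = 0" "(LINT x|M2. W2 x * g (X2 x)) = 0"
   by (auto intro!: integral_eq_zero_AE elim: eventually_mono)
  then show ?thesis by simp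
 next
  case False
  then have p: "0 < (LINT x|M1. W1 x)" "0 < (LINT x|M2. W2 x)" using W(1,3) m by (auto simp: less_le integral_nonneg)
  note L1 = weighted_law[OF fin(1) meas(1,3) W(1,2) p(1)] and L2 = weighted_law[OF fin(2) meas(2,4) W(3,4) p(2)]
  have cis: "(\<lambda>x. cis (s * x)) \<in> borel_measurable borel" for s
   by (intro borel_measurable_continuous_onI continuous_intros)
  have char: "char D s = (LINT y|D. cis (s * y))" for D s by (simp add: char_def cis_conv_exp)
  have "distr (density M1 (\<lambda>x. ennreal (W1 x / (LINT x|M1. W1 x)))) borel X1 = distr (density M2 (\<lambda>x. ennreal (W2 x / (LINT x|M2. W2 x)))) borel X2"
   by (intro Levy_uniqueness L1(1) L2(1) ext) (unfold char, unfold L1(2)[OF cis] L2(2)[OF cis], unfold c m, rule refl)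
  then show ?thesis using L1(2)[OF g] L2(2)[OF g] p m by simp
 qed
qed

text \<open>Complex factors \<open>cis (S x)\<close> are traded for the real weights
  \<open>1 + cos (S x)\<close> and \<open>1 + sin (S x)\<close>, which are nonnegative and bounded
  by 2, so that \<open>weighted_law_unique\<close> applies to them. The first two identities express
  transforms under these weights by plain ones; the third recovers the complex factor.\<close>

lemma cis_integrals:
 fixes X S W g :: "'a \<Rightarrow> real"
 assumes fin: "finite_measure M" and [measurable]: "X \<in> borel_measurable M" "S \<in> borel_measurable M" "W \<in> borel_measurable M" "g \<in> borel_measurable M"
  and W: "\<And>x. 0 \<le> W x" "\<And>x. W x \<le> 1" and g: "\<And>x. 0 \<le> g x" "\<And>x. g x \<le> 1"
 shows "(LINT x|M. (W x * (1 + cos (S x))) *\<^sub>R cis (X x)) =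
   (LINT x|M. W x *\<^sub>R cis (X x)) + ((LINT x|M. W x *\<^sub>R cis (X x + S x)) + (LINT x|M. W x *\<^sub>R cis (X x - S x))) / 2"
  and "(LINT x|M. (W x * (1 + sin (S x))) *\<^sub>R cis (X x)) =
   (LINT x|M. W x *\<^sub>R cis (X x)) - \<i> * ((LINT x|M. W x *\<^sub>R cis (X x + S x)) - (LINT x|M. W x *\<^sub>R cis (X x - S x))) / 2"
  and "(LINT x|M. (W x * g x) *\<^sub>R cis (S x)) =
   of_real ((LINT x|M. W x * (1 + cos (S x)) * g x) - (LINT x|M. W x * g x)) + \<i> * of_real ((LINT x|M. W x * (1 + sin (S x)) * g x) - (LINT x|M. W x * g x))"
proof -
 interpret finite_measure M by fact
 have [measurable]: "cis \<in> borel_measurable borel" by (intro borel_measurable_continuous_onI continuous_intros)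
 have i: "integrable M (\<lambda>x. W x *\<^sub>R cis (f x))" if "f \<in> borel_measurable M" for f
  using W that by (intro integrable_const_bound[where B=1]) auto
 note i' = i[of X] i[of "\<lambda>x. X x + S x"] i[of "\<lambda>x. X x - S x"]
 have "(LINT x|M. (W x * (1 + cos (S x))) *\<^sub>R cis (X x)) = (LINT x|M. W x *\<^sub>R cis (X x) + (W x *\<^sub>R cis (X x + S x) + W x *\<^sub>R cis (X x - S x)) / 2)"
  by (intro Bochner_Integration.integral_cong refl)
   (auto simp: complex_eq_iff cos_add cos_diff sin_add sin_diff algebra_simps)
 then show "(LINT x|M. (W x * (1 + cos (S x))) *\<^sub>R cis (X x)) =
   (LINT x|M. W x *\<^sub>R cis (X x)) + ((LINT x|M. W x *\<^sub>R cis (X x + S x)) + (LINT x|M. W x *\<^sub>R cis (X x - S x))) / 2"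
  using i' by simp
 have "(LINT x|M. (W x * (1 + sin (S x))) *\<^sub>R cis (X x)) = (LINT x|M. W x *\<^sub>R cis (X x) - \<i> * (W x *\<^sub>R cis (X x + S x) - W x *\<^sub>R cis (X x - S x)) / 2)"
  by (intro Bochner_Integration.integral_cong refl)
   (auto simp: complex_eq_iff cos_add cos_diff sin_add sin_diff algebra_simps)
 then show "(LINT x|M. (W x * (1 + sin (S x))) *\<^sub>R cis (X x)) =
   (LINT x|M. W x *\<^sub>R cis (X x)) - \<i> * ((LINT x|M. W x *\<^sub>R cis (X x + S x)) - (LINT x|M. W x *\<^sub>R cis (X x - S x))) / 2"
  using i' by simp
 have j: "integrable M (\<lambda>x. W x * f x * g x)" "integrable M (\<lambda>x. W x * g x)" if "f \<in> borel_measurable M" "\<And>x. 0 \<le> f x \<and> f x \<le> 2" for f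
 proof -
  have "0 \<le> W x * f x * g x" "W x * f x * g x \<le> 1 * 2 * 1" "0 \<le> W x * g x" "W x * g x \<le> 1 * 1" for x
   by (intro mult_mono mult_nonneg_nonneg; use W g that(2) in simp)+
  then show "integrable M (\<lambda>x. W x * f x * g x)" "integrable M (\<lambda>x. W x * g x)"
   using that(1) by (auto intro!: integrable_bounded_real[OF fin, of _ 2] intro: order_trans[of _ 1])
 qed
 have b: "0 \<le> 1 + cos a \<and> 1 + cos a \<le> 2" "0 \<le> 1 + sin a \<and> 1 + sin a \<le> 2" for a :: real
  using cos_ge_minus_one[of a] sin_ge_minus_one[of a] cos_le_one[of a] sin_le_one[of a] by linarith+
 have "(LINT x|M. (W x * g x) *\<^sub>R cis (S x)) =
  (LINT x|M. of_real (W x * (1 + cos (S x)) * g x - W x * g x) + \<i> * of_real (W x * (1 + sin (S x)) * g x - W x * g x))"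
  by (intro Bochner_Integration.integral_cong refl) (auto simp: complex_eq_iff algebra_simps)
 also have "\<dots> = of_real ((LINT x|M. W x * (1 + cos (S x)) * g x) - (LINT x|M. W x * g x)) + \<i> * of_real ((LINT x|M. W x * (1 + sin (S x)) * g x) - (LINT x|M. W x * g x))"
  using j[of "\<lambda>x. 1 + cos (S x)"] j[of "\<lambda>x. 1 + sin (S x)"] b
  by (subst Bochner_Integration.integral_add) (auto simp del: of_real_diff)
 finally show "(LINT x|M. (W x * g x) *\<^sub>R cis (S x)) =
  of_real ((LINT x|M. W x * (1 + cos (S x)) * g x) - (LINT x|M. W x * g x)) + \<i> * of_real ((LINT x|M. W x * (1 + sin (S x)) * g x) - (LINT x|M. W x * g x))" .
qed

text \<open>The Cramer-Wold device by one-dimensional uniqueness only: one factor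
  \<open>g j (X j)\<close> at a time is absorbed into the weight, and the transform of the remaining
  variables under the new weight is computed from the old one.\<close>

lemma product_law_unique:
 fixes X1 :: "'i \<Rightarrow> 'a \<Rightarrow> real" and X2 :: "'i \<Rightarrow> 'b \<Rightarrow> real" and g :: "'i \<Rightarrow> real \<Rightarrow> real"
 assumes fin: "finite_measure M1" "finite_measure M2"
  and "finite A"
  and "\<And>i. X1 i \<in> borel_measurable M1" "\<And>i. X2 i \<in> borel_measurable M2"
   "W1 \<in> borel_measurable M1" "W2 \<in> borel_measurable M2"
  and "\<And>x. 0 \<le> W1 x" "\<And>x. W1 x \<le> 1" "\<And>x. 0 \<le> W2 x" "\<And>x. W2 x \<le> 1"
  and "\<And>c. (LINT x|M1. W1 x *\<^sub>R cis (\<Sum>i\<in>A. c i * X1 i x)) = (LINT x|M2. W2 x *\<^sub>R cis (\<Sum>i\<in>A. c i * X2 i x))"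
  and g: "\<And>i. g i \<in> borel_measurable borel" and gb: "\<And>i x. 0 \<le> g i x" "\<And>i x. g i x \<le> 1"
 shows "(LINT x|M1. W1 x * (\<Prod>i\<in>A. g i (X1 i x))) = (LINT x|M2. W2 x * (\<Prod>i\<in>A. g i (X2 i x)))"
 using \<open>finite A\<close> assms(4-12)
proof (induction A arbitrary: W1 W2 rule: finite_induct)
 case empty
 from empty(9)[of "\<lambda>_. 0"] show ?case by (simp add: scaleR_conv_of_real)
next
 case (insert j A)
 note [measurable] = insert.prems(1-4) g
 note W = insert.prems(5-8)
 define S1 where "S1 c x = (\<Sum>i\<in>A. c i * X1 i x)" for c x
 define S2 where "S2 c x = (\<Sum>i\<in>A. c i * X2 i x)" for c x
 have [measurable]: "S1 c \<in> borel_measurable M1" "S2 c \<in> borel_measurable M2" for c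
  unfolding S1_def[abs_def] S2_def[abs_def] by measurable
 have C: "(LINT x|M1. W1 x *\<^sub>R cis (s * X1 j x + S1 c x)) = (LINT x|M2. W2 x *\<^sub>R cis (s * X2 j x + S2 c x))" for c s
 proof -
  have "(\<Sum>i\<in>A. (c(j := s)) i * X1 i x) = S1 c x" "(\<Sum>i\<in>A. (c(j := s)) i * X2 i y) = S2 c y" for x y
   unfolding S1_def S2_def using insert.hyps by (auto intro!: sum.cong)
  then show ?thesis using insert.prems(9)[of "c(j := s)"] insert.hyps by simp
 qed
 have C': "(LINT x|M1. W1 x *\<^sub>R cis (s * X1 j x - S1 c x)) = (LINT x|M2. W2 x *\<^sub>R cis (s * X2 j x - S2 c x))" for c s
  using C[of s "\<lambda>i. - c i"] by (simp add: S1_def S2_def sum_negf)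
 have C0: "(LINT x|M1. W1 x *\<^sub>R cis (s * X1 j x)) = (LINT x|M2. W2 x *\<^sub>R cis (s * X2 j x))" for s
  using C[of s "\<lambda>_. 0"] by (simp add: S1_def S2_def)
 \<comment> \<open>The function \<open>g\<close> of \<open>cis_integrals\<close> occurs only in its
   third identity; 0 is a placeholder.\<close>
 note I1 = cis_integrals[OF fin(1) _ _ insert.prems(3) _ W(1,2), of _ _ "\<lambda>_. 0"] and I2 = cis_integrals[OF fin(2) _ _ insert.prems(4) _ W(3,4), of _ _ "\<lambda>_. 0"]
 have Wb: "0 \<le> W1 x * y" "0 \<le> W2 x' * y" "W1 x * y \<le> 2" "W2 x' * y \<le> 2" if "0 \<le> y" "y \<le> 2" for x x' y
  using mult_mono[of "W1 x" 1 y 2] mult_mono[of "W2 x'" 1 y 2] W that by auto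
 have b: "0 \<le> 1 + cos a" "1 + cos a \<le> 2" "0 \<le> 1 + sin a" "1 + sin a \<le> 2" for a :: real
  using cos_ge_minus_one[of a] sin_ge_minus_one[of a] cos_le_one[of a] sin_le_one[of a] by linarith+
 have 0: "(LINT x|M1. W1 x * g j (X1 j x)) = (LINT x|M2. W2 x * g j (X2 j x))"
  by (rule weighted_law_unique[where K=1, OF fin]) (use W C0 in auto)
 have 1: "(LINT x|M1. W1 x * (1 + cos (S1 c x)) * g j (X1 j x)) = (LINT x|M2. W2 x * (1 + cos (S2 c x)) * g j (X2 j x))" for c
  by (rule weighted_law_unique[where K=2, OF fin]) (simp_all add: Wb b I1 I2 C C' C0)
 have 2: "(LINT x|M1. W1 x * (1 + sin (S1 c x)) * g j (X1 j x)) = (LINT x|M2. W2 x * (1 + sin (S2 c x)) * g j (X2 j x))" for c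
  by (rule weighted_law_unique[where K=2, OF fin]) (simp_all add: Wb b I1 I2 C C' C0)
 \<comment> \<open>Real and imaginary part of the transform under the new weight are the integrals
   in \<open>1\<close> and \<open>2\<close> minus the one in \<open>0\<close>.\<close>
 have 3: "(LINT x|M1. (W1 x * g j (X1 j x)) *\<^sub>R cis (S1 c x)) = (LINT x|M2. (W2 x * g j (X2 j x)) *\<^sub>R cis (S2 c x))" for c
  using cis_integrals(3)[OF fin(1), of "\<lambda>_. 0" "S1 c" W1 "\<lambda>x. g j (X1 j x)"]
   cis_integrals(3)[OF fin(2), of "\<lambda>_. 0" "S2 c" W2 "\<lambda>x. g j (X2 j x)"] W gb 0 1 2 by simp
 have "(LINT x|M1. (W1 x * g j (X1 j x)) * (\<Prod>i\<in>A. g i (X1 i x))) = (LINT x|M2. (W2 x * g j (X2 j x)) * (\<Prod>i\<in>A. g i (X2 i x)))"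
  by (rule insert.IH) (use insert.prems W gb 3 in \<open>auto simp: S1_def S2_def mult_le_one\<close>)
 then show ?case using insert.hyps by (simp add: mult.assoc)
qed

section \<open>The branching recursion\<close>

definition glue :: "'a \<Rightarrow> (particle \<Rightarrow> 'a) \<Rightarrow> (particle \<Rightarrow> 'a) \<Rightarrow> particle \<Rightarrow> 'a" where
 "glue a f0 f1 = (\<lambda>u. case u of [] \<Rightarrow> a | b # w \<Rightarrow> if b then f1 w else f0 w)"

lemma glue_simps [simp]:
 "glue a f0 f1 [] = a" "glue a f0 f1 (False # w) = f0 w" "glue a f0 f1 (True # w) = f1 w"
 by (auto simp: glue_def)

lemma glue_sections [simp]:
 "(\<lambda>w. glue a f0 f1 (False # w)) = f0" "(\<lambda>w. glue a f0 f1 (True # w)) = f1"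
 by auto

lemma measurable_glue [measurable (raw)]:
 assumes "f \<in> measurable M N" "g0 \<in> measurable M (Pi\<^sub>M UNIV (\<lambda>_. N))" "g1 \<in> measurable M (Pi\<^sub>M UNIV (\<lambda>_. N))"
 shows "(\<lambda>x. glue (f x) (g0 x) (g1 x)) \<in> measurable M (Pi\<^sub>M UNIV (\<lambda>_. N))"
proof (rule measurable_PiM_single')
 fix u :: particle
 show "(\<lambda>x. glue (f x) (g0 x) (g1 x) u) \<in> measurable M N"
  using assms measurable_compose[OF assms(2) measurable_component_singleton]
   measurable_compose[OF assms(3) measurable_component_singleton]
  by (cases u) (auto simp: glue_def)
next
 have "glue (f x) (g0 x) (g1 x) u \<in> space N" if "x \<in> space M" for x u
  using measurable_space[OF assms(1) that] measurable_space[OF assms(2) that] measurable_space[OF assms(3) that]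
  by (auto simp: glue_def space_PiM PiE_iff split: list.split)
 then show "(\<lambda>x i. glue (f x) (g0 x) (g1 x) i) \<in> space M \<rightarrow> UNIV \<rightarrow>\<^sub>E space N"
  by (auto simp: PiE_iff)
qed

text \<open>An independent family indexed by all labels consists of its root value and two
  independent copies of itself below the two children. This self-similarity is the source of the
  branching property; it is checked on finite-dimensional rectangles by sorting the labels of
  \<open>J\<close> by their first letter.\<close>

lemma distr_glue:
 fixes m :: "'a measure"
 assumes "prob_space m"
 defines "N \<equiv> Pi\<^sub>M (UNIV :: particle set) (\<lambda>_. m)"
 shows "distr (m \<Otimes>\<^sub>M (N \<Otimes>\<^sub>M N)) N (\<lambda>(a, f0, f1). glue a f0 f1) = N"
proof -
 interpret m: prob_space m by fact
 interpret P: product_prob_space "\<lambda>_. m" "UNIV :: particle set" by unfold_locales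
 interpret N: prob_space N unfolding N_def by (intro prob_space_PiM m.prob_space_axioms)
 interpret NN: pair_prob_space N N by unfold_locales
 have [measurable]: "(\<lambda>(a, f0, f1). glue a f0 f1) \<in> measurable (m \<Otimes>\<^sub>M (N \<Otimes>\<^sub>M N)) N"
  unfolding N_def by measurable
 show ?thesis unfolding N_def
 proof (rule P.PiM_eq, unfold N_def[symmetric])
  fix J :: "particle set" and F assume J: "finite J" "J \<subseteq> UNIV" and F: "\<And>j. j \<in> J \<Longrightarrow> F j \<in> sets m"
  define X0 where "X0 = (if [] \<in> J then F [] else space m)"
  define Jb where "Jb = (\<lambda>b. {w. b # w \<in> J})"
  define Y where "Y = (\<lambda>b. {f \<in> space N. \<forall>w\<in>Jb b. f w \<in> F (b # w)})"
  have Jb: "finite (Jb b)" for b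
   unfolding Jb_def using finite_vimageI[OF J(1), of "(#) b"] by (simp add: vimage_def)
  have Y: "emeasure N (Y b) = (\<Prod>w\<in>Jb b. emeasure m (F (b # w)))" for b
   unfolding Y_def N_def using Jb F by (intro P.emeasure_PiM_Collect) (auto simp: Jb_def)
  have [measurable]: "Y b \<in> sets N" for b
   unfolding Y_def N_def using Jb F
   by (intro sets.sets_Collect_finite_All sets_Collect_single') (auto simp: Jb_def)
  have X0: "X0 \<in> sets m" using F by (auto simp: X0_def)
  have emb: "prod_emb UNIV (\<lambda>_. m) J (\<Pi>\<^sub>E j\<in>J. F j) = {f \<in> space N. \<forall>j\<in>J. f j \<in> F j}"
   by (auto simp: prod_emb_def N_def space_PiM PiE_iff)
  have emb_sets: "{f \<in> space N. \<forall>j\<in>J. f j \<in> F j} \<in> sets N"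
   unfolding N_def using J F by (intro sets.sets_Collect_finite_All sets_Collect_single') auto
  have Jsplit: "(\<forall>j\<in>J. P j) \<longleftrightarrow> ([] \<in> J \<longrightarrow> P []) \<and> (\<forall>w\<in>Jb False. P (False # w)) \<and> (\<forall>w\<in>Jb True. P (True # w))" for P
  proof (intro iffI ballI)
   fix j assume j: "j \<in> J"
    and "([] \<in> J \<longrightarrow> P []) \<and> (\<forall>w\<in>Jb False. P (False # w)) \<and> (\<forall>w\<in>Jb True. P (True # w))"
   then have "\<forall>b w. b # w \<in> J \<longrightarrow> P (b # w)" "[] \<in> J \<longrightarrow> P []"
    unfolding all_bool_eq by (auto simp: Jb_def)
   then show "P j" using j by (cases j) auto
  qed (auto simp: Jb_def)
  have vim: "(\<lambda>(a, f0, f1). glue a f0 f1) -` {f \<in> space N. \<forall>j\<in>J. f j \<in> F j} \<inter> space (m \<Otimes>\<^sub>M (N \<Otimes>\<^sub>M N))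
    = X0 \<times> (Y False \<times> Y True)"
  proof -
   have sp: "glue a f0 f1 \<in> space N \<longleftrightarrow> a \<in> space m \<and> f0 \<in> space N \<and> f1 \<in> space N" for a f0 f1
   proof
    assume "glue a f0 f1 \<in> space N"
    then have *: "glue a f0 f1 u \<in> space m" for u by (auto simp: N_def space_PiM)
    have "a \<in> space m" "f0 w \<in> space m" "f1 w \<in> space m" for w
     using *[of "[]"] *[of "False # w"] *[of "True # w"] by simp_all
    then show "a \<in> space m \<and> f0 \<in> space N \<and> f1 \<in> space N" by (auto simp: N_def space_PiM)
   next
    assume "a \<in> space m \<and> f0 \<in> space N \<and> f1 \<in> space N"
    then show "glue a f0 f1 \<in> space N"
     by (auto simp: N_def space_PiM glue_def PiE_iff split: list.split)
   qed
   have "F [] \<subseteq> space m" if "[] \<in> J" using F[OF that] sets.sets_into_space by auto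
   then show ?thesis unfolding Jsplit
    by (auto simp: space_pair_measure sp X0_def Y_def)
  qed
  have prodJ: "(\<Prod>j\<in>J. f j) = (if [] \<in> J then f [] else 1) * ((\<Prod>w\<in>Jb False. f (False # w)) * (\<Prod>w\<in>Jb True. f (True # w)))"
   for f :: "particle \<Rightarrow> ennreal"
  proof -
   have Je: "J = (if [] \<in> J then {[]} else {}) \<union> ((#) False ` Jb False \<union> (#) True ` Jb True)"
   proof (intro set_eqI iffI)
    fix j assume "j \<in> J"
    then show "j \<in> (if [] \<in> J then {[]} else {}) \<union> ((#) False ` Jb False \<union> (#) True ` Jb True)"
     by (cases j; cases "hd j") (auto simp: Jb_def)
   qed (auto simp: Jb_def split: if_splits)
   have "prod f J = prod f ((if [] \<in> J then {[]} else {}) \<union> ((#) False ` Jb False \<union> (#) True ` Jb True))"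
    using Je by simp
   also have "\<dots> = prod f (if [] \<in> J then {[]} else {}) * prod f ((#) False ` Jb False \<union> (#) True ` Jb True)"
    using Jb by (intro prod.union_disjoint) auto
   also have "prod f ((#) False ` Jb False \<union> (#) True ` Jb True) = prod f ((#) False ` Jb False) * prod f ((#) True ` Jb True)"
    using Jb by (intro prod.union_disjoint) auto
   finally show ?thesis by (simp add: prod.reindex)
  qed
  have "emeasure (distr (m \<Otimes>\<^sub>M (N \<Otimes>\<^sub>M N)) N (\<lambda>(a, f0, f1). glue a f0 f1)) {f \<in> space N. \<forall>j\<in>J. f j \<in> F j}
    = emeasure (m \<Otimes>\<^sub>M (N \<Otimes>\<^sub>M N)) (X0 \<times> (Y False \<times> Y True))"
   using emb_sets by (subst emeasure_distr) (simp_all only: vim, simp)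
  also have "\<dots> = emeasure m X0 * (emeasure N (Y False) * emeasure N (Y True))"
   using X0 by (simp add: NN.emeasure_pair_measure_Times N.emeasure_pair_measure_Times)
  also have "\<dots> = (\<Prod>j\<in>J. emeasure m (F j))"
   unfolding prodJ Y by (simp add: X0_def m.emeasure_space_1)
  finally show "emeasure (distr (m \<Otimes>\<^sub>M (N \<Otimes>\<^sub>M N)) N (\<lambda>(a, f0, f1). glue a f0 f1))
    (prod_emb UNIV (\<lambda>_. m) J (\<Pi>\<^sub>E j\<in>J. F j)) = (\<Prod>j\<in>J. emeasure m (F j))"
   unfolding emb .
 qed (simp add: N_def)
qed

lemma nn_integral_glue:
 fixes m :: "'a measure"
 assumes "prob_space m" and f: "f \<in> borel_measurable (Pi\<^sub>M (UNIV :: particle set) (\<lambda>_. m))"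
 shows "(\<integral>\<^sup>+x. f x \<partial>Pi\<^sub>M UNIV (\<lambda>_. m)) =
  (\<integral>\<^sup>+a. \<integral>\<^sup>+x0. \<integral>\<^sup>+x1. f (glue a x0 x1) \<partial>Pi\<^sub>M UNIV (\<lambda>_. m) \<partial>Pi\<^sub>M UNIV (\<lambda>_. m) \<partial>m)"
proof -
 define N where "N = Pi\<^sub>M (UNIV :: particle set) (\<lambda>_. m)"
 note [measurable] = f[folded N_def]
 interpret m: prob_space m by fact
 interpret N: prob_space N unfolding N_def by (intro prob_space_PiM m.prob_space_axioms)
 interpret NN: pair_prob_space N N by unfold_locales
 have [measurable]: "(\<lambda>(a, f0, f1). glue a f0 f1) \<in> measurable (m \<Otimes>\<^sub>M (N \<Otimes>\<^sub>M N)) N"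
  unfolding N_def by measurable
 have [measurable]: "(\<lambda>x. glue (fst x) (fst (snd x)) (snd (snd x))) \<in> measurable (m \<Otimes>\<^sub>M (N \<Otimes>\<^sub>M N)) N"
  unfolding N_def by measurable
 have "(\<integral>\<^sup>+x. f x \<partial>N) = (\<integral>\<^sup>+x. f x \<partial>distr (m \<Otimes>\<^sub>M (N \<Otimes>\<^sub>M N)) N (\<lambda>(a, f0, f1). glue a f0 f1))"
  using distr_glue[OF assms(1)] by (simp add: N_def)
 also have "\<dots> = (\<integral>\<^sup>+x. f (glue (fst x) (fst (snd x)) (snd (snd x))) \<partial>(m \<Otimes>\<^sub>M (N \<Otimes>\<^sub>M N)))"
  by (subst nn_integral_distr) (auto simp: case_prod_beta)
 also have "\<dots> = (\<integral>\<^sup>+a. \<integral>\<^sup>+y. f (glue a (fst y) (snd y)) \<partial>(N \<Otimes>\<^sub>M N) \<partial>m)"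
  by (subst NN.nn_integral_fst[symmetric]) auto
 also have "\<dots> = (\<integral>\<^sup>+a. \<integral>\<^sup>+x0. \<integral>\<^sup>+x1. f (glue a x0 x1) \<partial>N \<partial>N \<partial>m)"
 proof (intro nn_integral_cong)
  fix a assume a: "a \<in> space m"
  have "(\<lambda>y. f (glue a (fst y) (snd y))) \<in> borel_measurable (N \<Otimes>\<^sub>M N)"
   using a by (intro measurable_compose[OF _ f[folded N_def]]) (simp add: N_def)
  then show "(\<integral>\<^sup>+y. f (glue a (fst y) (snd y)) \<partial>(N \<Otimes>\<^sub>M N)) = (\<integral>\<^sup>+x0. \<integral>\<^sup>+x1. f (glue a x0 x1) \<partial>N \<partial>N)"
   by (subst N.nn_integral_fst[symmetric]) auto
 qed
 finally show ?thesis unfolding N_def .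
qed

section \<open>The tree with Gaussian displacements and its recursion at the first split\<close>

abbreviation eexp :: "real \<Rightarrow> ennreal" where "eexp x \<equiv> ennreal (exp x)"

abbreviation lifetime_law :: "real measure" where
 "lifetime_law \<equiv> density lborel (\<lambda>x. ennreal (exponential_density 1 x))"

abbreviation lifetimes_law :: "(particle \<Rightarrow> real) measure" where
 "lifetimes_law \<equiv> Pi\<^sub>M UNIV (\<lambda>_. lifetime_law)"

abbreviation displacements_law :: "(particle \<Rightarrow> real) measure" where
 "displacements_law \<equiv> Pi\<^sub>M UNIV (\<lambda>_. std_normal_distribution)"

text \<open>
 Given the lifetimes, the heights have the law of \<open>model_height\<close> for independent standard normal
 \<open>\<xi>\<close>: as far as a single time is concerned, a Brownian path enters only through its increments
 over the lifetimes. The truncation to labels of length below \<open>n\<close> in \<open>leaf_prod\<close> makes all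
 products finite.
\<close>

definition model_height :: "(particle \<Rightarrow> real) \<Rightarrow> (particle \<Rightarrow> real) \<Rightarrow> real \<Rightarrow> particle \<Rightarrow> real" where
 "model_height \<tau> \<xi> t u = (\<Sum>w | strict_prefix w u. sqrt (\<tau> w) * \<xi> w) + sqrt (t - birth_time \<tau> u) * \<xi> u"

definition leaf_prod :: "(real \<Rightarrow> ennreal) \<Rightarrow> nat \<Rightarrow> (particle \<Rightarrow> real) \<Rightarrow> (particle \<Rightarrow> real) \<Rightarrow> real \<Rightarrow> real \<Rightarrow> ennreal" where
 "leaf_prod g n \<tau> \<xi> t y =
   (\<Prod>u | length u < n. if u \<in> alive \<tau> t then g (y - model_height \<tau> \<xi> t u) else 1)"

lemma finite_short: "finite {u :: particle. length u < n}"
 using finite_lists_length_le[of "UNIV :: bool set" n] by (rule finite_subset[rotated]) auto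

lemma short_Suc: "{u :: particle. length u < Suc n} =
  insert [] ((#) False ` {u. length u < n} \<union> (#) True ` {u. length u < n})"
proof (intro set_eqI)
 fix x :: particle
 show "x \<in> {u. length u < Suc n} \<longleftrightarrow> x \<in> insert [] ((#) False ` {u. length u < n} \<union> (#) True ` {u. length u < n})"
  by (cases x; cases "hd x") auto
qed

lemma model_height_Cons:
 "model_height \<tau> \<xi> t (b # u) =
   sqrt (\<tau> []) * \<xi> [] + model_height (\<lambda>w. \<tau> (b # w)) (\<lambda>w. \<xi> (b # w)) (t - \<tau> []) u"
 unfolding model_height_def strict_prefixes_Cons birth_time_Cons
 by (subst sum.insert) (auto simp: finite_strict_prefixes sum.reindex diff_diff_eq)

text \<open>Before time \<open>s\<close> the root alone is alive. Afterwards the living particles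
  are divided between the two subtrees, the displacement \<open>sqrt s * z\<close> of the root is
  common to both, and labels lose their first letter, which lowers the truncation by one.\<close>

lemma leaf_prod_glue:
 assumes pos: "0 < s" "\<And>u. 0 < \<tau>0 u" "\<And>u. 0 < \<tau>1 u" and t: "0 \<le> t"
 shows "leaf_prod g (Suc n) (glue s \<tau>0 \<tau>1) (glue z \<xi>0 \<xi>1) t y =
  (if t < s then g (y - sqrt t * z)
   else leaf_prod g n \<tau>0 \<xi>0 (t - s) (y - sqrt s * z) * leaf_prod g n \<tau>1 \<xi>1 (t - s) (y - sqrt s * z))"
proof -
 let ?\<tau> = "glue s \<tau>0 \<tau>1" and ?\<xi> = "glue z \<xi>0 \<xi>1"
 let ?f = "\<lambda>u. if u \<in> alive ?\<tau> t then g (y - model_height ?\<tau> ?\<xi> t u) else 1"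
 have split: "leaf_prod g (Suc n) ?\<tau> ?\<xi> t y =
   ?f [] * ((\<Prod>u | length u < n. ?f (False # u)) * (\<Prod>u | length u < n. ?f (True # u)))"
  unfolding leaf_prod_def short_Suc
  by (subst prod.insert; (subst prod.union_disjoint)?) (auto simp: finite_short prod.reindex)
 have posg: "0 < ?\<tau> u" for u
  using pos by (auto simp: glue_def split: list.split)
 show ?thesis
 proof (cases "t < s")
  case True
  then have "alive ?\<tau> t = {[]}" using posg t by (intro alive_before) auto
  then have "?f [] = g (y - sqrt t * z)" "\<And>b u. ?f (b # u) = 1"
   by (simp_all add: model_height_def)
  then show ?thesis unfolding split using True by simp
 next
  case False
  then have al: "alive ?\<tau> t = (\<Union>b. (#) b ` alive (\<lambda>w. ?\<tau> (b # w)) (t - s))"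
   by (subst alive_after) auto
  have mem: "b # u \<in> alive ?\<tau> t \<longleftrightarrow> u \<in> alive (\<lambda>w. ?\<tau> (b # w)) (t - s)" "[] \<notin> alive ?\<tau> t" for b u
   unfolding al by auto
  have "(\<Prod>u | length u < n. ?f (False # u)) = leaf_prod g n \<tau>0 \<xi>0 (t - s) (y - sqrt s * z)"
   "(\<Prod>u | length u < n. ?f (True # u)) = leaf_prod g n \<tau>1 \<xi>1 (t - s) (y - sqrt s * z)"
   unfolding leaf_prod_def mem model_height_Cons by (simp_all add: diff_diff_eq cong: if_cong)
  then show ?thesis unfolding split using False mem(2) by simp
 qed
qed

lemma sets_PiM_lifetime [measurable_cong]:
 "sets lifetimes_law = sets (Pi\<^sub>M UNIV (\<lambda>_. borel))"
 by (intro sets_PiM_cong) auto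

lemma sets_PiM_normal [measurable_cong]:
 "sets displacements_law = sets (Pi\<^sub>M UNIV (\<lambda>_. borel))"
 by (intro sets_PiM_cong) auto

abbreviation lebesgue_nn_integral (binder "LEB " 61) where
 "lebesgue_nn_integral (f :: real \<Rightarrow> ennreal) \<equiv> nn_integral lborel f"

abbreviation gauss_nn_integral (binder "GAUSS " 61) where
 "gauss_nn_integral (f :: real \<Rightarrow> ennreal) \<equiv> nn_integral std_normal_distribution f"

abbreviation lifetime_nn_integral (binder "LIFE " 61) where
 "lifetime_nn_integral (f :: real \<Rightarrow> ennreal) \<equiv> nn_integral lifetime_law f"

lemma prob_space_lifetime: "prob_space lifetime_law"
 by (rule prob_space_exponential_density) simp

lemma prob_space_std_normal: "prob_space std_normal_distribution"
 by (rule prob_space_normal_density) simp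

interpretation lifetime: prob_space lifetime_law by (rule prob_space_lifetime)

interpretation gauss: prob_space std_normal_distribution by (rule prob_space_std_normal)

lemma AE_lifetime_pos: "AE s in lifetime_law. 0 < s"
proof (subst AE_density)
 show "AE x in lborel. 0 < ennreal (exponential_density 1 x) \<longrightarrow> 0 < x"
  using AE_lborel_singleton[of 0] by eventually_elim (auto simp: erlang_density_def)
qed simp

lemma AE_lifetimes_pos: "AE \<tau> in lifetimes_law. \<forall>u. 0 < \<tau> u"
proof -
 have "AE s in lifetime_law. 0 < s"
  by (rule AE_lifetime_pos)
 then have "AE \<tau> in lifetimes_law. 0 < \<tau> u" for u
  by (intro AE_PiM_component) (auto simp: prob_space_lifetime)
 then show ?thesis by (subst AE_all_countable) auto
qed

lemma measurable_birth_time [measurable (raw)]: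
 assumes [measurable]: "T \<in> measurable M (Pi\<^sub>M UNIV (\<lambda>_. borel))"
 shows "(\<lambda>x. birth_time (T x) u) \<in> borel_measurable M"
 unfolding birth_time_def by measurable

lemma pred_alive [measurable (raw)]:
 assumes [measurable]: "T \<in> measurable M (Pi\<^sub>M UNIV (\<lambda>_. borel))" "t \<in> borel_measurable M"
 shows "Measurable.pred M (\<lambda>x. u \<in> alive (T x) (t x))"
 unfolding alive_def by measurable

lemma measurable_leaf_prod [measurable (raw)]:
 assumes [measurable]: "T \<in> measurable M (Pi\<^sub>M UNIV (\<lambda>_. borel))" "X \<in> measurable M (Pi\<^sub>M UNIV (\<lambda>_. borel))"
  "t \<in> borel_measurable M" "y \<in> borel_measurable M" "g \<in> borel_measurable borel"
 shows "(\<lambda>x. leaf_prod g n (T x) (X x) (t x) (y x)) \<in> borel_measurable M"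
 unfolding leaf_prod_def model_height_def by measurable

definition branch_fun :: "(real \<Rightarrow> ennreal) \<Rightarrow> nat \<Rightarrow> real \<Rightarrow> real \<Rightarrow> ennreal" where
 "branch_fun g n t y = (\<integral>\<^sup>+\<tau>. \<integral>\<^sup>+\<xi>. leaf_prod g n \<tau> \<xi> t y \<partial>displacements_law \<partial>lifetimes_law)"

lemma branch_fun_0: "branch_fun g 0 t y = 1"
proof -
 interpret A: prob_space lifetimes_law by (intro prob_space_PiM prob_space_lifetime)
 interpret B: prob_space displacements_law by (intro prob_space_PiM prob_space_std_normal)
 show ?thesis by (simp add: branch_fun_def leaf_prod_def A.emeasure_space_1 B.emeasure_space_1)
qed

text \<open>Given lifetime and displacement of the root, the two subtrees are independent with the
  same law, which produces the square.\<close>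

lemma branch_fun_Suc:
 assumes [measurable]: "g \<in> borel_measurable borel" and t: "0 \<le> t"
 shows "branch_fun g (Suc n) t y =
  (LIFE s. GAUSS z. (if t < s then g (y - sqrt t * z) else (branch_fun g n (t - s) (y - sqrt s * z))\<^sup>2))"
proof -
 let ?T = lifetimes_law and ?X = displacements_law and ?N = std_normal_distribution
 interpret A: prob_space ?T by (intro prob_space_PiM prob_space_lifetime)
 interpret B: prob_space ?X by (intro prob_space_PiM prob_space_std_normal)
 interpret NT: pair_sigma_finite ?N ?T ..
 \<comment> \<open>The average over displacements for given lifetimes; \<open>branch_fun\<close>
   integrates the displacements inside and the lifetimes outside.\<close>
 define K where "K = (\<lambda>m \<tau> t y. \<integral>\<^sup>+\<xi>. leaf_prod g m \<tau> \<xi> t y \<partial>?X)"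
 have K_meas [measurable (raw)]: "(\<lambda>x. K m (T x) (t x) (y x)) \<in> borel_measurable M"
  if [measurable]: "T \<in> measurable M (Pi\<^sub>M UNIV (\<lambda>_. borel))" "t \<in> borel_measurable M" "y \<in> borel_measurable M"
  for M :: "'x measure" and T t y m
  unfolding K_def by measurable
 have bf: "branch_fun g m t y = (\<integral>\<^sup>+\<tau>. K m \<tau> t y \<partial>?T)" for m t y
  unfolding branch_fun_def K_def ..
 let ?b = "\<lambda>s z \<tau>0 \<tau>1. if t < s then g (y - sqrt t * z) else K n \<tau>0 (t - s) (y - sqrt s * z) * K n \<tau>1 (t - s) (y - sqrt s * z)"
 have KSuc: "K (Suc n) (glue s \<tau>0 \<tau>1) t y =
   (GAUSS z. (?b s z \<tau>0 \<tau>1))"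
  if pos: "0 < s" "\<forall>u. 0 < \<tau>0 u" "\<forall>u. 0 < \<tau>1 u" and sp: "\<tau>0 \<in> space ?T" "\<tau>1 \<in> space ?T" for s \<tau>0 \<tau>1
 proof -
  have [measurable]: "\<tau> \<in> space (Pi\<^sub>M UNIV (\<lambda>_. borel))" for \<tau> :: "particle \<Rightarrow> real"
   by (simp add: space_PiM)
  have "K (Suc n) (glue s \<tau>0 \<tau>1) t y = (GAUSS z. \<integral>\<^sup>+\<xi>0. \<integral>\<^sup>+\<xi>1. leaf_prod g (Suc n) (glue s \<tau>0 \<tau>1) (glue z \<xi>0 \<xi>1) t y \<partial>?X \<partial>?X)"
   unfolding K_def by (rule nn_integral_glue[OF prob_space_std_normal]) measurable
  also have "\<dots> = (GAUSS z. (?b s z \<tau>0 \<tau>1))"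
  proof (intro nn_integral_cong)
   fix z
   have "(\<integral>\<^sup>+\<xi>0. \<integral>\<^sup>+\<xi>1. leaf_prod g n \<tau>0 \<xi>0 (t - s) (y - sqrt s * z) * leaf_prod g n \<tau>1 \<xi>1 (t - s) (y - sqrt s * z) \<partial>?X \<partial>?X)
     = K n \<tau>0 (t - s) (y - sqrt s * z) * K n \<tau>1 (t - s) (y - sqrt s * z)"
    unfolding K_def by (simp add: nn_integral_cmult nn_integral_multc)
   then show "(\<integral>\<^sup>+\<xi>0. \<integral>\<^sup>+\<xi>1. leaf_prod g (Suc n) (glue s \<tau>0 \<tau>1) (glue z \<xi>0 \<xi>1) t y \<partial>?X \<partial>?X) =
    (?b s z \<tau>0 \<tau>1)"
    using pos t by (simp add: leaf_prod_glue B.emeasure_space_1)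
  qed
  finally show ?thesis .
 qed
 have AEs: "AE s in lifetime_law. 0 < s"
  by (rule AE_lifetime_pos)
 have "branch_fun g (Suc n) t y = (LIFE s. \<integral>\<^sup>+\<tau>0. \<integral>\<^sup>+\<tau>1. K (Suc n) (glue s \<tau>0 \<tau>1) t y \<partial>?T \<partial>?T)"
  unfolding bf by (rule nn_integral_glue[OF prob_space_lifetime]) measurable
 also have "\<dots> = (LIFE s. GAUSS z. (if t < s then g (y - sqrt t * z) else (branch_fun g n (t - s) (y - sqrt s * z))\<^sup>2))"
 proof (intro nn_integral_cong_AE, use AEs in eventually_elim)
  fix s :: real assume s: "0 < s"
  have "(\<integral>\<^sup>+\<tau>0. \<integral>\<^sup>+\<tau>1. K (Suc n) (glue s \<tau>0 \<tau>1) t y \<partial>?T \<partial>?T) =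
   (\<integral>\<^sup>+\<tau>0. \<integral>\<^sup>+\<tau>1. \<integral>\<^sup>+z. (?b s z \<tau>0 \<tau>1) \<partial>?N \<partial>?T \<partial>?T)"
  proof (rule nn_integral_cong_AE)
   show "AE \<tau>0 in ?T. (\<integral>\<^sup>+\<tau>1. K (Suc n) (glue s \<tau>0 \<tau>1) t y \<partial>?T) =
    (\<integral>\<^sup>+\<tau>1. \<integral>\<^sup>+z. (?b s z \<tau>0 \<tau>1) \<partial>?N \<partial>?T)"
    using AE_lifetimes_pos AE_space[of ?T]
   proof eventually_elim
    case (elim \<tau>0)
    have "AE \<tau>1 in ?T. K (Suc n) (glue s \<tau>0 \<tau>1) t y =
     (GAUSS z. (?b s z \<tau>0 \<tau>1))"
     using AE_lifetimes_pos AE_space[of ?T] by eventually_elim (use elim s in \<open>auto intro!: KSuc\<close>)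
    then show ?case by (rule nn_integral_cong_AE)
   qed
  qed
  also have "\<dots> = (GAUSS z. (if t < s then g (y - sqrt t * z) else (branch_fun g n (t - s) (y - sqrt s * z))\<^sup>2))"
  proof (cases "t < s")
   case True
   then show ?thesis by (simp add: A.emeasure_space_1)
  next
   \<comment> \<open>Both subtrees see the same root displacement \<open>z\<close>, so
     \<open>z\<close> has to be integrated last: Fubini moves it outside of the lifetimes before the
     square forms.\<close>
   case False
   have [measurable]: "\<tau> \<in> space (Pi\<^sub>M UNIV (\<lambda>_. borel))" for \<tau> :: "particle \<Rightarrow> real"
    by (simp add: space_PiM)
   have "(\<integral>\<^sup>+\<tau>0. \<integral>\<^sup>+\<tau>1. \<integral>\<^sup>+z. K n \<tau>0 (t - s) (y - sqrt s * z) * K n \<tau>1 (t - s) (y - sqrt s * z) \<partial>?N \<partial>?T \<partial>?T)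
    = (\<integral>\<^sup>+\<tau>0. \<integral>\<^sup>+z. \<integral>\<^sup>+\<tau>1. K n \<tau>0 (t - s) (y - sqrt s * z) * K n \<tau>1 (t - s) (y - sqrt s * z) \<partial>?T \<partial>?N \<partial>?T)"
    by (intro nn_integral_cong NT.Fubini') simp
   also have "\<dots> = (\<integral>\<^sup>+\<tau>0. \<integral>\<^sup>+z. K n \<tau>0 (t - s) (y - sqrt s * z) * branch_fun g n (t - s) (y - sqrt s * z) \<partial>?N \<partial>?T)"
    unfolding bf by (simp add: nn_integral_cmult)
   also have "\<dots> = (GAUSS z. \<integral>\<^sup>+\<tau>0. K n \<tau>0 (t - s) (y - sqrt s * z) * branch_fun g n (t - s) (y - sqrt s * z) \<partial>?T)"
    unfolding bf by (intro NT.Fubini') simp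
   also have "\<dots> = (GAUSS z. (branch_fun g n (t - s) (y - sqrt s * z))\<^sup>2)"
    by (intro nn_integral_cong) (simp add: nn_integral_multc bf[symmetric] power2_eq_square)
   finally show ?thesis using False by simp
  qed
  finally show "(\<integral>\<^sup>+\<tau>0. \<integral>\<^sup>+\<tau>1. K (Suc n) (glue s \<tau>0 \<tau>1) t y \<partial>?T \<partial>?T) =
    (GAUSS z. (if t < s then g (y - sqrt t * z) else (branch_fun g n (t - s) (y - sqrt s * z))\<^sup>2))" .
 qed
 finally show ?thesis .
qed

lemma measure_distr_eq_integral:
 assumes "f \<in> measurable M N" "B \<in> sets N"
 shows "measure (distr M N f) B = (LINT x|M. indicat_real B (f x))"
proof -
 have "(LINT x|M. indicat_real B (f x)) = (LINT y|distr M N f. indicat_real B y)"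
  using assms by (subst integral_distr) auto
 then show ?thesis using sets.sets_into_space[OF assms(2)] by (simp add: Int_absorb2)
qed

text \<open>Characteristic functions treat vanishing coefficients, and a vanishing total variance
  for which \<open>centred_gaussian\<close> is a Dirac mass, on the same footing as the
  others.\<close>

lemma distr_weighted_normals:
 assumes "finite U"
 shows "distr displacements_law borel (\<lambda>\<xi>. \<Sum>u\<in>U. d u * \<xi> u) = centred_gaussian (\<Sum>u\<in>U. (d u)\<^sup>2)"
proof (rule Levy_uniqueness)
 interpret X: prob_space displacements_law by (intro prob_space_PiM prob_space_std_normal)
 interpret PX: product_prob_space "\<lambda>_. std_normal_distribution" "UNIV :: particle set"
  using prob_space_std_normal by unfold_locales (auto simp: prob_space_def prob_space_axioms_def finite_measure_def sigma_finite_measure_def)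
 show "real_distribution (distr displacements_law borel (\<lambda>\<xi>. \<Sum>u\<in>U. d u * \<xi> u))"
  by (auto intro!: real_distribution.intro X.prob_space_distr simp: real_distribution_axioms_def)
 show "real_distribution (centred_gaussian (\<Sum>u\<in>U. (d u)\<^sup>2))"
  unfolding centred_gaussian_def
  by (auto intro!: real_distribution.intro prob_space.prob_space_distr[OF prob_space_std_normal] simp: real_distribution_axioms_def)
 have ch: "char (distr std_normal_distribution borel (\<lambda>z. a * z)) t = exp (- (a * t)\<^sup>2 / 2)" for a t
 proof -
  have "char (distr std_normal_distribution borel (\<lambda>z. a * z)) t = char std_normal_distribution (a * t)"
   unfolding char_def by (subst integral_distr) (auto simp: ac_simps)
  then show ?thesis by (simp add: char_std_normal_distribution flip: exp_of_real)
 qed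
 have indep: "X.indep_vars (\<lambda>_. borel) (\<lambda>u \<xi>. d u * \<xi> u) U"
 proof -
  have "X.indep_vars (\<lambda>_. std_normal_distribution) (\<lambda>u \<xi>. \<xi> u) UNIV"
   by (subst X.indep_vars_iff_distr_eq_PiM') (auto simp: PX.PiM_component restrict_UNIV)
  then have "X.indep_vars (\<lambda>_. std_normal_distribution) (\<lambda>u \<xi>. \<xi> u) U"
   by (rule X.indep_vars_subset) auto
  then show ?thesis
   by (rule X.indep_vars_compose2[where Y = "\<lambda>u x. d u * x"]) auto
 qed
 show "char (distr displacements_law borel (\<lambda>\<xi>. \<Sum>u\<in>U. d u * \<xi> u)) = char (centred_gaussian (\<Sum>u\<in>U. (d u)\<^sup>2))"
 proof
  fix t
  have 1: "distr displacements_law borel (\<lambda>\<xi>. d u * \<xi> u) = distr std_normal_distribution borel (\<lambda>z. d u * z)" for u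
  proof -
   have "distr std_normal_distribution borel (\<lambda>z. d u * z) = distr (distr displacements_law std_normal_distribution (\<lambda>\<xi>. \<xi> u)) borel (\<lambda>z. d u * z)"
    by (simp add: PX.PiM_component)
   also have "\<dots> = distr displacements_law borel (\<lambda>\<xi>. d u * \<xi> u)"
    by (subst distr_distr) (auto simp: comp_def)
   finally show ?thesis ..
  qed
  have "char (distr displacements_law borel (\<lambda>\<xi>. \<Sum>u\<in>U. d u * \<xi> u)) t = (\<Prod>u\<in>U. char (distr displacements_law borel (\<lambda>\<xi>. d u * \<xi> u)) t)"
   by (rule X.char_distr_sum[OF indep])
  also have "\<dots> = (\<Prod>u\<in>U. complex_of_real (exp (- (d u * t)\<^sup>2 / 2)))"
   unfolding 1 ch by simp
  also have "\<dots> = complex_of_real (exp (\<Sum>u\<in>U. - (d u * t)\<^sup>2 / 2))"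
   by (simp add: exp_sum assms)
  also have "(\<Sum>u\<in>U. - (d u * t)\<^sup>2 / 2) = - (sqrt (\<Sum>u\<in>U. (d u)\<^sup>2) * t)\<^sup>2 / 2"
   by (simp add: power_mult_distrib sum_nonneg sum_distrib_right sum_divide_distrib sum_negf flip: sum_divide_distrib)
  finally show "char (distr displacements_law borel (\<lambda>\<xi>. \<Sum>u\<in>U. d u * \<xi> u)) t = char (centred_gaussian (\<Sum>u\<in>U. (d u)\<^sup>2)) t"
   unfolding centred_gaussian_def ch by simp
 qed
qed

definition height_coeff :: "(particle \<Rightarrow> real) \<Rightarrow> real \<Rightarrow> particle \<Rightarrow> particle \<Rightarrow> real" where
 "height_coeff \<tau> t x u = (if strict_prefix u x then sqrt (\<tau> u) else if u = x then sqrt (t - birth_time \<tau> x) else 0)"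

lemma model_height_eq:
 assumes "length x < n"
 shows "model_height \<tau> \<xi> t x = (\<Sum>u | length u < n. height_coeff \<tau> t x u * \<xi> u)"
proof -
 have "(\<Sum>u | length u < n. height_coeff \<tau> t x u * \<xi> u) = (\<Sum>u\<in>insert x {w. strict_prefix w x}. height_coeff \<tau> t x u * \<xi> u)"
  using assms finite_short[of n]
  by (intro sum.mono_neutral_right) (auto simp: height_coeff_def strict_prefix_def dest: prefix_length_le)
 also have "\<dots> = model_height \<tau> \<xi> t x"
  unfolding model_height_def
  by (subst sum.insert) (auto simp: finite_strict_prefixes height_coeff_def intro!: sum.cong)
 finally show ?thesis ..
qed

text \<open>Distinct living particles are incomparable, so only their common strict ancestors
  contribute, each with its lifetime; these add up to \<open>shared_time\<close>. This identifies
  the covariance of \<open>model_height\<close> with the one prescribed for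
  \<open>h\<close>.\<close>

lemma height_coeff_covariance:
 assumes pos: "\<And>u. 0 < \<tau> u" and t: "0 \<le> t" and x: "x \<in> alive \<tau> t" "length x < n" and y: "y \<in> alive \<tau> t" "length y < n"
 shows "(\<Sum>u | length u < n. height_coeff \<tau> t x u * height_coeff \<tau> t y u) = t - gdist \<tau> t x t y"
proof (cases "x = y")
 case True
 have "(\<Sum>u | length u < n. height_coeff \<tau> t x u * height_coeff \<tau> t x u) = (\<Sum>u\<in>insert x {w. strict_prefix w x}. height_coeff \<tau> t x u * height_coeff \<tau> t x u)"
  using x(2) finite_short[of n]
  by (intro sum.mono_neutral_right) (auto simp: height_coeff_def strict_prefix_def dest: prefix_length_le)
 also have "\<dots> = (t - birth_time \<tau> x) + birth_time \<tau> x"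
  using x(1) pos by (subst sum.insert)
   (auto simp: finite_strict_prefixes height_coeff_def birth_time_def alive_def less_imp_le intro!: sum.cong)
 finally show ?thesis using True gdist_same[of \<tau> t x] pos t x by simp
next
 case False
 have np: "\<not> prefix x y" "\<not> prefix y x"
  using alive_prefix_eq[of \<tau> x t y, OF pos] alive_prefix_eq[of \<tau> y t x, OF pos] x y False by auto
 have "(\<Sum>u | length u < n. height_coeff \<tau> t x u * height_coeff \<tau> t y u) = (\<Sum>u | strict_prefix u x \<and> strict_prefix u y. height_coeff \<tau> t x u * height_coeff \<tau> t y u)"
  using x(2) finite_short[of n] np
  by (intro sum.mono_neutral_right) (auto simp: height_coeff_def strict_prefix_def dest: prefix_length_le)
 also have "\<dots> = shared_time \<tau> x y"
  unfolding shared_time_def using pos by (intro sum.cong) (auto simp: height_coeff_def less_imp_le)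
 finally show ?thesis using gdist_distinct[of \<tau> x t y, OF pos] x y False by simp
qed

lemma measurable_height_coeff [measurable (raw)]:
 assumes [measurable]: "T \<in> measurable M (Pi\<^sub>M UNIV (\<lambda>_. borel))"
 shows "(\<lambda>x. height_coeff (T x) t y u) \<in> borel_measurable M"
 unfolding height_coeff_def by measurable

section \<open>Conditional law of the heights\<close>

locale bbm =
 fixes M :: "'w measure" and \<tau> :: "'w \<Rightarrow> particle \<Rightarrow> real" and h :: "'w \<Rightarrow> real \<Rightarrow> particle \<Rightarrow> real"
 assumes bbm: "branching_brownian_motion M \<tau> h"
begin

sublocale prob_space M using bbm by (simp add: branching_brownian_motion_def)

lemmas integrable_bounded = integrable_bounded_real[where K=1, OF finite_measure_axioms]

lemma lifetime_pos: "w \<in> space M \<Longrightarrow> 0 < \<tau> w u"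
 using bbm by (simp add: branching_brownian_motion_def)

lemma finite_alive: "w \<in> space M \<Longrightarrow> 0 \<le> t \<Longrightarrow> finite (alive (\<tau> w) t)"
 using bbm by (simp add: branching_brownian_motion_def)

lemma height_measurable: "0 \<le> t \<Longrightarrow> (\<lambda>w. h w t u) \<in> borel_measurable M"
 using bbm by (simp add: branching_brownian_motion_def)

lemma lifetime_distributed: "distributed M lborel (\<lambda>w. \<tau> w u) (exponential_density 1)"
 using bbm by (simp add: branching_brownian_motion_def)

lemma tree_measurable [measurable]: "\<tau> \<in> measurable M (Pi\<^sub>M UNIV (\<lambda>_. borel))"
proof (rule measurable_PiM_single')
 fix u show "(\<lambda>w. \<tau> w u) \<in> borel_measurable M"
  using distributed_measurable[OF lifetime_distributed[of u]] by simp
qed auto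

lemma distr_tree: "distr M (Pi\<^sub>M UNIV (\<lambda>_. borel)) \<tau> = lifetimes_law"
proof -
 have "indep_vars (\<lambda>_. borel) (\<lambda>u w. \<tau> w u) UNIV"
  using bbm by (simp add: branching_brownian_motion_def)
 then have "distr M (Pi\<^sub>M UNIV (\<lambda>_. borel)) (\<lambda>w. \<lambda>i\<in>UNIV. \<tau> w i) = Pi\<^sub>M UNIV (\<lambda>i. distr M borel (\<lambda>w. \<tau> w i))"
  by (subst (asm) indep_vars_iff_distr_eq_PiM') auto
 also have "(\<lambda>i. distr M borel (\<lambda>w. \<tau> w i)) = (\<lambda>_. lifetime_law)"
 proof
  fix u
  have "distr M borel (\<lambda>w. \<tau> w u) = distr M lborel (\<lambda>w. \<tau> w u)"
   by (rule distr_cong) auto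
  then show "distr M borel (\<lambda>w. \<tau> w u) = lifetime_law"
   using distributed_distr_eq_density[OF lifetime_distributed[of u]] by simp
 qed
 finally show ?thesis by (simp add: restrict_UNIV)
qed

lemma subalgebra_tree: "sigma_finite_subalgebra M (tree_sigma M \<tau>)"
proof -
 have "subalgebra M (tree_sigma M \<tau>)"
  unfolding subalgebra_def tree_sigma_def
  using measurable_sets[OF tree_measurable]
  by (auto simp: sets_vimage_algebra2 space_PiM)
 then show ?thesis by (intro finite_measure_subalgebra_is_sigma_finite finite_measure_subalgebra.intro finite_measure_axioms finite_measure_subalgebra_axioms.intro)
qed

text \<open>The conditional law is prescribed only where all labels of \<open>A\<close> are alive,
  and almost surely for each single combination and Borel set. Integration over a tree event
  \<open>E\<close> inside that region removes the conditional expectation.\<close>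

lemma conditional_law:
 assumes t: "0 \<le> t" and A: "finite A" "\<And>x. x \<in> A \<Longrightarrow> length x < n" and E: "E \<in> sets (Pi\<^sub>M UNIV (\<lambda>_. borel))"
  and EA: "\<And>q. q \<in> E \<Longrightarrow> A \<subseteq> alive q t" and B: "B \<in> sets borel"
 shows "(LINT w|M. indicat_real E (\<tau> w) * indicat_real B (\<Sum>x\<in>A. c x * h w t x)) =
  (LINT w|M. indicator E (\<tau> w) * measure (centred_gaussian (\<Sum>u | length u < n. (\<Sum>x\<in>A. c x * height_coeff (\<tau> w) t x u)\<^sup>2)) B)"
proof -
 interpret S: sigma_finite_subalgebra M "tree_sigma M \<tau>" by (rule subalgebra_tree)
 note [measurable] = height_measurable[OF t] B E
 define Y where "Y = {w\<in>space M. (\<Sum>x\<in>A. c x * h w t x) \<in> B}"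
 let ?c = "real_cond_exp M (tree_sigma M \<tau>) (indicator Y)"
  and ?m = "\<lambda>w. measure (centred_gaussian (\<Sum>u | length u < n. (\<Sum>x\<in>A. c x * height_coeff (\<tau> w) t x u)\<^sup>2)) B"
 define I where "I = Pair t ` A"
 have sumI: "(\<Sum>(s, x)\<in>I. f s x) = (\<Sum>x\<in>A. f t x)" for f :: "real \<Rightarrow> particle \<Rightarrow> real"
  unfolding I_def by (subst sum.reindex) (auto simp: inj_on_def)
 from bbm[unfolded branching_brownian_motion_def, THEN conjunct2, THEN conjunct2, THEN conjunct2, THEN conjunct2, THEN conjunct2, THEN conjunct1, rule_format, of B I "\<lambda>(t, x). c x"]
 have "AE w in M. A \<subseteq> alive (\<tau> w) t \<longrightarrow> ?c w =
   measure (centred_gaussian (\<Sum>x\<in>A. \<Sum>x'\<in>A. c x * c x' * (t - gdist (\<tau> w) t x t x'))) B"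
  using A t unfolding sumI Y_def by (simp add: sumI) (simp add: I_def subset_eq)
 then have ae: "AE w in M. A \<subseteq> alive (\<tau> w) t \<longrightarrow> ?c w =
   ?m w"
  using AE_space
 proof eventually_elim
  case (elim w)
  show ?case
  proof
   assume al: "A \<subseteq> alive (\<tau> w) t"
   have "(\<Sum>u | length u < n. (\<Sum>x\<in>A. c x * height_coeff (\<tau> w) t x u)\<^sup>2) =
    (\<Sum>u | length u < n. \<Sum>x\<in>A. \<Sum>x'\<in>A. c x * c x' * (height_coeff (\<tau> w) t x u * height_coeff (\<tau> w) t x' u))"
    by (simp add: power2_eq_square sum_product ac_simps)
   also have "\<dots> = (\<Sum>x\<in>A. \<Sum>x'\<in>A. \<Sum>u | length u < n. c x * c x' * (height_coeff (\<tau> w) t x u * height_coeff (\<tau> w) t x' u))"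
    by (subst sum.swap) (intro sum.cong refl sum.swap)
   also have "\<dots> = (\<Sum>x\<in>A. \<Sum>x'\<in>A. c x * c x' * (t - gdist (\<tau> w) t x t x'))"
    unfolding sum_distrib_left[symmetric]
    using al A t elim(2) by (intro sum.cong refl) (subst height_coeff_covariance, auto intro: lifetime_pos)
   finally show "?c w =
     ?m w"
    using elim(1) al by simp
  qed
 qed
 have Ysets [measurable]: "Y \<in> sets M" unfolding Y_def by measurable
 define E' where "E' = \<tau> -` E \<inter> space M"
 have E': "E' \<in> sets (tree_sigma M \<tau>)"
  unfolding E'_def tree_sigma_def using E by (intro in_vimage_algebra)
 have "(LINT w|M. indicat_real E (\<tau> w) * indicat_real B (\<Sum>x\<in>A. c x * h w t x)) = (\<integral>w\<in>E'. indicator Y w \<partial>M)"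
  unfolding set_lebesgue_integral_def
  by (intro Bochner_Integration.integral_cong) (auto simp: E'_def Y_def indicator_def)
 also have "\<dots> = (\<integral>w\<in>E'. ?c w \<partial>M)"
  using E' by (intro S.real_cond_exp_intA) (auto simp: fmeasurable_def emeasure_eq_measure)
 also have "\<dots> = (LINT w|M. indicator E (\<tau> w) * ?c w)"
  unfolding set_lebesgue_integral_def
  by (intro Bochner_Integration.integral_cong) (auto simp: E'_def indicator_def)
 also have "\<dots> = (LINT w|M. indicator E (\<tau> w) * (if \<tau> w \<in> E then ?c w else 0))"
  by (intro Bochner_Integration.integral_cong) (auto simp: indicator_def)
 also have "\<dots> = (LINT w|M. indicator E (\<tau> w) * ?m w)"
 proof -
  have m: "(\<lambda>w. ?m w) \<in> borel_measurable M"
  proof -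
   have "measure (centred_gaussian v) B = (LINT z|std_normal_distribution. indicator B (sqrt v * z))" for v
    unfolding centred_gaussian_def
    by (subst measure_distr_eq_integral) auto
   then show ?thesis by simp
  qed
  show ?thesis
   by (intro integral_cong_AE) (use m ae EA in \<open>auto simp: indicator_def elim!: eventually_mono\<close>)
 qed
 finally show ?thesis .
qed


text \<open>On the tree event \<open>E\<close> each linear combination of the heights has the same
  law under \<open>h\<close> and in the model, so \<open>product_law_unique\<close> yields all
  products over \<open>A\<close>.\<close>

lemma leaf_law:
 assumes t: "0 \<le> t" and A: "finite A" "\<And>x. x \<in> A \<Longrightarrow> length x < n" and E: "E \<in> sets (Pi\<^sub>M UNIV (\<lambda>_. borel))"
  and EA: "\<And>s. s \<in> E \<Longrightarrow> A \<subseteq> alive s t"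
  and g: "g \<in> borel_measurable borel" "\<And>x. 0 \<le> g x" "\<And>x. g x \<le> (1::real)"
 shows "(LINT w|M. indicator E (\<tau> w) * (\<Prod>x\<in>A. g (h w t x))) =
  (LINT p|(lifetimes_law \<Otimes>\<^sub>M displacements_law). indicator E (fst p) * (\<Prod>x\<in>A. g (model_height (fst p) (snd p) t x)))"
proof -
 let ?L = lifetimes_law and ?X = displacements_law
 interpret L: prob_space ?L by (intro prob_space_PiM prob_space_lifetime)
 interpret X: prob_space ?X by (intro prob_space_PiM prob_space_std_normal)
 interpret LX: pair_prob_space ?L ?X ..
 note [measurable] = height_measurable[OF t] E g(1)
 let ?P = "?L \<Otimes>\<^sub>M ?X"
 let ?H = "\<lambda>c w. \<Sum>x\<in>A. c x * h w t x" and ?G = "\<lambda>c p. \<Sum>x\<in>A. c x * model_height (fst p) (snd p) t x"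
 define Q where "Q = (\<lambda>c s. \<Sum>u | length u < n. (\<Sum>x\<in>A. c x * height_coeff s t x u)\<^sup>2)"
 have mg: "measure (centred_gaussian v) B = (LINT z|std_normal_distribution. indicator B (sqrt v * z))" if [measurable]: "B \<in> sets borel" for v B
  unfolding centred_gaussian_def
  by (subst measure_distr_eq_integral) auto
 have [measurable]: "(\<lambda>s. measure (centred_gaussian (Q c s)) B) \<in> borel_measurable (Pi\<^sub>M UNIV (\<lambda>_. borel))"
  if [measurable]: "B \<in> sets borel" for c B
  unfolding mg[OF that] Q_def by measurable
 have mh [measurable]: "(\<lambda>p. model_height (fst p) (snd p) t x) \<in> borel_measurable ?P" for x
  unfolding model_height_def by measurable
 have law: "(LINT w|M. indicat_real E (\<tau> w) * indicator B (?H c w)) =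
   (LINT p|?P. indicat_real E (fst p) * indicator B (?G c p))"
  if [measurable]: "B \<in> sets borel" for B c
 proof -
  have "(LINT w|M. indicat_real E (\<tau> w) * indicator B (?H c w)) =
   (LINT w|M. indicator E (\<tau> w) * measure (centred_gaussian (Q c (\<tau> w))) B)"
   unfolding Q_def by (rule conditional_law[OF t A E EA that])
  also have "\<dots> = (LINT s|?L. indicator E s * measure (centred_gaussian (Q c s)) B)"
   unfolding distr_tree[symmetric] by (subst integral_distr) auto
  also have "\<dots> = (LINT s|?L. \<integral>\<xi>. indicator E s * indicator B (\<Sum>x\<in>A. c x * model_height s \<xi> t x) \<partial>?X)"
  proof (rule Bochner_Integration.integral_cong[OF refl])
   fix s
   have "(\<Sum>x\<in>A. c x * model_height s \<xi> t x) = (\<Sum>u | length u < n. (\<Sum>x\<in>A. c x * height_coeff s t x u) * \<xi> u)" for \<xi>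
   proof -
    have "(\<Sum>x\<in>A. c x * model_height s \<xi> t x) = (\<Sum>x\<in>A. \<Sum>u | length u < n. c x * height_coeff s t x u * \<xi> u)"
     using A by (intro sum.cong refl) (simp add: model_height_eq[where n=n] sum_distrib_left mult.assoc)
    then show ?thesis by (subst (asm) sum.swap) (simp add: sum_distrib_right)
   qed
   then have "measure (centred_gaussian (Q c s)) B = (LINT \<xi>|?X. indicator B (\<Sum>x\<in>A. c x * model_height s \<xi> t x))"
    unfolding Q_def distr_weighted_normals[OF finite_short, symmetric]
    by (subst measure_distr_eq_integral) auto
   then show "indicator E s * measure (centred_gaussian (Q c s)) B = (LINT \<xi>|?X. indicator E s * indicator B (\<Sum>x\<in>A. c x * model_height s \<xi> t x))"
    by simp
  qed
  also have "\<dots> = (LINT p|?P. indicat_real E (fst p) * indicator B (?G c p))"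
  proof -
   have "integrable ?P (\<lambda>p. indicat_real E (fst p) * indicator B (?G c p))"
    by (intro integrable_bounded_real[where K=1] LX.finite_measure_axioms) (auto simp: indicator_def)
   from LX.integral_fst'[OF this] show ?thesis by simp
  qed
  finally show ?thesis .
 qed
 \<comment> \<open>Equality on Borel sets becomes equality of the measures weighted by
   \<open>E\<close>, and hence of their Fourier transforms.\<close>
 have int: "(LINT w|M. indicat_real E (\<tau> w) *\<^sub>R cis (?H c w)) = (LINT p|?P. indicat_real E (fst p) *\<^sub>R cis (?G c p))" for c
 proof -
  have e: "emeasure (distr (density N (\<lambda>x. ennreal (indicator E (T x)))) borel X) B = ennreal (LINT x|N. indicat_real E (T x) * indicator B (X x))"
   if "finite_measure N" and [measurable]: "T \<in> measurable N (Pi\<^sub>M UNIV (\<lambda>_. borel))" "X \<in> borel_measurable N" "B \<in> sets borel"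
   for N :: "'z measure" and T and X :: "'z \<Rightarrow> real" and B
  proof -
   have "emeasure (distr (density N (\<lambda>x. ennreal (indicator E (T x)))) borel X) B = (\<integral>\<^sup>+x. ennreal (indicat_real E (T x) * indicator B (X x)) \<partial>N)"
    by (subst emeasure_distr, simp, simp, subst emeasure_density) (auto intro!: nn_integral_cong simp: indicator_def)
   also have "\<dots> = ennreal (LINT x|N. indicat_real E (T x) * indicator B (X x))"
    using that(1) by (intro nn_integral_eq_integral integrable_bounded_real[where K=1]) (auto simp: indicator_def)
   finally show ?thesis .
  qed
  have [measurable]: "cis \<in> borel_measurable borel" by (intro borel_measurable_continuous_onI continuous_intros)
  have "distr (density M (\<lambda>w. ennreal (indicator E (\<tau> w)))) borel (?H c) = distr (density ?P (\<lambda>p. ennreal (indicator E (fst p)))) borel (?G c)"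
   by (intro measure_eqI) (simp_all add: e law finite_measure_axioms LX.finite_measure_axioms)
  then have "(LINT x|distr (density M (\<lambda>w. ennreal (indicator E (\<tau> w)))) borel (?H c). cis x) = (LINT x|distr (density ?P (\<lambda>p. ennreal (indicator E (fst p)))) borel (?G c). cis x)"
   by simp
  then show ?thesis by (simp add: integral_distr integral_density)
 qed
 show ?thesis
  by (rule product_law_unique[where ?W1.0 = "\<lambda>w. indicator E (\<tau> w)" and ?W2.0 = "\<lambda>p. indicator E (fst p)" and ?X1.0 = "\<lambda>x w. h w t x"
   and ?X2.0 = "\<lambda>x p. model_height (fst p) (snd p) t x" and g = "\<lambda>_. g"])
   (use A g int in \<open>auto intro: finite_measure_axioms LX.finite_measure_axioms\<close>)
qed

text \<open>The set of living particles is random, whereas \<open>leaf_law\<close> needs a fixed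
  one: the product is decomposed according to which of the finitely many short labels are
  alive.\<close>

lemma short_leaf_law:
 assumes t: "0 \<le> t" and g: "g \<in> borel_measurable borel" "\<And>x. 0 \<le> g x" "\<And>x. g x \<le> (1::real)"
 shows "ennreal (LINT w|M. (\<Prod>x | length x < n. if x \<in> alive (\<tau> w) t then g (y - h w t x) else 1)) =
  branch_fun (\<lambda>x. ennreal (g x)) n t y"
proof -
 let ?L = lifetimes_law and ?X = displacements_law
 interpret L: prob_space ?L by (intro prob_space_PiM prob_space_lifetime)
 interpret X: prob_space ?X by (intro prob_space_PiM prob_space_std_normal)
 interpret LX: pair_prob_space ?L ?X ..
 let ?P = "?L \<Otimes>\<^sub>M ?X"
 note [measurable] = height_measurable[OF t] g(1)
 have mh [measurable]: "(\<lambda>p. model_height (fst p) (snd p) t x) \<in> borel_measurable ?P" for x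
  unfolding model_height_def by measurable
 define U where "U = {u :: particle. length u < n}"
 have U: "finite U" "finite (Pow U)" by (simp_all add: U_def finite_short)
 define E where "E = (\<lambda>A. {s. alive s t \<inter> U = A})"
 have E [measurable]: "E A \<in> sets (Pi\<^sub>M UNIV (\<lambda>_. borel))" for A
 proof -
  have "Measurable.pred (Pi\<^sub>M UNIV (\<lambda>_::particle. borel)) (\<lambda>s. \<forall>u. (u \<in> alive s t \<and> u \<in> U) = (u \<in> A))"
   by measurable
  then show ?thesis
   by (simp add: E_def pred_def space_PiM set_eq_iff)
 qed
 have split: "(\<Prod>x\<in>U. if x \<in> alive s t then f x else 1) = (\<Sum>A\<in>Pow U. indicator (E A) s * (\<Prod>x\<in>A. f x))" for s and f :: "particle \<Rightarrow> real"
 proof -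
  have "(\<Sum>A\<in>Pow U. indicator (E A) s * (\<Prod>x\<in>A. f x)) = (\<Sum>A\<in>{alive s t \<inter> U}. (\<Prod>x\<in>A. f x))"
   using U by (intro sum.mono_neutral_cong_right) (auto simp: E_def indicator_def)
  also have "\<dots> = (\<Prod>x\<in>U. if x \<in> alive s t then f x else 1)"
   using U by (simp add: prod.If_cases Int_commute)
  finally show ?thesis ..
 qed
 let ?g = "\<lambda>x. g (y - x)"
 have g': "?g \<in> borel_measurable borel" "\<And>x. 0 \<le> ?g x" "\<And>x. ?g x \<le> 1" using g by auto
 have pr: "0 \<le> (\<Prod>x\<in>A. g (f x))" "(\<Prod>x\<in>A. g (f x)) \<le> 1" for A and f :: "particle \<Rightarrow> real"
  using g by (auto intro!: prod_nonneg prod_le_1)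
 let ?q = "\<lambda>p. \<Prod>x\<in>U. if x \<in> alive (fst p) t then g (y - model_height (fst p) (snd p) t x) else 1"
 have "(LINT w|M. (\<Prod>x\<in>U. if x \<in> alive (\<tau> w) t then g (y - h w t x) else 1)) =
   (\<Sum>A\<in>Pow U. \<integral>w. indicator (E A) (\<tau> w) * (\<Prod>x\<in>A. g (y - h w t x)) \<partial>M)"
  unfolding split
  by (intro Bochner_Integration.integral_sum integrable_bounded)
   (auto simp: indicator_def pr abs_of_nonneg)
 also have "\<dots> = (\<Sum>A\<in>Pow U. \<integral>p. indicator (E A) (fst p) * (\<Prod>x\<in>A. g (y - model_height (fst p) (snd p) t x)) \<partial>?P)"
  by (intro sum.cong refl leaf_law[OF t _ _ E _ g', where n=n]) (auto simp: U_def E_def intro: finite_subset[OF _ finite_short])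
 also have "\<dots> = (LINT p|?P. (?q p))"
  unfolding split
  by (intro Bochner_Integration.integral_sum[symmetric] integrable_bounded_real[where K=1] LX.finite_measure_axioms)
   (auto simp: indicator_def pr abs_of_nonneg)
 finally have eq: "(LINT w|M. (\<Prod>x\<in>U. if x \<in> alive (\<tau> w) t then g (y - h w t x) else 1)) =
  (LINT p|?P. (?q p))" .
 have "ennreal (LINT p|?P. (?q p)) = (\<integral>\<^sup>+p. ennreal (?q p) \<partial>?P)"
 proof (intro nn_integral_eq_integral[symmetric] integrable_bounded_real[where K=1] LX.finite_measure_axioms)
  fix p :: "(particle \<Rightarrow> real) \<times> (particle \<Rightarrow> real)"
  have "0 \<le> (?q p)"
   "(?q p) \<le> 1"
   using g by (auto intro!: prod_le_1 prod_nonneg)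
  then show "\<bar>\<Prod>x\<in>U. if x \<in> alive (fst p) t then g (y - model_height (fst p) (snd p) t x) else 1\<bar> \<le> 1" by simp
 qed (use g in \<open>auto intro!: prod_nonneg\<close>)
 also have "\<dots> = (\<integral>\<^sup>+p. leaf_prod (\<lambda>x. ennreal (g x)) n (fst p) (snd p) t y \<partial>?P)"
  unfolding leaf_prod_def U_def using g
  by (intro nn_integral_cong) (subst prod_ennreal[symmetric], auto intro!: prod.cong)
 also have "\<dots> = branch_fun (\<lambda>x. ennreal (g x)) n t y"
  unfolding branch_fun_def by (subst X.nn_integral_fst[symmetric]) auto
 finally show ?thesis unfolding eq[unfolded U_def] unfolding U_def .
qed

end

section \<open>Gaussian and exponential integrals\<close>

lemma nn_integral_normal_add:
 assumes [measurable]: "f \<in> borel_measurable borel" and rs: "0 \<le> r" "0 \<le> s"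
 shows "(GAUSS z. GAUSS z'. f (sqrt r * z + sqrt s * z')) =
  (GAUSS z. f (sqrt (r + s) * z))"
proof -
 let ?X = displacements_law and ?N = std_normal_distribution
 interpret X: prob_space ?X by (intro prob_space_PiM prob_space_std_normal)
 interpret PX: product_prob_space "\<lambda>_. std_normal_distribution" "UNIV :: particle set"
  using prob_space_std_normal by unfold_locales (auto simp: prob_space_def prob_space_axioms_def finite_measure_def sigma_finite_measure_def)
 \<comment> \<open>The coordinates \<open>[]\<close> and \<open>[False]\<close> of the displacement
   family serve as two independent normal variables.\<close>
 define d where "d = (\<lambda>u :: particle. if u = [] then sqrt r else sqrt s)"
 have "(\<Sum>u\<in>{[], [False]}. (d u)\<^sup>2) = r + s" using rs by (simp add: d_def)
 then have "distr ?X borel (\<lambda>\<xi>. \<Sum>u\<in>{[], [False]}. d u * \<xi> u) = distr ?N borel (\<lambda>z. sqrt (r + s) * z)"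
  using distr_weighted_normals[of "{[], [False]}" d] by (simp add: centred_gaussian_def)
 then have law: "distr ?X borel (\<lambda>\<xi>. sqrt r * \<xi> [] + sqrt s * \<xi> [False]) = distr ?N borel (\<lambda>z. sqrt (r + s) * z)"
  by (simp add: d_def)
 have "(GAUSS z. f (sqrt (r + s) * z)) = (\<integral>\<^sup>+x. f x \<partial>distr ?N borel (\<lambda>z. sqrt (r + s) * z))"
  by (subst nn_integral_distr) auto
 also have "\<dots> = (\<integral>\<^sup>+\<xi>. f (sqrt r * \<xi> [] + sqrt s * \<xi> [False]) \<partial>?X)"
  unfolding law[symmetric] by (subst nn_integral_distr) auto
 also have "\<dots> = (GAUSS z. \<integral>\<^sup>+\<xi>0. \<integral>\<^sup>+\<xi>1. f (sqrt r * z + sqrt s * \<xi>0 []) \<partial>?X \<partial>?X)"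
  by (subst nn_integral_glue[OF prob_space_std_normal]) auto
 also have "\<dots> = (GAUSS z. GAUSS z'. f (sqrt r * z + sqrt s * z'))"
 proof (intro nn_integral_cong)
  fix z
  have "(GAUSS z'. f (sqrt r * z + sqrt s * z')) = (\<integral>\<^sup>+z'. f (sqrt r * z + sqrt s * z') \<partial>distr ?X ?N (\<lambda>\<xi>. \<xi> []))"
   by (simp add: PX.PiM_component)
  also have "\<dots> = (\<integral>\<^sup>+\<xi>. f (sqrt r * z + sqrt s * \<xi> []) \<partial>?X)"
   by (subst nn_integral_distr) auto
  finally show "(\<integral>\<^sup>+\<xi>0. \<integral>\<^sup>+\<xi>1. f (sqrt r * z + sqrt s * \<xi>0 []) \<partial>?X \<partial>?X) = (GAUSS z'. f (sqrt r * z + sqrt s * z'))"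
   by (simp add: X.emeasure_space_1)
 qed
 finally show ?thesis ..
qed

text \<open>The Cameron-Martin formula. With \<open>a = sqrt 2 * sqrt s\<close> it turns the weight
  \<open>exp (sqrt 2 * y)\<close> into a drift of speed \<open>sqrt 2\<close>.\<close>

lemma nn_integral_normal_shift:
 assumes [measurable]: "f \<in> borel_measurable borel"
 shows "(GAUSS z. eexp (a * z - a\<^sup>2 / 2) * f z) = (GAUSS z. f (z + a))"
proof -
 have e: "std_normal_density z * exp (a * z - a\<^sup>2 / 2) = std_normal_density (z - a)" for z
  by (simp add: std_normal_density_def power2_eq_square field_simps flip: exp_add)
 have "(GAUSS z. eexp (a * z - a\<^sup>2 / 2) * f z) =
  (LEB z. ennreal (std_normal_density (z - a)) * f z)"
  by (subst nn_integral_density) (auto simp: mult.assoc[symmetric] ennreal_mult[symmetric] e)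
 also have "\<dots> = (LEB z. ennreal (std_normal_density z) * f (z + a))"
  by (subst nn_integral_real_affine[where c=1 and t=a]) (auto simp: ac_simps)
 also have "\<dots> = (GAUSS z. f (z + a))"
  by (subst nn_integral_density) auto
 finally show ?thesis .
qed

lemma nn_integral_lifetime:
 assumes [measurable]: "f \<in> borel_measurable borel"
 shows "(LIFE s. f s) = (LEB s. eexp (- s) * f s * indicator {0..} s)"
 by (subst nn_integral_density) (auto simp: exponential_density_def indicator_def ac_simps intro!: nn_integral_cong)

lemma lifetime_memoryless:
 assumes [measurable]: "f \<in> borel_measurable borel" and r: "0 \<le> r"
 shows "(LIFE s. f s * indicator {r<..} s) = eexp (- r) * (LIFE s. f (s + r))"
proof -
 have "(LIFE s. f s * indicator {r<..} s) = (LEB s. eexp (- s) * f s * indicator {r<..} s)"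
  using r by (subst nn_integral_lifetime) (auto simp: indicator_def intro!: nn_integral_cong)
 also have "\<dots> = (LEB s. eexp (- r) * (eexp (- s) * f (s + r) * indicator {0<..} s))"
 proof (subst nn_integral_real_affine[where c=1 and t=r])
  have e: "eexp (- (r + s)) = eexp (- r) * eexp (- s)" for s
   by (simp add: ennreal_mult[symmetric] exp_add[symmetric])
  have i: "indicator {r<..} (r + s) = (indicator {0<..} s :: ennreal)" for s
   by (simp add: indicator_def)
  show "ennreal \<bar>1\<bar> * (LEB s. eexp (- (r + 1 * s)) * f (r + 1 * s) * indicator {r<..} (r + 1 * s)) =
   (LEB s. eexp (- r) * (eexp (- s) * f (s + r) * indicator {0<..} s))"
   by (simp add: e[simplified] i mult.assoc add.commute[of _ r])
 qed auto
 also have "\<dots> = eexp (- r) * (LEB s. eexp (- s) * f (s + r) * indicator {0<..} s)"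
  by (subst nn_integral_cmult) auto
 also have "(LEB s. eexp (- s) * f (s + r) * indicator {0<..} s) = (LIFE s. f (s + r))"
  by (subst nn_integral_lifetime, simp, intro nn_integral_cong_AE, use AE_lborel_singleton[of 0] in eventually_elim)
   (auto simp: indicator_def)
 finally show ?thesis .
qed

text \<open>The renewal equation of the mean population size \<open>exp t\<close>: a split at time
  \<open>s\<close> leaves two populations of mean size \<open>exp (t - s)\<close>, and no split
  occurs with probability \<open>exp (- t)\<close>.\<close>

lemma lifetime_exp_upto:
 assumes "0 \<le> t"
 shows "(LIFE s. ennreal (2 * exp (t - s)) * indicator {..t} s) + eexp (- t) = ennreal (exp t)"
proof -
 have "(LIFE s. ennreal (2 * exp (t - s)) * indicator {..t} s) =
  (LEB s. ennreal (2 * exp (t - 2 * s)) * indicator {0..t} s)"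
 proof -
  have "exp (- s) * (2 * exp (t - s)) = 2 * exp (t - 2 * s)" for s :: real
   by (simp add: mult.left_commute[of "exp (- s)"] exp_add[symmetric])
  then show ?thesis
   by (subst nn_integral_lifetime) (auto simp: indicator_def ennreal_mult[symmetric] intro!: nn_integral_cong)
 qed
 also have "\<dots> = ennreal (- exp (t - 2 * t) - (- exp (t - 2 * 0)))"
  using assms by (intro nn_integral_FTC_Icc[where F = "\<lambda>s. - exp (t - 2 * s)"]) (auto intro!: derivative_eq_intros)
 also have "\<dots> + eexp (- t) = ennreal (exp t)"
  using assms by (simp flip: ennreal_plus)
 finally show ?thesis .
qed

lemma lifetime_laplace: "(LINT s|lifetime_law. exp (- 4 * s)) = 1 / 5"
proof -
 have "(LIFE s. eexp (- 4 * s)) = (LEB s. ennreal (1 / 5) * ennreal (exponential_density 5 s))"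
  by (subst nn_integral_density)
   (auto simp: exponential_density_def ennreal_mult[symmetric] exp_add[symmetric] intro!: nn_integral_cong)
 also have "\<dots> = ennreal (1 / 5)"
  using prob_space.emeasure_space_1[OF prob_space_exponential_density[of 5]]
  by (simp add: nn_integral_cmult emeasure_density)
 finally show ?thesis by (simp add: integral_eq_nn_integral)
qed

section \<open>The KPP equation\<close>

abbreviation first_split_law :: "(real \<times> real) measure" where
 "first_split_law \<equiv> lifetime_law \<Otimes>\<^sub>M std_normal_distribution"

abbreviation split_nn_integral (binder "SPLIT " 61) where
 "split_nn_integral (f :: real \<times> real \<Rightarrow> ennreal) \<equiv> nn_integral first_split_law f"

interpretation split: pair_prob_space lifetime_law std_normal_distribution ..

lemma nn_integral_first_split:
 assumes [measurable]: "f \<in> borel_measurable (borel \<Otimes>\<^sub>M borel)"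
 shows "(SPLIT p. f p) = (LIFE s. GAUSS z. f (s, z))"
proof -
 show ?thesis by (subst gauss.nn_integral_fst[symmetric]) auto
qed

text \<open>For the mild form of the equation: \<open>fst p\<close> is the lifetime of the root, and \<open>snd p\<close> its
 displacement divided by the square root of the time elapsed.\<close>

definition first_split :: "(real \<Rightarrow> 'a) \<Rightarrow> (real \<Rightarrow> real \<Rightarrow> 'a) \<Rightarrow> real \<Rightarrow> real \<Rightarrow> real \<times> real \<Rightarrow> 'a" where
 "first_split g k t y p = (if t < fst p then g (y - sqrt t * snd p) else k (t - fst p) (y - sqrt (fst p) * snd p))"

lemma measurable_first_split [measurable (raw)]:
 assumes [measurable]: "g \<in> measurable borel N" "(\<lambda>p. k (fst p) (snd p)) \<in> measurable (borel \<Otimes>\<^sub>M borel) N"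
  "T \<in> borel_measurable M" "Y \<in> borel_measurable M" "S \<in> measurable M (borel \<Otimes>\<^sub>M borel)"
 shows "(\<lambda>x. first_split g k (T x) (Y x) (S x)) \<in> measurable M N"
proof -
 have [measurable]: "(\<lambda>x. k (T x - fst (S x)) (Y x - sqrt (fst (S x)) * snd (S x))) \<in> measurable M N"
  using measurable_compose[of "\<lambda>x. (T x - fst (S x), Y x - sqrt (fst (S x)) * snd (S x))" M "borel \<Otimes>\<^sub>M borel" "\<lambda>p. k (fst p) (snd p)" N]
  by simp
 show ?thesis unfolding first_split_def by measurable
qed

text \<open>McKean's representation: for \<open>g \<le> 1\<close> the truncated products decrease as
  labels are added, so the infimum is the expectation of the product over all living particles,
  which solves the KPP equation with initial value \<open>g\<close>.\<close>

definition kpp :: "(real \<Rightarrow> real) \<Rightarrow> real \<Rightarrow> real \<Rightarrow> real" where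
 "kpp g t y = enn2real (INF n. branch_fun (\<lambda>x. ennreal (g x)) n t y)"

lemma measurable_branch_fun [measurable (raw)]:
 assumes [measurable]: "g \<in> borel_measurable borel" "T \<in> borel_measurable M" "Y \<in> borel_measurable M"
 shows "(\<lambda>x. branch_fun g n (T x) (Y x)) \<in> borel_measurable M"
proof -
 interpret A: prob_space lifetimes_law by (intro prob_space_PiM prob_space_lifetime)
 interpret B: prob_space displacements_law by (intro prob_space_PiM prob_space_std_normal)
 show ?thesis unfolding branch_fun_def by measurable
qed

lemma measurable_kpp [measurable (raw)]:
 assumes [measurable]: "g \<in> borel_measurable borel" "T \<in> borel_measurable M" "Y \<in> borel_measurable M"
 shows "(\<lambda>x. kpp g (T x) (Y x)) \<in> borel_measurable M"
 unfolding kpp_def by measurable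

lemma kpp_nonneg [simp]: "0 \<le> kpp g t y"
 by (simp add: kpp_def)

lemma INF_branch_fun_le_1: "(INF n. branch_fun g n t y) \<le> 1"
 by (rule INF_lower2[of 0]) (auto simp: branch_fun_0)

lemma kpp_le_1 [simp]: "kpp g t y \<le> 1"
 unfolding kpp_def using INF_branch_fun_le_1[of "\<lambda>x. ennreal (g x)" t y]
 by (simp add: enn2real_leI)

lemma ennreal_kpp: "ennreal (kpp g t y) = (INF n. branch_fun (\<lambda>x. ennreal (g x)) n t y)"
 unfolding kpp_def using INF_branch_fun_le_1[of "\<lambda>x. ennreal (g x)" t y]
 by (intro ennreal_enn2real) (auto intro: le_less_trans)

lemma branch_fun_decseq:
 assumes "\<And>x. g x \<le> 1" shows "decseq (\<lambda>n. branch_fun g n t y)"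
proof (rule decseq_SucI)
 fix n
 have "leaf_prod g (Suc n) \<tau> \<xi> t y \<le> leaf_prod g n \<tau> \<xi> t y" for \<tau> \<xi>
 proof -
  let ?f = "\<lambda>u. if u \<in> alive \<tau> t then g (y - model_height \<tau> \<xi> t u) else 1"
  have "prod ?f B \<le> 1" if "finite B" for B
   using that by induction (use assms mult_mono[of _ "1 :: ennreal" _ 1] in \<open>auto simp: mult_le_one\<close>)
  then have "prod ?f ({u. length u < Suc n} - {u. length u < n}) * prod ?f {u. length u < n} \<le> 1 * prod ?f {u. length u < n}"
   using finite_short by (intro mult_right_mono) auto
  moreover have "prod ?f {u. length u < Suc n} = prod ?f ({u. length u < Suc n} - {u. length u < n}) * prod ?f {u. length u < n}"
   by (rule prod.subset_diff) (auto simp: finite_short)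
  ultimately show ?thesis unfolding leaf_prod_def by simp
 qed
 then show "branch_fun g (Suc n) t y \<le> branch_fun g n t y"
  unfolding branch_fun_def by (intro nn_integral_mono)
qed

lemma nn_integral_INF_prob:
 assumes "prob_space M" "\<And>n. f n \<in> borel_measurable M" "\<And>x. decseq (\<lambda>n. f n x)" "\<And>x. f 0 x \<le> (1::ennreal)"
 shows "(\<integral>\<^sup>+x. (INF n. f n x) \<partial>M) = (INF n. \<integral>\<^sup>+x. f n x \<partial>M)"
proof (rule nn_integral_monotone_convergence_INF_decseq)
 show "decseq f" using assms(3) by (intro decseq_SucI le_funI) (auto simp: decseq_Suc_iff)
 have "(\<integral>\<^sup>+x. f 0 x \<partial>M) \<le> (\<integral>\<^sup>+x. 1 \<partial>M)" using assms(4) by (intro nn_integral_mono)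
 also have "\<dots> = 1" using prob_space.emeasure_space_1[OF assms(1)] by simp
 finally show "(\<integral>\<^sup>+x. f 0 x \<partial>M) < \<infinity>" by (rule le_less_trans) simp
qed (use assms in auto)

text \<open>Passage to the limit in \<open>branch_fun_Suc\<close>: infima of decreasing sequences
  commute with integrals over probability spaces and with the square.\<close>

lemma kpp_mild_nn:
 assumes [measurable]: "g \<in> borel_measurable borel" and g: "\<And>x. 0 \<le> g x" "\<And>x. g x \<le> 1" and t: "0 \<le> t"
 shows "ennreal (kpp g t y) = (SPLIT p. ennreal (first_split g (\<lambda>r x. (kpp g r x)\<^sup>2) t y p))"
proof -
 let ?g = "\<lambda>x. ennreal (g x)"
 let ?b = "\<lambda>n. branch_fun ?g n"
 have dec: "decseq (\<lambda>n. ?b n t y)" for t y by (rule branch_fun_decseq) (use g in \<open>auto simp: ennreal_le_1\<close>)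
 have le1: "?b n t y \<le> 1" for n t y
  using decseqD[OF dec[of t y], of 0 n] by (simp add: branch_fun_0)
 have rec: "?b (Suc n) t y = (SPLIT p. first_split ?g (\<lambda>r x. (?b n r x)\<^sup>2) t y p)" for n
  using t by (subst branch_fun_Suc; simp add: nn_integral_first_split) (simp add: first_split_def cong: if_cong)
 have sq: "(INF n. (?b n r x)\<^sup>2) = (INF n. ?b n r x)\<^sup>2" for r x
 proof -
  define a where "a = (INF n. ?b n r x)"
  have "(\<lambda>n. ?b n r x) \<longlonglongrightarrow> a" unfolding a_def by (rule LIMSEQ_INF[OF dec])
  then have "(\<lambda>n. (?b n r x)\<^sup>2) \<longlonglongrightarrow> (INF n. ?b n r x)\<^sup>2"
   unfolding power2_eq_square a_def[symmetric] by (intro tendsto_mult_ennreal) auto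
  moreover have "decseq (\<lambda>n. (?b n r x)\<^sup>2)"
   using dec[of r x] by (auto simp: decseq_def intro!: power_mono)
  ultimately show ?thesis using LIMSEQ_INF LIMSEQ_unique by blast
 qed
 have "ennreal (kpp g t y) = (INF n. ?b (Suc n) t y)"
  unfolding ennreal_kpp
 proof (rule antisym)
  show "(INF n. ?b n t y) \<le> (INF n. ?b (Suc n) t y)" by (intro INF_greatest INF_lower) auto
  show "(INF n. ?b (Suc n) t y) \<le> (INF n. ?b n t y)"
   using dec[of t y] by (intro INF_mono) (auto simp: decseq_Suc_iff)
 qed
 also have "\<dots> = (SPLIT p. (INF n. first_split ?g (\<lambda>r x. (?b n r x)\<^sup>2) t y p))"
  unfolding rec
  by (rule nn_integral_INF_prob[symmetric, OF split.prob_space_axioms])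
   (use dec g le1 in \<open>auto simp: first_split_def decseq_def branch_fun_0 ennreal_le_1 intro!: power_mono\<close>)
 also have "\<dots> = (SPLIT p. ennreal (first_split g (\<lambda>r x. (kpp g r x)\<^sup>2) t y p))"
  by (intro nn_integral_cong) (auto simp: first_split_def sq ennreal_kpp[symmetric] ennreal_power)
 finally show ?thesis .
qed

lemma kpp_mild:
 assumes [measurable]: "g \<in> borel_measurable borel" and g: "\<And>x. 0 \<le> g x" "\<And>x. g x \<le> 1" and t: "0 \<le> t"
 shows "kpp g t y = (LINT p|first_split_law. first_split g (\<lambda>r x. (kpp g r x)\<^sup>2) t y p)"
proof -
 have "(LINT p|first_split_law. first_split g (\<lambda>r x. (kpp g r x)\<^sup>2) t y p) = enn2real (ennreal (kpp g t y))"
  unfolding kpp_mild_nn[OF assms] using g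
  by (intro integral_eq_nn_integral) (auto simp: first_split_def)
 then show ?thesis by simp
qed

lemma first_split_integrable:
 fixes g :: "real \<Rightarrow> real"
 assumes [measurable]: "g \<in> borel_measurable borel" "(\<lambda>p. k (fst p) (snd p)) \<in> borel_measurable (borel \<Otimes>\<^sub>M borel)"
  and "\<And>x. \<bar>g x\<bar> \<le> K" "\<And>r x. \<bar>k r x\<bar> \<le> K"
 shows "integrable first_split_law (first_split g k t y)"
proof -
 show ?thesis
  by (rule integrable_bounded_real[where K=K, OF split.finite_measure_axioms]) (use assms(3,4) in \<open>auto simp: first_split_def\<close>)
qed

text \<open>The squares are \<open>2\<close>-Lipschitz on \<open>[0, 1]\<close>, so in the norm weighted by \<open>exp (- 4 t)\<close> the mild
 equation is a contraction with factor \<open>2 / 5\<close>.\<close>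

lemma mild_comparison:
 fixes k l :: "real \<Rightarrow> real \<Rightarrow> real"
 assumes g [measurable]: "g \<in> borel_measurable borel" "g' \<in> borel_measurable borel"
  and gb: "\<And>x. 0 \<le> g x" "\<And>x. g' x \<le> 1" "\<And>x. g x \<le> g' x"
  and k_meas [measurable]: "(\<lambda>p. k (fst p) (snd p)) \<in> borel_measurable (borel \<Otimes>\<^sub>M borel)"
  and l_meas [measurable]: "(\<lambda>p. l (fst p) (snd p)) \<in> borel_measurable (borel \<Otimes>\<^sub>M borel)"
  and kl: "\<And>t x. 0 \<le> k t x" "\<And>t x. k t x \<le> 1" "\<And>t x. 0 \<le> l t x" "\<And>t x. l t x \<le> 1"
  and sub: "\<And>t y. 0 \<le> t \<Longrightarrow> k t y \<le> (LINT p|first_split_law. first_split g (\<lambda>r x. (k r x)\<^sup>2) t y p)"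
  and super: "\<And>t y. 0 \<le> t \<Longrightarrow> (LINT p|first_split_law. first_split g' (\<lambda>r x. (l r x)\<^sup>2) t y p) \<le> l t y"
  and t: "0 \<le> t"
 shows "k t y \<le> l t y"
proof -
 interpret PP: pair_prob_space lifetime_law std_normal_distribution ..
 have sq1: "\<bar>(k t x)\<^sup>2\<bar> \<le> 1" "\<bar>(l t x)\<^sup>2\<bar> \<le> 1" for t x
  using power_mono[OF kl(2)[of t x] kl(1), of 2] power_mono[OF kl(4)[of t x] kl(3), of 2] by auto
 have int: "integrable first_split_law (first_split g (\<lambda>r x. (k r x)\<^sup>2) t y)"
    "integrable first_split_law (first_split g' (\<lambda>r x. (l r x)\<^sup>2) t y)" for t y
  using sq1 gb order_trans[OF gb(1) gb(3)] order_trans[OF gb(3) gb(2)]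
  by (auto intro!: first_split_integrable[where K=1] simp: abs_of_nonneg)
 have lap: "(LINT p|first_split_law. exp (- 4 * fst p)) = 1 / 5"
 proof -
  have "integrable first_split_law (\<lambda>p. exp (- 4 * fst p) * indicator {0..} (fst p))"
   by (rule integrable_bounded_real[where K=1, OF split.finite_measure_axioms]) (auto simp: indicator_def)
  have "(LINT p|first_split_law. exp (- 4 * fst p)) = (LINT s|distr first_split_law lifetime_law fst. exp (- 4 * s))"
   by (subst integral_distr) auto
  also have "distr first_split_law lifetime_law fst = lifetime_law"
   by (rule gauss.distr_pair_fst)
  finally show ?thesis by (simp only: lifetime_laplace)
 qed
 have aesp: "AE p in first_split_law. 0 < fst p"
 proof -
  have "AE s in distr first_split_law lifetime_law fst. 0 < s"
   unfolding gauss.distr_pair_fst by (rule AE_lifetime_pos)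
  then show ?thesis by (subst (asm) AE_distr_iff) auto
 qed
 have intexp: "integrable first_split_law (\<lambda>p. exp (- 4 * fst p))"
  by (rule split.integrable_const_bound[of _ 1]) (use aesp in \<open>auto elim!: eventually_mono\<close>)
 have step: "k t y - l t y \<le> 2 / 5 * c * exp (4 * t)"
  if c: "0 \<le> c" and IH: "\<And>t y. 0 \<le> t \<Longrightarrow> k t y - l t y \<le> c * exp (4 * t)" and t: "0 \<le> t" for c t y
 proof -
  have "k t y - l t y \<le> (LINT p|first_split_law. first_split g (\<lambda>r x. (k r x)\<^sup>2) t y p) - (LINT p|first_split_law. first_split g' (\<lambda>r x. (l r x)\<^sup>2) t y p)"
   using sub[OF t, of y] super[OF t, of y] by linarith
  also have "\<dots> = (LINT p|first_split_law. first_split g (\<lambda>r x. (k r x)\<^sup>2) t y p - first_split g' (\<lambda>r x. (l r x)\<^sup>2) t y p)"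
   using int by (intro Bochner_Integration.integral_diff[symmetric]) auto
  also have "\<dots> \<le> (LINT p|first_split_law. 2 * c * exp (4 * t) * exp (- 4 * fst p))"
  proof (intro integral_mono Bochner_Integration.integrable_diff int)
   fix p :: "real \<times> real"
   let ?a = "k (t - fst p) (y - sqrt (fst p) * snd p)" and ?b = "l (t - fst p) (y - sqrt (fst p) * snd p)"
   show "first_split g (\<lambda>r x. (k r x)\<^sup>2) t y p - first_split g' (\<lambda>r x. (l r x)\<^sup>2) t y p \<le> 2 * c * exp (4 * t) * exp (- 4 * fst p)"
   proof (cases "t < fst p")
    case True
    have "g (y - sqrt t * snd p) - g' (y - sqrt t * snd p) \<le> 0" using gb(3) by simp
    also have "0 \<le> 2 * c * exp (4 * t) * exp (- 4 * fst p)" using c by simp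
    finally show ?thesis using True by (simp add: first_split_def)
   next
    \<comment> \<open>The induction provides only an upper bound of \<open>k - l\<close>, hence the
      positive part in the Lipschitz estimate.\<close>
    case False
    have "?a\<^sup>2 - ?b\<^sup>2 \<le> 2 * max 0 (?a - ?b)"
    proof (cases "?b \<le> ?a")
     case True
     have "?a\<^sup>2 - ?b\<^sup>2 = (?a + ?b) * (?a - ?b)" by (simp add: power2_eq_square algebra_simps)
     also have "\<dots> \<le> 2 * (?a - ?b)"
      using True kl(2)[of "t - fst p" "y - sqrt (fst p) * snd p"] kl(4)[of "t - fst p" "y - sqrt (fst p) * snd p"]
      by (intro mult_right_mono) linarith+
     finally show ?thesis using True by simp
    next
     case False
     then have "?a\<^sup>2 \<le> ?b\<^sup>2" by (intro power_mono kl(1)) auto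
     moreover have "0 \<le> 2 * max 0 (?a - ?b)" by simp
     ultimately show ?thesis by linarith
    qed
    also have "\<dots> \<le> 2 * (c * exp (4 * (t - fst p)))"
     using IH[of "t - fst p"] False c by (intro mult_left_mono) auto
    also have "\<dots> = 2 * c * exp (4 * t) * exp (- 4 * fst p)"
     by (simp add: mult.assoc exp_add[symmetric] algebra_simps)
    finally show ?thesis using False by (simp add: first_split_def)
   qed
  qed (intro integrable_mult_right intexp)
  also have "\<dots> = 2 * c * exp (4 * t) * (1 / 5)"
   using lap by simp
  finally show ?thesis by simp
 qed
 have bound: "k t y - l t y \<le> (2 / 5) ^ n * exp (4 * t)" if "0 \<le> t" for n t y
  using that
 proof (induction n arbitrary: t y)
  case 0
  have "k t y - l t y \<le> 1" using kl(2)[of t y] kl(3)[of t y] by linarith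
  also have "\<dots> \<le> exp (4 * t)" using 0 by simp
  finally show ?case by simp
 next
  case (Suc n)
  show ?case using step[of "(2/5)^n" t y] Suc by simp
 qed
 have "(\<lambda>n. (2 / 5) ^ n * exp (4 * t)) \<longlonglongrightarrow> 0 * exp (4 * t)"
  by (intro tendsto_mult LIMSEQ_realpow_zero tendsto_const) auto
 then have "k t y - l t y \<le> 0 * exp (4 * t)"
  by (rule LIMSEQ_le_const) (use bound[OF t] in auto)
 then show ?thesis by simp
qed

lemma kpp_unique:
 fixes k :: "real \<Rightarrow> real \<Rightarrow> real"
 assumes [measurable]: "g \<in> borel_measurable borel" and gb: "\<And>x. 0 \<le> g x" "\<And>x. g x \<le> 1"
  and [measurable]: "(\<lambda>p. k (fst p) (snd p)) \<in> borel_measurable (borel \<Otimes>\<^sub>M borel)"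
  and k: "\<And>t x. 0 \<le> k t x" "\<And>t x. k t x \<le> 1"
  and eq: "\<And>t y. 0 \<le> t \<Longrightarrow> ennreal (k t y) = (SPLIT p. ennreal (first_split g (\<lambda>r x. (k r x)\<^sup>2) t y p))"
  and t: "0 \<le> t"
 shows "k t y = kpp g t y"
proof -
 have e: "k t y = (LINT p|first_split_law. first_split g (\<lambda>r x. (k r x)\<^sup>2) t y p)" if "0 \<le> t" for t y
 proof -
  have "(LINT p|first_split_law. first_split g (\<lambda>r x. (k r x)\<^sup>2) t y p) = enn2real (ennreal (k t y))"
   unfolding eq[OF that]
  proof (rule integral_eq_nn_integral)
   show "first_split g (\<lambda>r x. (k r x)\<^sup>2) t y \<in> borel_measurable first_split_law" by measurable
  qed (use gb in \<open>auto simp: first_split_def\<close>)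
  then show ?thesis using k by simp
 qed
 note m = kpp_mild[OF assms(1-3)]
 show ?thesis
 proof (rule antisym)
  show "k t y \<le> kpp g t y"
   by (rule mild_comparison[where g=g and g'=g and k=k and l="kpp g"]) (use gb k t in \<open>auto simp: e[symmetric] m[symmetric]\<close>)
  show "kpp g t y \<le> k t y"
   by (rule mild_comparison[where g=g and g'=g and k="kpp g" and l=k]) (use gb k t in \<open>auto simp: e[symmetric] m[symmetric]\<close>)
 qed
qed

text \<open>By uniqueness it is enough that \<open>kpp g (s + r)\<close>, as a function of
  \<open>r\<close>, solves the mild equation with initial value \<open>kpp g s\<close>. If the first
  lifetime exceeds \<open>t\<close>, the remaining lifetime is again exponential and the
  displacement splits into independent increments, which restarts the equation at time
  \<open>t\<close>.\<close>

lemma kpp_semigroup: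
 assumes [measurable]: "g \<in> borel_measurable borel" and gb: "\<And>x. 0 \<le> g x" "\<And>x. g x \<le> 1"
  and s: "0 \<le> s" and t: "0 \<le> t"
 shows "kpp g (s + t) y = kpp (kpp g s) t y"
proof (rule kpp_unique[where k = "\<lambda>r x. kpp g (s + r) x"])
 let ?N = std_normal_distribution and ?L = lifetime_law
 interpret NE: pair_sigma_finite ?N ?L ..
 fix t y :: real assume t: "0 \<le> t"
 define q where "q = (\<lambda>r x. ennreal ((kpp g r x)\<^sup>2))"
 have [measurable (raw)]: "(\<lambda>x. q (T x) (Y x)) \<in> borel_measurable M"
  if [measurable]: "T \<in> borel_measurable M" "Y \<in> borel_measurable M" for T Y and M :: "'x measure"
  unfolding q_def by measurable
 define f where "f = (\<lambda>e. \<integral>\<^sup>+z. (if s + t < e then ennreal (g (y - sqrt (s + t) * z)) else q (s + t - e) (y - sqrt e * z)) \<partial>?N)"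
 have [measurable]: "f \<in> borel_measurable borel" unfolding f_def by measurable
 have ind: "\<integral>\<^sup>+e. indicator {t<..} e \<partial>?L = eexp (- t)"
  using lifetime_memoryless[of "\<lambda>_. 1" t] t lifetime.emeasure_space_1 by simp
 \<comment> \<open>Here \<open>e\<close> is the residual lifetime at time \<open>t\<close>;
   averaging over it reproduces the mild equation for \<open>kpp g s\<close> at the position reached
   at time \<open>t\<close>.\<close>
 have late: "(LIFE e. f (e + t)) = (GAUSS z. ennreal (kpp g s (y - sqrt t * z)))"
 proof -
  have "(LIFE e. f (e + t)) = (LIFE e. GAUSS z. GAUSS z'. ennreal (first_split g (\<lambda>r x. (kpp g r x)\<^sup>2) s (y - sqrt t * z) (e, z')))"
  proof (intro nn_integral_cong_AE, use AE_lifetime_pos in eventually_elim)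
   fix e :: real assume e: "0 < e"
   show "f (e + t) = (GAUSS z. GAUSS z'. ennreal (first_split g (\<lambda>r x. (kpp g r x)\<^sup>2) s (y - sqrt t * z) (e, z')))"
   proof (cases "s < e")
    case True
    then show ?thesis
     using nn_integral_normal_add[of "\<lambda>x. ennreal (g (y - x))" t s] s t
     by (simp add: f_def first_split_def diff_diff_eq add.commute[of s t])
   next
    case False
    then show ?thesis
     using nn_integral_normal_add[of "\<lambda>x. q (s - e) (y - x)" t e] e t
     by (simp add: f_def first_split_def diff_diff_eq q_def add.commute[of e t])
   qed
  qed
  also have "\<dots> = (GAUSS z. LIFE e. GAUSS z'. ennreal (first_split g (\<lambda>r x. (kpp g r x)\<^sup>2) s (y - sqrt t * z) (e, z')))"
   by (intro NE.Fubini') simp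
  also have "\<dots> = (GAUSS z. ennreal (kpp g s (y - sqrt t * z)))"
  proof (intro nn_integral_cong)
   fix z
   show "(LIFE e. GAUSS z'. ennreal (first_split g (\<lambda>r x. (kpp g r x)\<^sup>2) s (y - sqrt t * z) (e, z'))) = ennreal (kpp g s (y - sqrt t * z))"
    unfolding kpp_mild_nn[OF assms(1) gb s] by (subst nn_integral_first_split) auto
  qed
  finally show ?thesis .
 qed
 have "ennreal (kpp g (s + t) y) = (LIFE e. f e)"
 proof -
  have "ennreal (kpp g (s + t) y) = (LIFE e. GAUSS z. ennreal (first_split g (\<lambda>r x. (kpp g r x)\<^sup>2) (s + t) y (e, z)))"
   using s t by (subst kpp_mild_nn[OF assms(1) gb], simp, subst nn_integral_first_split) auto
  also have "\<dots> = (LIFE e. f e)"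
   unfolding f_def by (intro nn_integral_cong) (simp add: first_split_def q_def)
  finally show ?thesis .
 qed
 also have "\<dots> = (LIFE e. f e * indicator {..t} e + f e * indicator {t<..} e)"
  by (intro nn_integral_cong) (auto simp: indicator_def)
 also have "\<dots> = (LIFE e. f e * indicator {..t} e) + (LIFE e. f e * indicator {t<..} e)"
  by (intro nn_integral_add) auto
 also have "(LIFE e. f e * indicator {t<..} e) = eexp (- t) * (GAUSS z. ennreal (kpp g s (y - sqrt t * z)))"
  using t by (subst lifetime_memoryless) (auto simp: late)
 also have "\<dots> = (LIFE e. (GAUSS z. ennreal (kpp g s (y - sqrt t * z))) * indicator {t<..} e)"
  by (subst nn_integral_cmult) (auto simp: ind mult.commute)
 also have "(LIFE e. f e * indicator {..t} e) + \<dots> =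
   (LIFE e. f e * indicator {..t} e + (GAUSS z. ennreal (kpp g s (y - sqrt t * z))) * indicator {t<..} e)"
  by (intro nn_integral_add[symmetric]) auto
 also have "\<dots> = (LIFE e. GAUSS z. ennreal (first_split (kpp g s) (\<lambda>r x. (kpp g (s + r) x)\<^sup>2) t y (e, z)))"
  using s by (intro nn_integral_cong) (auto simp: first_split_def f_def q_def indicator_def add_diff_eq)
 also have "\<dots> = (SPLIT p. ennreal (first_split (kpp g s) (\<lambda>r x. (kpp g (s + r) x)\<^sup>2) t y p))"
  by (subst nn_integral_first_split) auto
 finally show "ennreal (kpp g (s + t) y) = (SPLIT p. ennreal (first_split (kpp g s) (\<lambda>r x. (kpp g (s + r) x)\<^sup>2) t y p))" .
qed (use t in auto)

section \<open>Comparison with the linearised equation\<close>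

definition heat :: "(real \<Rightarrow> real) \<Rightarrow> real \<Rightarrow> real \<Rightarrow> ennreal" where
 "heat \<psi> t y = (GAUSS z. ennreal (\<psi> (y - sqrt t * z)))"

lemma measurable_heat [measurable (raw)]:
 assumes [measurable]: "\<psi> \<in> borel_measurable borel" "T \<in> borel_measurable M" "Y \<in> borel_measurable M"
 shows "(\<lambda>x. heat \<psi> (T x) (Y x)) \<in> borel_measurable M"
proof -
 show ?thesis unfolding heat_def by measurable
qed

lemma heat_semigroup:
 assumes [measurable]: "\<psi> \<in> borel_measurable borel" and "0 \<le> r" "0 \<le> s"
 shows "(GAUSS z. heat \<psi> r (y - sqrt s * z)) = heat \<psi> (r + s) y"
 using nn_integral_normal_add[of "\<lambda>x. ennreal (\<psi> (y - x))" s r] assms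
 by (simp add: heat_def diff_diff_eq add.commute)

text \<open>After a split the equation for \<open>u = 1 - kpp\<close> contains
  \<open>2 * u - u\<^sup>2\<close>. Dropping the square leaves a linear equation, solved by the heat
  flow times the mean population size \<open>exp t\<close>.\<close>

lemma heat_linear_mild:
 assumes [measurable]: "\<psi> \<in> borel_measurable borel" and t: "0 \<le> t"
 shows "(SPLIT p. first_split (\<lambda>x. ennreal (\<psi> x)) (\<lambda>r x. ennreal (2 * exp r) * heat \<psi> r x) t y p) = ennreal (exp t) * heat \<psi> t y"
proof -
 let ?L = lifetime_law
 have ind: "\<integral>\<^sup>+s. indicator {t<..} s \<partial>?L = eexp (- t)"
  using lifetime_memoryless[of "\<lambda>_. 1" t] t lifetime.emeasure_space_1 by simp
 have "(SPLIT p. first_split (\<lambda>x. ennreal (\<psi> x)) (\<lambda>r x. ennreal (2 * exp r) * heat \<psi> r x) t y p) =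
  (LIFE s. GAUSS z. first_split (\<lambda>x. ennreal (\<psi> x)) (\<lambda>r x. ennreal (2 * exp r) * heat \<psi> r x) t y (s, z))"
  by (subst nn_integral_first_split) auto
 also have "\<dots> = (LIFE s. ennreal (2 * exp (t - s)) * indicator {..t} s * heat \<psi> t y + indicator {t<..} s * heat \<psi> t y)"
 proof (intro nn_integral_cong_AE, use AE_lifetime_pos in eventually_elim)
  fix s :: real assume s: "0 < s"
  show "(GAUSS z. first_split (\<lambda>x. ennreal (\<psi> x)) (\<lambda>r x. ennreal (2 * exp r) * heat \<psi> r x) t y (s, z)) =
   ennreal (2 * exp (t - s)) * indicator {..t} s * heat \<psi> t y + indicator {t<..} s * heat \<psi> t y"
  proof (cases "t < s")
   case True then show ?thesis by (simp add: first_split_def heat_def)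
  next
   case False
   then show ?thesis using s t
    by (simp add: first_split_def nn_integral_cmult heat_semigroup)
  qed
 qed
 also have "\<dots> = ((LIFE s. ennreal (2 * exp (t - s)) * indicator {..t} s) + eexp (- t)) * heat \<psi> t y"
  unfolding ind[symmetric] by (subst nn_integral_add) (auto simp: nn_integral_multc distrib_right)
 also have "\<dots> = ennreal (exp t) * heat \<psi> t y"
  using t by (simp add: lifetime_exp_upto)
 finally show ?thesis .
qed

text \<open>The first-moment (many-to-one) bound. The linear solution dominates because
  \<open>1 - (1 - v)\<^sup>2 \<le> 2 * v\<close>; it is cut off at 1 since
  \<open>mild_comparison\<close> requires values between 0 and 1.\<close>

lemma one_minus_kpp_le_heat:
 assumes [measurable]: "g \<in> borel_measurable borel" and gb: "\<And>x. 0 \<le> g x" "\<And>x. g x \<le> 1" and t: "0 \<le> t"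
 shows "ennreal (1 - kpp g t y) \<le> ennreal (exp t) * heat (\<lambda>x. 1 - g x) t y"
proof -
 define H where "H = (\<lambda>t y. ennreal (exp t) * heat (\<lambda>x. 1 - g x) t y)"
 define v where "v = (\<lambda>t y. enn2real (min 1 (H t y)))"
 have [measurable]: "(\<lambda>p. v (fst p) (snd p)) \<in> borel_measurable (borel \<Otimes>\<^sub>M borel)"
  unfolding v_def H_def by measurable
 have ev: "ennreal (v t y) = min 1 (H t y)" for t y
  unfolding v_def by (rule ennreal_enn2real, rule le_less_trans[of _ 1]) auto
 have v: "0 \<le> v t y" "v t y \<le> 1" for t y
  unfolding v_def by (auto intro!: enn2real_leI)
 have "1 - v t y \<le> kpp g t y"
 proof (rule mild_comparison[where g=g and g'=g and k="\<lambda>t y. 1 - v t y" and l="kpp g"])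
  fix t y :: real assume t: "0 \<le> t"
  let ?f = "first_split (\<lambda>x. 1 - g x) (\<lambda>r x. 1 - (1 - v r x)\<^sup>2) t y"
  have sq1: "(1 - v r x)\<^sup>2 \<le> 1" for r x using v[of r x] by (auto simp: power2_eq_square intro!: mult_le_one)
  have fb: "0 \<le> ?f p" "?f p \<le> 1" for p
   using gb sq1 by (auto simp: first_split_def)
  have intf: "integrable first_split_law ?f"
   by (rule integrable_bounded_real[where K=1, OF split.finite_measure_axioms]) (use fb in auto)
  have "ennreal (LINT p|first_split_law. ?f p) = (SPLIT p. ennreal (?f p))"
   using intf fb by (intro nn_integral_eq_integral[symmetric]) auto
  also have "\<dots> \<le> (SPLIT p. first_split (\<lambda>x. ennreal (1 - g x)) (\<lambda>r x. ennreal (2 * exp r) * heat (\<lambda>x. 1 - g x) r x) t y p)"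
  proof (rule nn_integral_mono)
   fix p :: "real \<times> real"
   have "1 - (1 - v r x)\<^sup>2 \<le> 2 * v r x" for r x by (simp add: power2_eq_square algebra_simps)
   then have "ennreal (1 - (1 - v r x)\<^sup>2) \<le> ennreal (2 * v r x)" for r x by (rule ennreal_leI)
   also have "ennreal (2 * v r x) = 2 * ennreal (v r x)" for r x by (subst ennreal_mult) (auto simp: v)
   also have "2 * ennreal (v r x) \<le> 2 * H r x" for r x unfolding ev by (intro mult_left_mono) auto
   finally have "ennreal (1 - (1 - v r x)\<^sup>2) \<le> ennreal (2 * exp r) * heat (\<lambda>x. 1 - g x) r x" for r x
    by (simp add: H_def ennreal_mult mult.assoc)
   then show "ennreal (?f p) \<le> first_split (\<lambda>x. ennreal (1 - g x)) (\<lambda>r x. ennreal (2 * exp r) * heat (\<lambda>x. 1 - g x) r x) t y p"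
    by (simp add: first_split_def)
  qed
  also have "\<dots> = H t y" unfolding H_def using t by (subst heat_linear_mild) auto
  finally have "ennreal (LINT p|first_split_law. ?f p) \<le> H t y" .
  moreover have "(LINT p|first_split_law. ?f p) \<le> 1"
   using fb intf by (intro split.integral_le_const) auto
  ultimately have "ennreal (LINT p|first_split_law. ?f p) \<le> ennreal (v t y)"
   unfolding ev by (auto simp: ennreal_le_1)
  then have "(LINT p|first_split_law. ?f p) \<le> v t y"
   using v by simp
  moreover have "(LINT p|first_split_law. first_split g (\<lambda>r x. (1 - v r x)\<^sup>2) t y p) = (LINT p|first_split_law. 1 - ?f p)"
   by (intro Bochner_Integration.integral_cong) (auto simp: first_split_def)
  moreover have "\<dots> = 1 - (LINT p|first_split_law. ?f p)"
   using intf by (simp add: split.prob_space)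
  ultimately show "1 - v t y \<le> (LINT p|first_split_law. first_split g (\<lambda>r x. (1 - v r x)\<^sup>2) t y p)" by simp
 next
  fix t y :: real assume "0 \<le> t"
  then show "(LINT p|first_split_law. first_split g (\<lambda>r x. (kpp g r x)\<^sup>2) t y p) \<le> kpp g t y"
   using kpp_mild[of g t y] gb by simp
 qed (use gb v t in auto)
 then have "1 - kpp g t y \<le> v t y" by simp
 then have "ennreal (1 - kpp g t y) \<le> ennreal (v t y)" by (rule ennreal_leI)
 also have "\<dots> \<le> H t y" unfolding ev by simp
 finally show ?thesis by (simp add: H_def)
qed

text \<open>Sharpens the first-moment bound by the cost of the quadratic term at the first split,
  through \<open>(1 - k\<^sup>2) + (1 - k)\<^sup>2 = 2 * (1 - k)\<close>; after that split the plain
  bound is applied. The loss stands on the left because subtraction behaves badly in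
  \<open>ennreal\<close>.\<close>

lemma kpp_gain:
 assumes [measurable]: "g \<in> borel_measurable borel" and gb: "\<And>x. 0 \<le> g x" "\<And>x. g x \<le> 1" and t: "0 \<le> t"
 shows "ennreal (1 - kpp g t y) + (SPLIT p. first_split (\<lambda>_. 0) (\<lambda>r x. ennreal ((1 - kpp g r x)\<^sup>2)) t y p)
  \<le> ennreal (exp t) * heat (\<lambda>x. 1 - g x) t y"
proof -
 let ?f = "first_split (\<lambda>x. 1 - g x) (\<lambda>r x. 1 - (kpp g r x)\<^sup>2) t y"
 have sq1: "(kpp g r x)\<^sup>2 \<le> 1" for r x
  by (auto simp: power2_eq_square intro!: mult_le_one)
 have fb: "0 \<le> ?f p" "?f p \<le> 1" for p
  using gb sq1 by (auto simp: first_split_def)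
 have intf: "integrable first_split_law ?f"
  by (rule integrable_bounded_real[where K=1, OF split.finite_measure_axioms]) (use fb in auto)
 have "1 - kpp g t y = 1 - (LINT p|first_split_law. 1 - ?f p)"
  unfolding kpp_mild[OF assms]
  by (simp, intro Bochner_Integration.integral_cong) (auto simp: first_split_def)
 also have "\<dots> = (LINT p|first_split_law. ?f p)"
  using intf by (simp add: split.prob_space)
 finally have "ennreal (1 - kpp g t y) = (SPLIT p. ennreal (?f p))"
  using intf fb by (simp add: nn_integral_eq_integral)
 then have "ennreal (1 - kpp g t y) + (SPLIT p. first_split (\<lambda>_. 0) (\<lambda>r x. ennreal ((1 - kpp g r x)\<^sup>2)) t y p)
  = (SPLIT p. ennreal (?f p) + first_split (\<lambda>_. 0) (\<lambda>r x. ennreal ((1 - kpp g r x)\<^sup>2)) t y p)"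
  by (subst nn_integral_add) auto
 also have "\<dots> \<le> (SPLIT p. first_split (\<lambda>x. ennreal (1 - g x)) (\<lambda>r x. ennreal (2 * exp r) * heat (\<lambda>x. 1 - g x) r x) t y p)"
 proof (rule nn_integral_mono)
  fix p :: "real \<times> real"
  have "ennreal (1 - (kpp g r x)\<^sup>2) + ennreal ((1 - kpp g r x)\<^sup>2) \<le> ennreal (2 * exp r) * heat (\<lambda>x. 1 - g x) r x" if "0 \<le> r" for r x
  proof -
   have "(1 - (kpp g r x)\<^sup>2) + (1 - kpp g r x)\<^sup>2 = 2 * (1 - kpp g r x)"
    by (simp add: power2_eq_square algebra_simps)
   then have "ennreal (1 - (kpp g r x)\<^sup>2) + ennreal ((1 - kpp g r x)\<^sup>2) = ennreal (2 * (1 - kpp g r x))"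
    using sq1[of r x] by (simp add: ennreal_plus[symmetric] del: ennreal_plus)
   also have "\<dots> = 2 * ennreal (1 - kpp g r x)" by (subst ennreal_mult) auto
   also have "\<dots> \<le> 2 * (ennreal (exp r) * heat (\<lambda>x. 1 - g x) r x)"
    using that gb by (intro mult_left_mono one_minus_kpp_le_heat) auto
   finally show ?thesis by (simp add: ennreal_mult mult.assoc)
  qed
  then show "ennreal (?f p) + first_split (\<lambda>_. 0) (\<lambda>r x. ennreal ((1 - kpp g r x)\<^sup>2)) t y p \<le> first_split (\<lambda>x. ennreal (1 - g x)) (\<lambda>r x. ennreal (2 * exp r) * heat (\<lambda>x. 1 - g x) r x) t y p"
   by (simp add: first_split_def)
 qed
 also have "\<dots> = ennreal (exp t) * heat (\<lambda>x. 1 - g x) t y"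
  using t by (subst heat_linear_mild) auto
 finally show ?thesis .
qed

text \<open>The weight \<open>exp (sqrt 2 * y)\<close> is an eigenfunction of
  \<open>exp s * heat\<close> with eigenvalue \<open>exp (2 * s)\<close>, so for
  \<open>B = UNIV\<close> the linear flow conserves the weighted mass. In general this mass is
  carried along by Brownian motion with drift \<open>sqrt 2\<close>.\<close>

lemma tilted_heat:
 assumes [measurable]: "f \<in> borel_measurable borel" "B \<in> sets borel" and f: "\<And>x. 0 \<le> f x" and s: "0 \<le> s"
 shows "(LEB y. eexp (sqrt 2 * y - 2 * (t + s)) * (ennreal (exp s) * heat f s y) * indicator B y) =
  (LEB y. eexp (sqrt 2 * y - 2 * t) * ennreal (f y) *
    (GAUSS z. indicator B (y + sqrt s * z + sqrt 2 * s)))"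
proof -
 let ?N = std_normal_distribution
 interpret NL: pair_sigma_finite ?N lborel ..
 interpret LN: pair_sigma_finite lborel ?N ..
 define a where "a = sqrt 2 * sqrt s"
 have a2: "a\<^sup>2 / 2 = s" using s by (simp add: a_def power_mult_distrib)
 have as: "sqrt s * a = sqrt 2 * s" using s by (simp add: a_def mult.left_commute)
 let ?f = "\<lambda>y z. eexp (a * z - a\<^sup>2 / 2) * indicator B (y + sqrt s * z)"
 have "(LEB y. eexp (sqrt 2 * y - 2 * (t + s)) * (ennreal (exp s) * heat f s y) * indicator B y) =
  (LEB y. GAUSS z. eexp (sqrt 2 * y - 2 * t - s) * ennreal (f (y - sqrt s * z)) * indicator B y)"
 proof (intro nn_integral_cong)
  fix y :: real
  have "eexp (sqrt 2 * y - 2 * (t + s)) * ennreal (exp s) = eexp (sqrt 2 * y - 2 * t - s)"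
   by (simp add: ennreal_mult[symmetric] exp_add[symmetric])
  then show "eexp (sqrt 2 * y - 2 * (t + s)) * (ennreal (exp s) * heat f s y) * indicator B y =
   (GAUSS z. eexp (sqrt 2 * y - 2 * t - s) * ennreal (f (y - sqrt s * z)) * indicator B y)"
   unfolding heat_def by (simp add: nn_integral_cmult nn_integral_multc mult.assoc[symmetric])
 qed
 also have "\<dots> = (GAUSS z. LEB y. eexp (sqrt 2 * y - 2 * t - s) * ennreal (f (y - sqrt s * z)) * indicator B y)"
  by (intro LN.Fubini'[symmetric]) simp
 also have "\<dots> = (GAUSS z. LEB y. eexp (sqrt 2 * y - 2 * t) * ennreal (f y) * (?f y z))"
 proof (rule nn_integral_cong)
  fix z :: real
  have "(LEB y. eexp (sqrt 2 * y - 2 * t - s) * ennreal (f (y - sqrt s * z)) * indicator B y) =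
   (LEB y. eexp (sqrt 2 * (sqrt s * z + y) - 2 * t - s) * ennreal (f y) * indicator B (sqrt s * z + y))"
   by (subst nn_integral_real_affine[where c=1 and t="sqrt s * z"]) auto
  also have "\<dots> = (LEB y. eexp (sqrt 2 * y - 2 * t) * ennreal (f y) * (?f y z))"
  proof (intro nn_integral_cong)
   fix y :: real
   have "eexp (sqrt 2 * (sqrt s * z + y) - 2 * t - s) = eexp (sqrt 2 * y - 2 * t) * eexp (a * z - a\<^sup>2 / 2)"
    unfolding a2 by (simp add: ennreal_mult[symmetric] exp_add[symmetric] a_def algebra_simps)
   then show "eexp (sqrt 2 * (sqrt s * z + y) - 2 * t - s) * ennreal (f y) * indicator B (sqrt s * z + y) =
    eexp (sqrt 2 * y - 2 * t) * ennreal (f y) * (?f y z)"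
    by (simp add: ac_simps)
  qed
  finally show "(LEB y. eexp (sqrt 2 * y - 2 * t - s) * ennreal (f (y - sqrt s * z)) * indicator B y) =
   (LEB y. eexp (sqrt 2 * y - 2 * t) * ennreal (f y) * (?f y z))" .
 qed
 also have "\<dots> = (LEB y. GAUSS z. eexp (sqrt 2 * y - 2 * t) * ennreal (f y) * (?f y z))"
  by (intro NL.Fubini'[symmetric]) simp
 also have "\<dots> = (LEB y. eexp (sqrt 2 * y - 2 * t) * ennreal (f y) *
    (GAUSS z. indicator B (y + sqrt s * z + sqrt 2 * s)))"
 proof (intro nn_integral_cong)
  fix y :: real
  have "(GAUSS z. eexp (a * z - a\<^sup>2 / 2) * indicator B (y + sqrt s * z)) = (GAUSS z. indicator B (y + sqrt s * z + sqrt 2 * s))"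
   by (subst nn_integral_normal_shift) (auto simp: distrib_left as add.assoc)
  then show "(GAUSS z. eexp (sqrt 2 * y - 2 * t) * ennreal (f y) * (?f y z)) =
   eexp (sqrt 2 * y - 2 * t) * ennreal (f y) * (GAUSS z. indicator B (y + sqrt s * z + sqrt 2 * s))"
   by (simp add: nn_integral_cmult)
 qed
 finally show ?thesis .
qed

lemma kpp_0:
 assumes [measurable]: "g \<in> borel_measurable borel" and g: "\<And>x. 0 \<le> g x" "\<And>x. g x \<le> 1"
 shows "kpp g 0 y = g y"
proof -
 interpret PP: pair_prob_space lifetime_law std_normal_distribution ..
 have "AE s in distr first_split_law lifetime_law fst. 0 < s"
  unfolding gauss.distr_pair_fst by (rule AE_lifetime_pos)
 then have ae: "AE p in first_split_law. 0 < fst p" by (subst (asm) AE_distr_iff) auto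
 have "kpp g 0 y = (LINT p|first_split_law. first_split g (\<lambda>r x. (kpp g r x)\<^sup>2) 0 y p)"
  by (rule kpp_mild) (use g in auto)
 also have "\<dots> = (LINT p|first_split_law. g y)"
  by (intro integral_cong_AE) (use ae in \<open>auto simp: first_split_def elim!: eventually_mono\<close>)
 finally show ?thesis by (simp add: split.prob_space)
qed

text \<open>With \<open>g = 1\<close> on \<open>(0, \<infinity>)\<close>, the function \<open>tail_prob t y\<close> is the probability that the maximum
 at time \<open>t\<close> is at least \<open>y\<close>.\<close>

abbreviation pos_ind :: "real \<Rightarrow> real" where
 "pos_ind \<equiv> indicator {0<..}"

definition tail_prob :: "real \<Rightarrow> real \<Rightarrow> real" where
 "tail_prob t y = 1 - kpp pos_ind t y"

lemma tail_prob_measurable [measurable (raw)]: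
 assumes [measurable]: "T \<in> borel_measurable M" "Y \<in> borel_measurable M"
 shows "(\<lambda>x. tail_prob (T x) (Y x)) \<in> borel_measurable M"
 unfolding tail_prob_def by measurable

lemma tail_prob_bounds [simp]: "0 \<le> tail_prob t y" "tail_prob t y \<le> 1"
 by (auto simp: tail_prob_def)

lemma tail_prob_0: "tail_prob 0 y = indicator {..0} y"
 unfolding tail_prob_def by (subst kpp_0) (auto simp: indicator_def)

lemma tail_prob_add:
 assumes "0 \<le> t" "0 \<le> s"
 shows "tail_prob (t + s) y = 1 - kpp (\<lambda>x. 1 - tail_prob t x) s y"
 unfolding tail_prob_def by (subst kpp_semigroup) (use assms in \<open>auto simp: indicator_def\<close>)

lemma tail_prob_le_heat:
 assumes "0 \<le> t" "0 \<le> s"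
 shows "ennreal (tail_prob (t + s) y) \<le> ennreal (exp s) * heat (tail_prob t) s y"
proof -
 have "ennreal (1 - kpp (\<lambda>x. 1 - tail_prob t x) s y) \<le> ennreal (exp s) * heat (\<lambda>x. 1 - (1 - tail_prob t x)) s y"
  by (rule one_minus_kpp_le_heat) (use assms in auto)
 then show ?thesis by (simp add: tail_prob_add[OF assms])
qed

text \<open>The weight is the one conserved in \<open>tilted_heat\<close>, so the mass can only
  decrease, and only through the quadratic term.\<close>

definition front_mass :: "real \<Rightarrow> ennreal" where
 "front_mass t = (LEB y. eexp (sqrt 2 * y - 2 * t) * ennreal (tail_prob t y))"

definition front_square_mass :: "real \<Rightarrow> ennreal" where
 "front_square_mass t = (LEB y. eexp (sqrt 2 * y - 2 * t) * ennreal ((tail_prob t y)\<^sup>2))"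

lemma front_square_mass_measurable [measurable]: "front_square_mass \<in> borel_measurable borel"
 unfolding front_square_mass_def by measurable

lemma front_mass_0_finite: "front_mass 0 < \<infinity>"
proof -
 have "front_mass 0 = (LEB y. eexp (sqrt 2 * y) * indicator {..0} y)"
  unfolding front_mass_def tail_prob_0 by (intro nn_integral_cong) (auto simp: indicator_def)
 also have "\<dots> = (LEB y. eexp (- sqrt 2 * y) * indicator {0..} y)"
  by (subst nn_integral_real_affine[where c="-1" and t=0]) (auto simp: indicator_def intro!: nn_integral_cong)
 also have "\<dots> = (LEB y. ennreal (1 / sqrt 2) * ennreal (exponential_density (sqrt 2) y))"
  by (intro nn_integral_cong) (auto simp: indicator_def exponential_density_def ennreal_mult[symmetric] mult.commute)
 also have "\<dots> = ennreal (1 / sqrt 2)"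
  using prob_space.emeasure_space_1[OF prob_space_exponential_density[of "sqrt 2"]]
  by (simp add: nn_integral_cmult emeasure_density)
 finally show ?thesis by simp
qed

text \<open>\<open>kpp_gain\<close>, started from the profile at time \<open>t\<close>, is
  integrated against the conserved weight. The loss at a first split after time \<open>q\<close> is
  carried by plain heat flow without the growth \<open>exp q\<close>, whence the factor
  \<open>exp (- q)\<close> before the squared mass at time \<open>t + r - q\<close>.\<close>

lemma front_mass_step:
 assumes t: "0 \<le> t" and r: "0 \<le> r"
 shows "front_mass (t + r) + (LIFE q. eexp (- q) * front_square_mass (t + r - q) * indicator {..r} q) \<le> front_mass t"
proof -
 let ?L = lifetime_law
 interpret LE: pair_sigma_finite lborel ?L ..
 let ?e = "\<lambda>y. eexp (sqrt 2 * y - 2 * (t + r))"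
 let ?g = "\<lambda>x. 1 - tail_prob t x"
 have k: "1 - kpp ?g \<rho> y = tail_prob (t + \<rho>) y" if "0 \<le> \<rho>" for \<rho> y
  using tail_prob_add[OF t that] by simp
 have heat_mass: "(LEB y. eexp (sqrt 2 * y - 2 * (t' + s)) * (ennreal (exp s) * heat f s y)) =
  (LEB y. eexp (sqrt 2 * y - 2 * t') * ennreal (f y))"
  if [measurable]: "f \<in> borel_measurable borel" and "\<And>x. 0 \<le> f x" "0 \<le> s" for f s t'
  using tilted_heat[of f UNIV s t'] that gauss.emeasure_space_1 by simp
 let ?Q = "\<lambda>y. SPLIT p. first_split (\<lambda>_. 0) (\<lambda>\<rho> x. ennreal ((1 - kpp ?g \<rho> x)\<^sup>2)) r y p"
 have "front_mass (t + r) + (LIFE q. eexp (- q) * front_square_mass (t + r - q) * indicator {..r} q) =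
  front_mass (t + r) + (LIFE q. LEB y. ?e y * heat (\<lambda>x. (tail_prob (t + r - q) x)\<^sup>2) q y * indicator {..r} q)"
 proof (intro arg_cong2[where f="(+)"] refl nn_integral_cong_AE, use AE_lifetime_pos in eventually_elim)
  fix q :: real assume q: "0 < q"
  let ?f = "\<lambda>x. (tail_prob (t + r - q) x)\<^sup>2"
  have "eexp (- q) * front_square_mass (t + r - q) = eexp (- q) * (LEB y. ?e y * (ennreal (exp q) * heat ?f q y))"
   unfolding front_square_mass_def using heat_mass[of ?f q "t + r - q"] q by simp
  also have "\<dots> = (LEB y. eexp (- q) * (?e y * (ennreal (exp q) * heat ?f q y)))"
   by (rule nn_integral_cmult[symmetric]) measurable
  also have "\<dots> = (LEB y. ?e y * heat ?f q y)"
  proof (intro nn_integral_cong)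
   fix y
   have "eexp (- q) * ennreal (exp q) = 1" by (simp add: ennreal_mult[symmetric] exp_add[symmetric])
   moreover have "eexp (- q) * (?e y * (ennreal (exp q) * heat ?f q y)) =
    eexp (- q) * ennreal (exp q) * (?e y * heat ?f q y)"
    by (simp only: ac_simps)
   ultimately show "eexp (- q) * (?e y * (ennreal (exp q) * heat ?f q y)) = ?e y * heat ?f q y"
    by (simp only: mult_1)
  qed
  finally show "eexp (- q) * front_square_mass (t + r - q) * indicator {..r} q = (LEB y. ?e y * heat ?f q y * indicator {..r} q)"
   by (simp add: nn_integral_multc)
 qed
 also have "\<dots> = front_mass (t + r) + (LEB y. LIFE q. ?e y * heat (\<lambda>x. (tail_prob (t + r - q) x)\<^sup>2) q y * indicator {..r} q)"
  unfolding heat_def by (subst LE.Fubini') auto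
 also have "\<dots> = (LEB y. ?e y * ennreal (tail_prob (t + r) y)) + (LEB y. ?e y * (?Q y))"
 proof (intro arg_cong2[where f="(+)"] nn_integral_cong)
  show "front_mass (t + r) = (LEB y. ?e y * ennreal (tail_prob (t + r) y))" by (simp add: front_mass_def)
  fix y
  have "(?Q y) =
   (LIFE q. GAUSS z. first_split (\<lambda>_. 0) (\<lambda>\<rho> x. ennreal ((1 - kpp ?g \<rho> x)\<^sup>2)) r y (q, z))"
   by (subst nn_integral_first_split) auto
  also have "\<dots> = (LIFE q. heat (\<lambda>x. (tail_prob (t + r - q) x)\<^sup>2) q y * indicator {..r} q)"
   by (intro nn_integral_cong) (auto simp: first_split_def heat_def k indicator_def add_diff_eq)
  finally have split: "(?Q y) =
   (LIFE q. heat (\<lambda>x. (tail_prob (t + r - q) x)\<^sup>2) q y * indicator {..r} q)" .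
  show "(LIFE q. ?e y * heat (\<lambda>x. (tail_prob (t + r - q) x)\<^sup>2) q y * indicator {..r} q) =
   ?e y * (?Q y)"
  proof -
   have "(LIFE q. ?e y * (heat (\<lambda>x. (tail_prob (t + r - q) x)\<^sup>2) q y * indicator {..r} q)) =
    ?e y * (LIFE q. heat (\<lambda>x. (tail_prob (t + r - q) x)\<^sup>2) q y * indicator {..r} q)"
    unfolding heat_def by (rule nn_integral_cmult) measurable
   then show ?thesis unfolding split by (simp only: mult.assoc)
  qed
 qed
 also have "\<dots> = (LEB y. ?e y * (ennreal (1 - kpp ?g r y) + (?Q y)))"
 proof -
  show ?thesis
   by (subst nn_integral_add[symmetric]) (auto simp: k[OF r] distrib_left)
 qed
 also have "\<dots> \<le> (LEB y. ?e y * (ennreal (exp r) * heat (\<lambda>x. 1 - ?g x) r y))"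
  using r by (intro nn_integral_mono mult_left_mono kpp_gain) auto
 also have "\<dots> = front_mass t"
  unfolding front_mass_def using heat_mass[of "tail_prob t" r t] r by simp
 finally show ?thesis .
qed

lemma front_mass_antimono: "0 \<le> t \<Longrightarrow> t \<le> s \<Longrightarrow> front_mass s \<le> front_mass t"
 using front_mass_step[of t "s - t"] by (auto intro: order_trans[OF add_increasing2[OF zero_le order_refl]])

section \<open>Decay of the mass of the front\<close>

abbreviation gauss_upper :: "real \<Rightarrow> real" where
 "gauss_upper a \<equiv> measure std_normal_distribution {a<..}"

lemma gauss_upper_tendsto: "(gauss_upper \<longlongrightarrow> 0) at_top"
proof -
 interpret N: real_distribution std_normal_distribution by (rule real_dist_normal_dist)
 have "gauss_upper = (\<lambda>a. 1 - cdf std_normal_distribution a)"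
 proof
  fix a
  have "{a<..} = space std_normal_distribution - {..a}" by auto
  then show "gauss_upper a = 1 - cdf std_normal_distribution a"
   unfolding cdf_def using gauss.prob_compl[of "{..a}"] by simp
 qed
 then show ?thesis using tendsto_diff[OF tendsto_const N.cdf_lim_at_top_prob, of 1] by simp
qed

lemma gauss_lower_pos: "0 < measure std_normal_distribution {..a}"
proof -
 have "emeasure std_normal_distribution {..a} \<noteq> 0"
 proof
  assume "emeasure std_normal_distribution {..a} = 0"
  then have "{..a} \<in> null_sets std_normal_distribution" by (auto simp: null_sets_def)
  then have "{..a} \<in> null_sets lborel"
  proof (subst (asm) null_sets_density_iff)
   assume "{..a} \<in> sets lborel \<and> (AE x in lborel. x \<in> {..a} \<longrightarrow> ennreal (std_normal_density x) = 0)"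
   then have "AE x in lborel. x \<notin> {..a}" by (auto simp: normal_density_def elim!: eventually_mono)
   then show ?thesis by (subst AE_iff_null_sets) auto
  qed simp
  then have "emeasure lborel {a - 1..a} = 0"
   using null_sets_subset[of "{..a}" lborel "{a - 1..a}"] by (auto simp: null_sets_def)
  then show False by simp
 qed
 then show ?thesis using gauss.emeasure_eq_measure[of "{..a}"] by (auto simp: less_le)
qed

text \<open>The true mass is dominated by the linear flow started at time \<open>S\<close>, in
  particular above the level \<open>sqrt 2 * r - sqrt r\<close>. Below that level the linear flow
  holds at least the stated Gaussian fraction of the mass that lay below
  \<open>sqrt 2 * S + A * sqrt S\<close> at time \<open>S\<close>; what lay above is bounded by a
  Gaussian tail. All terms are arranged without subtraction.\<close>

lemma front_low_mass:
 assumes S: "1 \<le> S" and \<rho>: "0 \<le> \<rho>" "\<rho> \<le> 1" and A: "0 \<le> A"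
 defines "r \<equiv> S + (S + \<rho>)"
 shows "front_mass r + ennreal (measure std_normal_distribution {..- (A + 2)}) * front_mass S \<le>
  (LEB y. eexp (sqrt 2 * y - 2 * r) * ennreal (tail_prob r y) * indicator {..sqrt 2 * r - sqrt r} y) +
  front_mass S + ennreal (measure std_normal_distribution {..- (A + 2)}) * (front_mass 0 * ennreal (gauss_upper A))"
proof -
 let ?N = std_normal_distribution
 define s where "s = S + \<rho>"
 have rs: "r = S + s" and s1: "1 \<le> s" "S \<le> s" using S \<rho> by (auto simp: r_def s_def)
 define b where "b = sqrt 2 * r - sqrt r"
 define p where "p = measure ?N {..- (A + 2)}"
 define low where "low = (\<lambda>f. \<integral>\<^sup>+y. f y * indicator {..b} y \<partial>lborel :: ennreal)"
 define high where "high = (\<lambda>f. \<integral>\<^sup>+y. f y * indicator {b<..} y \<partial>lborel :: ennreal)"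
 define k where "k = (\<lambda>y. eexp (sqrt 2 * y - 2 * r) * ennreal (tail_prob r y))"
 define k' where "k' = (\<lambda>y. eexp (sqrt 2 * y - 2 * r) * (ennreal (exp s) * heat (tail_prob S) s y))"
 define j where "j = (\<lambda>y. eexp (sqrt 2 * y - 2 * S) * ennreal (tail_prob S y))"
 have [measurable]: "k \<in> borel_measurable borel" "k' \<in> borel_measurable borel" "j \<in> borel_measurable borel"
  unfolding k_def k'_def j_def by measurable
 have split: "(LEB y. f y) = low f + high f" if [measurable]: "f \<in> borel_measurable borel" for f
  unfolding low_def high_def
  by (subst nn_integral_add[symmetric]) (auto intro!: nn_integral_cong simp: indicator_def)
 have kk': "k y \<le> k' y" for y
  unfolding k_def k'_def rs using s1 S by (intro mult_left_mono tail_prob_le_heat) auto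
 have mr: "front_mass r = low k + high k" by (subst split[symmetric]) (auto simp: front_mass_def k_def)
 have m': "front_mass S = low k' + high k'"
 proof -
  have "(LEB y. k' y * indicator UNIV y) = front_mass S"
   unfolding k'_def rs front_mass_def using s1 gauss.emeasure_space_1 by (subst tilted_heat) auto
  then show ?thesis by (subst split[symmetric]) auto
 qed
 define B where "B = {..sqrt 2 * S + A * sqrt S}"
 have mS: "front_mass S = (LEB y. j y * indicator B y) + (LEB y. j y * indicator (- B) y)"
  unfolding front_mass_def j_def[symmetric]
  by (subst nn_integral_add[symmetric]) (auto intro!: nn_integral_cong simp: indicator_def B_def)
 have tail: "(LEB y. j y * indicator (- B) y) \<le> front_mass 0 * ennreal (gauss_upper A)"
 proof -
  have "(LEB y. j y * indicator (- B) y) \<le>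
   (LEB y. eexp (sqrt 2 * y - 2 * (0 + S)) * (ennreal (exp S) * heat (tail_prob 0) S y) * indicator (- B) y)"
   unfolding j_def using S tail_prob_le_heat[of 0 S]
   by (intro nn_integral_mono mult_right_mono) (auto intro!: mult_left_mono)
  also have "\<dots> = (LEB y. eexp (sqrt 2 * y - 2 * 0) * ennreal (tail_prob 0 y) *
    (GAUSS z. indicator (- B) (y + sqrt S * z + sqrt 2 * S)))"
   using S by (intro tilted_heat) (auto simp: B_def)
  also have "\<dots> \<le> (LEB y. eexp (sqrt 2 * y - 2 * 0) * ennreal (tail_prob 0 y) * ennreal (gauss_upper A))"
  proof (intro nn_integral_mono)
   fix y
   show "eexp (sqrt 2 * y - 2 * 0) * ennreal (tail_prob 0 y) * (GAUSS z. indicator (- B) (y + sqrt S * z + sqrt 2 * S))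
     \<le> eexp (sqrt 2 * y - 2 * 0) * ennreal (tail_prob 0 y) * ennreal (gauss_upper A)"
   proof (cases "y \<le> 0")
    case True
    have "(GAUSS z. indicator (- B) (y + sqrt S * z + sqrt 2 * S)) \<le> (GAUSS z. indicator {A<..} z)"
    proof (intro nn_integral_mono)
     fix z
     show "indicator (- B) (y + sqrt S * z + sqrt 2 * S) \<le> (indicator {A<..} z :: ennreal)"
     proof (cases "A < z")
      case False
      then have "sqrt S * z \<le> A * sqrt S" using S by (subst mult.commute) (intro mult_right_mono, auto)
      then show ?thesis using True by (auto simp: B_def indicator_def)
     qed (auto simp: indicator_def)
    qed
    also have "\<dots> = ennreal (gauss_upper A)" by (simp add: gauss.emeasure_eq_measure)
    finally show ?thesis by (intro mult_left_mono) auto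
   qed (simp add: tail_prob_0)
  qed
  also have "\<dots> = front_mass 0 * ennreal (gauss_upper A)"
   unfolding front_mass_def by (subst nn_integral_multc) auto
  finally show ?thesis .
 qed
 have lowk': "ennreal p * (LEB y. j y * indicator B y) \<le> low k'"
 proof -
  have "ennreal p * (LEB y. j y * indicator B y) = (LEB y. ennreal p * (j y * indicator B y))"
   by (rule nn_integral_cmult[symmetric]) (auto simp: B_def)
  also have "\<dots> \<le> (LEB y. j y * (GAUSS z. indicator {..b} (y + sqrt s * z + sqrt 2 * s)))"
  proof (intro nn_integral_mono)
   fix y
   show "ennreal p * (j y * indicator B y) \<le> j y * (GAUSS z. indicator {..b} (y + sqrt s * z + sqrt 2 * s))"
   proof (cases "y \<in> B")
    case True
    have "ennreal p = (GAUSS z. indicator {..- (A + 2)} z)" by (simp add: gauss.emeasure_eq_measure p_def)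
    also have "\<dots> \<le> (GAUSS z. indicator {..b} (y + sqrt s * z + sqrt 2 * s))"
    proof (intro nn_integral_mono)
     fix z
     show "indicator {..- (A + 2)} z \<le> (indicator {..b} (y + sqrt s * z + sqrt 2 * s) :: ennreal)"
     proof (cases "z \<le> - (A + 2)")
      \<comment> \<open>In \<open>- (A + 2)\<close> the part \<open>A\<close> cancels the excess of
        \<open>y\<close> over \<open>sqrt 2 * S\<close>, and the 2 pays for \<open>sqrt r\<close>,
        as \<open>sqrt r \<le> 2 * sqrt s\<close>.\<close>
      case z: True
      have "r \<le> 4 * s" using s1 rs by simp
      then have "sqrt r \<le> sqrt (4 * s)" by (rule real_sqrt_le_mono)
      then have r2: "sqrt r \<le> 2 * sqrt s" by (simp add: real_sqrt_mult)
      have "sqrt s * z \<le> sqrt s * (- (A + 2))" using z s1 by (intro mult_left_mono) auto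
      moreover have "A * sqrt S \<le> A * sqrt s" using A s1 by (intro mult_left_mono) auto
      moreover have "y \<le> sqrt 2 * S + A * sqrt S" using True by (simp add: B_def)
      moreover have "sqrt 2 * r = sqrt 2 * S + sqrt 2 * s" by (simp add: rs distrib_left)
      ultimately have "y + sqrt s * z + sqrt 2 * s \<le> b"
       unfolding b_def using r2 by (simp add: algebra_simps)
      then show ?thesis by (simp add: indicator_def)
     qed (simp add: indicator_def)
    qed
    finally show ?thesis using True by (simp add: mult.commute[of "ennreal p"] mult_left_mono)
   qed simp
  qed
  also have "\<dots> = low k'"
   unfolding low_def k'_def j_def rs using s1 by (subst tilted_heat) auto
  finally show ?thesis .
 qed
 have high: "high k \<le> high k'" unfolding high_def using kk' by (intro nn_integral_mono mult_right_mono) auto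
 have "front_mass r + ennreal p * front_mass S = low k + high k + ennreal p * (LEB y. j y * indicator B y) + ennreal p * (LEB y. j y * indicator (- B) y)"
  by (simp add: mr mS distrib_left add.assoc)
 also have "\<dots> \<le> low k + high k' + low k' + ennreal p * (front_mass 0 * ennreal (gauss_upper A))"
  using high lowk' tail by (intro add_mono mult_left_mono) auto
 also have "\<dots> = low k + front_mass S + ennreal p * (front_mass 0 * ennreal (gauss_upper A))"
  by (simp add: m' ac_simps)
 finally show ?thesis by (simp add: p_def low_def k_def b_def)
qed

text \<open>If the mass kept a positive limit, the linear heat flow would bring a fixed fraction of it
 behind the front, where the killing rate is bounded below.\<close>

lemma front_mass_vanishes:
 assumes c: "0 < c" and front: "\<And>r y. r0 \<le> r \<Longrightarrow> y \<le> sqrt 2 * r - sqrt r \<Longrightarrow> c \<le> tail_prob r y" and e: "0 < e"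
 shows "\<exists>s\<ge>0. front_mass s < ennreal e"
proof (rule ccontr)
 assume "\<not> ?thesis"
 then have ge: "ennreal e \<le> front_mass s" if "0 \<le> s" for s using that by (auto simp: not_less)
 let ?N = std_normal_distribution
 define m where "m = (\<lambda>s. enn2real (front_mass s))"
 have em: "front_mass s = ennreal (m s)" if "0 \<le> s" for s
  using front_mass_antimono[of 0 s] front_mass_0_finite that
  unfolding m_def by (subst ennreal_enn2real) (auto intro: le_less_trans)
 have m0: "0 \<le> m s" for s by (simp add: m_def)
 have me: "e \<le> m s" if "0 \<le> s" for s using ge[OF that] em[OF that] m0 e by simp
 have anti: "m t \<le> m s" if "0 \<le> s" "s \<le> t" for s t
  using front_mass_antimono[OF that] em that m0 by simp
 have "\<forall>\<^sub>F A in at_top. m 0 * gauss_upper A < e / 2 \<and> (0 :: real) \<le> A"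
 proof (intro eventually_conj eventually_ge_at_top)
  have "((\<lambda>A. m 0 * gauss_upper A) \<longlongrightarrow> m 0 * 0) at_top" by (intro tendsto_mult tendsto_const gauss_upper_tendsto)
  then show "\<forall>\<^sub>F A in at_top. m 0 * gauss_upper A < e / 2" using e by (intro order_tendstoD) auto
 qed
 \<comment> \<open>With this \<open>A\<close> the far mass in \<open>front_low_mass\<close> is less
   than half of the assumed lower bound \<open>e\<close>.\<close>
 then obtain A where A: "m 0 * gauss_upper A < e / 2" "0 \<le> A"
  by (auto simp: eventually_at_top_linorder)
 define p where "p = measure ?N {..- (A + 2)}"
 have p: "0 < p" "p \<le> 1" unfolding p_def by (auto simp: gauss_lower_pos gauss.prob_le_1)
 let ?low = "\<lambda>r. \<integral>\<^sup>+y. eexp (sqrt 2 * y - 2 * r) * ennreal (tail_prob r y) * indicator {..sqrt 2 * r - sqrt r} y \<partial>lborel"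
 have p1: "measure lifetime_law {..1} = 1 - exp (- 1)"
 proof -
  have "emeasure lifetime_law {1<..} = eexp (- 1)"
   using lifetime_memoryless[of "\<lambda>_. 1" 1] lifetime.emeasure_space_1 by simp
  then have "measure lifetime_law {1<..} = exp (- 1)" by (simp add: measure_def)
  moreover have "{..1} = space lifetime_law - {1<..}" by auto
  ultimately show ?thesis using lifetime.prob_compl[of "{1<..}"] by simp
 qed
 define q where "q = measure lifetime_law {..1}"
 have q: "0 < q" unfolding q_def p1 by simp
 text \<open>\<open>\<delta>\<close> bounds the mass behind the front from below, \<open>\<eta>\<close> the mass lost per unit of time.\<close>
 define \<delta> where "\<delta> = p * (e / 2) / 2"
 define \<eta> where "\<eta> = exp (- 1) * (c * \<delta>) * q"
 have pos: "0 < \<delta>" "0 < \<eta>" using p e c q by (auto simp: \<delta>_def \<eta>_def)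
 define l where "l = Inf (m ` {0..})"
 have bdd: "bdd_below (m ` {0..})" using m0 by (auto intro!: bdd_belowI[of _ 0])
 have ll: "l \<le> m s" if "0 \<le> s" for s unfolding l_def using bdd that by (intro cInf_lower) auto
 have "\<exists>x\<in>m ` {0..}. x < l + min \<delta> \<eta>"
  unfolding l_def using bdd pos by (subst cInf_less_iff[symmetric]) auto
 \<comment> \<open>From \<open>s0\<close> on, the mass is within \<open>min \<delta> \<eta>\<close>
   of its infimum and can lose neither \<open>\<delta>\<close> nor \<open>\<eta>\<close> any
   more.\<close>
 then obtain s0 where s0: "0 \<le> s0" "m s0 < l + min \<delta> \<eta>" by auto
 define S where "S = max 1 (max s0 r0)"
 have S: "1 \<le> S" "s0 \<le> S" "r0 \<le> S" by (auto simp: S_def)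
 have close: "m s < l + min \<delta> \<eta>" if "S \<le> s" for s
  using anti[of s0 s] s0 S that by simp
 \<comment> \<open>If less than \<open>\<delta>\<close> lay behind the front at time
   \<open>r\<close>, the inequality of \<open>front_low_mass\<close> would force the mass to drop by
   more than \<open>\<delta>\<close> between \<open>S\<close> and \<open>r\<close>.\<close>
 have low: "ennreal \<delta> \<le> ?low r" if r: "2 * S \<le> r" "r \<le> 2 * S + 1" for r
 proof -
  have r': "r = S + (S + (r - 2 * S))" by simp
  have "ennreal (m r) + ennreal p * ennreal (m S) \<le> ?low r + ennreal (m S) + ennreal p * (ennreal (m 0) * ennreal (gauss_upper A))"
   using front_low_mass[OF S(1), of "r - 2 * S" A] r A S unfolding r'[symmetric] p_def by (simp add: em)
  then have le: "ennreal (m r + p * m S) \<le> ?low r + ennreal (m S + p * (m 0 * gauss_upper A))"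
   using m0 p by (simp add: ennreal_plus ennreal_mult add.assoc)
  show ?thesis
  proof (rule ccontr)
   assume "\<not> ?thesis"
   then have lt: "?low r < ennreal \<delta>" by simp
   then have "?low r \<noteq> \<top>" by (auto simp: top_unique)
   then obtain x where x: "?low r = ennreal x" "0 \<le> x" by (cases "?low r") auto
   then have "x < \<delta>" using lt pos by (simp add: ennreal_less_iff)
   moreover have "m S < m r + \<delta>" using close[of S] ll[of r] S r by simp
   moreover have "p * (m 0 * gauss_upper A) \<le> p * (e / 2)" using A(1) p by (intro mult_left_mono) auto
   moreover have "p * e \<le> p * m S" using me[of S] S p by (intro mult_left_mono) auto
   moreover have "m r + p * m S \<le> x + (m S + p * (m 0 * gauss_upper A))"
    using le x m0 p unfolding x(1) by (simp add: ennreal_plus[symmetric] del: ennreal_plus)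
   ultimately show False by (simp add: \<delta>_def)
  qed
 qed
 have square: "ennreal (c * \<delta>) \<le> front_square_mass r" if r: "2 * S \<le> r" "r \<le> 2 * S + 1" for r
 proof -
  have "ennreal (c * \<delta>) = ennreal c * ennreal \<delta>" using c pos by (intro ennreal_mult) auto
  also have "\<dots> \<le> ennreal c * ?low r" using low[OF r] by (intro mult_left_mono) auto
  also have "\<dots> = (LEB y. ennreal c * (eexp (sqrt 2 * y - 2 * r) * ennreal (tail_prob r y) * indicator {..sqrt 2 * r - sqrt r} y))"
   by (rule nn_integral_cmult[symmetric]) measurable
  also have "\<dots> \<le> front_square_mass r"
   unfolding front_square_mass_def
  proof (intro nn_integral_mono)
   fix y
   show "ennreal c * (eexp (sqrt 2 * y - 2 * r) * ennreal (tail_prob r y) * indicator {..sqrt 2 * r - sqrt r} y)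
    \<le> eexp (sqrt 2 * y - 2 * r) * ennreal ((tail_prob r y)\<^sup>2)"
   proof (cases "y \<le> sqrt 2 * r - sqrt r")
    case True
    have "c * tail_prob r y \<le> (tail_prob r y)\<^sup>2"
     unfolding power2_eq_square using front[OF _ True] r S by (intro mult_right_mono) auto
    then have "exp (sqrt 2 * y - 2 * r) * (c * tail_prob r y) \<le> exp (sqrt 2 * y - 2 * r) * (tail_prob r y)\<^sup>2"
     by (intro mult_left_mono) auto
    then show ?thesis using True c
     by (simp add: ennreal_mult[symmetric] mult.left_commute)
   qed simp
  qed
  finally show ?thesis .
 qed
 \<comment> \<open>For lifetimes \<open>k \<le> 1\<close> the time \<open>2 * S + 1 - k\<close>
   stays in the window where \<open>square\<close> holds, so this unit of time costs at least
   \<open>\<eta>\<close>, against the choice of \<open>s0\<close>.\<close>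
 have "ennreal \<eta> = ennreal (exp (- 1) * (c * \<delta>)) * ennreal q"
  unfolding \<eta>_def using c pos q by (intro ennreal_mult) auto
 also have "\<dots> = (LIFE k. ennreal (exp (- 1) * (c * \<delta>)) * indicator {..1} k)"
  by (simp add: nn_integral_cmult q_def lifetime.emeasure_eq_measure)
 also have "\<dots> \<le> (LIFE k. eexp (- k) * front_square_mass (2 * S + 1 - k) * indicator {..1} k)"
 proof (intro nn_integral_mono_AE, use AE_lifetime_pos in eventually_elim)
  fix k :: real assume "0 < k"
  show "ennreal (exp (- 1) * (c * \<delta>)) * indicator {..1} k \<le> eexp (- k) * front_square_mass (2 * S + 1 - k) * indicator {..1} k"
  proof (cases "k \<le> 1")
   case True
   have "ennreal (exp (- 1) * (c * \<delta>)) = eexp (- 1) * ennreal (c * \<delta>)"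
    using c pos by (intro ennreal_mult) auto
   also have "\<dots> \<le> eexp (- k) * front_square_mass (2 * S + 1 - k)"
    using True \<open>0 < k\<close> by (intro mult_mono square ennreal_leI) auto
   finally show ?thesis using True by simp
  qed simp
 qed
 finally have "front_mass (2 * S + 1) + ennreal \<eta> \<le> front_mass (2 * S)"
  using front_mass_step[of "2 * S" 1] S by (meson add_left_mono order_trans le_numeral_extra(1) dual_order.trans mult_nonneg_nonneg zero_le_numeral zero_le_one)
 then have "m (2 * S + 1) + \<eta> \<le> m (2 * S)"
  using S m0 pos by (simp add: em ennreal_plus[symmetric] del: ennreal_plus)
 then show False using close[of "2 * S"] ll[of "2 * S + 1"] S by simp
qed

section \<open>A subsolution at speed \<open>\<surd>2\<close>\<close>

lemma nn_integral_normal_reflect: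
 assumes [measurable]: "f \<in> borel_measurable borel"
 shows "(GAUSS z. f (- z)) = (GAUSS z. f z)"
proof -
 have "(GAUSS z. f z) = (LEB z. ennreal (std_normal_density z) * f z)"
  by (subst nn_integral_density) auto
 also have "\<dots> = (LEB z. ennreal (std_normal_density z) * f (- z))"
  by (subst nn_integral_real_affine[where c="-1" and t=0]) (auto simp: std_normal_density_def)
 also have "\<dots> = (GAUSS z. f (- z))"
  by (subst nn_integral_density) auto
 finally show ?thesis ..
qed

text \<open>The negative of the normal density is an antiderivative of
  \<open>z * std_normal_density z\<close>.\<close>

lemma gauss_tail_moment:
 assumes "0 \<le> c"
 shows "(GAUSS z. ennreal z * indicator {c<..} z) = ennreal (std_normal_density c)"
proof -
 have "(GAUSS z. ennreal z * indicator {c<..} z) =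
  (LEB z. ennreal (z * std_normal_density z) * indicator {c..} z)"
 proof (subst nn_integral_density, simp, simp, intro nn_integral_cong_AE, use AE_lborel_singleton[of c] in eventually_elim)
  fix z assume "z \<noteq> c"
  then show "ennreal (std_normal_density z) * (ennreal z * indicator {c<..} z) = ennreal (z * std_normal_density z) * indicator {c..} z"
   using assms by (auto simp: indicator_def ennreal_mult[symmetric] mult.commute)
 qed
 also have "\<dots> = ennreal (0 - (- std_normal_density c))"
 proof (rule nn_integral_FTC_atLeast)
  show "((\<lambda>z. - std_normal_density z) has_real_derivative z * std_normal_density z) (at z)" for z
   unfolding std_normal_density_def
   by (auto intro!: derivative_eq_intros simp: field_simps)
  have "((\<lambda>z. 1 / sqrt (2 * pi) * exp (- z\<^sup>2 / 2)) \<longlongrightarrow> 1 / sqrt (2 * pi) * 0) at_top"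
   by (intro tendsto_mult tendsto_const) real_asymp
  then show "((\<lambda>z. - std_normal_density z) \<longlongrightarrow> 0) at_top"
   unfolding std_normal_density_def using tendsto_minus by fastforce
 qed (use assms in auto)
 finally show ?thesis by simp
qed

text \<open>Tanaka's formula in expectation: the right side is half the expected local time at
  \<open>b\<close> of Brownian motion up to time \<open>s\<close>, as \<open>sqrt q * z\<close> has
  density \<open>std_normal_density (b / sqrt q) / sqrt q\<close> at \<open>b\<close>. For the proof
  the excess is written as an integral over \<open>q\<close>.\<close>

lemma gauss_excess:
 assumes b: "0 < b" and s: "0 \<le> s"
 shows "(GAUSS z. ennreal (max 0 (sqrt s * z - b))) =
  (LEB q. ennreal (std_normal_density (b / sqrt q) / (2 * sqrt q)) * indicator {0<..s} q)"
proof -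
 let ?N = std_normal_distribution
 interpret LN: pair_sigma_finite lborel ?N ..
 have pt: "ennreal (max 0 (sqrt s * z - b)) =
   (LEB q. ennreal (1 / (2 * sqrt q)) * (ennreal z * (if b / sqrt q < z then 1 else 0)) * (if 0 < q \<and> q \<le> s then 1 else 0))" (is "_ = ?R") for z
 proof (cases "0 < z")
  case False
  then have "max 0 (sqrt s * z - b) = 0" using b s mult_nonneg_nonpos[of "sqrt s" z] by auto
  then show ?thesis using False by (simp add: ennreal_neg)
 next
  case z: True
  define a where "a = (b / z)\<^sup>2"
  have a: "0 < a" "sqrt a = b / z" using b z by (auto simp: a_def)
  have cond: "b / sqrt q < z \<longleftrightarrow> a < q" if "0 < q" for q
  proof -
   have "b / sqrt q < z \<longleftrightarrow> b / z < sqrt q" using that z by (simp add: field_simps)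
   also have "\<dots> \<longleftrightarrow> sqrt a < sqrt q" using a by simp
   finally show ?thesis by simp
  qed
  have "?R = (LEB q. ennreal (z / (2 * sqrt q)) * indicator {a<..s} q)"
  proof (intro nn_integral_cong)
   fix q :: real
   show "ennreal (1 / (2 * sqrt q)) * (ennreal z * (if b / sqrt q < z then 1 else 0)) * (if 0 < q \<and> q \<le> s then 1 else 0) = ennreal (z / (2 * sqrt q)) * indicator {a<..s} q"
    using cond[of q] z a(1) by (auto simp: indicator_def ennreal_mult[symmetric])
  qed
  also have "\<dots> = ennreal (max 0 (sqrt s * z - b))"
  proof (cases "a < s")
   case False
   then have "{a<..s} = {}" by auto
   moreover have "sqrt s \<le> b / z" using False a by (metis not_less real_sqrt_le_iff)
   then have "sqrt s * z \<le> b" using z by (simp add: field_simps)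
   ultimately show ?thesis by simp
  next
   case True
   have "(LEB q. ennreal (z / (2 * sqrt q)) * indicator {a<..s} q) =
    (LEB q. ennreal (z / (2 * sqrt q)) * indicator {a..s} q)"
    by (intro nn_integral_cong_AE, use AE_lborel_singleton[of a] in eventually_elim) (auto simp: indicator_def)
   also have "\<dots> = ennreal (z * sqrt s - z * sqrt a)"
    using True a z by (intro nn_integral_FTC_Icc[where F="\<lambda>q. z * sqrt q"])
     (auto intro!: derivative_eq_intros simp: field_simps)
   also have "z * sqrt s - z * sqrt a = max 0 (sqrt s * z - b)"
   proof -
    have "z * sqrt a = b" using a z by simp
    moreover have "z * sqrt a \<le> z * sqrt s" using True z by (intro mult_left_mono) auto
    ultimately show ?thesis by (simp add: mult.commute)
   qed
   finally show ?thesis .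
  qed
  finally show ?thesis ..
 qed
 have "(GAUSS z. ennreal (max 0 (sqrt s * z - b))) =
   (LEB q. GAUSS z. ennreal (1 / (2 * sqrt q)) * (ennreal z * (if b / sqrt q < z then 1 else 0)) * (if 0 < q \<and> q \<le> s then 1 else 0))"
  unfolding pt by (rule LN.Fubini') measurable
 also have "\<dots> = (LEB q. ennreal (std_normal_density (b / sqrt q) / (2 * sqrt q)) * indicator {0<..s} q)"
 proof (rule nn_integral_cong)
  fix q :: real
  show "(GAUSS z. ennreal (1 / (2 * sqrt q)) * (ennreal z * (if b / sqrt q < z then 1 else 0)) * (if 0 < q \<and> q \<le> s then 1 else 0)) =
    ennreal (std_normal_density (b / sqrt q) / (2 * sqrt q)) * indicator {0<..s} q"
  proof (cases "0 < q")
   case True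
   have "(GAUSS z. ennreal (1 / (2 * sqrt q)) * (ennreal z * (if b / sqrt q < z then 1 else 0)) * (if 0 < q \<and> q \<le> s then 1 else 0)) =
    ennreal (1 / (2 * sqrt q)) * (GAUSS z. ennreal z * indicator {b / sqrt q<..} z) * indicator {0<..s} q"
    by (subst nn_integral_multc, simp, subst nn_integral_cmult) (auto intro!: arg_cong2[where f="(*)"] nn_integral_cong simp: indicator_def)
   also have "\<dots> = ennreal (std_normal_density (b / sqrt q) / (2 * sqrt q)) * indicator {0<..s} q"
    using b True by (subst gauss_tail_moment) (auto simp: ennreal_mult[symmetric])
   finally show ?thesis .
  qed simp
 qed
 finally show ?thesis .
qed

text \<open>Tanaka's formula for either sign of \<open>w\<close>. For \<open>w < 0\<close> it is
  \<open>gauss_excess\<close> after reflection; for \<open>w > 0\<close> a number is compared with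
  its positive and negative parts in a form without subtraction, and the finite mean
  \<open>A\<close> is cancelled at the end.\<close>

lemma gauss_positive_part:
 assumes w: "w \<noteq> 0" and s: "0 \<le> s"
 shows "(GAUSS z. ennreal (max 0 (w - sqrt s * z))) =
  ennreal (max 0 w) + (LEB q. ennreal (std_normal_density (w / sqrt q) / (2 * sqrt q)) * indicator {0<..s} q)"
proof (cases "0 < w")
 case False
 then have w': "0 < - w" using w by simp
 have "(GAUSS z. ennreal (max 0 (w - sqrt s * z))) = (GAUSS z. ennreal (max 0 (sqrt s * z - (- w))))"
  by (subst nn_integral_normal_reflect[symmetric]) (auto simp: add.commute)
 then show ?thesis using False gauss_excess[OF w' s] by (simp add: std_normal_density_def)
next
 case True
 define A where "A = (GAUSS z. ennreal (max 0 (sqrt s * z)))"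
 have A': "(GAUSS z. ennreal (max 0 (- (sqrt s * z)))) = A"
  unfolding A_def by (subst nn_integral_normal_reflect[symmetric]) auto
 have "A \<le> (GAUSS z. ennreal (sqrt s) * (ennreal z * indicator {0<..} z))"
  unfolding A_def using s by (intro nn_integral_mono) (auto simp: indicator_def max_def ennreal_mult zero_le_mult_iff ennreal_neg)
 also have "\<dots> < \<infinity>" by (subst nn_integral_cmult) (auto simp: gauss_tail_moment ennreal_mult_less_top)
 finally have fin: "A < \<infinity>" .
 have "(GAUSS z. ennreal (max 0 (w - sqrt s * z))) + A = (GAUSS z. ennreal (max 0 (w - sqrt s * z)) + ennreal (max 0 (sqrt s * z)))"
  unfolding A_def by (subst nn_integral_add) auto
 also have "\<dots> = (GAUSS z. ennreal w + ennreal (max 0 (- (sqrt s * z))) + ennreal (max 0 (sqrt s * z - w)))"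
  using True by (intro nn_integral_cong) (auto simp: ennreal_plus[symmetric] max_def simp del: ennreal_plus)
 also have "\<dots> = ennreal w + A + (GAUSS z. ennreal (max 0 (sqrt s * z - w)))"
  unfolding A'[symmetric]
  by (subst nn_integral_add, simp, simp, subst nn_integral_add) (use gauss.emeasure_space_1 in auto)
 finally have "(GAUSS z. ennreal (max 0 (w - sqrt s * z))) + A = ennreal w + (GAUSS z. ennreal (max 0 (sqrt s * z - w))) + A"
  by (simp add: ac_simps)
 then have "(GAUSS z. ennreal (max 0 (w - sqrt s * z))) = ennreal w + (GAUSS z. ennreal (max 0 (sqrt s * z - w)))"
  using fin by (metis add.commute ennreal_add_left_cancel infinity_ennreal_def less_irrefl)
 then show ?thesis using True gauss_excess[OF True s] by simp
qed

text \<open>Convex and continuously differentiable, with second derivative \<open>ramp_curv\<close>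
  away from 0. The linear growth matches the prefactor of the critical travelling wave.\<close>

definition ramp_fun :: "real \<Rightarrow> real" where
 "ramp_fun u = (if u \<le> 0 then 0 else u - 1 + exp (- u))"

definition ramp_curv :: "real \<Rightarrow> real" where
 "ramp_curv v = exp (- v) * indicator {0<..} v"

lemma ramp_fun_measurable [measurable]: "ramp_fun \<in> borel_measurable borel"
 unfolding ramp_fun_def by measurable

lemma ramp_curv_measurable [measurable]: "ramp_curv \<in> borel_measurable borel"
 unfolding ramp_curv_def by measurable

lemma ramp_fun_nonneg [simp]: "0 \<le> ramp_fun u"
 using exp_ge_add_one_self[of "- u"] by (simp add: ramp_fun_def)

lemma ramp_fun_le: "ramp_fun u \<le> max 0 u"
 by (auto simp: ramp_fun_def)

lemma ramp_fun_pos: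
 assumes "0 < u" shows "0 < ramp_fun u"
proof -
 have "1 - u < exp (- u)"
  using assms exp_minus_greater[of u] by simp
 then show ?thesis using assms by (simp add: ramp_fun_def)
qed

text \<open>Taylor's formula with integral remainder: a superposition of hinges weighted by the
  second derivative. It reduces the heat flow of \<open>ramp_fun\<close> to that of a single
  hinge.\<close>

lemma ramp_fun_conv:
 "ennreal (ramp_fun u) = (LEB v. ennreal (max 0 (u - v)) * ennreal (ramp_curv v))"
proof (cases "0 < u")
 case False
 then have "(LEB v. ennreal (max 0 (u - v)) * ennreal (ramp_curv v)) = (\<integral>\<^sup>+v. 0 \<partial>(lborel :: real measure))"
  by (intro nn_integral_cong) (auto simp: ramp_curv_def indicator_def ennreal_neg)
 then show ?thesis using False by (simp add: ramp_fun_def)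
next
 case True
 have "(LEB v. ennreal (max 0 (u - v)) * ennreal (ramp_curv v)) = (LEB v. ennreal ((u - v) * exp (- v)) * indicator {0..u} v)"
 proof (intro nn_integral_cong_AE, use AE_lborel_singleton[of 0] in eventually_elim)
  fix v :: real assume "v \<noteq> 0"
  then show "ennreal (max 0 (u - v)) * ennreal (ramp_curv v) = ennreal ((u - v) * exp (- v)) * indicator {0..u} v"
   by (cases "v \<le> u") (auto simp: ramp_curv_def indicator_def ennreal_mult[symmetric] ennreal_neg)
 qed
 also have "\<dots> = ennreal ((- (u - u) * exp (- u) + exp (- u)) - (- (u - 0) * exp (- 0) + exp (- 0)))"
  using True by (intro nn_integral_FTC_Icc[where F = "\<lambda>v. - (u - v) * exp (- v) + exp (- v)"])
   (auto intro!: derivative_eq_intros simp: field_simps)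
 finally show ?thesis using True by (simp add: ramp_fun_def algebra_simps)
qed

text \<open>Ito's formula in expectation, obtained by superposing \<open>gauss_positive_part\<close>
  instead of differentiating under the integral.\<close>

lemma heat_ramp_fun:
 assumes s: "0 \<le> s"
 shows "heat ramp_fun s u = ennreal (ramp_fun u) + (LEB q. ennreal (1 / 2) * heat ramp_curv q u * indicator {0<..s} q)"
proof -
 let ?N = std_normal_distribution
 interpret LN: pair_sigma_finite lborel ?N ..
 let ?d = "\<lambda>v q. std_normal_density ((u - v) / sqrt q) / (2 * sqrt q)"
 have "heat ramp_fun s u = (GAUSS z. LEB v. ennreal (max 0 (u - sqrt s * z - v)) * ennreal (ramp_curv v))"
  unfolding heat_def ramp_fun_conv ..
 also have "\<dots> = (LEB v. GAUSS z. ennreal (max 0 (u - sqrt s * z - v)) * ennreal (ramp_curv v))"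
  by (rule LN.Fubini') measurable
 also have "\<dots> = (LEB v. ennreal (max 0 (u - v)) * ennreal (ramp_curv v) +
   (LEB q. ennreal (?d v q) * indicator {0<..s} q) * ennreal (ramp_curv v))"
 proof (intro nn_integral_cong_AE, use AE_lborel_singleton[of u] in eventually_elim)
  fix v :: real assume "v \<noteq> u"
  then have "u - v \<noteq> 0" by simp
  have "(GAUSS z. ennreal (max 0 (u - sqrt s * z - v)) * ennreal (ramp_curv v)) =
   (GAUSS z. ennreal (max 0 (u - v - sqrt s * z))) * ennreal (ramp_curv v)"
   by (subst nn_integral_multc[symmetric]) (auto simp: algebra_simps)
  then show "(GAUSS z. ennreal (max 0 (u - sqrt s * z - v)) * ennreal (ramp_curv v)) = ennreal (max 0 (u - v)) * ennreal (ramp_curv v) +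
   (LEB q. ennreal (?d v q) * indicator {0<..s} q) * ennreal (ramp_curv v)"
   unfolding gauss_positive_part[OF \<open>u - v \<noteq> 0\<close> s] by (simp only: distrib_right)
 qed
 also have "\<dots> = ennreal (ramp_fun u) +
   (LEB v. (LEB q. ennreal (?d v q) * indicator {0<..s} q) * ennreal (ramp_curv v))"
  unfolding ramp_fun_conv by (subst nn_integral_add) auto
 also have "(LEB v. (LEB q. ennreal (?d v q) * indicator {0<..s} q) * ennreal (ramp_curv v))
  = (LEB v. LEB q. ennreal (?d v q) * indicator {0<..s} q * ennreal (ramp_curv v))"
  by (subst nn_integral_multc) auto
 also have "\<dots> = (LEB q. LEB v. ennreal (?d v q) * indicator {0<..s} q * ennreal (ramp_curv v))"
  by (rule lborel_pair.Fubini'[symmetric]) measurable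
 also have "\<dots> = (LEB q. ennreal (1 / 2) * heat ramp_curv q u * indicator {0<..s} q)"
 proof (rule nn_integral_cong)
  fix q :: real
  show "(LEB v. ennreal (?d v q) * indicator {0<..s} q * ennreal (ramp_curv v)) =
   ennreal (1 / 2) * heat ramp_curv q u * indicator {0<..s} q"
  proof (cases "0 < q")
   case True
   then have sq: "0 < sqrt q" by simp
   have "(LEB v. ennreal (?d v q) * indicator {0<..s} q * ennreal (ramp_curv v))
    = ennreal (sqrt q) * (LEB z. ennreal (std_normal_density z / (2 * sqrt q)) * indicator {0<..s} q * ennreal (ramp_curv (u - sqrt q * z)))"
    using sq by (subst nn_integral_real_affine[where c="- sqrt q" and t=u]) (auto simp: field_simps)
   also have "\<dots> = (LEB z. ennreal (sqrt q) * (ennreal (std_normal_density z / (2 * sqrt q)) * indicator {0<..s} q * ennreal (ramp_curv (u - sqrt q * z))))"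
    by (rule nn_integral_cmult[symmetric]) measurable
   also have "\<dots> = (LEB z. ennreal (1 / 2) * indicator {0<..s} q * (ennreal (std_normal_density z) * ennreal (ramp_curv (u - sqrt q * z))))"
   proof (rule nn_integral_cong)
    fix z
    have "ennreal (sqrt q) * ennreal (std_normal_density z / (2 * sqrt q)) = ennreal (1 / 2) * ennreal (std_normal_density z)"
    proof -
     have "ennreal (sqrt q) * ennreal (std_normal_density z / (2 * sqrt q)) = ennreal (sqrt q * (std_normal_density z / (2 * sqrt q)))"
      by (rule ennreal_mult[symmetric]) (use sq in auto)
     also have "sqrt q * (std_normal_density z / (2 * sqrt q)) = 1 / 2 * std_normal_density z" using sq by simp
     also have "ennreal (1 / 2 * std_normal_density z) = ennreal (1 / 2) * ennreal (std_normal_density z)"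
      by (rule ennreal_mult) auto
     finally show ?thesis .
    qed
    then show "ennreal (sqrt q) * (ennreal (std_normal_density z / (2 * sqrt q)) * indicator {0<..s} q * ennreal (ramp_curv (u - sqrt q * z))) =
     ennreal (1 / 2) * indicator {0<..s} q * (ennreal (std_normal_density z) * ennreal (ramp_curv (u - sqrt q * z)))"
     by (simp only: mult.assoc[symmetric]) (simp only: ac_simps)
   qed
   also have "\<dots> = ennreal (1 / 2) * indicator {0<..s} q * heat ramp_curv q u"
    unfolding heat_def by (subst nn_integral_cmult, simp, subst nn_integral_density) auto
   finally show ?thesis by (simp only: ac_simps)
  qed simp
 qed
 finally show ?thesis .
qed

text \<open>After the tilt a split at \<open>s\<close> counts \<open>2 * exp (- s)\<close>, and
  survival up to \<open>t\<close> counts \<open>exp (- t)\<close>. Together with the law of the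
  lifetime this is a probability: the split time becomes exponential with rate 2, stopped at
  \<open>t\<close>.\<close>

definition stop_weight :: "real \<Rightarrow> real \<Rightarrow> real" where
 "stop_weight t s = (if t < s then exp (- t) else 2 * exp (- s))"

lemma stop_weight_measurable [measurable]: "stop_weight t \<in> borel_measurable borel"
 unfolding stop_weight_def by measurable

lemma stop_weight_total:
 assumes "0 \<le> t" shows "(LIFE s. ennreal (stop_weight t s)) = 1"
proof -
 have ind: "\<integral>\<^sup>+s. indicator {t<..} s \<partial>lifetime_law = eexp (- t)"
  using lifetime_memoryless[of "\<lambda>_. 1" t] assms lifetime.emeasure_space_1 by simp
 have "(LIFE s. ennreal (stop_weight t s)) =
  (LIFE s. eexp (- t) * (ennreal (2 * exp (t - s)) * indicator {..t} s + indicator {t<..} s))"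
  by (intro nn_integral_cong)
   (auto simp: stop_weight_def indicator_def ennreal_mult[symmetric] exp_add[symmetric] mult.left_commute)
 also have "\<dots> = eexp (- t) * ((LIFE s. ennreal (2 * exp (t - s)) * indicator {..t} s) + eexp (- t))"
  unfolding ind[symmetric] by (subst nn_integral_cmult, simp, subst nn_integral_add) auto
 also have "\<dots> = 1"
  unfolding lifetime_exp_upto[OF assms] by (simp add: ennreal_mult[symmetric] exp_add[symmetric])
 finally show ?thesis .
qed

lemma stop_weight_after:
 assumes "0 \<le> r" "r \<le> t"
 shows "(LIFE s. ennreal (stop_weight t s) * indicator {r<..} s) = eexp (- 2 * r)"
proof -
 have "(LIFE s. ennreal (stop_weight t s) * indicator {r<..} s) = eexp (- r) * (LIFE s. ennreal (stop_weight t (s + r)))"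
  using assms by (subst lifetime_memoryless) auto
 also have "(LIFE s. ennreal (stop_weight t (s + r))) = (LIFE s. eexp (- r) * ennreal (stop_weight (t - r) s))"
  by (intro nn_integral_cong) (auto simp: stop_weight_def ennreal_mult[symmetric] exp_add[symmetric] mult.left_commute)
 also have "\<dots> = eexp (- r)"
  using assms by (subst nn_integral_cmult) (auto simp: stop_weight_total)
 finally show ?thesis by (simp add: ennreal_mult[symmetric] exp_add[symmetric])
qed

text \<open>Here \<open>x\<close> is the position in the frame moving at speed
  \<open>sqrt 2\<close>. The Cameron-Martin formula removes the drift, and \<open>exp (- s)\<close>
  is what remains of the tilt.\<close>

lemma tilted_heat_pointwise:
 assumes [measurable]: "f \<in> borel_measurable borel" and f: "\<And>x. 0 \<le> f x" and s: "0 \<le> s"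
 shows "(GAUSS z. ennreal (exp (- sqrt 2 * (x + sqrt 2 * s - sqrt s * z)) * f (x + sqrt 2 * s - sqrt s * z))) =
  eexp (- sqrt 2 * x) * (eexp (- s) * heat f s x)"
proof -
 define a where "a = sqrt 2 * sqrt s"
 have a2: "a\<^sup>2 / 2 = s" using s by (simp add: a_def power_mult_distrib)
 have as: "sqrt s * a = sqrt 2 * s" using s by (simp add: a_def mult.left_commute)
 have "(GAUSS z. ennreal (exp (- sqrt 2 * (x + sqrt 2 * s - sqrt s * z)) * f (x + sqrt 2 * s - sqrt s * z))) =
  (GAUSS z. eexp (- sqrt 2 * x) * eexp (- s) * (eexp (a * z - a\<^sup>2 / 2) * ennreal (f (x + sqrt 2 * s - sqrt s * z))))"
 proof (rule nn_integral_cong)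
  fix z
  have "exp (- sqrt 2 * (x + sqrt 2 * s - sqrt s * z)) = exp (- sqrt 2 * x) * exp (- s) * exp (a * z - a\<^sup>2 / 2)"
   unfolding a2 exp_add[symmetric] by (simp add: a_def algebra_simps)
  then show "ennreal (exp (- sqrt 2 * (x + sqrt 2 * s - sqrt s * z)) * f (x + sqrt 2 * s - sqrt s * z)) =
   eexp (- sqrt 2 * x) * eexp (- s) * (eexp (a * z - a\<^sup>2 / 2) * ennreal (f (x + sqrt 2 * s - sqrt s * z)))"
   using f by (simp add: ennreal_mult mult.assoc)
 qed
 also have "\<dots> = eexp (- sqrt 2 * x) * eexp (- s) * (GAUSS z. ennreal (f (x + sqrt 2 * s - sqrt s * (z + a))))"
  by (subst nn_integral_cmult, simp, subst nn_integral_normal_shift) auto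
 also have "(GAUSS z. ennreal (f (x + sqrt 2 * s - sqrt s * (z + a)))) = heat f s x"
  unfolding heat_def by (simp add: distrib_left as)
 finally show ?thesis by (simp only: mult.assoc)
qed

text \<open>As \<open>sqrt 2 > 1\<close>, the function \<open>exp (- sqrt 2 * u) * u\<^sup>2\<close>
  is at most a constant times \<open>exp (- u)\<close>, and the shift by \<open>K\<close> makes the
  constant small. The value 1000 is generous: \<open>exp (- sqrt 2 * K) \<le> 1 / 25\<close> would
  do.\<close>

lemma ramp_fun_square:
 assumes K: "1000 \<le> K"
 shows "exp (- sqrt 2 * (u + K)) * (ramp_fun u)\<^sup>2 \<le> 1 / 2 * ramp_curv u"
proof (cases "0 < u")
 case False
 then show ?thesis by (simp add: ramp_fun_def ramp_curv_def)
next
 case True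
 define \<alpha> where "\<alpha> = sqrt 2 - (1 :: real)"
 have "(14 / 10)\<^sup>2 \<le> (2 :: real)" by (simp add: power2_eq_square)
 then have s2: "14 / 10 \<le> sqrt (2 :: real)" by (rule real_le_rsqrt)
 then have \<alpha>: "2 / 5 \<le> \<alpha>" by (simp add: \<alpha>_def)
 have "(2 / 5 * u)\<^sup>2 \<le> (\<alpha> * u)\<^sup>2" using True \<alpha> by (intro power_mono mult_right_mono) auto
 moreover have "1 + \<alpha> * u + (\<alpha> * u)\<^sup>2 / 2 \<le> exp (\<alpha> * u)"
  using True \<alpha> by (intro exp_lower_Taylor_quadratic) auto
 moreover have "0 \<le> \<alpha> * u" using True \<alpha> by simp
 ultimately have "(2 / 5 * u)\<^sup>2 / 2 \<le> exp (\<alpha> * u)" by linarith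
 then have 1: "u\<^sup>2 \<le> 25 / 2 * exp (\<alpha> * u)" by (simp add: power_mult_distrib power2_eq_square)
 have "14 / 10 * 1000 \<le> sqrt 2 * K" using s2 K by (intro mult_mono) auto
 then have "100 \<le> 1 + sqrt 2 * K" by simp
 also have "\<dots> \<le> exp (sqrt 2 * K)" by (rule exp_ge_add_one_self)
 finally have "exp (- (sqrt 2 * K)) \<le> 1 / 100" unfolding exp_minus by (simp add: inverse_eq_divide frac_le)
 have "(ramp_fun u)\<^sup>2 \<le> u\<^sup>2" using ramp_fun_le[of u] True by (intro power_mono) auto
 then have "exp (- sqrt 2 * (u + K)) * (ramp_fun u)\<^sup>2 \<le> exp (- sqrt 2 * (u + K)) * (25 / 2 * exp (\<alpha> * u))"
  using 1 by (intro mult_left_mono) auto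
 also have "\<dots> = 25 / 2 * (exp (- (sqrt 2 * K)) * exp (- u))"
  by (simp add: exp_add[symmetric] \<alpha>_def algebra_simps)
 also have "\<dots> \<le> 25 / 2 * (1 / 100 * exp (- u))"
  using \<open>exp (- (sqrt 2 * K)) \<le> 1 / 100\<close> by (intro mult_left_mono mult_right_mono) auto
 also have "\<dots> \<le> 1 / 2 * ramp_curv u" using True by (simp add: ramp_curv_def)
 finally show ?thesis .
qed

text \<open>A stationary subsolution of the KPP equation in the frame moving at speed \<open>\<surd>2\<close>:
 in the variable \<open>exp (\<surd>2 x) u\<close> the linear part of the equation is the heat equation, and
 the convexity of \<^const>\<open>ramp_fun\<close> dominates the quadratic loss.\<close>

definition wave_sub :: "real \<Rightarrow> real" where
 "wave_sub x = exp (- sqrt 2 * x) * ramp_fun (x - 1000)"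

lemma wave_sub_measurable [measurable]: "wave_sub \<in> borel_measurable borel"
 unfolding wave_sub_def by measurable

lemma wave_sub_nonneg [simp]: "0 \<le> wave_sub x"
 by (simp add: wave_sub_def)

lemma wave_sub_le: "wave_sub x \<le> exp (- sqrt 2 * x) * max 0 x"
 unfolding wave_sub_def by (intro mult_left_mono order_trans[OF ramp_fun_le]) auto

lemma wave_sub_le_1 [simp]: "wave_sub x \<le> 1"
proof (cases "0 < x")
 case True
 have "wave_sub x \<le> exp (- sqrt 2 * x) * x" using wave_sub_le[of x] True by simp
 also have "\<dots> \<le> exp (- x) * exp x"
 proof (intro mult_mono)
  show "x \<le> exp x" using exp_ge_add_one_self[of x] by linarith
 qed (use True in auto)
 finally show ?thesis by (simp add: exp_add[symmetric])
qed (use wave_sub_le[of x] in simp)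

text \<open>The subsolution inequality in mild form, with the quadratic loss on the left to avoid
  subtraction. After the tilt both sides carry the factor \<open>ex\<close>; the linear part gains
  the accumulated curvature \<open>?I\<close>, and the loss is at most \<open>?I\<close> by
  \<open>ramp_fun_square\<close>.\<close>

lemma wave_sub_mild:
 assumes t: "0 \<le> t"
 shows "ennreal (wave_sub x) + (SPLIT p. first_split (\<lambda>_. 0) (\<lambda>r y. ennreal ((wave_sub (y - sqrt 2 * r))\<^sup>2)) t (x + sqrt 2 * t) p)
  \<le> (SPLIT p. first_split (\<lambda>y. ennreal (wave_sub y)) (\<lambda>r y. ennreal (2 * wave_sub (y - sqrt 2 * r))) t (x + sqrt 2 * t) p)"
proof -
 let ?L = lifetime_law
 interpret LE: pair_sigma_finite lborel ?L ..
 define u where "u = x - 1000"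
 define ex where "ex = eexp (- sqrt 2 * x)"
 define R where "R = (\<lambda>s. heat ramp_curv s u)"
 have [measurable]: "R \<in> borel_measurable borel" unfolding R_def by measurable
 have shift: "heat (\<lambda>y. f (y - 1000)) s x = heat f s u" for f s
  by (simp add: heat_def u_def algebra_simps)
 let ?x = "\<lambda>s z. x + sqrt 2 * s - sqrt s * z"
 have lin: "(GAUSS z. ennreal (wave_sub (?x s z))) = ex * (eexp (- s) * heat ramp_fun s u)"
  if "0 \<le> s" for s
  unfolding wave_sub_def ex_def shift[symmetric] using that by (intro tilted_heat_pointwise) auto
 have quad: "(GAUSS z. ennreal ((wave_sub (?x s z))\<^sup>2)) \<le> ex * (eexp (- s) * (ennreal (1 / 2) * R s))"
  if "0 \<le> s" for s
 proof -
  let ?q = "\<lambda>y. exp (- sqrt 2 * y) * (ramp_fun (y - 1000))\<^sup>2"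
  have "(GAUSS z. ennreal ((wave_sub (?x s z))\<^sup>2)) =
   (GAUSS z. ennreal (exp (- sqrt 2 * (?x s z)) * ?q (?x s z)))"
   unfolding wave_sub_def by (simp only: power2_eq_square ac_simps)
  also have "\<dots> = ex * (eexp (- s) * heat ?q s x)"
   unfolding ex_def using that by (intro tilted_heat_pointwise) auto
  finally have eq: "(GAUSS z. ennreal ((wave_sub (?x s z))\<^sup>2)) = ex * (eexp (- s) * heat ?q s x)" .
  have "heat ?q s x \<le> (GAUSS z. ennreal (1 / 2) * ennreal (ramp_curv (u - sqrt s * z)))"
   unfolding heat_def
  proof (intro nn_integral_mono)
   fix z
   have "?q (x - sqrt s * z) \<le> 1 / 2 * ramp_curv (u - sqrt s * z)"
    using ramp_fun_square[of 1000 "u - sqrt s * z"] by (simp add: u_def algebra_simps)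
   then show "ennreal (?q (x - sqrt s * z)) \<le> ennreal (1 / 2) * ennreal (ramp_curv (u - sqrt s * z))"
    by (subst ennreal_mult[symmetric]) (auto simp: ramp_curv_def intro!: ennreal_leI)
  qed
  also have "\<dots> = ennreal (1 / 2) * R s"
   unfolding R_def heat_def by (rule nn_integral_cmult) measurable
  finally show ?thesis unfolding eq by (intro mult_left_mono) auto
 qed
 let ?I = "LEB s. ennreal (1 / 2) * R s * eexp (- 2 * s) * indicator {0<..t} s"
 have B: "(SPLIT p. first_split (\<lambda>_. 0) (\<lambda>r y. ennreal ((wave_sub (y - sqrt 2 * r))\<^sup>2)) t (x + sqrt 2 * t) p)
  \<le> ex * ?I"
 proof -
  have "(SPLIT p. first_split (\<lambda>_. 0) (\<lambda>r y. ennreal ((wave_sub (y - sqrt 2 * r))\<^sup>2)) t (x + sqrt 2 * t) p) =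
   (LIFE s. GAUSS z. first_split (\<lambda>_. 0) (\<lambda>r y. ennreal ((wave_sub (y - sqrt 2 * r))\<^sup>2)) t (x + sqrt 2 * t) (s, z))"
   by (subst nn_integral_first_split) auto
  also have "\<dots> \<le> (LIFE s. ex * (eexp (- s) * (ennreal (1 / 2) * R s)) * indicator {..t} s)"
  proof (intro nn_integral_mono_AE, use AE_lifetime_pos in eventually_elim)
   fix s :: real assume s: "0 < s"
   show "(GAUSS z. first_split (\<lambda>_. 0) (\<lambda>r y. ennreal ((wave_sub (y - sqrt 2 * r))\<^sup>2)) t (x + sqrt 2 * t) (s, z))
    \<le> ex * (eexp (- s) * (ennreal (1 / 2) * R s)) * indicator {..t} s"
   proof (cases "t < s")
    case False
    have e: "x + sqrt 2 * t - sqrt s * z - sqrt 2 * (t - s) = x + sqrt 2 * s - sqrt s * z" for z by (simp add: algebra_simps)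
    show ?thesis using False quad[of s] s by (simp add: first_split_def e)
   qed (simp add: first_split_def)
  qed
  also have "\<dots> = (LEB s. ex * (ennreal (1 / 2) * R s * eexp (- 2 * s) * indicator {0<..t} s))"
  proof (subst nn_integral_lifetime, simp, intro nn_integral_cong_AE, use AE_lborel_singleton[of 0] in eventually_elim)
   fix s :: real assume "s \<noteq> 0"
   have e: "eexp (- 2 * s) = eexp (- s) * eexp (- s)"
    by (simp add: ennreal_mult[symmetric] exp_add[symmetric])
   have i: "indicator {..t} s * indicator {0..} s = (indicator {0<..t} s :: ennreal)"
    using \<open>s \<noteq> 0\<close> by (auto simp: indicator_def)
   show "eexp (- s) * (ex * (eexp (- s) * (ennreal (1 / 2) * R s)) * indicator {..t} s) * indicator {0..} s =
    ex * (ennreal (1 / 2) * R s * eexp (- 2 * s) * indicator {0<..t} s)"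
    unfolding e i[symmetric] by (simp only: ac_simps)
  qed
  also have "\<dots> = ex * ?I"
   by (rule nn_integral_cmult) measurable
  finally show ?thesis .
 qed
 have A: "(SPLIT p. first_split (\<lambda>y. ennreal (wave_sub y)) (\<lambda>r y. ennreal (2 * wave_sub (y - sqrt 2 * r))) t (x + sqrt 2 * t) p)
  = ex * (LIFE s. ennreal (stop_weight t s) * heat ramp_fun (min s t) u)"
 proof -
  have "(SPLIT p. first_split (\<lambda>y. ennreal (wave_sub y)) (\<lambda>r y. ennreal (2 * wave_sub (y - sqrt 2 * r))) t (x + sqrt 2 * t) p)
   = (LIFE s. GAUSS z. first_split (\<lambda>y. ennreal (wave_sub y)) (\<lambda>r y. ennreal (2 * wave_sub (y - sqrt 2 * r))) t (x + sqrt 2 * t) (s, z))"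
   by (subst nn_integral_first_split) auto
  also have "\<dots> = (LIFE s. ex * (ennreal (stop_weight t s) * heat ramp_fun (min s t) u))"
  proof (intro nn_integral_cong_AE, use AE_lifetime_pos in eventually_elim)
   fix s :: real assume s: "0 < s"
   show "(GAUSS z. first_split (\<lambda>y. ennreal (wave_sub y)) (\<lambda>r y. ennreal (2 * wave_sub (y - sqrt 2 * r))) t (x + sqrt 2 * t) (s, z))
    = ex * (ennreal (stop_weight t s) * heat ramp_fun (min s t) u)"
   proof (cases "t < s")
    case True
    then show ?thesis using lin[OF t] by (simp add: first_split_def stop_weight_def)
   next
    case False
    have e: "x + sqrt 2 * t - sqrt s * z - sqrt 2 * (t - s) = x + sqrt 2 * s - sqrt s * z" for z by (simp add: algebra_simps)
    have "(GAUSS z. ennreal (2 * wave_sub (?x s z))) = 2 * (ex * (eexp (- s) * heat ramp_fun s u))"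
     using s by (simp add: ennreal_mult nn_integral_cmult lin)
    also have "\<dots> = ex * (ennreal (2 * exp (- s)) * heat ramp_fun s u)"
     by (simp add: ennreal_mult ac_simps)
    finally show ?thesis using False by (simp add: first_split_def stop_weight_def e)
   qed
  qed
  also have "\<dots> = ex * (LIFE s. ennreal (stop_weight t s) * heat ramp_fun (min s t) u)"
   by (rule nn_integral_cmult) measurable
  finally show ?thesis .
 qed
 \<comment> \<open>The curvature at heat time \<open>r\<close> counts if the split comes after
   \<open>r\<close>, which has weight \<open>exp (- 2 * r)\<close> by
   \<open>stop_weight_after\<close>; Fubini collects these contributions.\<close>
 let ?w = "\<lambda>s r. ennreal (stop_weight t s) * (if r \<le> s then 1 else 0)"
 have C: "(LIFE s. ennreal (stop_weight t s) * heat ramp_fun (min s t) u) = ennreal (ramp_fun u) +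
  ?I"
 proof -
  have "(LIFE s. ennreal (stop_weight t s) * heat ramp_fun (min s t) u) =
   (LIFE s. ennreal (stop_weight t s) * ennreal (ramp_fun u) +
     (LEB r. ennreal (1 / 2) * R r * (if 0 < r \<and> r \<le> t then 1 else 0) * (?w s r)))"
  proof (intro nn_integral_cong_AE, use AE_lifetime_pos in eventually_elim)
   fix s :: real assume s: "0 < s"
   have "ennreal (stop_weight t s) * (LEB r. ennreal (1 / 2) * R r * indicator {0<..min s t} r) =
    (LEB r. ennreal (stop_weight t s) * (ennreal (1 / 2) * R r * indicator {0<..min s t} r))"
    by (rule nn_integral_cmult[symmetric]) measurable
   also have "\<dots> = (LEB r. ennreal (1 / 2) * R r * (if 0 < r \<and> r \<le> t then 1 else 0) * (?w s r))"
    by (intro nn_integral_cong) (auto simp: indicator_def ac_simps)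
   finally show "ennreal (stop_weight t s) * heat ramp_fun (min s t) u = ennreal (stop_weight t s) * ennreal (ramp_fun u) +
     (LEB r. ennreal (1 / 2) * R r * (if 0 < r \<and> r \<le> t then 1 else 0) * (?w s r))"
    using s t by (subst heat_ramp_fun) (auto simp: distrib_left R_def)
  qed
  also have "\<dots> = (LIFE s. ennreal (stop_weight t s) * ennreal (ramp_fun u)) +
    (LIFE s. LEB r. ennreal (1 / 2) * R r * (if 0 < r \<and> r \<le> t then 1 else 0) * (?w s r))"
   by (rule nn_integral_add) measurable
  also have "(LIFE s. ennreal (stop_weight t s) * ennreal (ramp_fun u)) = ennreal (ramp_fun u)"
   using t by (subst nn_integral_multc) (auto simp: stop_weight_total)
  also have "(LIFE s. LEB r. ennreal (1 / 2) * R r * (if 0 < r \<and> r \<le> t then 1 else 0) * (?w s r)) =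
   (LEB r. LIFE s. ennreal (1 / 2) * R r * (if 0 < r \<and> r \<le> t then 1 else 0) * (?w s r))"
   by (rule LE.Fubini') measurable
  also have "\<dots> = ?I"
  proof (rule nn_integral_cong)
   fix r :: real
   show "(LIFE s. ennreal (1 / 2) * R r * (if 0 < r \<and> r \<le> t then 1 else 0) * (?w s r)) =
    ennreal (1 / 2) * R r * eexp (- 2 * r) * indicator {0<..t} r"
   proof (cases "0 < r \<and> r \<le> t")
    case True
    have aer: "AE s in ?L. s \<noteq> r"
     by (subst AE_density) (use AE_lborel_singleton[of r] in \<open>auto elim!: eventually_mono\<close>)
    have "(LIFE s. ennreal (stop_weight t s) * (if r \<le> s then 1 else 0)) = (LIFE s. ennreal (stop_weight t s) * indicator {r<..} s)"
     by (intro nn_integral_cong_AE, use aer in eventually_elim) (auto simp: indicator_def)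
    also have "\<dots> = eexp (- 2 * r)" using True by (intro stop_weight_after) auto
    finally have w: "(LIFE s. ennreal (stop_weight t s) * (if r \<le> s then 1 else 0)) = eexp (- 2 * r)" .
    show ?thesis using True by (subst nn_integral_cmult) (auto simp: w)
   qed (auto simp: indicator_def)
  qed
  finally show ?thesis .
 qed
 have "ennreal (wave_sub x) = ex * ennreal (ramp_fun u)"
  by (simp add: wave_sub_def ex_def u_def ennreal_mult)
 then show ?thesis using B unfolding A C by (simp add: distrib_left add_left_mono)
qed

text \<open>In the moving frame \<open>1 - wave_sub\<close> is a stationary supersolution of the
  equation for \<open>kpp\<close>, so \<open>mild_comparison\<close> keeps it above the solution
  started from it.\<close>

lemma kpp_wave_sub:
 assumes t: "0 \<le> t"
 shows "kpp (\<lambda>y. 1 - wave_sub y) t (x + sqrt 2 * t) \<le> 1 - wave_sub x"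
proof -
 let ?g = "\<lambda>y. 1 - wave_sub y"
 have sq1: "(wave_sub y)\<^sup>2 \<le> 1" for y by (auto simp: power2_eq_square intro!: mult_le_one)
 have "kpp ?g t (x + sqrt 2 * t) \<le> 1 - wave_sub (x + sqrt 2 * t - sqrt 2 * t)"
 proof (rule mild_comparison[where g="?g" and g'="?g" and k="kpp ?g" and l="\<lambda>r y. 1 - wave_sub (y - sqrt 2 * r)"])
  fix t y :: real assume t: "0 \<le> t"
  show "kpp ?g t y \<le> (LINT p|first_split_law. first_split ?g (\<lambda>r x. (kpp ?g r x)\<^sup>2) t y p)"
   using t by (subst kpp_mild) auto
  define x where "x = y - sqrt 2 * t"
  have y: "y = x + sqrt 2 * t" by (simp add: x_def)
  define a where "a = first_split wave_sub (\<lambda>r y. 2 * wave_sub (y - sqrt 2 * r)) t y"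
  define b where "b = first_split (\<lambda>_. 0) (\<lambda>r y. (wave_sub (y - sqrt 2 * r))\<^sup>2) t y"
  have [measurable]: "a \<in> borel_measurable first_split_law" "b \<in> borel_measurable first_split_law"
   unfolding a_def b_def by measurable
  have ab: "0 \<le> a p" "a p \<le> 2" "0 \<le> b p" "b p \<le> 1" for p
   using sq1 by (auto simp: a_def b_def first_split_def intro: order_trans[OF wave_sub_le_1])
  have int: "integrable first_split_law a" "integrable first_split_law b"
  proof -
   have "\<bar>a p\<bar> \<le> 2" "\<bar>b p\<bar> \<le> 2" for p using ab[of p] by auto
   then show "integrable first_split_law a" "integrable first_split_law b"
    by (auto intro!: integrable_bounded_real[where K=2, OF split.finite_measure_axioms])
  qed
  have "(\<lambda>p. ennreal (a p)) = first_split (\<lambda>y. ennreal (wave_sub y)) (\<lambda>r y. ennreal (2 * wave_sub (y - sqrt 2 * r))) t y"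
   "(\<lambda>p. ennreal (b p)) = first_split (\<lambda>_. 0) (\<lambda>r y. ennreal ((wave_sub (y - sqrt 2 * r))\<^sup>2)) t y"
   by (auto simp: a_def b_def first_split_def)
  then have "ennreal (wave_sub x) + (SPLIT p. ennreal (b p)) \<le> (SPLIT p. ennreal (a p))"
   using wave_sub_mild[OF t, of x] unfolding y by simp
  then have "wave_sub x + (LINT p|first_split_law. b p) \<le> (LINT p|first_split_law. a p)"
   using int ab by (simp add: nn_integral_eq_integral integral_nonneg ennreal_plus[symmetric] del: ennreal_plus)
  moreover have "(LINT p|first_split_law. first_split ?g (\<lambda>r x. (1 - wave_sub (x - sqrt 2 * r))\<^sup>2) t y p) = (LINT p|first_split_law. 1 - (a p - b p))"
   by (intro Bochner_Integration.integral_cong) (auto simp: a_def b_def first_split_def power2_eq_square algebra_simps)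
  moreover have "\<dots> = 1 - ((LINT p|first_split_law. a p) - (LINT p|first_split_law. b p))"
   using int by (simp add: split.prob_space)
  ultimately show "(LINT p|first_split_law. first_split ?g (\<lambda>r x. (1 - wave_sub (x - sqrt 2 * r))\<^sup>2) t y p) \<le> 1 - wave_sub (y - sqrt 2 * t)"
   by (simp add: x_def)
 qed (use t in auto)
 then show ?thesis by simp
qed

section \<open>The KPP solution as an expectation over living particles\<close>

context bbm
begin

definition alive_prod :: "(real \<Rightarrow> real) \<Rightarrow> real \<Rightarrow> real \<Rightarrow> 'w \<Rightarrow> real" where
 "alive_prod g t y w = (\<Prod>u\<in>alive (\<tau> w) t. g (y - h w t u))"

lemma alive_prod_limit:
 assumes t: "0 \<le> t" and w: "w \<in> space M"
 shows "(\<lambda>n. \<Prod>u | length u < n. if u \<in> alive (\<tau> w) t then g (y - h w t u) else 1) \<longlonglongrightarrow> alive_prod g t y w"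
proof -
 have fin: "finite (alive (\<tau> w) t)" by (rule finite_alive[OF w t])
 then obtain m where m: "\<And>u. u \<in> alive (\<tau> w) t \<Longrightarrow> length u < m"
  using finite_imageI[OF fin, of length] unfolding finite_nat_set_iff_bounded by auto
 have "(\<Prod>u | length u < n. if u \<in> alive (\<tau> w) t then g (y - h w t u) else 1) = alive_prod g t y w" if "m \<le> n" for n
 proof -
  have "(\<Prod>u | length u < n. if u \<in> alive (\<tau> w) t then g (y - h w t u) else 1) =
   (\<Prod>u\<in>alive (\<tau> w) t. if u \<in> alive (\<tau> w) t then g (y - h w t u) else 1)"
   by (rule prod.mono_neutral_right) (use m that in \<open>auto simp: finite_short intro: less_le_trans\<close>)
  then show ?thesis by (simp add: alive_prod_def cong: prod.cong)
 qed
 then show ?thesis by (intro tendsto_eventually) (auto simp: eventually_sequentially)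
qed

lemma measurable_short_prod:
 assumes t: "0 \<le> t" and [measurable]: "g \<in> borel_measurable borel"
 shows "(\<lambda>w. \<Prod>u | length u < n. if u \<in> alive (\<tau> w) t then g (y - h w t u) else (1 :: real)) \<in> borel_measurable M"
proof -
 note [measurable] = height_measurable[OF t]
 show ?thesis by measurable
qed

lemma alive_prod_measurable:
 assumes t: "0 \<le> t" and g: "g \<in> borel_measurable borel"
 shows "alive_prod g t y \<in> borel_measurable M"
 by (rule borel_measurable_LIMSEQ_real[OF alive_prod_limit[OF t] measurable_short_prod[OF t g]])

text \<open>Transfers the model to \<open>h\<close>: truncated products have equal expectations, and
  each realization has finitely many living particles, so that the truncation eventually has no
  effect.\<close>

lemma kpp_expectation:
 assumes t: "0 \<le> t" and g: "g \<in> borel_measurable borel" "\<And>x. 0 \<le> g x" "\<And>x. g x \<le> 1"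
 shows "kpp g t y = (LINT w|M. alive_prod g t y w)"
proof -
 let ?P = "\<lambda>n w. \<Prod>u | length u < n. if u \<in> alive (\<tau> w) t then g (y - h w t u) else 1"
 have bd: "0 \<le> ?P n w" "?P n w \<le> 1" for n w
  using g by (auto intro!: prod_nonneg prod_le_1)
 have 1: "(\<lambda>n. \<integral>w. ?P n w \<partial>M) \<longlonglongrightarrow> (LINT w|M. alive_prod g t y w)"
  by (rule integral_dominated_convergence[where w="\<lambda>_. 1"])
   (use bd in \<open>auto intro!: alive_prod_measurable[OF t g(1)] measurable_short_prod[OF t g(1)] alive_prod_limit[OF t]\<close>)
 have "(\<lambda>n. branch_fun (\<lambda>x. ennreal (g x)) n t y) \<longlonglongrightarrow> (INF n. branch_fun (\<lambda>x. ennreal (g x)) n t y)"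
  by (intro LIMSEQ_INF branch_fun_decseq) (use g in \<open>auto simp: ennreal_le_1\<close>)
 then have "(\<lambda>n. ennreal (LINT w|M. ?P n w)) \<longlonglongrightarrow> ennreal (kpp g t y)"
  unfolding ennreal_kpp short_leaf_law[OF t g] .
 then have "(\<lambda>n. \<integral>w. ?P n w \<partial>M) \<longlonglongrightarrow> kpp g t y"
  using bd by (subst (asm) tendsto_ennreal_iff) (auto intro!: always_eventually Bochner_Integration.integral_nonneg)
 then show ?thesis using 1 by (rule LIMSEQ_unique)
qed

lemma tail_prob_eq:
 assumes t: "0 \<le> t"
 shows "{w\<in>space M. \<exists>u\<in>alive (\<tau> w) t. y \<le> h w t u} \<in> sets M"
  and "tail_prob t y = prob {w\<in>space M. \<exists>u\<in>alive (\<tau> w) t. y \<le> h w t u}"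
proof -
 note [measurable] = height_measurable[OF t]
 let ?A = "{w\<in>space M. \<exists>u\<in>alive (\<tau> w) t. y \<le> h w t u}"
 show A: "?A \<in> sets M"
 proof -
  have "?A = {w\<in>space M. \<exists>u. u \<in> alive (\<tau> w) t \<and> y \<le> h w t u}" by auto
  also have "\<dots> \<in> sets M" by measurable
  finally show ?thesis .
 qed
 have "kpp pos_ind t y = (LINT w|M. alive_prod pos_ind t y w)"
  by (rule kpp_expectation[OF t]) (auto simp: indicator_def)
 also have "\<dots> = (LINT w|M. 1 - indicator ?A w)"
 proof (rule Bochner_Integration.integral_cong[OF refl])
  fix w assume "w \<in> space M"
  then show "alive_prod pos_ind t y w = 1 - indicator ?A w"
   using finite_alive[OF _ t, of w] by (auto simp: alive_prod_def indicator_def prod_zero_iff not_less[symmetric])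
 qed
 also have "\<dots> = 1 - prob ?A"
 proof -
  have "(LINT w|M. 1 - indicat_real B w) = 1 - prob B" if [measurable]: "B \<in> sets M" for B
   by (subst Bochner_Integration.integral_diff) (auto simp: prob_space emeasure_eq_measure)
  from this[OF A] show ?thesis .
 qed
 finally show "tail_prob t y = prob ?A" by (simp add: tail_prob_def)
qed

lemma tail_prob_antimono:
 assumes t: "0 \<le> t" and "y \<le> y'" shows "tail_prob t y' \<le> tail_prob t y"
 unfolding tail_prob_eq(2)[OF t]
 by (intro finite_measure_mono tail_prob_eq(1)[OF t]) (use assms(2) in force)

end

section \<open>Gaussian tails of the maximum at a fixed time\<close>

lemma gauss_tail_upper:
 assumes "1 \<le> c" shows "measure std_normal_distribution {c..} \<le> std_normal_density c"
proof -
 have "ennreal (measure std_normal_distribution {c..}) = (GAUSS z. indicator {c..} z)"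
  by (simp add: gauss.emeasure_eq_measure)
 also have "\<dots> \<le> (GAUSS z. ennreal z * indicator {c<..} z)"
 proof (rule nn_integral_mono_AE)
  have "AE z in std_normal_distribution. z \<noteq> c"
   by (subst AE_density) (use AE_lborel_singleton[of c] in \<open>auto elim!: eventually_mono\<close>)
  then show "AE z in std_normal_distribution. indicator {c..} z \<le> ennreal z * indicator {c<..} z"
   by eventually_elim (use assms in \<open>auto simp: indicator_def\<close>)
 qed
 also have "\<dots> = ennreal (std_normal_density c)" using assms by (intro gauss_tail_moment) auto
 finally show ?thesis by simp
qed

lemma gauss_tail_lower:
 assumes "0 \<le> c" shows "std_normal_density (c + 1) \<le> measure std_normal_distribution {c..}"
proof -
 have "ennreal (std_normal_density (c + 1)) = (LEB z. ennreal (std_normal_density (c + 1)) * indicator {c..c + 1} z)"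
  by (simp add: nn_integral_cmult)
 also have "\<dots> \<le> (LEB z. ennreal (std_normal_density z) * indicator {c..} z)"
 proof (rule nn_integral_mono)
  fix z
  show "ennreal (std_normal_density (c + 1)) * indicator {c..c + 1} z \<le> ennreal (std_normal_density z) * indicator {c..} z"
  proof (cases "z \<in> {c..c + 1}")
   case True
   then have "z\<^sup>2 \<le> (c + 1)\<^sup>2" using assms by (intro power_mono) auto
   then show ?thesis using True by (auto simp: std_normal_density_def intro!: ennreal_leI divide_right_mono)
  qed simp
 qed
 also have "\<dots> = (GAUSS z. indicator {c..} z)"
  by (subst nn_integral_density) auto
 also have "\<dots> = ennreal (measure std_normal_distribution {c..})"
  by (simp add: gauss.emeasure_eq_measure)
 finally show ?thesis by simp
qed

text \<open>The upper bound is the first moment; the lower bound comes from the event, of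
  probability \<open>exp (- t)\<close>, that the root does not split before
  \<open>t\<close>.\<close>

lemma tail_prob_gauss:
 assumes t: "0 < t"
 shows "tail_prob t y \<le> exp t * measure std_normal_distribution {y / sqrt t..}"
  and "exp (- t) * measure std_normal_distribution {y / sqrt t..} \<le> tail_prob t y"
proof -
 let ?N = std_normal_distribution
 have heat: "heat (\<lambda>x. 1 - pos_ind x) t y = ennreal (measure ?N {y / sqrt t..})"
 proof -
  have "heat (\<lambda>x. 1 - pos_ind x) t y = (GAUSS z. indicator {y / sqrt t..} z)"
   unfolding heat_def using t by (intro nn_integral_cong) (auto simp: indicator_def field_simps)
  then show ?thesis by (simp add: gauss.emeasure_eq_measure)
 qed
 have "ennreal (tail_prob t y) \<le> ennreal (exp t) * heat (\<lambda>x. 1 - pos_ind x) t y"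
  unfolding tail_prob_def using t by (intro one_minus_kpp_le_heat) (auto simp: indicator_def)
 then show "tail_prob t y \<le> exp t * measure ?N {y / sqrt t..}"
  by (simp add: heat ennreal_mult[symmetric])
 have ind: "\<integral>\<^sup>+s. indicator {t<..} s \<partial>lifetime_law = eexp (- t)"
  using lifetime_memoryless[of "\<lambda>_. 1" t] t lifetime.emeasure_space_1 by simp
 have bd: "0 \<le> first_split pos_ind (\<lambda>r x. (kpp pos_ind r x)\<^sup>2) t y p" "first_split pos_ind (\<lambda>r x. (kpp pos_ind r x)\<^sup>2) t y p \<le> 1" for p
  by (auto simp: first_split_def indicator_def power2_eq_square intro!: mult_le_one)
 have int: "integrable first_split_law (first_split pos_ind (\<lambda>r x. (kpp pos_ind r x)\<^sup>2) t y)"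
  by (rule integrable_bounded_real[where K=1, OF split.finite_measure_axioms]) (use bd in auto)
 have "ennreal (exp (- t) * measure ?N {y / sqrt t..}) = (LIFE s. indicator {t<..} s * heat (\<lambda>x. 1 - pos_ind x) t y)"
  by (simp add: heat nn_integral_multc ind[simplified] ennreal_mult)
 also have "\<dots> = (SPLIT p. indicator {t<..} (fst p) * ennreal (1 - pos_ind (y - sqrt t * snd p)))"
  unfolding heat_def by (subst nn_integral_first_split) (auto simp: nn_integral_cmult)
 also have "\<dots> \<le> (SPLIT p. ennreal (1 - first_split pos_ind (\<lambda>r x. (kpp pos_ind r x)\<^sup>2) t y p))"
  by (intro nn_integral_mono) (auto simp: first_split_def indicator_def)
 also have "\<dots> = ennreal (LINT p|first_split_law. 1 - first_split pos_ind (\<lambda>r x. (kpp pos_ind r x)\<^sup>2) t y p)"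
  using int bd by (intro nn_integral_eq_integral) auto
 also have "(LINT p|first_split_law. 1 - first_split pos_ind (\<lambda>r x. (kpp pos_ind r x)\<^sup>2) t y p) = tail_prob t y"
  unfolding tail_prob_def using t int by (subst kpp_mild) (auto simp: split.prob_space indicator_def)
 finally show "exp (- t) * measure ?N {y / sqrt t..} \<le> tail_prob t y"
  by simp
qed

text \<open>The Gaussian exponents \<open>z\<^sup>2 / (2 * s)\<close> and
  \<open>(z + a)\<^sup>2 / (4 * s)\<close> differ to leading order, which beats any shift
  \<open>a\<close> and any factor \<open>\<theta>\<close>. From far below, reaching the front in
  time \<open>s\<close> is thus negligible against reaching it in time \<open>2 * s\<close>.\<close>

lemma tail_prob_domination:
 assumes s: "0 < s" and \<theta>: "0 < \<theta>"
 shows "\<exists>R. \<forall>z\<ge>R. tail_prob s z \<le> \<theta> * tail_prob (2 * s) (z + a)"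
proof -
 define \<gamma> where "\<gamma> = a / sqrt (2 * s)"
 have "((\<lambda>x. exp (- (sqrt 2 * x)\<^sup>2 / 2 + (x + (\<gamma> + 1))\<^sup>2 / 2)) \<longlongrightarrow> 0) at_top"
 proof -
  have "((\<lambda>x. exp (- x\<^sup>2 + (x + (\<gamma> + 1))\<^sup>2 / 2)) \<longlongrightarrow> 0) at_top" by real_asymp
  then show ?thesis by (simp add: power_mult_distrib)
 qed
 \<comment> \<open>The factor \<open>exp (- 3 * s)\<close> combines \<open>exp s\<close> of the
   upper and \<open>exp (- (2 * s))\<close> of the lower bound in \<open>tail_prob_gauss\<close>;
   the 1 in \<open>\<gamma> + 1\<close> stems from \<open>gauss_tail_lower\<close>.\<close>
 then have "\<forall>\<^sub>F x in at_top. exp (- (sqrt 2 * x)\<^sup>2 / 2 + (x + (\<gamma> + 1))\<^sup>2 / 2) < \<theta> * exp (- 3 * s)"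
  using \<theta> by (intro order_tendstoD) auto
 then have "\<forall>\<^sub>F x in at_top. exp (- (sqrt 2 * x)\<^sup>2 / 2 + (x + (\<gamma> + 1))\<^sup>2 / 2) < \<theta> * exp (- 3 * s) \<and> 1 \<le> x \<and> - \<gamma> \<le> x"
  by (intro eventually_conj eventually_ge_at_top)
 then obtain X where X: "\<And>x. X \<le> x \<Longrightarrow> exp (- (sqrt 2 * x)\<^sup>2 / 2 + (x + (\<gamma> + 1))\<^sup>2 / 2) < \<theta> * exp (- 3 * s) \<and> 1 \<le> x \<and> - \<gamma> \<le> x"
  by (auto simp: eventually_at_top_linorder)
 show ?thesis
 proof (intro exI[of _ "sqrt (2 * s) * X"] allI impI)
  fix z assume z: "sqrt (2 * s) * X \<le> z"
  define x where "x = z / sqrt (2 * s)"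
  have x: "X \<le> x" using z s by (simp add: x_def field_simps)
  have zx: "z / sqrt s = sqrt 2 * x" using s by (simp add: x_def real_sqrt_mult)
  have zy: "(z + a) / sqrt (2 * s) = x + \<gamma>" by (simp add: x_def \<gamma>_def add_divide_distrib)
  have "1 \<le> sqrt 2 * x" using X[OF x] mult_mono[of 1 "sqrt 2" 1 x] by simp
  have e: "exp (- (sqrt 2 * x)\<^sup>2 / 2) \<le> \<theta> * exp (- 3 * s) * exp (- (x + (\<gamma> + 1))\<^sup>2 / 2)"
  proof -
   have "exp (- (sqrt 2 * x)\<^sup>2 / 2) = exp (- (sqrt 2 * x)\<^sup>2 / 2 + (x + (\<gamma> + 1))\<^sup>2 / 2) * exp (- (x + (\<gamma> + 1))\<^sup>2 / 2)"
    by (simp add: exp_add[symmetric])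
   then show ?thesis using X[OF x] by (auto intro: mult_right_mono less_imp_le)
  qed
  have "tail_prob s z \<le> exp s * measure std_normal_distribution {sqrt 2 * x..}"
   using tail_prob_gauss(1)[OF s, of z] by (simp add: zx)
  also have "\<dots> \<le> exp s * std_normal_density (sqrt 2 * x)"
   using \<open>1 \<le> sqrt 2 * x\<close> by (intro mult_left_mono gauss_tail_upper) auto
  also have "\<dots> = 1 / sqrt (2 * pi) * (exp s * exp (- (sqrt 2 * x)\<^sup>2 / 2))"
   by (simp add: std_normal_density_def)
  also have "\<dots> \<le> 1 / sqrt (2 * pi) * (exp s * (\<theta> * exp (- 3 * s) * exp (- (x + (\<gamma> + 1))\<^sup>2 / 2)))"
   using e by (intro mult_left_mono) auto
  also have "\<dots> = \<theta> * (exp (- (2 * s)) * std_normal_density (x + (\<gamma> + 1)))"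
  proof -
   have "exp s * exp (- 3 * s) = exp (- (2 * s))" by (simp add: exp_add[symmetric])
   then show ?thesis unfolding std_normal_density_def
    by (simp add: mult.assoc[symmetric] mult.commute[of _ \<theta>])
  qed
  also have "\<dots> \<le> \<theta> * (exp (- (2 * s)) * measure std_normal_distribution {x + \<gamma>..})"
   using X[OF x] \<theta> gauss_tail_lower[of "x + \<gamma>"] by (intro mult_left_mono) (auto simp: add.assoc)
  also have "\<dots> \<le> \<theta> * tail_prob (2 * s) (z + a)"
   using tail_prob_gauss(2)[of "2 * s" "z + a"] s \<theta> by (intro mult_left_mono) (auto simp: zy)
  finally show "tail_prob s z \<le> \<theta> * tail_prob (2 * s) (z + a)" .
 qed
qed

section \<open>Functionals of marked point measures\<close>

lemma emeasure_distr_count: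
 assumes "f \<in> I \<rightarrow> space S" "A \<in> sets S"
 shows "emeasure (distr (count_space I) S f) A = emeasure (count_space I) {i\<in>I. f i \<in> A}"
 using assms by (subst emeasure_distr) (auto intro!: arg_cong2[where f=emeasure])

lemma topspace_vague:
 assumes "(\<lambda>_. 0) \<in> F"
 shows "topspace (vague_topology P F) = P"
proof -
 have "\<Union>{{\<mu>\<in>P. integral\<^sup>L \<mu> f \<in> U} | f U. f \<in> F \<and> open U} = P"
 proof (intro subset_antisym subsetI)
  fix x assume "x \<in> P"
  then show "x \<in> \<Union>{{\<mu>\<in>P. integral\<^sup>L \<mu> f \<in> U} | f U. f \<in> F \<and> open U}"
   using assms by (intro UnionI[of P]) (auto intro!: exI[of _ "\<lambda>_. 0"] exI[of _ UNIV])
 qed auto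
 then show ?thesis unfolding vague_topology_def topspace_def
  by (metis topology_generated_by_topspace topspace_def)
qed

lemma continuous_map_vague:
 assumes "f \<in> F" "(\<lambda>_. 0) \<in> F"
 shows "continuous_map (vague_topology P F) euclideanreal (\<lambda>\<mu>. integral\<^sup>L \<mu> f)"
 unfolding continuous_map_def
proof (intro conjI allI impI)
 fix U :: "real set" assume "openin euclideanreal U"
 then have "open U" by simp
 then have "openin (vague_topology P F) {\<mu>\<in>P. integral\<^sup>L \<mu> f \<in> U}"
  unfolding vague_topology_def using assms by (intro topology_generated_by_Basis) auto
 then show "openin (vague_topology P F) {\<mu> \<in> topspace (vague_topology P F). integral\<^sup>L \<mu> f \<in> U}"
  using assms by (simp add: topspace_vague)
qed auto

lemma space_borel_of_topology: "space (borel_of_topology T) = topspace T"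
 unfolding borel_of_topology_def by (rule space_measure_of) (auto dest: openin_subset)

lemma measurable_continuous_map:
 assumes "continuous_map T euclideanreal f"
 shows "f \<in> borel_measurable (borel_of_topology T)"
proof (rule borel_measurableI)
 fix S :: "real set" assume "open S"
 then have "openin T {x\<in>topspace T. f x \<in> S}"
  using assms by (simp add: continuous_map_def)
 then have "{x\<in>topspace T. f x \<in> S} \<in> sets (borel_of_topology T)"
  unfolding borel_of_topology_def by (intro in_measure_of) (auto dest: openin_subset)
 moreover have "f -` S \<inter> space (borel_of_topology T) = {x\<in>topspace T. f x \<in> S}"
  by (auto simp: space_borel_of_topology)
 ultimately show "f -` S \<inter> space (borel_of_topology T) \<in> sets (borel_of_topology T)" by simp
qed

lemma continuous_map_realI:
 assumes "\<And>x e. x \<in> topspace X \<Longrightarrow> 0 < e \<Longrightarrow> \<exists>U. openin X U \<and> x \<in> U \<and> (\<forall>y\<in>U. \<bar>f y - f x\<bar> < (e :: real))"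
 shows "continuous_map X euclideanreal f"
 unfolding continuous_map_def
proof (intro conjI allI impI)
 fix V :: "real set" assume "openin euclideanreal V"
 then have V: "open V" by simp
 show "openin X {x\<in>topspace X. f x \<in> V}"
 proof (subst openin_subopen, intro ballI)
  fix x assume x: "x \<in> {x\<in>topspace X. f x \<in> V}"
  then obtain e where e: "0 < e" "ball (f x) e \<subseteq> V" using V by (auto simp: open_contains_ball)
  obtain U where U: "openin X U" "x \<in> U" "\<And>y. y \<in> U \<Longrightarrow> \<bar>f y - f x\<bar> < e"
   using assms[of x e] x e by auto
  have "U \<subseteq> {x\<in>topspace X. f x \<in> V}"
   using U e openin_subset[OF U(1)] by (force simp: dist_real_def ball_def abs_minus_commute)
  then show "\<exists>T. openin X T \<and> x \<in> T \<and> T \<subseteq> {x\<in>topspace X. f x \<in> V}" using U by blast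
 qed
qed auto

lemma cluster_spaceE:
 assumes "C \<in> cluster_space"
 obtains I :: "nat set" and f where "C = distr (count_space I) borel f" "\<And>i. i \<in> I \<Longrightarrow> f i \<le> 0"
  "\<And>a. finite {i\<in>I. a \<le> f i}"
 using assms unfolding cluster_space_def point_measures_def by (fastforce simp: image_subset_iff)

lemma sets_cluster: "C \<in> cluster_space \<Longrightarrow> sets C = sets borel"
 by (auto elim!: cluster_spaceE)

lemma space_cluster: "C \<in> cluster_space \<Longrightarrow> space C = UNIV"
 by (auto elim!: cluster_spaceE)

lemma cluster_emeasure:
 assumes "C \<in> cluster_space"
 shows "emeasure C {a..} \<noteq> \<infinity>" "emeasure C {0<..} = 0" "\<exists>n :: nat. emeasure C {a..} = of_nat n"
proof -
 from assms obtain I :: "nat set" and f where C: "C = distr (count_space I) borel f" "\<And>i. i \<in> I \<Longrightarrow> f i \<le> 0"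
  "\<And>a. finite {i\<in>I. a \<le> f i}" by (rule cluster_spaceE) blast
 have "emeasure C {a..} = of_nat (card {i\<in>I. a \<le> f i})"
  unfolding C(1) using C(3)[of a] by (subst emeasure_distr_count) (auto simp: emeasure_count_space_finite)
 then show "emeasure C {a..} \<noteq> \<infinity>" "\<exists>n :: nat. emeasure C {a..} = of_nat n" by auto
 have *: "{i \<in> I. 0 < f i} = {}" using C(2) by force
 show "emeasure C {0<..} = 0" unfolding C(1) by (subst emeasure_distr_count) (auto simp: *)
qed

lemma cluster_AE_nonpos:
 assumes "C \<in> cluster_space" shows "AE x in C. x \<le> 0"
proof (rule AE_I[of _ _ "{0<..}"])
 show "{0<..} \<in> sets C" using sets_cluster[OF assms] by simp
qed (use cluster_emeasure[OF assms] in auto)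

lemma topspace_cluster: "topspace cluster_topology = cluster_space"
 unfolding cluster_topology_def by (rule topspace_vague) auto

lemma space_cluster_borel: "space cluster_borel = cluster_space"
 unfolding cluster_borel_def space_borel_of_topology topspace_cluster ..

lemma space_marked_borel: "space marked_borel = UNIV \<times> cluster_space"
 by (simp add: marked_borel_def space_pair_measure space_cluster_borel)

text \<open>Clusters have no mass on the positive half-line, so a continuous function that vanishes
  far to the left may be cut off on the right, here at 2, without changing its integrals; it then
  has compact support.\<close>

lemma continuous_map_cluster:
 assumes "continuous_on UNIV f" "\<And>x. x < a \<Longrightarrow> f x = 0"
 shows "continuous_map cluster_topology euclideanreal (\<lambda>C. \<integral>x. f x \<partial>C)"
proof -
 define g where "g = (\<lambda>x. f x * max 0 (min 1 (2 - x)))"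
 have "continuous_map cluster_topology euclideanreal (\<lambda>C. \<integral>x. g x \<partial>C)"
  unfolding cluster_topology_def
 proof (rule continuous_map_vague)
  have "continuous_on UNIV g" unfolding g_def using assms(1) by (intro continuous_intros)
  moreover have "g x = 0" if "max \<bar>a\<bar> 2 < \<bar>x\<bar>" for x
  proof (cases "x < a")
   case False
   then have "2 < x" using that by (auto simp: abs_if split: if_splits)
   then show ?thesis by (simp add: g_def)
  qed (simp add: g_def assms)
  ultimately show "g \<in> {f. continuous_on UNIV f \<and> (\<exists>a. \<forall>x. a < \<bar>x\<bar> \<longrightarrow> f x = 0)}" by blast
 qed auto
 moreover have "(LINT x|C. f x) = (LINT x|C. g x)" if "C \<in> topspace cluster_topology" for C
 proof -
  have C: "C \<in> cluster_space" using that by (simp add: topspace_cluster)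
  have f: "f \<in> borel_measurable borel" using assms(1) by (rule borel_measurable_continuous_onI)
  have m: "f \<in> borel_measurable C" "g \<in> borel_measurable C"
   unfolding measurable_cong_sets[OF sets_cluster[OF C] refl] g_def using f by auto
  show ?thesis using cluster_AE_nonpos[OF C] by (intro integral_cong_AE m) (auto simp: g_def elim!: eventually_mono)
 qed
 ultimately show ?thesis by (subst continuous_map_eq) auto
qed

section \<open>Sums over clusters and test functions\<close>

definition cluster_sum :: "(real \<Rightarrow> real) \<Rightarrow> real \<times> real measure \<Rightarrow> real" where
 "cluster_sum \<phi> = (\<lambda>(u, C). \<integral>x. \<phi> (u + x) \<partial>C)"

text \<open>The Lipschitz bound controls the dependence of \<open>cluster_sum\<close> on
  \<open>u\<close> by the number of particles above a level, as needed for joint continuity.\<close>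

definition level_fun :: "real \<Rightarrow> (real \<Rightarrow> real) \<Rightarrow> bool" where
 "level_fun a \<phi> \<longleftrightarrow> (\<forall>x. 0 \<le> \<phi> x \<and> \<phi> x \<le> 1) \<and> (\<forall>x<a. \<phi> x = 0) \<and> (\<exists>L. \<forall>x y. \<bar>\<phi> x - \<phi> y\<bar> \<le> L * \<bar>x - y\<bar>)"

lemma level_funD:
 assumes "level_fun a \<phi>"
 shows "0 \<le> \<phi> x" "\<phi> x \<le> 1" "x < a \<Longrightarrow> \<phi> x = 0" "continuous_on UNIV \<phi>" "\<phi> \<in> borel_measurable borel"
proof -
 show 1: "0 \<le> \<phi> x" "\<phi> x \<le> 1" "x < a \<Longrightarrow> \<phi> x = 0" using assms by (auto simp: level_fun_def)
 obtain L where L: "\<bar>\<phi> x - \<phi> y\<bar> \<le> L * \<bar>x - y\<bar>" for x y using assms by (auto simp: level_fun_def)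
 have "L-lipschitz_on UNIV \<phi>"
  using L L[of 1 0] by (auto simp: lipschitz_on_def dist_real_def)
 then show "continuous_on UNIV \<phi>" by (rule lipschitz_on_continuous_on)
 then show "\<phi> \<in> borel_measurable borel" by (rule borel_measurable_continuous_onI)
qed

lemma cluster_sum_integrable:
 assumes \<phi>: "level_fun a \<phi>" and C: "C \<in> cluster_space"
 shows "integrable C (\<lambda>x. \<phi> (u + x))"
proof (rule Bochner_Integration.integrable_bound[where f="indicator {a - u..} :: real \<Rightarrow> real"])
 show "integrable C (indicator {a - u..} :: real \<Rightarrow> real)"
  using cluster_emeasure(1)[OF C, of "a - u"] sets_cluster[OF C] by (intro integrable_real_indicator) (auto simp: less_top)
 show "(\<lambda>x. \<phi> (u + x)) \<in> borel_measurable C"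
  unfolding measurable_cong_sets[OF sets_cluster[OF C] refl] using level_funD(5)[OF \<phi>] by measurable
 show "AE x in C. norm (\<phi> (u + x)) \<le> norm (indicator {a - u..} x :: real)"
  using level_funD(1-3)[OF \<phi>] by (auto simp: indicator_def)
qed

lemma cluster_sum_nonneg: "level_fun a \<phi> \<Longrightarrow> 0 \<le> cluster_sum \<phi> (u, C)"
 by (simp add: cluster_sum_def integral_nonneg level_funD)

lemma cluster_sum_eq_0:
 assumes "level_fun a \<phi>" "C \<in> cluster_space" "u < a"
 shows "cluster_sum \<phi> (u, C) = 0"
proof -
 have "(LINT x|C. \<phi> (u + x)) = (LINT x|C. 0)"
  using cluster_AE_nonpos[OF assms(2)] cluster_sum_integrable[OF assms(1,2)]
  by (intro integral_cong_AE) (auto elim!: eventually_mono intro!: level_funD(3)[OF assms(1)] simp: assms(3) add_le_same_cancel1 intro: le_less_trans[OF _ assms(3)])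
 then show ?thesis by (simp add: cluster_sum_def)
qed

lemma cluster_sum_bound:
 assumes \<phi>: "level_fun a \<phi>" and L: "\<And>x y. \<bar>\<phi> x - \<phi> y\<bar> \<le> L * \<bar>x - y\<bar>" and C: "C \<in> cluster_space" and u: "\<bar>u - u0\<bar> \<le> 1"
 shows "\<bar>cluster_sum \<phi> (u, C) - cluster_sum \<phi> (u0, C)\<bar> \<le> L * \<bar>u - u0\<bar> * measure C {a - u0 - 1..}"
proof -
 have i: "integrable C (indicator {a - u0 - 1..} :: real \<Rightarrow> real)"
  using cluster_emeasure(1)[OF C, of "a - u0 - 1"] sets_cluster[OF C] by (intro integrable_real_indicator) (auto simp: less_top)
 have "\<bar>cluster_sum \<phi> (u, C) - cluster_sum \<phi> (u0, C)\<bar> = \<bar>\<integral>x. \<phi> (u + x) - \<phi> (u0 + x) \<partial>C\<bar>"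
  unfolding cluster_sum_def using cluster_sum_integrable[OF \<phi> C] by simp
 also have "\<dots> \<le> (LINT x|C. \<bar>\<phi> (u + x) - \<phi> (u0 + x)\<bar>)" by (rule integral_abs_bound)
 also have "\<dots> \<le> (LINT x|C. L * \<bar>u - u0\<bar> * indicator {a - u0 - 1..} x)"
 proof (intro integral_mono integrable_abs Bochner_Integration.integrable_diff cluster_sum_integrable[OF \<phi> C] integrable_mult_right i)
  fix x
  show "\<bar>\<phi> (u + x) - \<phi> (u0 + x)\<bar> \<le> L * \<bar>u - u0\<bar> * indicator {a - u0 - 1..} x"
  proof (cases "a - u0 - 1 \<le> x")
   case True then show ?thesis using L[of "u + x" "u0 + x"] by simp
  next
   case False
   then have "\<phi> (u + x) = 0" "\<phi> (u0 + x) = 0" using u by (auto intro!: level_funD(3)[OF \<phi>] simp: abs_if split: if_splits)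
   then show ?thesis using False by simp
  qed
 qed
 also have "\<dots> = L * \<bar>u - u0\<bar> * measure C {a - u0 - 1..}"
  using space_cluster[OF C] by simp
 finally show ?thesis .
qed

text \<open>Continuity in \<open>C\<close> for fixed \<open>u0\<close> is the vague topology. The
  modulus in \<open>u\<close> depends on the number of particles of \<open>C\<close>, which is
  bounded near \<open>C0\<close> through the continuous majorant \<open>\<kappa>\<close> of an
  indicator.\<close>

lemma cluster_sum_continuous:
 assumes \<phi>: "level_fun a \<phi>"
 shows "continuous_map (prod_topology euclideanreal cluster_topology) euclideanreal (cluster_sum \<phi>)"
proof (rule continuous_map_realI)
 fix p :: "real \<times> real measure" and e :: real
 assume p: "p \<in> topspace (prod_topology euclideanreal cluster_topology)" and e: "0 < e"
 obtain u0 C0 where pe: "p = (u0, C0)" by (cases p)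
 have C0: "C0 \<in> cluster_space" using p by (simp add: pe topspace_cluster)
 obtain L where L: "\<bar>\<phi> x - \<phi> y\<bar> \<le> L * \<bar>x - y\<bar>" for x y using \<phi> by (auto simp: level_fun_def)
 have L0: "0 \<le> L" using L[of 1 0] by simp
 define b where "b = a - u0 - 1"
 define \<kappa> where "\<kappa> = (\<lambda>x :: real. max 0 (min 1 (x - b + 1)))"
 have \<kappa>: "level_fun (b - 1) \<kappa>"
  unfolding level_fun_def \<kappa>_def by (auto intro!: exI[of _ 1])
 have cm1: "continuous_map cluster_topology euclideanreal (\<lambda>C. \<integral>x. \<kappa> x \<partial>C)"
  using level_funD(3,4)[OF \<kappa>] by (intro continuous_map_cluster[of _ "b - 1"]) auto
 have cm2: "continuous_map cluster_topology euclideanreal (\<lambda>C. cluster_sum \<phi> (u0, C))"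
  unfolding cluster_sum_def prod.case
  using level_funD(3,4)[OF \<phi>] by (intro continuous_map_cluster[of _ "a - u0"]) (auto intro!: continuous_intros intro: continuous_on_compose2)
 have C\<kappa>: "measure C {b..} \<le> (LINT x|C. \<kappa> x)" if C: "C \<in> cluster_space" for C
 proof -
  have i: "integrable C (indicator {b..} :: real \<Rightarrow> real)"
   using cluster_emeasure(1)[OF C, of b] sets_cluster[OF C] by (intro integrable_real_indicator) (auto simp: less_top)
  have "measure C {b..} = (LINT x|C. indicator {b..} x)" using space_cluster[OF C] by simp
  also have "\<dots> \<le> (LINT x|C. \<kappa> x)"
   using cluster_sum_integrable[OF \<kappa> C, of 0] by (intro integral_mono i) (auto simp: indicator_def \<kappa>_def)
  finally show ?thesis .
 qed
 define m where "m = (LINT x|C0. \<kappa> x) + 1"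
 have m: "1 \<le> m" unfolding m_def using level_funD(1)[OF \<kappa>] by (simp add: integral_nonneg)
 define d where "d = min 1 (e / (2 * (L * m + 1)))"
 have d: "0 < d" using e L0 m by (auto simp: d_def intro!: divide_pos_pos add_nonneg_pos)
 define U where "U = {C\<in>cluster_space. (LINT x|C. \<kappa> x) < m} \<inter> {C\<in>cluster_space. \<bar>cluster_sum \<phi> (u0, C) - cluster_sum \<phi> (u0, C0)\<bar> < e / 2}"
 have U: "openin cluster_topology U"
  unfolding U_def
 proof (rule openin_Int)
  have "openin cluster_topology {C\<in>topspace cluster_topology. (LINT x|C. \<kappa> x) \<in> {..<m}}"
   by (rule openin_continuous_map_preimage[OF cm1]) simp
  then show "openin cluster_topology {C\<in>cluster_space. (LINT x|C. \<kappa> x) < m}" by (simp add: topspace_cluster)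
  have "openin cluster_topology {C\<in>topspace cluster_topology. cluster_sum \<phi> (u0, C) \<in> ball (cluster_sum \<phi> (u0, C0)) (e / 2)}"
   by (rule openin_continuous_map_preimage[OF cm2]) simp
  then show "openin cluster_topology {C\<in>cluster_space. \<bar>cluster_sum \<phi> (u0, C) - cluster_sum \<phi> (u0, C0)\<bar> < e / 2}"
   by (simp add: topspace_cluster ball_def dist_real_def abs_minus_commute)
 qed
 show "\<exists>V. openin (prod_topology euclideanreal cluster_topology) V \<and> p \<in> V \<and> (\<forall>q\<in>V. \<bar>cluster_sum \<phi> q - cluster_sum \<phi> p\<bar> < e)"
 proof (intro exI conjI ballI)
  show "openin (prod_topology euclideanreal cluster_topology) (ball u0 d \<times> U)"
   using U by (simp add: openin_prod_Times_iff)
  show "p \<in> ball u0 d \<times> U" using C0 d e by (auto simp: pe U_def m_def)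
  fix q assume "q \<in> ball u0 d \<times> U"
  then obtain u C where q: "q = (u, C)" "\<bar>u - u0\<bar> < d" "C \<in> U" by (auto simp: dist_real_def abs_minus_commute)
  then have C: "C \<in> cluster_space" "(LINT x|C. \<kappa> x) < m" "\<bar>cluster_sum \<phi> (u0, C) - cluster_sum \<phi> (u0, C0)\<bar> < e / 2"
   by (auto simp: U_def)
  have "\<bar>cluster_sum \<phi> (u, C) - cluster_sum \<phi> (u0, C)\<bar> \<le> L * \<bar>u - u0\<bar> * measure C {a - u0 - 1..}"
   using q(2) by (intro cluster_sum_bound[OF \<phi> L C(1)]) (auto simp: d_def)
  also have "\<dots> \<le> L * d * m"
   using C\<kappa>[OF C(1)] C(2) q(2) L0 d by (intro mult_mono) (auto simp: b_def)
  also have "\<dots> \<le> L * (e / (2 * (L * m + 1))) * m"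
   using L0 m by (intro mult_right_mono mult_left_mono) (auto simp: d_def)
  also have "\<dots> = (L * m) / (L * m + 1) * (e / 2)" by (simp add: algebra_simps)
  also have "\<dots> \<le> 1 * (e / 2)"
   using L0 m e by (intro mult_right_mono) (auto simp: divide_le_eq_1 add_nonneg_pos)
  finally show "\<bar>cluster_sum \<phi> q - cluster_sum \<phi> p\<bar> < e"
   using C(3) unfolding q pe by linarith
 qed
qed

text \<open>Measurability refers to the product sigma-algebra and is not drawn from continuity in
  the product topology: \<open>u\<close> is rounded to multiples of \<open>1 / Suc k\<close>, which
  leaves countably many measurable slices.\<close>

lemma cluster_sum_measurable:
 assumes \<phi>: "level_fun a \<phi>"
 shows "cluster_sum \<phi> \<in> borel_measurable marked_borel"
proof (rule borel_measurable_LIMSEQ_real)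
 let ?v = "\<lambda>k u. of_int \<lfloor>real (Suc k) * u\<rfloor> / real (Suc k)"
 obtain L where L: "\<bar>\<phi> x - \<phi> y\<bar> \<le> L * \<bar>x - y\<bar>" for x y using \<phi> by (auto simp: level_fun_def)
 have slice: "(\<lambda>C. cluster_sum \<phi> (u, C)) \<in> borel_measurable cluster_borel" for u
  unfolding cluster_borel_def cluster_sum_def prod.case
  using level_funD(3,4)[OF \<phi>]
  by (intro measurable_continuous_map continuous_map_cluster[of _ "a - u"]) (auto intro!: continuous_intros intro: continuous_on_compose2)
 show "(\<lambda>p. cluster_sum \<phi> (?v k (fst p), snd p)) \<in> borel_measurable marked_borel" for k
 proof -
  have "(\<lambda>p. cluster_sum \<phi> (of_int i / real (Suc k), snd p)) \<in> borel_measurable marked_borel" for i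
   unfolding marked_borel_def using slice by (rule measurable_compose[OF measurable_snd])
  moreover have "(\<lambda>p. \<lfloor>real (Suc k) * fst p\<rfloor>) \<in> measurable marked_borel (count_space UNIV)"
   unfolding marked_borel_def by measurable
  ultimately show ?thesis by (rule measurable_compose_countable)
 qed
 fix p assume "p \<in> space marked_borel"
 then obtain u C where p: "p = (u, C)" and C: "C \<in> cluster_space" by (auto simp: space_marked_borel)
 have near: "\<bar>?v k u - u\<bar> \<le> 1 / real (Suc k)" for k
 proof -
  have "?v k u - u = (of_int \<lfloor>real (Suc k) * u\<rfloor> - real (Suc k) * u) / real (Suc k)" by (simp add: field_simps del: of_nat_Suc)
  moreover have "\<bar>of_int \<lfloor>real (Suc k) * u\<rfloor> - real (Suc k) * u\<bar> \<le> 1" by linarith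
  ultimately show ?thesis by (simp add: abs_divide divide_right_mono del: of_nat_Suc)
 qed
 have "(\<lambda>k. cluster_sum \<phi> (?v k u, C) - cluster_sum \<phi> (u, C)) \<longlonglongrightarrow> 0"
 proof (rule Lim_null_comparison[OF always_eventually])
  show "\<forall>k. norm (cluster_sum \<phi> (?v k u, C) - cluster_sum \<phi> (u, C)) \<le> L * measure C {a - u - 1..} * (1 / real (Suc k))"
  proof
   fix k
   have "\<bar>cluster_sum \<phi> (?v k u, C) - cluster_sum \<phi> (u, C)\<bar> \<le> L * \<bar>?v k u - u\<bar> * measure C {a - u - 1..}"
    using near[of k] by (intro cluster_sum_bound[OF \<phi> L C]) (auto intro: order_trans)
   also have "\<dots> \<le> L * (1 / real (Suc k)) * measure C {a - u - 1..}"
    using near[of k] L[of 1 0] by (intro mult_right_mono mult_left_mono) auto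
   finally show "norm (cluster_sum \<phi> (?v k u, C) - cluster_sum \<phi> (u, C)) \<le> L * measure C {a - u - 1..} * (1 / real (Suc k))" by simp
  qed
  show "(\<lambda>k. L * measure C {a - u - 1..} * (1 / real (Suc k))) \<longlonglongrightarrow> 0"
   using tendsto_mult[OF tendsto_const LIMSEQ_Suc[OF lim_1_over_n], of "L * measure C {a - u - 1..}"] by simp
 qed
 then show "(\<lambda>k. cluster_sum \<phi> (?v k (fst p), snd p)) \<longlonglongrightarrow> cluster_sum \<phi> p"
  unfolding p by (simp add: LIM_zero_iff)
qed

text \<open>The test functions of \<open>marked_point_topology\<close>, with the level of their
  support made explicit and with measurability for the product sigma-algebra added, as integrals and
  counts require it.\<close>

definition test_fun :: "real \<Rightarrow> (real \<times> real measure \<Rightarrow> real) \<Rightarrow> bool" where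
 "test_fun a f \<longleftrightarrow> f \<in> borel_measurable marked_borel \<and>
   continuous_map (prod_topology euclideanreal cluster_topology) euclideanreal f \<and>
   (\<exists>K. \<forall>u. \<forall>C\<in>cluster_space. \<bar>f (u, C)\<bar> \<le> K) \<and> (\<forall>u<a. \<forall>C\<in>cluster_space. f (u, C) = 0)"

lemma test_fun_measurable: "test_fun a f \<Longrightarrow> f \<in> borel_measurable marked_borel"
 by (simp add: test_fun_def)

lemma test_fun_bound: "test_fun a f \<Longrightarrow> \<exists>K. \<forall>u. \<forall>C\<in>cluster_space. \<bar>f (u, C)\<bar> \<le> K"
 unfolding test_fun_def by blast

lemma test_fun_eq_0: "test_fun a f \<Longrightarrow> C \<in> cluster_space \<Longrightarrow> u < a \<Longrightarrow> f (u, C) = 0"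
 unfolding test_fun_def by blast

lemma test_fun_compose:
 assumes f: "test_fun a f" and \<Psi>: "continuous_on UNIV \<Psi>" "\<Psi> 0 = (0 :: real)"
 shows "test_fun a (\<lambda>p. \<Psi> (f p))"
proof -
 obtain K where K: "\<And>u C. C \<in> cluster_space \<Longrightarrow> \<bar>f (u, C)\<bar> \<le> K" using test_fun_bound[OF f] by blast
 have "compact (\<Psi> ` {-K..K})" by (intro compact_continuous_image continuous_on_subset[OF \<Psi>(1)]) auto
 then obtain K' where K': "\<And>y. y \<in> \<Psi> ` {-K..K} \<Longrightarrow> \<bar>y\<bar> \<le> K'"
  using compact_imp_bounded[of "\<Psi> ` {-K..K}"] unfolding bounded_real by metis
 have "\<bar>\<Psi> (f (u, C))\<bar> \<le> K'" if "C \<in> cluster_space" for u C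
  using K[OF that, of u] by (intro K' imageI) auto
 moreover have "continuous_map (prod_topology euclideanreal cluster_topology) euclideanreal (\<Psi> \<circ> f)"
  using f \<Psi> by (intro continuous_map_compose[where X'=euclideanreal]) (auto simp: test_fun_def)
 moreover have "(\<lambda>p. \<Psi> (f p)) \<in> borel_measurable marked_borel"
  using f \<Psi> by (intro measurable_compose[of f _ borel \<Psi>] borel_measurable_continuous_onI) (auto simp: test_fun_def)
 ultimately show ?thesis using f \<Psi> by (auto simp: test_fun_def comp_def)
qed

lemma test_fun_cluster_sum:
 assumes \<phi>: "level_fun a \<phi>" and \<Psi>: "continuous_on UNIV \<Psi>" "\<Psi> 0 = (0 :: real)" "\<And>x. 0 \<le> x \<Longrightarrow> \<bar>\<Psi> x\<bar> \<le> K"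
 shows "test_fun a (\<lambda>p. \<Psi> (cluster_sum \<phi> p))"
proof -
 have "continuous_map (prod_topology euclideanreal cluster_topology) euclideanreal (\<Psi> \<circ> cluster_sum \<phi>)"
  using cluster_sum_continuous[OF \<phi>] \<Psi> by (intro continuous_map_compose[where X'=euclideanreal]) auto
 moreover have "(\<lambda>p. \<Psi> (cluster_sum \<phi> p)) \<in> borel_measurable marked_borel"
  using cluster_sum_measurable[OF \<phi>] \<Psi> by (intro measurable_compose[of "cluster_sum \<phi>" _ borel \<Psi>] borel_measurable_continuous_onI) auto
 ultimately show ?thesis
  unfolding test_fun_def comp_def using \<Psi> cluster_sum_nonneg[OF \<phi>] cluster_sum_eq_0[OF \<phi>]
  by (auto intro!: exI[of _ K])
qed

lemma test_fun_fst:
 assumes "continuous_on UNIV \<eta>" "\<And>x. \<bar>\<eta> x\<bar> \<le> (K :: real)" "\<And>x. x < a \<Longrightarrow> \<eta> x = 0"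
 shows "test_fun a (\<lambda>p. \<eta> (fst p))"
proof -
 have "continuous_map (prod_topology euclideanreal cluster_topology) euclideanreal (\<eta> \<circ> fst)"
  using assms(1) by (intro continuous_map_compose[where X'=euclideanreal] continuous_map_fst) auto
 moreover have "(\<lambda>p. \<eta> (fst p)) \<in> borel_measurable marked_borel"
  using assms(1) unfolding marked_borel_def
  by (intro measurable_compose[of fst _ borel \<eta>] borel_measurable_continuous_onI) auto
 ultimately show ?thesis
  unfolding test_fun_def comp_def using assms(2,3) by (auto intro!: exI[of _ K])
qed

lemma topspace_marked: "topspace marked_point_topology = marked_point_space"
 unfolding marked_point_topology_def by (rule topspace_vague) (auto intro!: exI[of _ 0])

lemma test_fun_continuous:
 assumes "test_fun a f"
 shows "continuous_map marked_point_topology euclideanreal (\<lambda>X. integral\<^sup>L X f)"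
 unfolding marked_point_topology_def
proof (rule continuous_map_vague)
 show "f \<in> {f. continuous_map (prod_topology euclideanreal cluster_topology) euclideanreal f \<and>
      (\<exists>K. \<forall>u. \<forall>C\<in>cluster_space. \<bar>f (u, C)\<bar> \<le> K) \<and>
      (\<exists>a. \<forall>u<a. \<forall>C\<in>cluster_space. f (u, C) = 0)}"
  using assms unfolding test_fun_def by blast
qed (auto intro!: exI[of _ 0])

lemma marked_pointE:
 assumes "X \<in> marked_point_space"
 obtains I :: "nat set" and f where "X = distr (count_space I) marked_borel f" "f \<in> I \<rightarrow> UNIV \<times> cluster_space"
  "\<And>a. finite {i\<in>I. f i \<in> {a..} \<times> cluster_space}"
 using assms unfolding marked_point_space_def point_measures_def by (fastforce simp: image_subset_iff)

lemma sets_marked_point: "X \<in> marked_point_space \<Longrightarrow> sets X = sets marked_borel"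
 by (auto elim!: marked_pointE)

lemma space_marked_point: "X \<in> marked_point_space \<Longrightarrow> space X = UNIV \<times> cluster_space"
 by (auto elim!: marked_pointE simp: space_marked_borel)

lemma marked_point_emeasure:
 assumes X: "X \<in> marked_point_space" and A: "A \<in> sets marked_borel" "A \<subseteq> {a..} \<times> cluster_space"
 shows "\<exists>n :: nat. emeasure X A = of_nat n"
proof -
 from X obtain I :: "nat set" and f where X: "X = distr (count_space I) marked_borel f" "f \<in> I \<rightarrow> UNIV \<times> cluster_space"
  "\<And>a. finite {i\<in>I. f i \<in> {a..} \<times> cluster_space}" by (rule marked_pointE) blast
 have "finite {i\<in>I. f i \<in> A}" using A by (intro finite_subset[OF _ X(3)[of a]]) auto
 then have "emeasure X A = of_nat (card {i\<in>I. f i \<in> A})"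
  unfolding X(1) using X(2) A by (subst emeasure_distr_count) (auto simp: space_marked_borel emeasure_count_space_finite)
 then show ?thesis ..
qed

lemma half_space_marked [measurable]: "{a..} \<times> cluster_space \<in> sets marked_borel"
 unfolding marked_borel_def using sets.top[of cluster_borel] by (simp add: space_cluster_borel)

lemma marked_point_finite:
 assumes "X \<in> marked_point_space" "A \<in> sets marked_borel" "A \<subseteq> {a..} \<times> cluster_space"
 shows "emeasure X A < \<infinity>"
 using marked_point_emeasure[OF assms] by (auto simp: ennreal_of_nat_eq_real_of_nat)

lemma marked_point_integrable:
 assumes X: "X \<in> marked_point_space" and f: "f \<in> borel_measurable marked_borel"
  and K: "\<And>u C. C \<in> cluster_space \<Longrightarrow> \<bar>f (u, C)\<bar> \<le> K" and z: "\<And>u C. u < a \<Longrightarrow> C \<in> cluster_space \<Longrightarrow> f (u, C) = (0::real)"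
 shows "integrable X f"
proof (rule Bochner_Integration.integrable_bound[where f="\<lambda>p. K * indicator ({a..} \<times> cluster_space) p"])
 show "integrable X (\<lambda>p. K * indicator ({a..} \<times> cluster_space) p)"
  using marked_point_finite[OF X half_space_marked order_refl] sets_marked_point[OF X]
  by (intro integrable_mult_right integrable_real_indicator) auto
 show "f \<in> borel_measurable X"
  unfolding measurable_cong_sets[OF sets_marked_point[OF X] refl] by (rule f)
 have "norm (f p) \<le> norm (K * indicator ({a..} \<times> cluster_space) p)" if ps: "p \<in> space X" for p
 proof -
  obtain u C where p: "p = (u, C)" "C \<in> cluster_space" using ps unfolding space_marked_point[OF X] by auto
  then show ?thesis using K[OF p(2), of u] z[of u C] by (cases "u < a") (auto simp: indicator_def)
 qed
 then show "AE p in X. norm (f p) \<le> norm (K * indicator ({a..} \<times> cluster_space) p)" by (intro AE_I2)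
qed

lemma test_fun_integrable:
 assumes X: "X \<in> marked_point_space" and "test_fun a f"
 shows "integrable X f"
proof -
 obtain K where "\<And>u C. C \<in> cluster_space \<Longrightarrow> \<bar>f (u, C)\<bar> \<le> K" using test_fun_bound[OF assms(2)] by blast
 then show ?thesis
  using test_fun_eq_0[OF assms(2)] by (intro marked_point_integrable[OF X test_fun_measurable[OF assms(2)]]) auto
qed

text \<open>For each point measure the count of \<open>A\<close> is a limit of continuous
  functionals, by dominated convergence. Since all \<open>g k\<close> vanish below \<open>a\<close>,
  so does their limit, which locates \<open>A\<close>.\<close>

lemma measurable_count:
 assumes A: "A \<in> sets marked_borel" and g: "\<And>k :: nat. test_fun a (g k)"
  and g1: "\<And>k p. p \<in> space marked_borel \<Longrightarrow> \<bar>g k p\<bar> \<le> 1"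
  and lim: "\<And>p. p \<in> space marked_borel \<Longrightarrow> (\<lambda>k. g k p) \<longlonglongrightarrow> indicator A p"
 shows "(\<lambda>X. measure X A) \<in> borel_measurable (borel_of_topology marked_point_topology)"
  and "A \<subseteq> {a..} \<times> cluster_space"
proof -
 show sub: "A \<subseteq> {a..} \<times> cluster_space"
 proof
  fix p assume p: "p \<in> A"
  then have ps: "p \<in> space marked_borel" using sets.sets_into_space[OF A] by auto
  then obtain u C where pe: "p = (u, C)" "C \<in> cluster_space" by (auto simp: space_marked_borel)
  have "a \<le> u"
  proof (rule ccontr)
   assume "\<not> a \<le> u"
   then have "(\<lambda>k. g k p) = (\<lambda>k. 0)" using g pe by (auto simp: test_fun_def)
   then have "(\<lambda>k. 0 :: real) \<longlonglongrightarrow> 1" using lim[OF ps] p by simp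
   then show False using LIMSEQ_unique[OF _ tendsto_const] by fastforce
  qed
  then show "p \<in> {a..} \<times> cluster_space" using pe by auto
 qed
 show "(\<lambda>X. measure X A) \<in> borel_measurable (borel_of_topology marked_point_topology)"
 proof (rule borel_measurable_LIMSEQ_real)
  show "(\<lambda>X. integral\<^sup>L X (g k)) \<in> borel_measurable (borel_of_topology marked_point_topology)" for k
   by (intro measurable_continuous_map test_fun_continuous[OF g])
  fix X assume "X \<in> space (borel_of_topology marked_point_topology)"
  then have X: "X \<in> marked_point_space" by (simp add: space_borel_of_topology topspace_marked)
  have sp: "space X = space marked_borel" using space_marked_point[OF X] by (simp add: space_marked_borel)
  have "(\<lambda>k. integral\<^sup>L X (g k)) \<longlonglongrightarrow> (LINT p|X. indicator A p)"
  proof (rule integral_dominated_convergence[where w="indicator ({a..} \<times> cluster_space)"])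
   show "indicator A \<in> borel_measurable X" using A sets_marked_point[OF X] by simp
   show "g k \<in> borel_measurable X" for k
    unfolding measurable_cong_sets[OF sets_marked_point[OF X] refl] by (rule test_fun_measurable[OF g])
   show "integrable X (indicator ({a..} \<times> cluster_space) :: _ \<Rightarrow> real)"
    using marked_point_finite[OF X half_space_marked order_refl] sets_marked_point[OF X]
    by (intro integrable_real_indicator) auto
   show "AE p in X. (\<lambda>k. g k p) \<longlonglongrightarrow> indicator A p" using lim by (intro AE_I2) (simp add: sp)
   have "norm (g k p) \<le> indicator ({a..} \<times> cluster_space) p" if p: "p \<in> space X" for k p
   proof -
    obtain u C where pe: "p = (u, C)" "C \<in> cluster_space" using p unfolding space_marked_point[OF X] by auto
    have "\<bar>g k p\<bar> \<le> 1" using g1 p by (simp add: sp)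
    moreover have "u < a \<Longrightarrow> g k p = 0" using g[of k] pe by (auto simp: test_fun_def)
    ultimately show ?thesis using pe by (auto simp: indicator_def not_le)
   qed
   then show "AE p in X. norm (g k p) \<le> indicator ({a..} \<times> cluster_space) p" for k by (intro AE_I2)
  qed
  moreover have "(LINT p|X. indicator A p) = measure X A"
   using sets.sets_into_space[OF A] sp by (simp add: Int_absorb2)
  ultimately show "(\<lambda>k. integral\<^sup>L X (g k)) \<longlonglongrightarrow> measure X A" by simp
 qed
qed

text \<open>A continuous majorant of the indicator of \<open>{- v..}\<close> with transition zone
  from \<open>- v - 1 / k\<close> to \<open>- v\<close>. The slope \<open>k = 1\<close> serves for
  sandwich bounds, large \<open>k\<close> for limits.\<close>

definition ramp :: "real \<Rightarrow> real \<Rightarrow> real \<Rightarrow> real" where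
 "ramp v k x = max 0 (min 1 (k * (x + v) + 1))"

lemma level_fun_ramp: "1 \<le> k \<Longrightarrow> level_fun (- v - 1) (ramp v k)"
proof -
 assume k: "1 \<le> k"
 have "ramp v k x = 0" if "x < - v - 1" for x
 proof -
  have "k * (x + v) \<le> 1 * (x + v)" using that k by (intro mult_right_mono_neg) auto
  also have "\<dots> \<le> - 1" using that by simp
  finally have "k * (x + v) + 1 \<le> 0" by simp
  then show ?thesis by (simp add: ramp_def)
 qed
 moreover have "\<bar>ramp v k x - ramp v k y\<bar> \<le> k * \<bar>x - y\<bar>" for x y
 proof -
  have "\<bar>ramp v k x - ramp v k y\<bar> \<le> \<bar>k * (x + v) - k * (y + v)\<bar>" by (auto simp: ramp_def)
  also have "\<dots> = k * \<bar>x - y\<bar>" using k by (simp add: abs_mult flip: right_diff_distrib)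
  finally show ?thesis .
 qed
 ultimately show ?thesis unfolding level_fun_def by (auto simp: ramp_def)
qed

lemma ramp_eq_1: "- v \<le> x \<Longrightarrow> 0 \<le> k \<Longrightarrow> ramp v k x = 1"
 by (simp add: ramp_def)

lemma ramp_limit: "(\<lambda>n. ramp v (real (Suc n)) x) \<longlonglongrightarrow> indicator {- v..} x"
proof (cases "- v \<le> x")
 case True
 then show ?thesis by (simp add: ramp_eq_1 indicator_def)
next
 case False
 obtain N where N: "1 / (- v - x) < real N" using reals_Archimedean2 by blast
 have "ramp v (real (Suc n)) x = 0" if "N \<le> n" for n
 proof -
  have "1 / (- v - x) \<le> real (Suc n)" using N that by linarith
  then have "1 \<le> real (Suc n) * (- v - x)" using False by (simp add: pos_divide_le_eq)
  then show ?thesis by (simp add: ramp_def algebra_simps)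
 qed
 then show ?thesis using False by (intro tendsto_eventually) (auto simp: eventually_sequentially)
qed

definition level_count :: "real \<Rightarrow> real \<times> real measure \<Rightarrow> real" where
 "level_count v = (\<lambda>(u, C). measure C {- v - u..})"

lemma level_count_nat:
 assumes "C \<in> cluster_space" shows "\<exists>n :: nat. emeasure C {- v - u..} = of_nat n \<and> level_count v (u, C) = n"
 using cluster_emeasure(3)[OF assms, of "- v - u"] by (auto simp: level_count_def measure_def)

lemma emeasure_level_count:
 assumes "C \<in> cluster_space" shows "emeasure C {- v - u..} = ennreal (level_count v (u, C))"
 using level_count_nat[OF assms, of v u] by (auto simp: ennreal_of_nat_eq_real_of_nat)

lemma level_count_limit:
 assumes C: "C \<in> cluster_space"
 shows "(\<lambda>n. cluster_sum (ramp v (real (Suc n))) (u, C)) \<longlonglongrightarrow> level_count v (u, C)"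
proof -
 have "(\<lambda>n. \<integral>x. ramp v (real (Suc n)) (u + x) \<partial>C) \<longlonglongrightarrow> (LINT x|C. indicator {- v..} (u + x))"
 proof (rule integral_dominated_convergence[where w="indicator {- v - 1 - u..}"])
  show "(\<lambda>x. indicator {- v..} (u + x) :: real) \<in> borel_measurable C"
   unfolding measurable_cong_sets[OF sets_cluster[OF C] refl] by measurable
  show "(\<lambda>x. ramp v (real (Suc n)) (u + x)) \<in> borel_measurable C" for n
   using cluster_sum_integrable[OF level_fun_ramp C, of "real (Suc n)" v u] by auto
  show "integrable C (indicator {- v - 1 - u..} :: real \<Rightarrow> real)"
   using cluster_emeasure(1)[OF C, of "- v - 1 - u"] sets_cluster[OF C] by (intro integrable_real_indicator) (auto simp: less_top)
  show "AE x in C. (\<lambda>n. ramp v (real (Suc n)) (u + x)) \<longlonglongrightarrow> indicator {- v..} (u + x)"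
   using ramp_limit by auto
  show "AE x in C. norm (ramp v (real (Suc n)) (u + x)) \<le> indicator {- v - 1 - u..} x" for n
  proof (intro AE_I2)
   fix x
   note lf = level_fun_ramp[of "real (Suc n)" v, simplified]
   show "norm (ramp v (real (Suc n)) (u + x)) \<le> indicator {- v - 1 - u..} x"
    using level_funD(1,2)[OF lf, of "u + x"] level_funD(3)[OF lf, of "u + x"] by (auto simp: indicator_def)
  qed
 qed
 moreover have "(LINT x|C. indicator {- v..} (u + x)) = level_count v (u, C)"
 proof -
  have "(LINT x|C. indicat_real {- v..} (u + x)) = (LINT x|C. indicat_real {- v - u..} x)"
   by (intro Bochner_Integration.integral_cong) (auto simp: indicator_def)
  then show ?thesis using space_cluster[OF C] by (simp add: level_count_def)
 qed
 ultimately show ?thesis by (simp add: cluster_sum_def)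
qed

lemma level_count_measurable [measurable]: "level_count v \<in> borel_measurable marked_borel"
proof (rule borel_measurable_LIMSEQ_real)
 show "cluster_sum (ramp v (real (Suc n))) \<in> borel_measurable marked_borel" for n
  by (rule cluster_sum_measurable[OF level_fun_ramp]) simp
 show "(\<lambda>n. cluster_sum (ramp v (real (Suc n))) p) \<longlonglongrightarrow> level_count v p" if "p \<in> space marked_borel" for p
  using that level_count_limit by (auto simp: space_marked_borel)
qed

text \<open>Replacing sharp counts by continuous ones costs at most a unit shift of the level, which
  for the rates means a factor \<open>exp (sqrt 2)\<close>.\<close>

lemma level_count_bounds:
 assumes C: "C \<in> cluster_space"
 shows "level_count v (u, C) \<le> cluster_sum (ramp v 1) (u, C)" "cluster_sum (ramp v 1) (u, C) \<le> level_count (v + 1) (u, C)"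
proof -
 have i: "integrable C (indicator {b..} :: real \<Rightarrow> real)" for b
  using cluster_emeasure(1)[OF C, of b] sets_cluster[OF C] by (intro integrable_real_indicator) (auto simp: less_top)
 have lc: "level_count v (u, C) = (LINT x|C. indicator {- v - u..} x)" for v
  using space_cluster[OF C] by (simp add: level_count_def)
 note lf = level_fun_ramp[of 1 v, simplified]
 show "level_count v (u, C) \<le> cluster_sum (ramp v 1) (u, C)"
  unfolding lc cluster_sum_def prod.case
  using level_funD(1)[OF lf] by (intro integral_mono i cluster_sum_integrable[OF lf C]) (auto simp: indicator_def ramp_eq_1)
 show "cluster_sum (ramp v 1) (u, C) \<le> level_count (v + 1) (u, C)"
  unfolding lc cluster_sum_def prod.case
  using level_funD(2,3)[OF lf] by (intro integral_mono i cluster_sum_integrable[OF lf C]) (auto simp: indicator_def)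
qed

definition at_least :: "real \<Rightarrow> nat \<Rightarrow> (real \<times> real measure) set" where
 "at_least v j = {p\<in>space marked_borel. real j \<le> level_count v p}"

lemma at_least_sets [measurable]: "at_least v j \<in> sets marked_borel"
 unfolding at_least_def by measurable

lemma measurable_at_least:
 assumes "1 \<le> j"
 shows "(\<lambda>X. measure X (at_least v j)) \<in> borel_measurable (borel_of_topology marked_point_topology)"
  and "at_least v j \<subseteq> {- v - 1..} \<times> cluster_space"
proof -
 \<comment> \<open>Counts are integers, so this continuous function, rising from 0 at
   \<open>j - 1\<close> to 1 at \<open>j\<close>, acts on them as the indicator of
   \<open>{j..}\<close>; \<open>1 \<le> j\<close> ensures the value 0 at 0.\<close>
 define \<Psi> where "\<Psi> = (\<lambda>y. max 0 (min 1 (y - (real j - 1))))"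
 have 1: "test_fun (- v - 1) (\<lambda>p. \<Psi> (cluster_sum (ramp v (real (Suc k))) p))" for k
  by (rule test_fun_cluster_sum[where K=1, OF level_fun_ramp]) (use assms in \<open>auto simp: \<Psi>_def intro!: continuous_intros\<close>)
 have 2: "(\<lambda>k. \<Psi> (cluster_sum (ramp v (real (Suc k))) p)) \<longlonglongrightarrow> indicator (at_least v j) p" if p: "p \<in> space marked_borel" for p
 proof -
  obtain u C where pe: "p = (u, C)" "C \<in> cluster_space" using p by (auto simp: space_marked_borel)
  obtain n :: nat where n: "level_count v p = real n" using level_count_nat[OF pe(2), of v u] pe by auto
  have "isCont \<Psi> (level_count v p)" unfolding \<Psi>_def by (intro continuous_intros)
  then have "(\<lambda>k. \<Psi> (cluster_sum (ramp v (real (Suc k))) p)) \<longlonglongrightarrow> \<Psi> (level_count v p)"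
   using level_count_limit[OF pe(2), of v u] unfolding pe(1) by (rule isCont_tendsto_compose)
  moreover have "\<Psi> (level_count v p) = indicator (at_least v j) p"
   using p by (auto simp: at_least_def indicator_def n \<Psi>_def)
  ultimately show ?thesis by simp
 qed
 note * = measurable_count[OF at_least_sets 1 _ 2]
 show "(\<lambda>X. measure X (at_least v j)) \<in> borel_measurable (borel_of_topology marked_point_topology)"
  by (rule *(1)) (auto simp: \<Psi>_def)
 show "at_least v j \<subseteq> {- v - 1..} \<times> cluster_space"
  by (rule *(2)) (auto simp: \<Psi>_def)
qed

text \<open>No particle of a cluster lies above \<open>u\<close>, so a cluster with
  \<open>u < - v\<close> has none above \<open>- v\<close>.\<close>

lemma at_least_subset: "1 \<le> j \<Longrightarrow> at_least v j \<subseteq> {- v..} \<times> cluster_space"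
proof
 fix p assume j: "1 \<le> j" and p: "p \<in> at_least v j"
 then obtain u C where pe: "p = (u, C)" "C \<in> cluster_space" by (auto simp: at_least_def space_marked_borel)
 have "- v \<le> u"
 proof (rule ccontr)
  assume "\<not> - v \<le> u"
  then have "{- v - u..} \<subseteq> {0<..}" by auto
  then have "emeasure C {- v - u..} \<le> emeasure C {0<..}" using sets_cluster[OF pe(2)] by (intro emeasure_mono) auto
  then have "level_count v p = 0" using cluster_emeasure(2)[OF pe(2)] pe by (simp add: level_count_def measure_def)
  then show False using p j by (simp add: at_least_def)
 qed
 then show "p \<in> {- v..} \<times> cluster_space" using pe by simp
qed

lemma measurable_half_space:
 "(\<lambda>X. measure X ({a..} \<times> cluster_space)) \<in> borel_measurable (borel_of_topology marked_point_topology)"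
proof (rule measurable_count(1)[OF half_space_marked, where g="\<lambda>k p. ramp (- a) (real (Suc k)) (fst p)" and a="a - 1"])
 fix k :: nat
 note lf = level_fun_ramp[of "real (Suc k)" "- a"]
 show "test_fun (a - 1) (\<lambda>p. ramp (- a) (real (Suc k)) (fst p))"
  using level_funD[OF lf] by (intro test_fun_fst[where K=1]) auto
 show "\<bar>ramp (- a) (real (Suc k)) (fst p)\<bar> \<le> 1" for p :: "real \<times> real measure" by (auto simp: ramp_def)
next
 fix p :: "real \<times> real measure" assume "p \<in> space marked_borel"
 then have "indicator ({a..} \<times> cluster_space) p = (indicator {- (- a)..} (fst p) :: real)"
  by (auto simp: space_marked_borel indicator_def)
 then show "(\<lambda>k. ramp (- a) (real (Suc k)) (fst p)) \<longlonglongrightarrow> indicator ({a..} \<times> cluster_space) p"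
  using ramp_limit[of "- a" "fst p"] by simp
qed

definition above :: "(real \<times> real measure \<Rightarrow> real) \<Rightarrow> real \<Rightarrow> (real \<times> real measure) set" where
 "above f b = {p\<in>space marked_borel. b < f p}"

lemma measurable_above:
 assumes f: "test_fun a f" and b: "0 \<le> b"
 shows "(\<lambda>X. measure X (above f b)) \<in> borel_measurable (borel_of_topology marked_point_topology)"
  and "above f b \<subseteq> {a..} \<times> cluster_space" and "above f b \<in> sets marked_borel"
proof -
 show sets: "above f b \<in> sets marked_borel"
  unfolding above_def using test_fun_measurable[OF f] by measurable
 define g where "g = (\<lambda>k y. min 1 (real k * max 0 (y - b)))"
 have 1: "test_fun a (\<lambda>p. g k (f p))" for k
  using b by (intro test_fun_compose[OF f]) (auto simp: g_def intro!: continuous_intros)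
 have 2: "(\<lambda>k. g k (f p)) \<longlonglongrightarrow> indicator (above f b) p" if "p \<in> space marked_borel" for p
 proof (cases "b < f p")
  case True
  obtain N where N: "1 / (f p - b) < real N" using reals_Archimedean2 by blast
  have "g n (f p) = 1" if "N \<le> n" for n
  proof -
   have "1 / (f p - b) \<le> real n" using N that by linarith
   then show ?thesis using True by (simp add: g_def pos_divide_le_eq)
  qed
  then show ?thesis using True that by (intro tendsto_eventually) (auto simp: eventually_sequentially above_def)
 qed (simp add: g_def above_def)
 note * = measurable_count[OF sets 1 _ 2]
 have "\<bar>g k y\<bar> \<le> 1" for k y by (simp add: g_def)
 then show "(\<lambda>X. measure X (above f b)) \<in> borel_measurable (borel_of_topology marked_point_topology)"
  "above f b \<subseteq> {a..} \<times> cluster_space" using * by auto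
qed

section \<open>Counts of the limit process\<close>

definition poisson_weight :: "real \<Rightarrow> nat \<Rightarrow> real" where
 "poisson_weight l n = l ^ n / fact n * exp (- l)"

lemma poisson_weight_nonneg: "0 \<le> l \<Longrightarrow> 0 \<le> poisson_weight l n"
 by (simp add: poisson_weight_def)

lemma poisson_weight_measurable [measurable (raw)]:
 assumes [measurable]: "f \<in> borel_measurable M"
 shows "(\<lambda>x. poisson_weight (f x) n) \<in> borel_measurable M"
 unfolding poisson_weight_def by measurable

lemma poisson_weight_Suc: "real (Suc n) * poisson_weight l (Suc n) = l * poisson_weight l n"
proof -
 have "real (Suc n) \<noteq> 0" by simp
 then show ?thesis by (simp add: poisson_weight_def fact_Suc divide_simps del: of_nat_Suc)
qed

lemma poisson_sums: "poisson_weight l sums 1"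
proof -
 have "(\<lambda>n. (l ^ n /\<^sub>R fact n) * exp (- l)) sums (exp l * exp (- l))"
  by (intro sums_mult2 exp_converges)
 then show ?thesis by (simp add: poisson_weight_def[abs_def] field_simps exp_minus)
qed

lemma poisson_mean_sums: "(\<lambda>n. real n * poisson_weight l n) sums l"
proof -
 have "(\<lambda>n. real (Suc n) * poisson_weight l (Suc n)) sums (l * 1)"
  unfolding poisson_weight_Suc by (intro sums_mult poisson_sums)
 then show ?thesis by (subst (asm) sums_Suc_iff) simp
qed

text \<open>Obtained from the second factorial moment \<open>l * l\<close>, which follows from the
  mean by the index shift \<open>poisson_weight_Suc\<close>.\<close>

lemma poisson_variance_sums: "(\<lambda>n. (real n - l)\<^sup>2 * poisson_weight l n) sums l"
proof -
 have "(\<lambda>n. (real (Suc n) * real n) * poisson_weight l (Suc n)) sums (l * l)"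
 proof -
  have "(\<lambda>n. (real (Suc n) * real n) * poisson_weight l (Suc n)) = (\<lambda>n. l * (real n * poisson_weight l n))"
   using poisson_weight_Suc by (auto simp: fun_eq_iff mult.assoc mult.left_commute)
  then show ?thesis using sums_mult[OF poisson_mean_sums, of l l] by simp
 qed
 then have 2: "(\<lambda>n. (real n * (real n - 1)) * poisson_weight l n) sums (l * l)"
  using sums_Suc_iff[of "\<lambda>n. (real n * (real n - 1)) * poisson_weight l n" "l * l"] by simp
 have "(\<lambda>n. (real n * (real n - 1)) * poisson_weight l n + ((1 - 2 * l) * (real n * poisson_weight l n) + l\<^sup>2 * poisson_weight l n)) sums (l * l + ((1 - 2 * l) * l + l\<^sup>2 * 1))"
  by (intro sums_add sums_mult 2 poisson_mean_sums poisson_sums)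
 moreover have "(\<lambda>n. (real n * (real n - 1)) * poisson_weight l n + ((1 - 2 * l) * (real n * poisson_weight l n) + l\<^sup>2 * poisson_weight l n)) = (\<lambda>n. (real n - l)\<^sup>2 * poisson_weight l n)"
  by (auto simp: fun_eq_iff power2_eq_square algebra_simps)
 moreover have "l * l + ((1 - 2 * l) * l + l\<^sup>2 * 1) = l" by (simp add: power2_eq_square algebra_simps)
 ultimately show ?thesis by simp
qed

lemma poisson_chebyshev:
 assumes l: "0 \<le> l" and d: "0 < d"
 shows "(\<Sum>n. indicator {x. d < \<bar>x - l\<bar>} (real n) * ennreal (poisson_weight l n)) \<le> ennreal (l / d\<^sup>2)"
proof -
 have "(\<Sum>n. indicator {x. d < \<bar>x - l\<bar>} (real n) * ennreal (poisson_weight l n)) \<le> (\<Sum>n. ennreal ((1 / d\<^sup>2) * ((real n - l)\<^sup>2 * poisson_weight l n)))"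
 proof (rule suminf_le)
  fix n
  have "1 \<le> (1 / d\<^sup>2) * (real n - l)\<^sup>2" if "d < \<bar>real n - l\<bar>"
  proof -
   have "d\<^sup>2 \<le> \<bar>real n - l\<bar>\<^sup>2" using that d by (intro power_mono) auto
   then show ?thesis using d by (simp add: field_simps)
  qed
  then have "poisson_weight l n \<le> (1 / d\<^sup>2) * ((real n - l)\<^sup>2 * poisson_weight l n)" if "d < \<bar>real n - l\<bar>"
   using that mult_right_mono[of 1 "(1 / d\<^sup>2) * (real n - l)\<^sup>2" "poisson_weight l n"] poisson_weight_nonneg[OF l] by (simp add: mult.assoc)
  then show "indicator {x. d < \<bar>x - l\<bar>} (real n) * ennreal (poisson_weight l n) \<le> ennreal ((1 / d\<^sup>2) * ((real n - l)\<^sup>2 * poisson_weight l n))"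
   by (auto simp: indicator_def intro: ennreal_leI)
 qed auto
 also have "\<dots> = ennreal ((1 / d\<^sup>2) * l)"
 proof (rule suminf_ennreal_eq)
  show "0 \<le> (1 / d\<^sup>2) * ((real n - l)\<^sup>2 * poisson_weight l n)" for n
   using poisson_weight_nonneg[OF l] by (intro mult_nonneg_nonneg) auto
  show "(\<lambda>n. (1 / d\<^sup>2) * ((real n - l)\<^sup>2 * poisson_weight l n)) sums ((1 / d\<^sup>2) * l)"
   by (intro sums_mult poisson_variance_sums)
 qed
 finally show ?thesis by simp
qed

section \<open>The limit process under the assumptions of the theorem\<close>

locale extremal_limit = bbm M \<tau> h
 for M :: "'w measure" and \<tau> h +
 fixes r :: "real \<Rightarrow> real" and C\<^sub>0 :: real and Z :: "'w \<Rightarrow> real" and \<nu> :: "real measure measure"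
  and \<E> :: "'w \<Rightarrow> (real \<times> real measure) measure"
 assumes r_pos: "\<And>t. t \<ge> 0 \<Longrightarrow> r t > 0"
  and C\<^sub>0_pos: "C\<^sub>0 > 0"
  and Z_meas [measurable]: "Z \<in> borel_measurable M"
  and Z_lim: "AE w in M. ((\<lambda>t. deriv_mart C\<^sub>0 (\<tau> w) (h w) t) \<longlongrightarrow> Z w) at_top"
  and \<nu>_prob: "prob_space \<nu>"
  and \<nu>_sets [measurable_cong]: "sets \<nu> = sets cluster_borel"
  and \<E>_meas: "\<E> \<in> measurable M (borel_of_topology marked_point_topology)"
  and \<E>_poisson: "conditionally_poisson_process M (vimage_algebra (space M) Z borel) marked_borel
           \<E> (\<lambda>w. limit_intensity \<nu> (Z w))"
  and \<E>_lim: "weakly_converges M (prod_topology marked_point_topology euclideanreal)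
         (\<lambda>t w. (marked_process (\<tau> w) (h w) t (r t), deriv_mart C\<^sub>0 (\<tau> w) (h w) t))
         (\<lambda>w. (\<E> w, Z w))"
begin

definition intensity :: "(real \<times> real measure) measure" where
 "intensity = density lborel (\<lambda>u. eexp (- sqrt 2 * u)) \<Otimes>\<^sub>M \<nu>"

text \<open>\<open>ennreal\<close> truncates at 0, so only the positive part of \<open>Z\<close>
  enters \<open>limit_intensity\<close>. That \<open>Z\<close> is positive almost surely is shown
  only in \<open>Z_pos\<close>.\<close>

definition Zp :: "'w \<Rightarrow> real" where "Zp w = max 0 (Z w)"

lemma Zp_measurable [measurable]: "Zp \<in> borel_measurable M"
 unfolding Zp_def[abs_def] by measurable

lemma Zp_nonneg [simp]: "0 \<le> Zp w" by (simp add: Zp_def)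

sublocale \<nu>: prob_space \<nu> by (rule \<nu>_prob)

lemma space_\<nu>: "space \<nu> = cluster_space"
 using sets_eq_imp_space_eq[OF \<nu>_sets] by (simp add: space_cluster_borel)

lemma sets_intensity [measurable_cong]: "sets intensity = sets marked_borel"
 unfolding intensity_def marked_borel_def by (intro sets_pair_measure_cong) (auto simp: \<nu>_sets)

lemma space_intensity: "space intensity = UNIV \<times> cluster_space"
 using sets_eq_imp_space_eq[OF sets_intensity] by (simp add: space_marked_borel)

lemma nn_integral_intensity:
 assumes f: "f \<in> borel_measurable marked_borel"
 shows "(\<integral>\<^sup>+p. f p \<partial>intensity) = (\<integral>\<^sup>+C. LEB u. eexp (- sqrt 2 * u) * f (u, C) \<partial>\<nu>)"
proof -
 let ?L = "density lborel (\<lambda>u. eexp (- sqrt 2 * u))"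
 interpret L: sigma_finite_measure ?L
  by (subst sigma_finite_measure.sigma_finite_iff_density_finite[OF sigma_finite_lborel]) auto
 interpret P: pair_sigma_finite ?L \<nu> ..
 have f': "case_prod (\<lambda>u C. f (u, C)) \<in> borel_measurable (?L \<Otimes>\<^sub>M \<nu>)"
  using f unfolding measurable_cong_sets[OF sets_intensity[unfolded intensity_def] refl] by simp
 have "(\<integral>\<^sup>+p. f p \<partial>intensity) = (\<integral>\<^sup>+C. \<integral>\<^sup>+u. f (u, C) \<partial>?L \<partial>\<nu>)"
  unfolding intensity_def using P.nn_integral_snd[OF f'] by simp
 also have "\<dots> = (\<integral>\<^sup>+C. LEB u. eexp (- sqrt 2 * u) * f (u, C) \<partial>\<nu>)"
 proof (intro nn_integral_cong)
  fix C assume "C \<in> space \<nu>"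
  then have "(\<lambda>u. f (u, C)) \<in> borel_measurable lborel"
   using f by (intro measurable_compose[OF _ f]) (auto simp: marked_borel_def space_\<nu> space_cluster_borel intro!: measurable_Pair)
  then show "(\<integral>\<^sup>+u. f (u, C) \<partial>?L) = (LEB u. eexp (- sqrt 2 * u) * f (u, C))"
   by (subst nn_integral_density) auto
 qed
 finally show ?thesis .
qed

lemma exp_tail: "(LEB u. eexp (- sqrt 2 * u) * indicator {a..} u) = ennreal (exp (- sqrt 2 * a) / sqrt 2)"
proof -
 have "(LEB u. eexp (- sqrt 2 * u) * indicator {a..} u) = ennreal (0 - (- exp (- sqrt 2 * a) / sqrt 2))"
 proof (rule nn_integral_FTC_atLeast)
  show "((\<lambda>u. - exp (- sqrt 2 * u) / sqrt 2) has_real_derivative exp (- sqrt 2 * x)) (at x)" for x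
   by (rule derivative_eq_intros refl | simp)+
  have "((\<lambda>u. - (exp (- sqrt 2 * u)) / sqrt 2) \<longlongrightarrow> - 0 / sqrt 2) at_top"
   by (intro tendsto_intros) (real_asymp, simp)
  then show "((\<lambda>u. - exp (- sqrt 2 * u) / sqrt 2) \<longlongrightarrow> 0) at_top" by simp
 qed auto
 then show ?thesis by simp
qed

lemma intensity_half_space: "emeasure intensity ({a..} \<times> cluster_space) = ennreal (exp (- sqrt 2 * a) / sqrt 2)"
proof -
 have "emeasure intensity ({a..} \<times> cluster_space) = (\<integral>\<^sup>+p. indicator ({a..} \<times> cluster_space) p \<partial>intensity)"
  using sets_intensity by simp
 also have "\<dots> = (\<integral>\<^sup>+C. LEB u. eexp (- sqrt 2 * u) * indicator ({a..} \<times> cluster_space) (u, C) \<partial>\<nu>)"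
  by (rule nn_integral_intensity) simp
 also have "\<dots> = (\<integral>\<^sup>+C. ennreal (exp (- sqrt 2 * a) / sqrt 2) \<partial>\<nu>)"
 proof (intro nn_integral_cong)
  fix C assume "C \<in> space \<nu>"
  then have "(LEB u. eexp (- sqrt 2 * u) * indicator ({a..} \<times> cluster_space) (u, C)) = (LEB u. eexp (- sqrt 2 * u) * indicator {a..} u)"
   by (intro nn_integral_cong) (auto simp: indicator_def space_\<nu>)
  then show "(LEB u. eexp (- sqrt 2 * u) * indicator ({a..} \<times> cluster_space) (u, C)) = ennreal (exp (- sqrt 2 * a) / sqrt 2)"
   by (simp only: exp_tail)
 qed
 also have "\<dots> = ennreal (exp (- sqrt 2 * a) / sqrt 2)" by (simp add: \<nu>.emeasure_space_1)
 finally show ?thesis .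
qed

lemma limit_intensity_eq: "limit_intensity \<nu> (Z w) = scale_measure (ennreal (Zp w)) intensity"
 by (simp add: limit_intensity_def intensity_def Zp_def ennreal_max_0 max.commute)

lemma \<E>_marked: "w \<in> space M \<Longrightarrow> \<E> w \<in> marked_point_space"
 using measurable_space[OF \<E>_meas] by (simp add: space_borel_of_topology topspace_marked)

text \<open>Not countability in the sense of cardinals: a set bounded from below in height, whose
  number of points is a measurable functional of the point measure.\<close>

definition countable_set :: "real \<Rightarrow> (real \<times> real measure) set \<Rightarrow> bool" where
 "countable_set a A \<longleftrightarrow> A \<in> sets marked_borel \<and> A \<subseteq> {a..} \<times> cluster_space \<and>
   (\<lambda>X. measure X A) \<in> borel_measurable (borel_of_topology marked_point_topology)"

lemma countable_setD:
 assumes "countable_set a A"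
 shows "A \<in> sets marked_borel" "A \<subseteq> {a..} \<times> cluster_space" "(\<lambda>w. measure (\<E> w) A) \<in> borel_measurable M"
 using assms measurable_compose[OF \<E>_meas, of "\<lambda>X. measure X A"] by (auto simp: countable_set_def)

lemma countable_set_finite:
 assumes "countable_set a A" shows "emeasure intensity A < \<infinity>"
proof -
 have "emeasure intensity A \<le> emeasure intensity ({a..} \<times> cluster_space)"
  using countable_setD[OF assms] sets_intensity by (intro emeasure_mono) auto
 then show ?thesis unfolding intensity_half_space by (rule le_less_trans) simp
qed

lemma count_nat:
 assumes "countable_set a A" "w \<in> space M"
 obtains n :: nat where "emeasure (\<E> w) A = of_nat n" "measure (\<E> w) A = real n"
proof -
 obtain n :: nat where n: "emeasure (\<E> w) A = of_nat n"
  using marked_point_emeasure[OF \<E>_marked[OF assms(2)] countable_setD(1,2)[OF assms(1)]] by auto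
 then show ?thesis using that[of n] by (simp add: measure_def)
qed

lemma subalgebra_Z: "sigma_finite_subalgebra M (vimage_algebra (space M) Z borel)"
proof -
 have "subalgebra M (vimage_algebra (space M) Z borel)"
  unfolding subalgebra_def using measurable_sets[OF Z_meas] by (auto simp: sets_vimage_algebra2)
 then show ?thesis by (intro finite_measure_subalgebra_is_sigma_finite finite_measure_subalgebra.intro finite_measure_axioms finite_measure_subalgebra_axioms.intro)
qed

text \<open>The conditional Poisson law of a single count, recast as equality of two weighted laws
  of \<open>Z\<close>. In this form it integrates arbitrary functions of \<open>Z\<close>, and
  conditional expectations disappear.\<close>

lemma count_law_single:
 assumes A: "countable_set a A" and F [measurable]: "F \<in> borel_measurable borel"
 shows "(\<integral>\<^sup>+w. F (Z w) * indicator {x. x = real n} (measure (\<E> w) A) \<partial>M) =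
  (\<integral>\<^sup>+w. F (Z w) * ennreal (poisson_weight (Zp w * measure intensity A) n) \<partial>M)"
proof -
 let ?G = "vimage_algebra (space M) Z borel"
 interpret S: sigma_finite_subalgebra M ?G by (rule subalgebra_Z)
 note [measurable] = countable_setD(3)[OF A]
 define l where "l = measure intensity A"
 have l: "0 \<le> l" by (simp add: l_def)
 define Y where "Y = {w\<in>space M. measure (\<E> w) A = real n}"
 have Y [measurable]: "Y \<in> sets M" unfolding Y_def by measurable
 have Y': "Y = {w\<in>space M. \<forall>i<1. emeasure (\<E> w) ((\<lambda>_. A) i) = of_nat ((\<lambda>_. n) (i :: nat))}"
  unfolding Y_def
  by (intro Collect_cong conj_cong refl) (auto elim!: count_nat[OF A])
 have fin: "emeasure (limit_intensity \<nu> (Z w)) A < \<infinity>" for w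
  using countable_set_finite[OF A] countable_setD(1)[OF A] sets_intensity
  by (simp add: limit_intensity_eq ennreal_mult_less_top)
 have ms: "measure (limit_intensity \<nu> (Z w)) A = Zp w * l" for w
  using countable_setD(1)[OF A] sets_intensity
  by (simp add: limit_intensity_eq measure_def enn2real_mult l_def)
 have "AE w in M. (\<forall>i<1::nat. emeasure (limit_intensity \<nu> (Z w)) A < \<infinity>) \<longrightarrow>
    real_cond_exp M ?G (indicator Y) w =
    (\<Prod>i<1::nat. measure (limit_intensity \<nu> (Z w)) A ^ n / fact n * exp (- measure (limit_intensity \<nu> (Z w)) A))"
  unfolding Y' using \<E>_poisson[unfolded conditionally_poisson_process_def, rule_format, of 1 "\<lambda>_. A" "\<lambda>_. n"] countable_setD(1)[OF A]
  by (simp add: disjoint_family_on_def)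
 then have ae: "AE w in M. real_cond_exp M ?G (indicator Y) w = poisson_weight (Zp w * l) n"
  using fin by (simp add: ms poisson_weight_def)
 have pw: "0 \<le> poisson_weight (Zp w * l) n" "poisson_weight (Zp w * l) n \<le> 1" for w
 proof -
  show 0: "0 \<le> poisson_weight (Zp w * l) n" using l by (intro poisson_weight_nonneg) auto
  have "sum (poisson_weight (Zp w * l)) {n} \<le> 1"
   using l poisson_sums[of "Zp w * l"] sum_le_suminf[of "poisson_weight (Zp w * l)" "{n}"]
   by (auto simp: sums_iff poisson_weight_nonneg)
  then show "poisson_weight (Zp w * l) n \<le> 1" by simp
 qed
 have iY: "integrable M (indicator Y :: 'w \<Rightarrow> real)" by (intro integrable_real_indicator) (auto simp: emeasure_eq_measure)
 define \<mu>1 where "\<mu>1 = distr (density M (\<lambda>w. indicator {x. x = real n} (measure (\<E> w) A))) borel Z"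
 define \<mu>2 where "\<mu>2 = distr (density M (\<lambda>w. ennreal (poisson_weight (Zp w * l) n))) borel Z"
 have "\<mu>1 = \<mu>2"
 proof (rule measure_eqI)
  fix B assume "B \<in> sets \<mu>1"
  then have B [measurable]: "B \<in> sets borel" by (simp add: \<mu>1_def)
  define B' where "B' = Z -` B \<inter> space M"
  have B': "B' \<in> sets ?G" unfolding B'_def using B by (intro in_vimage_algebra)
  have B'm [measurable]: "B' \<in> sets M" unfolding B'_def by measurable
  have "emeasure \<mu>1 B = (\<integral>\<^sup>+w. ennreal (indicator B' w * indicator Y w) \<partial>M)"
   unfolding \<mu>1_def by (subst emeasure_distr, simp, simp, subst emeasure_density)
    (auto intro!: nn_integral_cong simp: indicator_def B'_def Y_def)
  also have "\<dots> = ennreal (LINT w|M. indicator B' w * indicator Y w)"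
   by (intro nn_integral_eq_integral integrable_bounded) (auto simp: indicator_def)
  also have "(LINT w|M. indicator B' w * indicator Y w) = (LINT w|M. indicator B' w * real_cond_exp M ?G (indicator Y) w)"
   using S.real_cond_exp_intA[OF iY B'] by (simp add: set_lebesgue_integral_def)
  also have "\<dots> = (LINT w|M. indicator B' w * poisson_weight (Zp w * l) n)"
   by (intro integral_cong_AE) (use ae in \<open>auto elim!: eventually_mono\<close>)
  also have "ennreal \<dots> = (\<integral>\<^sup>+w. ennreal (indicator B' w * poisson_weight (Zp w * l) n) \<partial>M)"
   using pw by (intro nn_integral_eq_integral[symmetric] integrable_bounded) (auto simp: indicator_def)
  also have "\<dots> = emeasure \<mu>2 B"
   unfolding \<mu>2_def by (subst emeasure_distr, simp, simp, subst emeasure_density)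
    (auto intro!: nn_integral_cong simp: indicator_def B'_def)
  finally show "emeasure \<mu>1 B = emeasure \<mu>2 B" .
 qed (simp add: \<mu>1_def \<mu>2_def)
 then have "(\<integral>\<^sup>+x. F x \<partial>\<mu>1) = (\<integral>\<^sup>+x. F x \<partial>\<mu>2)" by simp
 then show ?thesis
  unfolding \<mu>1_def \<mu>2_def l_def[symmetric]
  by (simp add: nn_integral_distr nn_integral_density mult.commute)
qed

lemma count_law:
 assumes A: "countable_set a A" and F [measurable]: "\<And>n. F n \<in> borel_measurable borel"
 shows "(\<integral>\<^sup>+w. F (nat \<lfloor>measure (\<E> w) A\<rfloor>) (Z w) \<partial>M) =
  (\<integral>\<^sup>+w. (\<Sum>n. F n (Z w) * ennreal (poisson_weight (Zp w * measure intensity A) n)) \<partial>M)"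
proof -
 note [measurable] = countable_setD(3)[OF A]
 have "(\<integral>\<^sup>+w. F (nat \<lfloor>measure (\<E> w) A\<rfloor>) (Z w) \<partial>M) = (\<integral>\<^sup>+w. (\<Sum>n. F n (Z w) * indicator {x. x = real n} (measure (\<E> w) A)) \<partial>M)"
 proof (intro nn_integral_cong)
  fix w assume "w \<in> space M"
  then obtain m :: nat where m: "measure (\<E> w) A = real m" by (rule count_nat[OF A])
  have "(\<Sum>n. F n (Z w) * indicator {x. x = real n} (measure (\<E> w) A)) = (\<Sum>n\<in>{m}. F n (Z w) * indicator {x. x = real n} (measure (\<E> w) A))"
   by (intro suminf_finite) (auto simp: m indicator_def)
  then show "F (nat \<lfloor>measure (\<E> w) A\<rfloor>) (Z w) = (\<Sum>n. F n (Z w) * indicator {x. x = real n} (measure (\<E> w) A))"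
   by (simp add: m)
 qed
 also have "\<dots> = (\<Sum>n. \<integral>\<^sup>+w. F n (Z w) * indicator {x. x = real n} (measure (\<E> w) A) \<partial>M)"
  by (rule nn_integral_suminf) measurable
 also have "\<dots> = (\<Sum>n. \<integral>\<^sup>+w. F n (Z w) * ennreal (poisson_weight (Zp w * measure intensity A) n) \<partial>M)"
  by (subst count_law_single[OF A F]) simp
 also have "\<dots> = (\<integral>\<^sup>+w. (\<Sum>n. F n (Z w) * ennreal (poisson_weight (Zp w * measure intensity A) n)) \<partial>M)"
  by (rule nn_integral_suminf[symmetric]) measurable
 finally show ?thesis .
qed

end

context extremal_limit
begin

lemma countable_at_least: "1 \<le> j \<Longrightarrow> countable_set (- v - 1) (at_least v j)"
 unfolding countable_set_def using measurable_at_least by auto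

lemma countable_half_space: "countable_set a ({a..} \<times> cluster_space)"
 unfolding countable_set_def using measurable_half_space by auto

lemma countable_above: "test_fun a f \<Longrightarrow> 0 \<le> b \<Longrightarrow> countable_set a (above f b)"
 unfolding countable_set_def using measurable_above by auto

lemma void_probability:
 assumes A: "countable_set a A"
 shows "prob {w\<in>space M. measure (\<E> w) A = 0} = (LINT w|M. exp (- (Zp w * measure intensity A)))"
proof -
 note [measurable] = countable_setD(3)[OF A]
 have "ennreal (prob {w\<in>space M. measure (\<E> w) A = 0}) = (\<integral>\<^sup>+w. indicator {w\<in>space M. measure (\<E> w) A = 0} w \<partial>M)"
  by (simp add: emeasure_eq_measure)
 also have "\<dots> = (\<integral>\<^sup>+w. 1 * indicator {x. x = real 0} (measure (\<E> w) A) \<partial>M)"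
  by (intro nn_integral_cong) (auto simp: indicator_def)
 also have "\<dots> = (\<integral>\<^sup>+w. 1 * ennreal (poisson_weight (Zp w * measure intensity A) 0) \<partial>M)"
  using count_law_single[OF A, of "\<lambda>_. 1" 0] by simp
 also have "\<dots> = (\<integral>\<^sup>+w. eexp (- (Zp w * measure intensity A)) \<partial>M)"
  by (simp add: poisson_weight_def)
 also have "\<dots> = ennreal (LINT w|M. exp (- (Zp w * measure intensity A)))"
  by (intro nn_integral_eq_integral integrable_bounded) auto
 finally show ?thesis by (simp add: integral_nonneg)
qed

text \<open>The restriction to \<open>Z \<le> K\<close> stands in for an integrability condition on
  \<open>Z\<close>.\<close>

lemma count_mean_le:
 assumes A: "countable_set a A" and K: "0 \<le> K"
 shows "(\<integral>\<^sup>+w. indicator {..K} (Z w) * ennreal (measure (\<E> w) A) \<partial>M) \<le> ennreal K * emeasure intensity A"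
proof -
 define l where "l = measure intensity A"
 have l: "0 \<le> l" "emeasure intensity A = ennreal l"
  using countable_set_finite[OF A] by (auto simp: l_def emeasure_eq_ennreal_measure)
 let ?F = "\<lambda>n z. indicator {..K} z * ennreal (real n)"
 have "(\<integral>\<^sup>+w. indicator {..K} (Z w) * ennreal (measure (\<E> w) A) \<partial>M) = (\<integral>\<^sup>+w. ?F (nat \<lfloor>measure (\<E> w) A\<rfloor>) (Z w) \<partial>M)"
  by (intro nn_integral_cong) (auto elim!: count_nat[OF A])
 also have "\<dots> = (\<integral>\<^sup>+w. (\<Sum>n. ?F n (Z w) * ennreal (poisson_weight (Zp w * l) n)) \<partial>M)"
  unfolding l_def by (rule count_law[OF A]) measurable
 also have "\<dots> \<le> (\<integral>\<^sup>+w. ennreal (K * l) \<partial>M)"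
 proof (intro nn_integral_mono)
  fix w
  have s: "(\<Sum>n. ennreal (real n) * ennreal (poisson_weight (Zp w * l) n)) = ennreal (Zp w * l)"
   using l by (subst ennreal_mult[symmetric])
    (auto intro!: suminf_ennreal_eq poisson_mean_sums mult_nonneg_nonneg poisson_weight_nonneg)
  show "(\<Sum>n. ?F n (Z w) * ennreal (poisson_weight (Zp w * l) n)) \<le> ennreal (K * l)"
  proof (cases "Z w \<le> K")
   case True
   then have "Zp w * l \<le> K * l" using K l by (intro mult_right_mono) (auto simp: Zp_def)
   then show ?thesis using True s by (simp add: ennreal_leI)
  qed simp
 qed
 also have "\<dots> = ennreal K * emeasure intensity A"
  using K l by (simp add: emeasure_space_1 ennreal_mult)
 finally show ?thesis .
qed

text \<open>Only counts of single sets are available, so \<open>f\<close> is rounded up to a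
  multiple of \<open>1 / m\<close>, a sum over the layers \<open>above f (j / m)\<close>. The
  rounding error lives on \<open>above f 0\<close>, which has finite intensity.\<close>

lemma campbell_le:
 assumes f: "test_fun a f" and f01: "\<And>p. 0 \<le> f p" "\<And>p. f p \<le> 1" and K: "0 \<le> K"
 shows "(\<integral>\<^sup>+w. indicator {..K} (Z w) * (\<integral>\<^sup>+p. ennreal (f p) \<partial>\<E> w) \<partial>M) \<le> ennreal K * (\<integral>\<^sup>+p. ennreal (f p) \<partial>intensity)"
proof (rule ennreal_le_epsilon)
 fix e :: real assume e: "0 < e"
 let ?c = "emeasure intensity (above f 0)" and ?f = "\<integral>\<^sup>+p. ennreal (f p) \<partial>intensity"
 have cA: "countable_set a (above f b)" if "0 \<le> b" for b by (rule countable_above[OF f that])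
 obtain c where c: "0 \<le> c" "?c = ennreal c" using countable_set_finite[OF cA, of 0] by (cases ?c) auto
 \<comment> \<open>Chosen such that the total rounding error \<open>K * c / m\<close> stays below
   \<open>e\<close>.\<close>
 obtain m :: nat where m: "K * c / e < m" using reals_Archimedean2 by auto
 have "0 \<le> K * c / e" using K c e by simp
 then have m0: "0 < m" using m by linarith
 let ?A = "\<lambda>j. above f (real j / real m)"
 define s where "s p = (\<Sum>j<m. ennreal (1 / m) * indicator (?A j) p)" for p
 note cs = cA[of "real j / real m" for j, simplified]
 note [measurable] = cs[THEN countable_setD(1)] cs[THEN countable_setD(3)]
 have s_eq: "s p = ennreal (real_of_int \<lceil>m * f p\<rceil> / m)" if p: "p \<in> space marked_borel" for p
 proof -
  have "real m * f p \<le> real m * 1" using f01 by (intro mult_left_mono) auto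
  then have "j < m \<and> real j < m * f p \<longleftrightarrow> j < nat \<lceil>m * f p\<rceil>" for j by linarith
  then have "{j\<in>{..<m}. real j < m * f p} = {..<nat \<lceil>m * f p\<rceil>}" unfolding set_eq_iff by simp
  moreover have "s p = (\<Sum>j<m. ennreal (if real j < m * f p then 1 / m else 0))"
   unfolding s_def using p m0 by (intro sum.cong refl) (auto simp: above_def field_simps)
  ultimately show ?thesis using f01[of p] by (simp add: sum_ennreal sum.inter_filter[symmetric] of_nat_nat)
 qed
 have sI: "(\<integral>\<^sup>+p. s p \<partial>X) = (\<Sum>j<m. ennreal (1 / m) * emeasure X (?A j))" if X: "sets X = sets marked_borel" for X
 proof -
  have [measurable]: "?A j \<in> sets X" for j unfolding X by simp
  show ?thesis unfolding s_def by (subst nn_integral_sum) (auto simp: nn_integral_cmult_indicator)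
 qed
 have "(\<integral>\<^sup>+w. indicator {..K} (Z w) * (\<integral>\<^sup>+p. ennreal (f p) \<partial>\<E> w) \<partial>M) \<le>
  (\<integral>\<^sup>+w. (\<Sum>j<m. ennreal (1 / m) * (indicator {..K} (Z w) * ennreal (measure (\<E> w) (?A j)))) \<partial>M)"
 proof (intro nn_integral_mono)
  fix w assume w: "w \<in> space M"
  note X = \<E>_marked[OF w]
  have "(\<integral>\<^sup>+p. ennreal (f p) \<partial>\<E> w) \<le> (\<integral>\<^sup>+p. s p \<partial>\<E> w)"
   using m0 by (intro nn_integral_mono) (auto simp: space_marked_point[OF X] space_marked_borel s_eq field_simps intro!: ennreal_leI)
  moreover have "emeasure (\<E> w) (?A j) = ennreal (measure (\<E> w) (?A j))" for j
   by (rule count_nat[OF cs[of j] w]) (simp add: ennreal_of_nat_eq_real_of_nat)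
  ultimately show "indicator {..K} (Z w) * (\<integral>\<^sup>+p. ennreal (f p) \<partial>\<E> w) \<le>
   (\<Sum>j<m. ennreal (1 / m) * (indicator {..K} (Z w) * ennreal (measure (\<E> w) (?A j))))"
   unfolding sI[OF sets_marked_point[OF X]] by (simp add: indicator_def)
 qed
 also have "\<dots> = (\<Sum>j<m. ennreal (1 / m) * (\<integral>\<^sup>+w. indicator {..K} (Z w) * ennreal (measure (\<E> w) (?A j)) \<partial>M))"
  by (subst nn_integral_sum) (auto simp: nn_integral_cmult)
 also have "\<dots> \<le> (\<Sum>j<m. ennreal (1 / m) * (ennreal K * emeasure intensity (?A j)))"
  by (intro sum_mono mult_left_mono count_mean_le[OF cs K]) auto
 also have "\<dots> = ennreal K * (\<integral>\<^sup>+p. s p \<partial>intensity)"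
  unfolding sI[OF sets_intensity] by (simp add: sum_distrib_left mult.left_commute)
 also have "\<dots> \<le> ennreal K * (\<integral>\<^sup>+p. ennreal (f p) + ennreal (1 / m) * indicator (above f 0) p \<partial>intensity)"
 proof (intro mult_left_mono nn_integral_mono)
  fix p assume p: "p \<in> space intensity"
  have "real_of_int \<lceil>m * f p\<rceil> / m \<le> f p + 1 / m * (if 0 < f p then 1 else 0)"
  proof (cases "0 < f p")
   case True
   have "real_of_int \<lceil>m * f p\<rceil> \<le> m * f p + 1" by linarith
   then show ?thesis using m0 True by (simp add: field_simps)
  next
   case False
   then have "f p = 0" using f01(1)[of p] by simp
   then show ?thesis by simp
  qed
  moreover have p': "p \<in> space marked_borel" using p by (simp add: space_intensity space_marked_borel)
  then have "(indicator (above f 0) p :: ennreal) = ennreal (if 0 < f p then 1 else 0)" by (simp add: above_def)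
  ultimately show "s p \<le> ennreal (f p) + ennreal (1 / m) * indicator (above f 0) p"
   using f01[of p] by (simp add: s_eq[OF p'] ennreal_mult[symmetric] ennreal_plus[symmetric] ennreal_leI del: ennreal_plus)
 qed simp
 also have "\<dots> = ennreal K * (?f + ennreal (1 / m) * ennreal c)"
  using test_fun_measurable[OF f] cA[of 0, THEN countable_setD(1)] unfolding c(2)[symmetric]
  by (subst nn_integral_add) (auto simp: nn_integral_cmult_indicator sets_intensity measurable_cong_sets[OF sets_intensity refl])
 also have "\<dots> = ennreal K * ?f + ennreal (K * c / m)"
  using K c by (simp add: distrib_left ennreal_mult[symmetric])
 also have "\<dots> \<le> ennreal K * ?f + ennreal e"
  using m m0 e by (intro add_left_mono ennreal_leI) (simp add: field_simps)
 finally show "(\<integral>\<^sup>+w. indicator {..K} (Z w) * (\<integral>\<^sup>+p. ennreal (f p) \<partial>\<E> w) \<partial>M) \<le> ennreal K * ?f + ennreal e" .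
qed

text \<open>Translation multiplies the exponential density by a constant, and the cluster law does
  not depend on the height. All rates at level \<open>- v\<close> thus scale by the same
  factor.\<close>

lemma intensity_shift:
 assumes A: "A \<in> sets marked_borel" "B \<in> sets marked_borel"
  and AB: "\<And>u C. C \<in> cluster_space \<Longrightarrow> (u, C) \<in> A \<longleftrightarrow> (u + v, C) \<in> B"
 shows "emeasure intensity A = eexp (sqrt 2 * v) * emeasure intensity B"
proof -
 have e: "emeasure intensity D = (\<integral>\<^sup>+C. LEB u. eexp (- sqrt 2 * u) * indicator D (u, C) \<partial>\<nu>)" if "D \<in> sets marked_borel" for D
  using nn_integral_intensity[of "indicator D"] that sets_intensity by simp
 have sec: "(\<lambda>u. indicator B (u, C) :: ennreal) \<in> borel_measurable borel" if "C \<in> cluster_space" for C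
  using that A by (intro measurable_compose[OF _ borel_measurable_indicator[OF A(2)]])
   (auto simp: marked_borel_def space_cluster_borel intro!: measurable_Pair)
 have "emeasure intensity A = (\<integral>\<^sup>+C. eexp (sqrt 2 * v) * (LEB u. eexp (- sqrt 2 * u) * indicator B (u, C)) \<partial>\<nu>)"
  unfolding e[OF A(1)]
 proof (intro nn_integral_cong)
  fix C assume "C \<in> space \<nu>"
  then have C: "C \<in> cluster_space" by (simp add: space_\<nu>)
  note [measurable] = sec[OF C]
  have "(LEB u. eexp (- sqrt 2 * u) * indicator B (u, C)) =
   (LEB u. eexp (- sqrt 2 * (v + u)) * indicator B (v + u, C))"
   by (subst nn_integral_real_affine[where c=1 and t=v]) auto
  also have "\<dots> = (LEB u. eexp (- sqrt 2 * v) * (eexp (- sqrt 2 * u) * indicator A (u, C)))"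
  proof (intro nn_integral_cong)
   fix u
   have "eexp (- sqrt 2 * (v + u)) = eexp (- sqrt 2 * v) * eexp (- sqrt 2 * u)"
    by (simp add: ennreal_mult[symmetric] exp_add[symmetric] distrib_left)
   moreover have "indicator B (v + u, C) = (indicator A (u, C) :: ennreal)"
    using AB[OF C, of u] by (simp add: indicator_def add.commute)
   ultimately show "eexp (- sqrt 2 * (v + u)) * indicator B (v + u, C) = eexp (- sqrt 2 * v) * (eexp (- sqrt 2 * u) * indicator A (u, C))"
    by (simp only: mult.assoc)
  qed
  also have "\<dots> = eexp (- sqrt 2 * v) * (LEB u. eexp (- sqrt 2 * u) * indicator A (u, C))"
  proof (rule nn_integral_cmult)
   have "(\<lambda>u. indicator A (u, C) :: ennreal) \<in> borel_measurable borel"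
    using C by (intro measurable_compose[OF _ borel_measurable_indicator[OF A(1)]])
     (auto simp: marked_borel_def space_cluster_borel intro!: measurable_Pair)
   then show "(\<lambda>u. eexp (- sqrt 2 * u) * indicator A (u, C)) \<in> borel_measurable lborel" by measurable
  qed
  finally have "(LEB u. eexp (- sqrt 2 * u) * indicator B (u, C)) = eexp (- sqrt 2 * v) * (LEB u. eexp (- sqrt 2 * u) * indicator A (u, C))" .
  moreover have "eexp (sqrt 2 * v) * eexp (- sqrt 2 * v) = 1" by (simp add: ennreal_mult[symmetric] exp_add[symmetric])
  ultimately show "(LEB u. eexp (- sqrt 2 * u) * indicator A (u, C)) =
   eexp (sqrt 2 * v) * (LEB u. eexp (- sqrt 2 * u) * indicator B (u, C))"
   by (simp only: mult.assoc[symmetric] mult_1)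
 qed
 also have "\<dots> = eexp (sqrt 2 * v) * emeasure intensity B"
  unfolding e[OF A(2)]
 proof (rule nn_integral_cmult)
  have "(\<lambda>p. eexp (- sqrt 2 * snd p) * indicator B (snd p, fst p)) \<in> borel_measurable (\<nu> \<Otimes>\<^sub>M lborel)"
  proof -
   have "(\<lambda>p. (snd p, fst p)) \<in> measurable (\<nu> \<Otimes>\<^sub>M lborel) (borel \<Otimes>\<^sub>M cluster_borel)"
    using measurable_cong_sets[OF \<nu>_sets refl] by (intro measurable_Pair) (auto simp: measurable_ident_sets[OF \<nu>_sets] intro: measurable_compose[OF measurable_fst])
   then have "(\<lambda>p. indicator B (snd p, fst p) :: ennreal) \<in> borel_measurable (\<nu> \<Otimes>\<^sub>M lborel)"
    by (rule measurable_compose) (use A(2) in \<open>simp add: marked_borel_def\<close>)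
   then show ?thesis by measurable
  qed
  from sigma_finite_measure.borel_measurable_nn_integral_fst[OF sigma_finite_lborel this]
  show "(\<lambda>C. \<integral>\<^sup>+u. eexp (- sqrt 2 * u) * indicator B (u, C) \<partial>lborel) \<in> borel_measurable \<nu>" by simp
 qed
 finally show ?thesis .
qed

end

section \<open>Means of sums over clusters\<close>

lemma cluster_sigma_finite:
 assumes C: "C \<in> cluster_space" shows "sigma_finite_measure C"
proof
 have "(\<Union>n :: nat. {- real n..}) = UNIV"
 proof (intro set_eqI iffI UNIV_I)
  fix x :: real
  obtain n where "- x \<le> real n" using real_arch_simple by blast
  then show "x \<in> (\<Union>n :: nat. {- real n..})" by (auto intro!: exI[of _ n])
 qed
 then show "\<exists>A. countable A \<and> A \<subseteq> sets C \<and> \<Union> A = space C \<and> (\<forall>a\<in>A. emeasure C a \<noteq> \<infinity>)"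
  using cluster_emeasure(1)[OF C] sets_cluster[OF C] space_cluster[OF C]
  by (intro exI[of _ "range (\<lambda>n :: nat. {- real n..})"]) auto
qed

text \<open>Each particle \<open>x\<close> of the cluster is followed at its own level
  \<open>z = u + x\<close>. The exponential density then factorises, and the cluster enters only
  through its exponential moment.\<close>

lemma cluster_exp_integral:
 assumes C: "C \<in> cluster_space" and [measurable]: "\<psi> \<in> borel_measurable borel"
 shows "(LEB u. eexp (- sqrt 2 * u) * (\<integral>\<^sup>+x. \<psi> (u + x) \<partial>C)) =
  (LEB z. eexp (- sqrt 2 * z) * \<psi> z) * (\<integral>\<^sup>+x. eexp (sqrt 2 * x) \<partial>C)"
proof -
 note [measurable_cong] = sets_cluster[OF C]
 interpret C: sigma_finite_measure C by (rule cluster_sigma_finite[OF C])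
 interpret LC: pair_sigma_finite C lborel ..
 have "(LEB u. eexp (- sqrt 2 * u) * (\<integral>\<^sup>+x. \<psi> (u + x) \<partial>C)) =
  (LEB u. \<integral>\<^sup>+x. eexp (- sqrt 2 * u) * \<psi> (u + x) \<partial>C)"
  by (simp add: nn_integral_cmult)
 also have "\<dots> = (\<integral>\<^sup>+x. LEB u. eexp (- sqrt 2 * u) * \<psi> (u + x) \<partial>C)"
  by (rule LC.Fubini') measurable
 also have "\<dots> = (\<integral>\<^sup>+x. (LEB z. eexp (- sqrt 2 * z) * \<psi> z) * eexp (sqrt 2 * x) \<partial>C)"
 proof (intro nn_integral_cong)
  fix x
  have "(LEB u. eexp (- sqrt 2 * u) * \<psi> (u + x)) =
   (LEB z. eexp (- sqrt 2 * (- x + z)) * \<psi> z)"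
   by (subst nn_integral_real_affine[where c=1 and t="- x"]) auto
  also have "\<dots> = (LEB z. eexp (- sqrt 2 * z) * \<psi> z * eexp (sqrt 2 * x))"
  proof (intro nn_integral_cong)
   fix z
   have "eexp (- sqrt 2 * (- x + z)) = eexp (- sqrt 2 * z) * eexp (sqrt 2 * x)"
    by (simp add: ennreal_mult[symmetric] exp_add[symmetric] algebra_simps)
   then show "eexp (- sqrt 2 * (- x + z)) * \<psi> z = eexp (- sqrt 2 * z) * \<psi> z * eexp (sqrt 2 * x)"
    by (simp only: ac_simps)
  qed
  also have "\<dots> = (LEB z. eexp (- sqrt 2 * z) * \<psi> z) * eexp (sqrt 2 * x)"
   by (rule nn_integral_multc) measurable
  finally show "(LEB u. eexp (- sqrt 2 * u) * \<psi> (u + x)) = (LEB z. eexp (- sqrt 2 * z) * \<psi> z) * eexp (sqrt 2 * x)" .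
 qed
 also have "\<dots> = (LEB z. eexp (- sqrt 2 * z) * \<psi> z) * (\<integral>\<^sup>+x. eexp (sqrt 2 * x) \<partial>C)"
  by (rule nn_integral_cmult) measurable
 finally show ?thesis .
qed

lemma tendsto_probI:
 fixes f :: "real \<Rightarrow> real"
 assumes "\<And>v. f v \<le> 1" "\<And>e. 0 < e \<Longrightarrow> \<forall>\<^sub>F v in at_top. 1 - e \<le> f v"
 shows "(f \<longlongrightarrow> 1) at_top"
proof (rule tendstoI)
 fix e :: real assume "0 < e"
 then have "\<forall>\<^sub>F v in at_top. 1 - e / 2 \<le> f v" by (intro assms(2)) simp
 then show "\<forall>\<^sub>F v in at_top. dist (f v) 1 < e"
 proof eventually_elim
  case (elim v)
  then show ?case using assms(1)[of v] \<open>0 < e\<close> by (simp add: dist_real_def)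
 qed
qed

context extremal_limit
begin

text \<open>By \<open>cluster_exp_integral\<close> the dependence on \<open>\<phi>\<close> separates
  from that on the clusters. Comparison with the indicator of \<open>{0..}\<close>, whose own
  integral is \<open>1 / sqrt 2\<close>, expresses the cluster factor by the mean count at level
  0.\<close>

lemma intensity_cluster_sum:
 assumes \<phi>: "level_fun a \<phi>"
 shows "(\<integral>\<^sup>+p. ennreal (cluster_sum \<phi> p) \<partial>intensity) =
  (LEB z. eexp (- sqrt 2 * z) * ennreal (\<phi> z)) * ennreal (sqrt 2) * (\<integral>\<^sup>+p. ennreal (level_count 0 p) \<partial>intensity)"
proof -
 have [measurable]: "\<phi> \<in> borel_measurable borel" by (rule level_funD(5)[OF \<phi>])
 let ?c = "\<integral>\<^sup>+z. eexp (- sqrt 2 * z) * ennreal (\<phi> z) \<partial>lborel"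
 let ?in = "\<lambda>C. \<integral>\<^sup>+u. eexp (- sqrt 2 * u) * ennreal (level_count 0 (u, C)) \<partial>lborel"
 have in0: "?in C = ennreal (1 / sqrt 2) * (\<integral>\<^sup>+x. eexp (sqrt 2 * x) \<partial>C)" if C: "C \<in> cluster_space" for C
 proof -
  have "ennreal (level_count 0 (u, C)) = (\<integral>\<^sup>+x. indicator {0..} (u + x) \<partial>C)" for u
  proof -
   have "(\<integral>\<^sup>+x. indicator {0..} (u + x) \<partial>C) = (\<integral>\<^sup>+x. indicator {- 0 - u..} x \<partial>C)"
    by (intro nn_integral_cong) (auto simp: indicator_def)
   also have "\<dots> = emeasure C {- 0 - u..}" using sets_cluster[OF C] by simp
   finally show ?thesis by (simp only: emeasure_level_count[OF C])
  qed
  then have "?in C = (LEB u. eexp (- sqrt 2 * u) * (\<integral>\<^sup>+x. indicator {0..} (u + x) \<partial>C))" by simp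
  also have "\<dots> = (LEB z. eexp (- sqrt 2 * z) * indicator {0..} z) * (\<integral>\<^sup>+x. eexp (sqrt 2 * x) \<partial>C)"
   by (rule cluster_exp_integral[OF C]) measurable
  finally show ?thesis by (simp only: exp_tail) simp
 qed
 have in_meas: "?in \<in> borel_measurable \<nu>"
 proof -
  have "(\<lambda>p. (snd p, fst p)) \<in> measurable (\<nu> \<Otimes>\<^sub>M lborel) (borel \<Otimes>\<^sub>M cluster_borel)"
   using measurable_cong_sets[OF \<nu>_sets refl] by (intro measurable_Pair) (auto simp: measurable_ident_sets[OF \<nu>_sets] intro: measurable_compose[OF measurable_fst])
  then have [measurable]: "(\<lambda>p. level_count 0 (snd p, fst p)) \<in> borel_measurable (\<nu> \<Otimes>\<^sub>M lborel)"
   by (rule measurable_compose) (use level_count_measurable in \<open>simp add: marked_borel_def\<close>)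
  have "(\<lambda>p. eexp (- sqrt 2 * snd p) * ennreal (level_count 0 (snd p, fst p))) \<in> borel_measurable (\<nu> \<Otimes>\<^sub>M lborel)"
   by measurable
  from sigma_finite_measure.borel_measurable_nn_integral_fst[OF sigma_finite_lborel this]
  show ?thesis by simp
 qed
 have "(\<integral>\<^sup>+p. ennreal (cluster_sum \<phi> p) \<partial>intensity) = (\<integral>\<^sup>+C. LEB u. eexp (- sqrt 2 * u) * ennreal (cluster_sum \<phi> (u, C)) \<partial>\<nu>)"
  by (rule nn_integral_intensity) (use cluster_sum_measurable[OF \<phi>] in measurable)
 also have "\<dots> = (\<integral>\<^sup>+C. ?c * ennreal (sqrt 2) * ?in C \<partial>\<nu>)"
 proof (intro nn_integral_cong)
  fix C assume "C \<in> space \<nu>"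
  then have C: "C \<in> cluster_space" by (simp add: space_\<nu>)
  have "ennreal (cluster_sum \<phi> (u, C)) = (\<integral>\<^sup>+x. ennreal (\<phi> (u + x)) \<partial>C)" for u
   unfolding cluster_sum_def prod.case using level_funD(1)[OF \<phi>]
   by (intro nn_integral_eq_integral[symmetric] cluster_sum_integrable[OF \<phi> C]) auto
  then have "(LEB u. eexp (- sqrt 2 * u) * ennreal (cluster_sum \<phi> (u, C))) = ?c * (\<integral>\<^sup>+x. eexp (sqrt 2 * x) \<partial>C)"
   using cluster_exp_integral[OF C, of "\<lambda>z. ennreal (\<phi> z)"] by simp
  also have "\<dots> = ?c * (ennreal (sqrt 2) * ennreal (1 / sqrt 2) * (\<integral>\<^sup>+x. eexp (sqrt 2 * x) \<partial>C))"
   by (simp add: ennreal_mult[symmetric])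
  also have "\<dots> = ?c * ennreal (sqrt 2) * ?in C" unfolding in0[OF C] by (simp only: mult.assoc)
  finally show "(LEB u. eexp (- sqrt 2 * u) * ennreal (cluster_sum \<phi> (u, C))) = ?c * ennreal (sqrt 2) * ?in C" .
 qed
 also have "\<dots> = ?c * ennreal (sqrt 2) * (\<integral>\<^sup>+C. ?in C \<partial>\<nu>)"
  by (rule nn_integral_cmult[OF in_meas])
 also have "(\<integral>\<^sup>+C. ?in C \<partial>\<nu>) = (\<integral>\<^sup>+p. ennreal (level_count 0 p) \<partial>intensity)"
  by (rule nn_integral_intensity[symmetric]) measurable
 finally show ?thesis .
qed

text \<open>The rate written \<open>p\<^sub>j\<close> in the overview.\<close>

definition tail_rate :: "nat \<Rightarrow> real" where
 "tail_rate j = measure intensity (at_least 0 j)"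

lemma intensity_at_least:
 assumes "1 \<le> j" shows "measure intensity (at_least v j) = exp (sqrt 2 * v) * tail_rate j"
proof -
 have "emeasure intensity (at_least v j) = eexp (sqrt 2 * v) * emeasure intensity (at_least 0 j)"
 proof (rule intensity_shift)
  fix u C assume "C \<in> cluster_space"
  moreover have "- 0 - (u + v) = - v - u" by simp
  ultimately show "((u, C) \<in> at_least v j) = ((u + v, C) \<in> at_least 0 j)"
   by (simp only: at_least_def level_count_def space_marked_borel mem_Collect_eq prod.case mem_Sigma_iff UNIV_I)
 qed auto
 then show ?thesis by (simp add: measure_def tail_rate_def enn2real_mult)
qed

lemma intensity_half_space_measure: "measure intensity ({- v..} \<times> cluster_space) = exp (sqrt 2 * v) / sqrt 2"
 using intensity_half_space[of "- v"] by (simp add: measure_def)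

lemma tail_rate_nonneg [simp]: "0 \<le> tail_rate j" by (simp add: tail_rate_def)

lemma tail_rate_vanishes: "tail_rate \<longlonglongrightarrow> 0"
proof -
 have "(\<lambda>j. measure intensity (at_least 0 (Suc j))) \<longlonglongrightarrow> measure intensity (\<Inter>j. at_least 0 (Suc j))"
 proof (rule Lim_measure_decseq)
  show "range (\<lambda>j. at_least 0 (Suc j)) \<subseteq> sets intensity"
   unfolding sets_intensity using at_least_sets by blast
  show "decseq (\<lambda>j. at_least 0 (Suc j))" by (rule decseq_SucI) (auto simp: at_least_def)
  show "emeasure intensity (at_least 0 (Suc j)) \<noteq> \<infinity>" for j
   using countable_set_finite[OF countable_at_least[of "Suc j" 0]] by simp
 qed
 moreover have "(\<Inter>j. at_least 0 (Suc j)) = {}"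
 proof safe
  fix u C assume *: "(u, C) \<in> (\<Inter>j. at_least 0 (Suc j))"
  obtain n where "level_count 0 (u, C) < real n" using reals_Archimedean2 by blast
  moreover have "(u, C) \<in> at_least 0 (Suc n)" using * by blast
  ultimately show "(u, C) \<in> {}" by (simp add: at_least_def)
 qed
 ultimately show ?thesis unfolding tail_rate_def by (intro LIMSEQ_imp_Suc[of "\<lambda>j. measure intensity (at_least 0 j)"]) simp
qed

text \<open>Summation by layers: an integer count is the number of positive thresholds that it
  reaches. A finite mean cluster size thus amounts to summable rates.\<close>

lemma level_count_intensity: "(\<integral>\<^sup>+p. ennreal (level_count 0 p) \<partial>intensity) = (\<Sum>j. ennreal (tail_rate (Suc j)))"
proof -
 have "(\<integral>\<^sup>+p. ennreal (level_count 0 p) \<partial>intensity) = (\<integral>\<^sup>+p. (\<Sum>j. indicator (at_least 0 (Suc j)) p) \<partial>intensity)"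
 proof (intro nn_integral_cong)
  fix p assume p: "p \<in> space intensity"
  then obtain n :: nat where n: "level_count 0 p = real n"
   using level_count_nat[of "snd p" 0 "fst p"] by (auto simp: space_intensity)
  have "(\<Sum>j. indicator (at_least 0 (Suc j)) p :: ennreal) = (\<Sum>j\<in>{..<n}. indicator (at_least 0 (Suc j)) p)"
   by (rule suminf_finite) (auto simp: at_least_def indicator_def n)
  also have "\<dots> = (\<Sum>j\<in>{..<n}. 1)"
   using p by (intro sum.cong) (auto simp: at_least_def indicator_def n space_intensity space_marked_borel)
  finally show "ennreal (level_count 0 p) = (\<Sum>j. indicator (at_least 0 (Suc j)) p)"
   by (simp add: n ennreal_of_nat_eq_real_of_nat)
 qed
 also have "\<dots> = (\<Sum>j. \<integral>\<^sup>+p. indicator (at_least 0 (Suc j)) p \<partial>intensity)"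
  by (rule nn_integral_suminf) measurable
 also have "\<dots> = (\<Sum>j. ennreal (tail_rate (Suc j)))"
  using countable_set_finite[OF countable_at_least] sets_intensity
  by (intro suminf_cong) (auto simp: tail_rate_def emeasure_eq_ennreal_measure less_top)
 finally show ?thesis .
qed

text \<open>Given \<open>Z\<close>, the normalised count has variance
  \<open>Zp * p * exp (- sqrt 2 * v)\<close>, and Chebyshev's inequality applies conditionally. The
  bound is cut off at 1 because no moment of \<open>Z\<close> is at hand.\<close>

lemma count_lln:
 assumes A: "\<And>v. countable_set (a v) (A v)" and p: "0 \<le> p" and int: "\<And>v. measure intensity (A v) = exp (sqrt 2 * v) * p" and \<delta>: "0 < \<delta>"
 shows "((\<lambda>v. prob {w\<in>space M. \<delta> < \<bar>exp (- sqrt 2 * v) * measure (\<E> w) (A v) - Zp w * p\<bar>}) \<longlongrightarrow> 0) at_top"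
proof (rule tendsto_sandwich[of "\<lambda>_. 0"])
 let ?b = "\<lambda>v w. min 1 (Zp w * p / \<delta>\<^sup>2 * exp (- sqrt 2 * v))"
 show "((\<lambda>v. \<integral>w. ?b v w \<partial>M) \<longlongrightarrow> 0) at_top"
 proof -
  have "((\<lambda>v. \<integral>w. ?b v w \<partial>M) \<longlongrightarrow> (LINT w|M. 0)) at_top"
  proof (rule integral_dominated_convergence_at_top[where w="\<lambda>_. 1"])
   have "((\<lambda>v. min 1 (Zp w * p / \<delta>\<^sup>2 * exp (- sqrt 2 * v))) \<longlongrightarrow> min 1 (Zp w * p / \<delta>\<^sup>2 * 0)) at_top" for w
    by (intro tendsto_intros) real_asymp
   then show "AE w in M. ((\<lambda>v. ?b v w) \<longlongrightarrow> 0) at_top" by simp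
   show "\<forall>\<^sub>F v in at_top. AE w in M. norm (?b v w) \<le> 1"
    using p \<delta> by (intro always_eventually allI AE_I2) (auto simp: min_def)
  qed auto
  then show ?thesis by simp
 qed
 show "\<forall>\<^sub>F v in at_top. prob {w\<in>space M. \<delta> < \<bar>exp (- sqrt 2 * v) * measure (\<E> w) (A v) - Zp w * p\<bar>} \<le> (LINT w|M. ?b v w)"
 proof (intro always_eventually allI)
  fix v
  note [measurable] = countable_setD(3)[OF A[of v]]
  define e where "e = exp (sqrt 2 * v)"
  have e: "0 < e" "exp (- sqrt 2 * v) = 1 / e" by (auto simp: e_def exp_minus field_simps)
  let ?S = "{w\<in>space M. \<delta> < \<bar>exp (- sqrt 2 * v) * measure (\<E> w) (A v) - Zp w * p\<bar>}"
  define F where "F = (\<lambda>n z. indicator {x. \<delta> * e < \<bar>x - max 0 z * (e * p)\<bar>} (real n) :: ennreal)"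
  have [measurable]: "F n \<in> borel_measurable borel" for n
  proof -
   have "F n = (\<lambda>z. indicator {z. \<delta> * e < \<bar>real n - max 0 z * (e * p)\<bar>} z)" by (auto simp: F_def indicator_def)
   then show ?thesis by simp
  qed
  have "ennreal (prob ?S) = (\<integral>\<^sup>+w. indicator ?S w \<partial>M)" by (simp add: emeasure_eq_measure)
  also have "\<dots> = (\<integral>\<^sup>+w. F (nat \<lfloor>measure (\<E> w) (A v)\<rfloor>) (Z w) \<partial>M)"
  proof (intro nn_integral_cong)
   fix w assume w: "w \<in> space M"
   obtain n :: nat where n: "measure (\<E> w) (A v) = real n" by (rule count_nat[OF A w])
   have "\<bar>exp (- sqrt 2 * v) * real n - Zp w * p\<bar> = \<bar>real n - max 0 (Z w) * (e * p)\<bar> / e"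
   proof -
    have "exp (- sqrt 2 * v) * real n - Zp w * p = (real n - max 0 (Z w) * (e * p)) / e"
     unfolding e(2) Zp_def using e(1) by (simp add: field_simps)
    then show ?thesis using e(1) by (simp add: abs_divide)
   qed
   then have "\<delta> < \<bar>exp (- sqrt 2 * v) * real n - Zp w * p\<bar> \<longleftrightarrow> \<delta> * e < \<bar>real n - max 0 (Z w) * (e * p)\<bar>"
    using e(1) by (simp only: pos_less_divide_eq)
   then show "indicator ?S w = F (nat \<lfloor>measure (\<E> w) (A v)\<rfloor>) (Z w)"
    using w by (simp add: F_def n indicator_def)
  qed
  also have "\<dots> = (\<integral>\<^sup>+w. (\<Sum>n. F n (Z w) * ennreal (poisson_weight (Zp w * (e * p)) n)) \<partial>M)"
   using count_law[OF A, of F v] by (simp add: int e_def)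
  also have "\<dots> \<le> (\<integral>\<^sup>+w. ennreal (?b v w) \<partial>M)"
  proof (intro nn_integral_mono)
   fix w
   have l: "0 \<le> Zp w * (e * p)" using e p by simp
   have "(\<Sum>n. F n (Z w) * ennreal (poisson_weight (Zp w * (e * p)) n)) \<le> ennreal (Zp w * (e * p) / (\<delta> * e)\<^sup>2)"
    unfolding F_def Zp_def[symmetric] using poisson_chebyshev[OF l, of "\<delta> * e"] \<delta> e by simp
   also have "Zp w * (e * p) / (\<delta> * e)\<^sup>2 = Zp w * p / \<delta>\<^sup>2 * exp (- sqrt 2 * v)"
    unfolding e(2) using e(1) by (simp add: power2_eq_square)
   finally have 1: "(\<Sum>n. F n (Z w) * ennreal (poisson_weight (Zp w * (e * p)) n)) \<le> ennreal (Zp w * p / \<delta>\<^sup>2 * exp (- sqrt 2 * v))" .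
   have "(\<Sum>n. F n (Z w) * ennreal (poisson_weight (Zp w * (e * p)) n)) \<le> (\<Sum>n. ennreal (poisson_weight (Zp w * (e * p)) n))"
    by (intro suminf_le) (auto simp: F_def indicator_def)
   also have "\<dots> = ennreal 1" by (rule suminf_ennreal_eq[OF poisson_weight_nonneg[OF l] poisson_sums])
   finally have 2: "(\<Sum>n. F n (Z w) * ennreal (poisson_weight (Zp w * (e * p)) n)) \<le> ennreal 1" .
   show "(\<Sum>n. F n (Z w) * ennreal (poisson_weight (Zp w * (e * p)) n)) \<le> ennreal (?b v w)"
    using 1 2 by (auto simp: min_def)
  qed
  also have "\<dots> = ennreal (LINT w|M. ?b v w)"
   using p \<delta> by (intro nn_integral_eq_integral integrable_bounded) (auto simp: min_def)
  finally show "prob ?S \<le> (LINT w|M. ?b v w)"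
   using p \<delta> by (subst (asm) ennreal_le_iff) (auto intro!: integral_nonneg)
 qed
qed (auto intro: always_eventually)

text \<open>After normalisation the counts are close to \<open>Zp\<close> times deterministic rates,
  so a signed combination of counts has the sign of the same combination of rates once
  \<open>Z\<close> is bounded away from 0.\<close>

lemma count_positive:
 assumes I: "finite I" and A: "\<And>i v. i \<in> I \<Longrightarrow> countable_set (a i v) (A i v)"
  and p: "\<And>i. i \<in> I \<Longrightarrow> 0 \<le> p i" and int: "\<And>i v. i \<in> I \<Longrightarrow> measure intensity (A i v) = exp (sqrt 2 * v) * p i"
  and pos: "0 < (\<Sum>i\<in>I. c i * p i)" and Zpos: "AE w in M. 0 < Z w"
 shows "((\<lambda>v. prob {w\<in>space M. 0 < (\<Sum>i\<in>I. c i * measure (\<E> w) (A i v))}) \<longlongrightarrow> 1) at_top"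
proof (rule tendsto_probI)
 show "prob {w\<in>space M. 0 < (\<Sum>i\<in>I. c i * measure (\<E> w) (A i v))} \<le> 1" for v by simp
 fix e :: real assume e: "0 < e"
 define m where "m = (\<Sum>i\<in>I. c i * p i)"
 define c1 where "c1 = (\<Sum>i\<in>I. \<bar>c i\<bar>) + 1"
 have c1: "0 < c1" unfolding c1_def by (simp add: add_nonneg_pos sum_nonneg)
 have "(\<lambda>n. prob {w\<in>space M. Z w \<le> 1 / real (Suc n)}) \<longlonglongrightarrow> prob (\<Inter>n. {w\<in>space M. Z w \<le> 1 / real (Suc n)})"
 proof (rule finite_Lim_measure_decseq)
  show "decseq (\<lambda>n. {w\<in>space M. Z w \<le> 1 / real (Suc n)})"
  proof (rule decseq_SucI)
   fix n
   have "1 / real (Suc (Suc n)) \<le> 1 / real (Suc n)" by (intro divide_left_mono) auto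
   then show "{w\<in>space M. Z w \<le> 1 / real (Suc (Suc n))} \<subseteq> {w\<in>space M. Z w \<le> 1 / real (Suc n)}"
    by (auto simp del: of_nat_Suc)
  qed
 qed auto
 moreover have "prob (\<Inter>n. {w\<in>space M. Z w \<le> 1 / real (Suc n)}) = 0"
 proof -
  have "AE w in M. w \<notin> (\<Inter>n. {w\<in>space M. Z w \<le> 1 / real (Suc n)})"
   using Zpos
  proof eventually_elim
   case (elim w)
   then obtain n where "1 / real (Suc n) < Z w" using reals_Archimedean[of "Z w"] by (auto simp: inverse_eq_divide)
   then show ?case by (auto simp: not_le intro!: exI[of _ n])
  qed
  then show ?thesis by (intro prob_eq_0[THEN iffD2]) auto
 qed
 ultimately have "\<forall>\<^sub>F n in sequentially. prob {w\<in>space M. Z w \<le> 1 / real (Suc n)} < e / 2"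
  using e by (intro order_tendstoD(2)[of _ 0]) auto
 then obtain n where n: "prob {w\<in>space M. Z w \<le> 1 / real (Suc n)} < e / 2"
  by (auto simp: eventually_sequentially)
 \<comment> \<open>Errors of at most \<open>\<delta>\<close> per count change the combination by
   less than \<open>c1 * \<delta> = m / Suc n\<close>, which is at most \<open>Zp * m\<close> where
   \<open>Z > 1 / Suc n\<close>. The summand 1 in \<open>c1\<close> makes the inequality
   strict.\<close>
 define \<delta> where "\<delta> = m / real (Suc n) / c1"
 have \<delta>: "0 < \<delta>" unfolding \<delta>_def using pos c1 by (simp add: m_def)
 let ?B = "\<lambda>i v. {w\<in>space M. \<delta> < \<bar>exp (- sqrt 2 * v) * measure (\<E> w) (A i v) - Zp w * p i\<bar>}"
 have "((\<lambda>v. \<Sum>i\<in>I. prob (?B i v)) \<longlongrightarrow> (\<Sum>i\<in>I. 0)) at_top"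
  using A p int \<delta> by (intro tendsto_sum count_lln) auto
 then have "\<forall>\<^sub>F v in at_top. (\<Sum>i\<in>I. prob (?B i v)) < e / 2"
  using e by (intro order_tendstoD(2)[of _ 0]) auto
 then show "\<forall>\<^sub>F v in at_top. 1 - e \<le> prob {w\<in>space M. 0 < (\<Sum>i\<in>I. c i * measure (\<E> w) (A i v))}"
 proof eventually_elim
  case (elim v)
  have [measurable]: "i \<in> I \<Longrightarrow> (\<lambda>w. measure (\<E> w) (A i v)) \<in> borel_measurable M" for i
   by (rule countable_setD(3)[OF A])
  let ?G = "{w\<in>space M. 0 < (\<Sum>i\<in>I. c i * measure (\<E> w) (A i v))}"
  let ?N = "{w\<in>space M. Z w \<le> 1 / real (Suc n)}"
  have Gs: "?G \<in> sets M" and Ns: "?N \<in> sets M" and Bs: "\<And>i. i \<in> I \<Longrightarrow> ?B i v \<in> sets M" by measurable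
  have "space M - ?G \<subseteq> ?N \<union> (\<Union>i\<in>I. ?B i v)"
  proof (rule ccontr)
   assume "\<not> ?thesis"
   then obtain w where w0: "w \<in> space M" "w \<notin> ?G" "w \<notin> ?N" "w \<notin> (\<Union>i\<in>I. ?B i v)" by blast
   have w: "w \<in> space M" "(\<Sum>i\<in>I. c i * measure (\<E> w) (A i v)) \<le> 0" "1 / real (Suc n) < Z w"
    using w0(1-3) by (auto simp: not_less not_le)
   have w4: "\<bar>exp (- sqrt 2 * v) * measure (\<E> w) (A i v) - Zp w * p i\<bar> \<le> \<delta>" if "i \<in> I" for i
    using w0(1,4) that by (auto simp: not_less)
   let ?d = "\<lambda>i. exp (- sqrt 2 * v) * measure (\<E> w) (A i v) - Zp w * p i"
   have "exp (- sqrt 2 * v) * (\<Sum>i\<in>I. c i * measure (\<E> w) (A i v)) = Zp w * m + (\<Sum>i\<in>I. c i * ?d i)"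
    unfolding m_def by (simp add: sum_distrib_left right_diff_distrib sum_subtractf mult.left_commute mult.assoc)
   moreover have "exp (- sqrt 2 * v) * (\<Sum>i\<in>I. c i * measure (\<E> w) (A i v)) \<le> 0"
    using w(2) by (intro mult_nonneg_nonpos) auto
   moreover have "\<bar>\<Sum>i\<in>I. c i * ?d i\<bar> \<le> (\<Sum>i\<in>I. \<bar>c i\<bar> * \<delta>)"
    by (intro order_trans[OF sum_abs] sum_mono) (auto simp: abs_mult intro!: mult_left_mono w4[simplified])
   moreover have "(\<Sum>i\<in>I. \<bar>c i\<bar> * \<delta>) < c1 * \<delta>"
    unfolding sum_distrib_right[symmetric] c1_def using \<delta> by (intro mult_strict_right_mono) auto
   moreover have "c1 * \<delta> = m / real (Suc n)" unfolding \<delta>_def using c1 by simp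
   moreover have "m / real (Suc n) \<le> Zp w * m"
   proof -
    have "1 / real (Suc n) * m \<le> Zp w * m"
     using w(3) pos by (intro mult_right_mono) (auto simp: Zp_def m_def)
    then show ?thesis by simp
   qed
   ultimately show False by linarith
  qed
  then have "prob (space M - ?G) \<le> prob (?N \<union> (\<Union>i\<in>I. ?B i v))"
   by (intro finite_measure_mono sets.Un sets.finite_UN I Ns Bs)
  also have "\<dots> \<le> prob ?N + prob (\<Union>i\<in>I. ?B i v)"
   by (intro measure_Un_le sets.finite_UN I Ns Bs)
  also have "prob (\<Union>i\<in>I. ?B i v) \<le> (\<Sum>i\<in>I. prob (?B i v))"
   by (intro measure_UNION_le I Bs)
  finally have "prob (space M - ?G) \<le> e" using n elim by simp
  then show ?case using prob_compl[OF Gs] by simp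
 qed
qed

end

section \<open>The law of the maximum and positivity of \<open>Z\<close>\<close>

text \<open>\<open>point_measures\<close> demands natural numbers as indices, whereas the processes
  at time \<open>t\<close> are indexed by labels; a bijection mediates.\<close>

lemma finite_point_measure:
 fixes L :: "'b set"
 assumes L: "finite L" and f: "f \<in> L \<rightarrow> X" "X \<subseteq> space S"
 shows "distr (count_space L) S f \<in> point_measures S X \<B>"
proof -
 obtain g where g: "bij_betw g {..<card L} L"
  using ex_bij_betw_nat_finite[OF L] by (auto simp: atLeast0LessThan)
 have gL: "g i \<in> L" if "i < card L" for i using g that by (auto simp: bij_betw_def)
 have "distr (count_space L) S f = distr (count_space {..<card L}) S (f \<circ> g)"
 proof -
  have c: "distr (count_space {..<card L}) (count_space L) g = count_space L"
   using g by (rule distr_bij_count_space)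
  have "distr (count_space L) S f = distr (distr (count_space {..<card L}) (count_space L) g) S f"
   unfolding c ..
  also have "\<dots> = distr (count_space {..<card L}) S (f \<circ> g)"
   using f gL by (intro distr_distr) auto
  finally show ?thesis .
 qed
 then show ?thesis unfolding point_measures_def using f gL
  by (intro CollectI exI[of _ "{..<card L}"] exI[of _ "f \<circ> g"]) auto
qed

definition clamp01 :: "real \<Rightarrow> real" where "clamp01 y = max 0 (min 1 y)"

lemma clamp01_bounds [simp]: "0 \<le> clamp01 y" "clamp01 y \<le> 1" "\<bar>clamp01 y\<bar> \<le> 1" "\<bar>1 - clamp01 y\<bar> \<le> 1"
 by (auto simp: clamp01_def)

lemma clamp01_continuous: "continuous_on A clamp01"
 unfolding clamp01_def by (intro continuous_intros)

context bbm
begin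

text \<open>The highest particle in the ball of \<open>y\<close> works: by the ultrametric
  inequality its own ball is contained in that of \<open>y\<close>.\<close>

lemma local_maximum_cover:
 assumes w: "w \<in> space M" and t: "0 \<le> t" and \<rho>: "0 < \<rho>" and y: "y \<in> alive (\<tau> w) t"
 shows "\<exists>x\<in>local_maxima (\<tau> w) (h w) t \<rho>. y \<in> genealogical_ball (\<tau> w) t \<rho> x \<and> h w t y \<le> h w t x"
proof -
 let ?B = "genealogical_ball (\<tau> w) t \<rho>"
 note pos = lifetime_pos[OF w]
 have fin: "finite (?B y)" using finite_alive[OF w t] by (auto simp: genealogical_ball_def)
 have yB: "y \<in> ?B y" using gdist_same[of "\<tau> w" t y] pos t y \<rho> by (simp add: genealogical_ball_def)
 define m where "m = Max (h w t ` ?B y)"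
 have "m \<in> h w t ` ?B y" unfolding m_def using fin yB by (intro Max_in) auto
 then obtain x where x: "x \<in> ?B y" "h w t x = m" by auto
 have mx: "h w t z \<le> h w t x" if "z \<in> ?B y" for z
  unfolding x(2) m_def using fin that by (intro Max_ge) auto
 have "z \<in> ?B y" if z: "z \<in> ?B x" for z
 proof -
  have "gdist (\<tau> w) t y t z \<le> max (gdist (\<tau> w) t y t x) (gdist (\<tau> w) t x t z)"
   using x(1) z y t by (intro gdist_ultrametric) (auto simp: genealogical_ball_def pos)
  then show ?thesis using x(1) z by (auto simp: genealogical_ball_def)
 qed
 then have "x \<in> local_maxima (\<tau> w) (h w) t \<rho>"
  using x(1) mx by (auto simp: local_maxima_def genealogical_ball_def)
 moreover have "y \<in> ?B x" using x(1) y gdist_commute[of "\<tau> w" t x y] by (auto simp: genealogical_ball_def)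
 ultimately show ?thesis using mx[OF yB] by blast
qed

lemma cluster_in_space:
 assumes w: "w \<in> space M" and t: "0 \<le> t" and x: "x \<in> local_maxima (\<tau> w) (h w) t \<rho>"
 shows "cluster (\<tau> w) (h w) t \<rho> x \<in> cluster_space"
 unfolding cluster_def cluster_space_def
 using finite_alive[OF w t] x by (intro finite_point_measure) (auto simp: genealogical_ball_def local_maxima_def)

lemma finite_local_maxima: "w \<in> space M \<Longrightarrow> 0 \<le> t \<Longrightarrow> finite (local_maxima (\<tau> w) (h w) t \<rho>)"
 using finite_alive by (auto simp: local_maxima_def)

lemma finite_ball: "w \<in> space M \<Longrightarrow> 0 \<le> t \<Longrightarrow> finite (genealogical_ball (\<tau> w) t \<rho> x)"
 using finite_alive by (auto simp: genealogical_ball_def)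

lemma marked_process_in_space:
 assumes w: "w \<in> space M" and t: "0 \<le> t"
 shows "marked_process (\<tau> w) (h w) t \<rho> \<in> marked_point_space"
 unfolding marked_process_def marked_point_space_def
 using finite_local_maxima[OF w t] cluster_in_space[OF w t]
 by (intro finite_point_measure) (auto simp: space_marked_borel)

lemma marked_map_measurable:
 assumes w: "w \<in> space M" and t: "0 \<le> t"
 shows "(\<lambda>x. (h w t x - m_centre t, cluster (\<tau> w) (h w) t \<rho> x)) \<in> measurable (count_space (local_maxima (\<tau> w) (h w) t \<rho>)) marked_borel"
 using cluster_in_space[OF w t] by (auto simp: space_marked_borel)

lemma integral_marked_process:
 assumes w: "w \<in> space M" and t: "0 \<le> t" and f: "f \<in> borel_measurable marked_borel"
 shows "(LINT p|marked_process (\<tau> w) (h w) t \<rho>. f p) =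
  (\<Sum>x\<in>local_maxima (\<tau> w) (h w) t \<rho>. f (h w t x - m_centre t, cluster (\<tau> w) (h w) t \<rho> x) :: real)"
 unfolding marked_process_def
 by (subst integral_distr[OF marked_map_measurable[OF w t] f])
  (simp add: lebesgue_integral_count_space_finite finite_local_maxima[OF w t])

lemma cluster_sum_cluster:
 assumes w: "w \<in> space M" and t: "0 \<le> t" and \<phi>: "\<phi> \<in> borel_measurable borel"
 shows "cluster_sum \<phi> (h w t x - c, cluster (\<tau> w) (h w) t \<rho> x) = (\<Sum>y\<in>genealogical_ball (\<tau> w) t \<rho> x. \<phi> (h w t y - c))"
 unfolding cluster_sum_def cluster_def prod.case using \<phi>
 by (subst integral_distr) (auto simp: lebesgue_integral_count_space_finite finite_ball[OF w t] algebra_simps)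

lemma level_count_cluster:
 assumes w: "w \<in> space M" and t: "0 \<le> t"
 shows "level_count v (h w t x - c, cluster (\<tau> w) (h w) t \<rho> x) = real (card {y\<in>genealogical_ball (\<tau> w) t \<rho> x. - v \<le> h w t y - c})"
proof -
 have "emeasure (cluster (\<tau> w) (h w) t \<rho> x) {- v - (h w t x - c)..} = of_nat (card {y\<in>genealogical_ball (\<tau> w) t \<rho> x. - v - (h w t x - c) \<le> h w t y - h w t x})"
  unfolding cluster_def using finite_ball[OF w t]
  by (subst emeasure_distr_count) (auto simp: emeasure_count_space_finite)
 then show ?thesis by (simp add: level_count_def measure_def algebra_simps)
qed

lemma sum_UN_le:
 fixes f :: "'b \<Rightarrow> real"
 assumes "finite L" "\<And>x. x \<in> L \<Longrightarrow> finite (B x)" "\<And>y. 0 \<le> f y"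
 shows "sum f (\<Union>x\<in>L. B x) \<le> (\<Sum>x\<in>L. sum f (B x))"
 using assms(1,2)
proof (induction L)
 case (insert a L)
 have "sum f (B a \<union> (\<Union>x\<in>L. B x)) \<le> sum f (B a) + sum f (\<Union>x\<in>L. B x)"
  using insert assms(3) by (subst sum_Un) (auto intro!: sum_nonneg)
 then show ?case using insert by simp
qed simp

text \<open>The balls around local maxima cover the population. Equality can fail: maxima tied in
  height may share a ball, whose particles are then counted repeatedly.\<close>

lemma sum_alive_le:
 assumes w: "w \<in> space M" and t: "0 \<le> t" and \<rho>: "0 < \<rho>" and f: "\<And>y. (0::real) \<le> f y"
 shows "(\<Sum>y\<in>alive (\<tau> w) t. f y) \<le> (\<Sum>x\<in>local_maxima (\<tau> w) (h w) t \<rho>. \<Sum>y\<in>genealogical_ball (\<tau> w) t \<rho> x. f y)"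
proof -
 let ?L = "local_maxima (\<tau> w) (h w) t \<rho>" and ?B = "genealogical_ball (\<tau> w) t \<rho>"
 have "alive (\<tau> w) t = (\<Union>x\<in>?L. ?B x)"
  using local_maximum_cover[OF w t \<rho>] by (force simp: genealogical_ball_def)
 then have "(\<Sum>y\<in>alive (\<tau> w) t. f y) = sum f (\<Union>x\<in>?L. ?B x)" by simp
 also have "\<dots> \<le> (\<Sum>x\<in>?L. sum f (?B x))"
  using finite_ball[OF w t] f by (intro sum_UN_le finite_local_maxima[OF w t]) auto
 finally show ?thesis .
qed

lemma marked_process_void:
 assumes w: "w \<in> space M" and t: "0 \<le> t" and \<rho>: "0 < \<rho>"
 shows "measure (marked_process (\<tau> w) (h w) t \<rho>) ({x..} \<times> cluster_space) = 0 \<longleftrightarrow> (\<forall>u\<in>alive (\<tau> w) t. h w t u < m_centre t + x)"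
proof -
 let ?L = "local_maxima (\<tau> w) (h w) t \<rho>" and ?A = "{x..} \<times> cluster_space"
 have "measure (marked_process (\<tau> w) (h w) t \<rho>) ?A = (LINT p|marked_process (\<tau> w) (h w) t \<rho>. indicator ?A p)"
  using space_marked_point[OF marked_process_in_space[OF w t]] by (simp add: Int_absorb2 Times_Int_Times)
 also have "\<dots> = (\<Sum>u\<in>?L. indicator {m_centre t + x..} (h w t u))"
  unfolding integral_marked_process[OF w t borel_measurable_indicator[OF half_space_marked]]
  using cluster_in_space[OF w t] by (intro sum.cong) (auto simp: indicator_def)
 also have "\<dots> = 0 \<longleftrightarrow> (\<forall>u\<in>?L. h w t u < m_centre t + x)"
  using finite_local_maxima[OF w t] by (subst sum_nonneg_eq_0_iff) (auto simp: indicator_def not_le)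
 also have "\<dots> \<longleftrightarrow> (\<forall>u\<in>alive (\<tau> w) t. h w t u < m_centre t + x)"
  using local_maximum_cover[OF w t \<rho>] by (fastforce simp: local_maxima_def)
 finally show ?thesis .
qed

end

section \<open>Weak limits of the marked process and the law of its maximum\<close>

context extremal_limit
begin

definition X_proc :: "real \<Rightarrow> 'w \<Rightarrow> (real \<times> real measure) measure" where
 "X_proc t w = marked_process (\<tau> w) (h w) t (r t)"

lemma continuous_clamp_integral:
 assumes "test_fun a f"
 shows "continuous_map (prod_topology marked_point_topology euclideanreal) euclideanreal (\<lambda>q. clamp01 (LINT p|fst q. f p))"
proof -
 have "continuous_map (prod_topology marked_point_topology euclideanreal) euclideanreal (clamp01 \<circ> ((\<lambda>X. integral\<^sup>L X f) \<circ> fst))"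
  using test_fun_continuous[OF assms] clamp01_continuous[of UNIV]
  by (intro continuous_map_compose[where X'=euclideanreal] continuous_map_compose[where X'=marked_point_topology] continuous_map_fst) auto
 then show ?thesis by (simp add: comp_def)
qed

text \<open>Two conditions will have to hold simultaneously in \<open>good\<close>, hence a product
  of two clamped functionals.\<close>

lemma weak_limit_marked:
 assumes f: "test_fun a f" "test_fun b g"
 shows "((\<lambda>t. \<integral>w. clamp01 (LINT p|X_proc t w. f p) * clamp01 (LINT p|X_proc t w. g p) \<partial>M) \<longlongrightarrow>
  (LINT w|M. clamp01 (LINT p|\<E> w. f p) * clamp01 (LINT p|\<E> w. g p))) at_top"
 using \<E>_lim continuous_map_real_mult[OF f[THEN continuous_clamp_integral]] unfolding weakly_converges_def X_proc_def
 by (elim allE[of _ "\<lambda>q. clamp01 (LINT p|fst q. f p) * clamp01 (LINT p|fst q. g p)"])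
  (auto intro!: exI[of _ 1] mult_le_one simp: abs_mult)

lemma test_fun_one_ramp: "test_fun (- v - 1) (\<lambda>p. ramp v (real (Suc k)) (fst p))"
 using level_funD[OF level_fun_ramp[of "real (Suc k)" v]] by (intro test_fun_fst[where K=1]) auto

lemma \<E>_integral_measurable: "test_fun a f \<Longrightarrow> (\<lambda>w. \<integral>p. f p \<partial>\<E> w) \<in> borel_measurable M"
 using measurable_compose[OF \<E>_meas measurable_continuous_map[OF test_fun_continuous]] by simp

lemma weak_limit_one:
 assumes f: "test_fun a f"
 shows "((\<lambda>t. \<integral>w. 1 - clamp01 (LINT p|X_proc t w. f p) \<partial>M) \<longlongrightarrow> (LINT w|M. 1 - clamp01 (LINT p|\<E> w. f p))) at_top"
  and "((\<lambda>t. \<integral>w. clamp01 (LINT p|X_proc t w. f p) \<partial>M) \<longlongrightarrow> (LINT w|M. clamp01 (LINT p|\<E> w. f p))) at_top"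
proof -
 note c = continuous_clamp_integral[OF f]
 have "continuous_map (prod_topology marked_point_topology euclideanreal) euclideanreal (\<lambda>q. 1 - clamp01 (LINT p|fst q. f p))"
  by (intro continuous_map_diff c) simp
 from \<E>_lim[unfolded weakly_converges_def, rule_format, OF conjI[OF this exI[of _ 1]]] show "((\<lambda>t. \<integral>w. 1 - clamp01 (LINT p|X_proc t w. f p) \<partial>M) \<longlongrightarrow> (LINT w|M. 1 - clamp01 (LINT p|\<E> w. f p))) at_top"
  unfolding X_proc_def by simp
 from \<E>_lim[unfolded weakly_converges_def, rule_format, OF conjI[OF c exI[of _ 1]]] show "((\<lambda>t. \<integral>w. clamp01 (LINT p|X_proc t w. f p) \<partial>M) \<longlongrightarrow> (LINT w|M. clamp01 (LINT p|\<E> w. f p))) at_top"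
  unfolding X_proc_def by simp
qed

text \<open>A lower bound for an event by the expectation of a possibly non-measurable function: if the
 function is not integrable, then its Bochner integral is \<open>0\<close>.\<close>

lemma integral_le_real:
 assumes g: "integrable M g" "\<And>w. w \<in> space M \<Longrightarrow> (0::real) \<le> g w" and f: "\<And>w. w \<in> space M \<Longrightarrow> f w \<le> g w"
 shows "(LINT w|M. f w) \<le> (LINT w|M. g w)"
proof (cases "integrable M f")
 case True then show ?thesis using g f by (intro integral_mono) auto
next
 case False
 then show ?thesis using g by (simp add: not_integrable_integral_eq integral_nonneg_AE AE_I2)
qed

lemma integral_le_prob:
 assumes S: "S \<in> sets M" and f: "\<And>w. w \<in> space M \<Longrightarrow> f w \<le> indicator S w"
 shows "(LINT w|M. f w) \<le> prob S"
proof -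
 have "(LINT w|M. f w) \<le> (LINT w|M. indicator S w)"
  using S f by (intro integral_le_real integrable_real_indicator) (auto simp: emeasure_eq_measure)
 then show ?thesis using sets.sets_into_space[OF S] by (simp add: Int_absorb2)
qed

text \<open>The distribution function of the highest point of the limit process, a Gumbel law mixed
  over \<open>Zp\<close>. From the explicit formula continuity and the limits at both ends follow by
  dominated convergence.\<close>

definition max_law :: "real \<Rightarrow> real" where
 "max_law x = (LINT w|M. exp (- (Zp w * (exp (- sqrt 2 * x) / sqrt 2))))"

lemma max_law_bounds: "0 \<le> max_law x" "max_law x \<le> 1"
proof -
 show "0 \<le> max_law x" unfolding max_law_def by (intro integral_nonneg_AE AE_I2) auto
 show "max_law x \<le> 1" unfolding max_law_def
  by (intro integral_le_const integrable_bounded) auto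
qed

lemma max_law_void: "max_law x = prob {w\<in>space M. measure (\<E> w) ({x..} \<times> cluster_space) = 0}"
proof -
 have "measure intensity ({x..} \<times> cluster_space) = exp (- sqrt 2 * x) / sqrt 2"
  unfolding measure_def intensity_half_space by simp
 then show ?thesis unfolding void_probability[OF countable_half_space] max_law_def by simp
qed

lemma max_law_limit:
 assumes "(\<lambda>n :: nat. x n) \<longlonglongrightarrow> x0"
 shows "(\<lambda>n. max_law (x n)) \<longlonglongrightarrow> max_law x0"
 unfolding max_law_def
proof (rule integral_dominated_convergence[where w="\<lambda>_. 1"])
 show "AE w in M. (\<lambda>n. exp (- (Zp w * (exp (- sqrt 2 * x n) / sqrt 2)))) \<longlonglongrightarrow> exp (- (Zp w * (exp (- sqrt 2 * x0) / sqrt 2)))"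
  using assms by (intro AE_I2 tendsto_intros) auto
qed auto

lemma max_law_at_top: "(max_law \<longlongrightarrow> 1) at_top"
proof -
 have "((\<lambda>x. max_law x) \<longlongrightarrow> (LINT w|M. 1)) at_top"
  unfolding max_law_def
 proof (rule integral_dominated_convergence_at_top[where w="\<lambda>_. 1"])
  have "((\<lambda>x. exp (- (Zp w * (exp (- sqrt 2 * x) / sqrt 2)))) \<longlongrightarrow> exp (- (Zp w * (0 / sqrt 2)))) at_top" for w
   by (intro tendsto_intros) (real_asymp, simp)
  then show "AE w in M. ((\<lambda>x. exp (- (Zp w * (exp (- sqrt 2 * x) / sqrt 2)))) \<longlongrightarrow> 1) at_top" by simp
 qed auto
 then show ?thesis by (simp add: prob_space)
qed

lemma tail_prob_compl:
 assumes t: "0 \<le> t"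
 shows "{w\<in>space M. \<forall>u\<in>alive (\<tau> w) t. h w t u < y} \<in> sets M"
  "prob {w\<in>space M. \<forall>u\<in>alive (\<tau> w) t. h w t u < y} = 1 - tail_prob t y"
proof -
 have e: "{w\<in>space M. \<forall>u\<in>alive (\<tau> w) t. h w t u < y} = space M - {w\<in>space M. \<exists>u\<in>alive (\<tau> w) t. y \<le> h w t u}"
  by (auto simp: not_le)
 show "{w\<in>space M. \<forall>u\<in>alive (\<tau> w) t. h w t u < y} \<in> sets M"
  unfolding e using tail_prob_eq(1)[OF t] by simp
 show "prob {w\<in>space M. \<forall>u\<in>alive (\<tau> w) t. h w t u < y} = 1 - tail_prob t y"
  unfolding e using tail_prob_eq[OF t] by (simp add: prob_compl)
qed

text \<open>The functional \<open>1 - clamp01 (LINT p|X. ramp (- x) k (fst p))\<close> lies between the indicators of the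
 events that \<open>X\<close> has no point above \<open>x - 1 / k\<close> and above \<open>x\<close>, respectively.\<close>

lemma ramp_void:
 fixes k :: nat and x :: real
 assumes X: "X \<in> marked_point_space"
 defines "I \<equiv> clamp01 (LINT p|X. ramp (- x) (real (Suc k)) (fst p))"
 shows "measure X ({x - 1 / real (Suc k)..} \<times> cluster_space) = 0 \<Longrightarrow> I = 0"
  and "measure X ({x..} \<times> cluster_space) \<noteq> 0 \<Longrightarrow> I = 1"
proof -
 note spX = space_marked_point[OF X] and int = test_fun_integrable[OF X test_fun_one_ramp[of "- x" k]]
 have fin: "emeasure X ({b..} \<times> cluster_space) < \<infinity>" for b
  by (rule marked_point_finite[OF X half_space_marked order_refl])
 {
  let ?A = "{x - 1 / real (Suc k)..} \<times> cluster_space"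
  assume "measure X ?A = 0"
  then have "emeasure X ?A = 0" using fin[of "x - 1 / real (Suc k)"] by (simp add: emeasure_eq_ennreal_measure less_top)
  then have "AE p in X. p \<notin> ?A" using sets_marked_point[OF X] by (intro AE_not_in) (auto simp: null_sets_def)
  then have "AE p in X. ramp (- x) (real (Suc k)) (fst p) = 0" using AE_space
  proof eventually_elim
   case (elim p)
   then have "fst p - x < - (1 / real (Suc k))" by (auto simp: spX simp del: of_nat_Suc)
   then have "real (Suc k) * (fst p - x) \<le> real (Suc k) * (- (1 / real (Suc k)))" by (intro mult_left_mono) auto
   then show ?case by (simp add: ramp_def del: of_nat_Suc)
  qed
  then show "I = 0" unfolding I_def by (simp add: integral_eq_zero_AE clamp01_def)
 next
  assume ne: "measure X ({x..} \<times> cluster_space) \<noteq> 0"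
  obtain n :: nat where "emeasure X ({x..} \<times> cluster_space) = of_nat n"
   using marked_point_emeasure[OF X half_space_marked order_refl] by blast
  then have "measure X ({x..} \<times> cluster_space) = real n" by (simp add: measure_def)
  then have "1 \<le> measure X ({x..} \<times> cluster_space)" using ne by simp
  also have "\<dots> = (LINT p|X. indicator ({x..} \<times> cluster_space) p)"
   using spX by (simp add: Int_absorb2 Times_Int_Times)
  also have "\<dots> \<le> (LINT p|X. ramp (- x) (real (Suc k)) (fst p))"
   using fin[of x] sets_marked_point[OF X]
   by (intro integral_mono int integrable_real_indicator) (auto simp: indicator_def ramp_eq_1 ramp_def)
  finally show "I = 1" by (simp add: I_def clamp01_def)
 }
qed

text \<open>The absence of points above a level is not a continuous functional, so it is enclosed
  between ramps of width \<open>1 / Suc k\<close>. By continuity of \<open>max_law\<close>,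
  \<open>k\<close> is chosen according to the margin left by \<open>c\<close>, and only then
  \<open>t\<close> tends to infinity.\<close>

lemma tail_prob_limit: "((\<lambda>t. tail_prob t (m_centre t + x)) \<longlongrightarrow> 1 - max_law x) at_top"
proof -
 let ?I = "\<lambda>x k X. clamp01 (LINT p|X. ramp (- x) (real (Suc k)) (fst p))"
 have m: "(\<lambda>w. ?I x k (\<E> w)) \<in> borel_measurable M" for x k
  using \<E>_integral_measurable[OF test_fun_one_ramp] unfolding clamp01_def by measurable
 have i: "integrable M (\<lambda>w. ?I x k (\<E> w))" for x k
  using m by (intro integrable_bounded) auto
 let ?V = "\<lambda>b. {w\<in>space M. measure (\<E> w) ({b..} \<times> cluster_space) = 0}"
 have V: "?V b \<in> sets M" "max_law b = (LINT w|M. indicator (?V b) w)" for b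
  using countable_setD(3)[OF countable_half_space[of b]] by (auto simp: max_law_void Int_absorb2)
 have iV: "integrable M (indicator (?V b) :: _ \<Rightarrow> real)" for b
  using V(1) by (intro integrable_real_indicator) (auto simp: emeasure_eq_measure)
 have le: "max_law (x - 1 / real (Suc k)) \<le> 1 - (LINT w|M. ?I x k (\<E> w))" for x k
 proof -
  have "(LINT w|M. indicator (?V (x - 1 / real (Suc k))) w) \<le> (LINT w|M. 1 - ?I x k (\<E> w))"
   using ramp_void(1)[OF \<E>_marked] by (intro integral_mono iV) (auto simp: indicator_def i simp del: of_nat_Suc)
  then show ?thesis unfolding V(2) using i by (simp add: prob_space)
 qed
 have ge: "1 - max_law x \<le> (LINT w|M. ?I x k (\<E> w))" for x k
 proof -
  have "(LINT w|M. 1 - indicator (?V x) w) \<le> (LINT w|M. ?I x k (\<E> w))"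
   using ramp_void(2)[OF \<E>_marked] by (intro integral_mono i Bochner_Integration.integrable_diff iV) (auto simp: indicator_def)
  then show ?thesis unfolding V(2) using iV by (simp add: prob_space)
 qed
 have X: "X_proc t w \<in> marked_point_space" "measure (X_proc t w) ({b..} \<times> cluster_space) = 0 \<longleftrightarrow> (\<forall>u\<in>alive (\<tau> w) t. h w t u < m_centre t + b)"
  if "w \<in> space M" "0 \<le> t" for t w b
  unfolding X_proc_def using marked_process_in_space[OF that] marked_process_void[OF that r_pos[OF that(2)]] by auto
 \<comment> \<open>The functional of \<open>X_proc\<close> may be non-measurable, and
   \<open>integral_le_prob\<close> bounds integrals by probabilities in one direction only; this
   direction therefore uses the complementary functional.\<close>
 have ub: "tail_prob t (m_centre t + x) \<le> 1 - (LINT w|M. 1 - ?I x k (X_proc t w))" if t: "0 \<le> t" for t x k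
 proof -
  have "(LINT w|M. 1 - ?I x k (X_proc t w)) \<le> prob {w\<in>space M. \<forall>u\<in>alive (\<tau> w) t. h w t u < m_centre t + x}"
  proof (rule integral_le_prob[OF tail_prob_compl(1)[OF t]])
   fix w assume w: "w \<in> space M"
   show "1 - ?I x k (X_proc t w) \<le> indicator {w\<in>space M. \<forall>u\<in>alive (\<tau> w) t. h w t u < m_centre t + x} w"
    using ramp_void(2)[OF X(1)[OF w t], of x k] X(2)[OF w t, of x] w by (auto simp: indicator_def)
  qed
  then show ?thesis unfolding tail_prob_compl(2)[OF t] by simp
 qed
 have lb: "(LINT w|M. ?I (x + 1 / real (Suc k)) k (X_proc t w)) \<le> tail_prob t (m_centre t + x)" if t: "0 \<le> t" for t x k
  unfolding tail_prob_eq(2)[OF t]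
 proof (rule integral_le_prob[OF tail_prob_eq(1)[OF t]])
  fix w assume w: "w \<in> space M"
  show "?I (x + 1 / real (Suc k)) k (X_proc t w) \<le> indicator {w\<in>space M. \<exists>u\<in>alive (\<tau> w) t. m_centre t + x \<le> h w t u} w"
   using ramp_void(1)[OF X(1)[OF w t], of "x + 1 / real (Suc k)" k] X(2)[OF w t, of x] w by (auto simp: indicator_def not_le simp del: of_nat_Suc)
 qed
 have lim: "(\<lambda>k. max_law (x + c / real (Suc k))) \<longlonglongrightarrow> max_law x" for c
 proof (rule max_law_limit)
  show "(\<lambda>k. x + c / real (Suc k)) \<longlonglongrightarrow> x" by real_asymp
 qed
 show ?thesis
 proof (rule order_tendstoI)
  fix c assume "c < 1 - max_law x"
  then have "\<forall>\<^sub>F k in sequentially. max_law (x + 1 / real (Suc k)) < 1 - c" using lim[of 1] by (intro order_tendstoD(2)) auto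
  then obtain k where "max_law (x + 1 / real (Suc k)) < 1 - c" by (auto simp: eventually_sequentially)
  then have "c < (LINT w|M. ?I (x + 1 / real (Suc k)) k (\<E> w))" using ge[of "x + 1 / real (Suc k)" k] by linarith
  from order_tendstoD(1)[OF weak_limit_one(2)[OF test_fun_one_ramp] this]
  show "\<forall>\<^sub>F t in at_top. c < tail_prob t (m_centre t + x)"
   using eventually_ge_at_top[of 0] by eventually_elim (rule less_le_trans[OF _ lb])
 next
  fix c assume "1 - max_law x < c"
  then have "\<forall>\<^sub>F k in sequentially. 1 - c < max_law (x + - 1 / real (Suc k))" using lim[of "- 1"] by (intro order_tendstoD(1)) auto
  then obtain k where "1 - c < max_law (x - 1 / real (Suc k))" by (auto simp: eventually_sequentially)
  then have "1 - c < (LINT w|M. 1 - ?I x k (\<E> w))" using le[of x k] i by (simp add: prob_space del: of_nat_Suc)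
  from order_tendstoD(1)[OF weak_limit_one(1)[OF test_fun_one_ramp] this]
  show "\<forall>\<^sub>F t in at_top. tail_prob t (m_centre t + x) < c"
   using eventually_ge_at_top[of 0] by eventually_elim (rule le_less_trans[OF ub[of _ x k]], simp_all)
 qed
qed

end

lemma m_centre_shift: "((\<lambda>t. m_centre t - m_centre (t - s)) \<longlongrightarrow> sqrt 2 * s) at_top"
proof -
 have "((\<lambda>t. sqrt 2 * s - 3 / (2 * sqrt 2) * (ln t - ln (t - s))) \<longlongrightarrow> sqrt 2 * s - 3 / (2 * sqrt 2) * 0) at_top"
  by (intro tendsto_intros) real_asymp
 moreover have "\<forall>\<^sub>F t in at_top. sqrt 2 * s - 3 / (2 * sqrt 2) * (ln t - ln (t - s)) = m_centre t - m_centre (t - s)"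
  using eventually_ge_at_top[of "max 1 (1 + s)"]
 proof eventually_elim
  case (elim t)
  then have "max t 1 = t" "max (t - s) 1 = t - s" by auto
  then show ?case by (simp only: m_centre_def right_diff_distrib)
 qed
 ultimately show ?thesis by (simp add: filterlim_cong)
qed

context extremal_limit
begin

lemma max_law_continuous: "continuous_on UNIV max_law"
 unfolding continuous_on_sequentially using max_law_limit by (auto simp: comp_def)

lemma max_law_measurable [measurable]: "max_law \<in> borel_measurable borel"
 by (rule borel_measurable_continuous_onI[OF max_law_continuous])

text \<open>Monotonicity in the level and continuity of the limit absorb the moving
  argument.\<close>

lemma tail_prob_limit_shift:
 assumes f: "(f \<longlongrightarrow> x) at_top"
 shows "((\<lambda>t. tail_prob t (m_centre t + f t)) \<longlongrightarrow> 1 - max_law x) at_top"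
proof -
 have cont: "\<exists>d>0. \<forall>y. \<bar>y - x\<bar> \<le> d \<longrightarrow> \<bar>max_law y - max_law x\<bar> < e" if "0 < e" for e
 proof -
  from max_law_continuous[unfolded continuous_on_iff, rule_format, of x e] that
  obtain d where "0 < d" "\<And>y. \<bar>y - x\<bar> < d \<Longrightarrow> \<bar>max_law y - max_law x\<bar> < e" by (auto simp: dist_real_def)
  then show ?thesis by (intro exI[of _ "d / 2"]) auto
 qed
 show ?thesis
 proof (rule order_tendstoI)
  fix c assume "c < 1 - max_law x"
  then obtain d where d: "0 < d" "\<And>y. \<bar>y - x\<bar> \<le> d \<Longrightarrow> \<bar>max_law y - max_law x\<bar> < 1 - max_law x - c"
   using cont[of "1 - max_law x - c"] by auto
  have "c < 1 - max_law (x + d)" using d(2)[of "x + d"] d(1) by auto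
  then have "\<forall>\<^sub>F t in at_top. c < tail_prob t (m_centre t + (x + d))" by (rule order_tendstoD(1)[OF tail_prob_limit])
  moreover have "\<forall>\<^sub>F t in at_top. f t < x + d" using f d(1) by (intro order_tendstoD(2)) auto
  ultimately show "\<forall>\<^sub>F t in at_top. c < tail_prob t (m_centre t + f t)"
   using eventually_ge_at_top[of 0] by eventually_elim (rule less_le_trans[OF _ tail_prob_antimono], auto)
 next
  fix c assume "1 - max_law x < c"
  then obtain d where d: "0 < d" "\<And>y. \<bar>y - x\<bar> \<le> d \<Longrightarrow> \<bar>max_law y - max_law x\<bar> < c - (1 - max_law x)"
   using cont[of "c - (1 - max_law x)"] by auto
  have "1 - max_law (x - d) < c" using d(2)[of "x - d"] d(1) by auto
  then have "\<forall>\<^sub>F t in at_top. tail_prob t (m_centre t + (x - d)) < c" by (rule order_tendstoD(2)[OF tail_prob_limit])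
  moreover have "\<forall>\<^sub>F t in at_top. x - d < f t" using f d(1) by (intro order_tendstoD(1)) auto
  ultimately show "\<forall>\<^sub>F t in at_top. tail_prob t (m_centre t + f t) < c"
   using eventually_ge_at_top[of 0] by eventually_elim (rule le_less_trans[OF tail_prob_antimono], auto)
 qed
qed

text \<open>The travelling wave equation in integrated form: the limit of the mild equation at level
  \<open>m_centre t + x\<close>. A first split at time \<open>fst p\<close> moves the centring by
  \<open>sqrt 2 * fst p\<close>.\<close>

lemma max_law_fixed_point: "max_law x = (LINT p|first_split_law. (max_law (x + sqrt 2 * fst p - sqrt (fst p) * snd p))\<^sup>2)"
proof -
 let ?k = "\<lambda>t p. first_split pos_ind (\<lambda>r y. (kpp pos_ind r y)\<^sup>2) t (m_centre t + x) p"
 have "((\<lambda>t. \<integral>p. ?k t p \<partial>first_split_law) \<longlongrightarrow> (LINT p|first_split_law. (max_law (x + sqrt 2 * fst p - sqrt (fst p) * snd p))\<^sup>2)) at_top"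
 proof (rule integral_dominated_convergence_at_top[where w="\<lambda>_. 1"])
  have "((\<lambda>t. ?k t p) \<longlongrightarrow> (max_law (x + sqrt 2 * fst p - sqrt (fst p) * snd p))\<^sup>2) at_top" for p
  proof -
   let ?f = "\<lambda>t. m_centre (t + fst p) - m_centre t + x - sqrt (fst p) * snd p"
   have "((\<lambda>t. m_centre (t + fst p) - m_centre t) \<longlongrightarrow> sqrt 2 * fst p) at_top"
    using filterlim_compose[OF m_centre_shift[of "fst p"] filterlim_tendsto_add_at_top[OF tendsto_const[of "fst p"] filterlim_ident]]
    by (simp add: add.commute)
   then have "(?f \<longlongrightarrow> sqrt 2 * fst p + x - sqrt (fst p) * snd p) at_top" by (intro tendsto_intros)
   from tendsto_diff[OF tendsto_const[of 1] tail_prob_limit_shift[OF this]]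
   have "((\<lambda>t. kpp pos_ind t (m_centre t + ?f t)) \<longlongrightarrow> max_law (x + sqrt 2 * fst p - sqrt (fst p) * snd p)) at_top"
    by (simp add: tail_prob_def algebra_simps)
   moreover have "filterlim (\<lambda>t. t - fst p) at_top at_top" for p :: "real \<times> real"
    using filterlim_tendsto_add_at_top[OF tendsto_const[of "- fst p"] filterlim_ident] by simp
   ultimately have "((\<lambda>t. kpp pos_ind (t - fst p) (m_centre (t - fst p) + ?f (t - fst p))) \<longlongrightarrow> max_law (x + sqrt 2 * fst p - sqrt (fst p) * snd p)) at_top"
    by (rule filterlim_compose)
   then have l: "((\<lambda>t. (kpp pos_ind (t - fst p) (m_centre t + x - sqrt (fst p) * snd p))\<^sup>2) \<longlongrightarrow> (max_law (x + sqrt 2 * fst p - sqrt (fst p) * snd p))\<^sup>2) at_top"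
    by (intro tendsto_power) (simp add: algebra_simps)
   show ?thesis
    by (rule Lim_transform_eventually[OF l]) (use eventually_ge_at_top[of "fst p"] in eventually_elim, simp add: first_split_def)
  qed
  then show "AE p in first_split_law. ((\<lambda>t. ?k t p) \<longlongrightarrow> (max_law (x + sqrt 2 * fst p - sqrt (fst p) * snd p))\<^sup>2) at_top" by simp
  show "\<forall>\<^sub>F t in at_top. AE p in first_split_law. norm (?k t p) \<le> 1"
   by (auto simp: first_split_def power_le_one indicator_def)
 qed auto
 moreover have "\<forall>\<^sub>F t in at_top. (LINT p|first_split_law. ?k t p) = 1 - tail_prob t (m_centre t + x)"
  using eventually_ge_at_top[of 0]
  by eventually_elim (subst kpp_mild[symmetric], auto simp: tail_prob_def indicator_def)
 ultimately have "((\<lambda>t. 1 - tail_prob t (m_centre t + x)) \<longlongrightarrow> (LINT p|first_split_law. (max_law (x + sqrt 2 * fst p - sqrt (fst p) * snd p))\<^sup>2)) at_top"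
  by (simp add: filterlim_cong)
 moreover have "((\<lambda>t. 1 - tail_prob t (m_centre t + x)) \<longlongrightarrow> 1 - (1 - max_law x)) at_top"
  by (intro tendsto_intros tail_prob_limit)
 ultimately show ?thesis using tendsto_unique[OF trivial_limit_at_top_linorder] by force
qed

lemma max_law_at_bot:
 assumes "filterlim x at_bot sequentially"
 shows "(\<lambda>n. max_law (x n)) \<longlonglongrightarrow> prob {w\<in>space M. Zp w = 0}"
proof -
 have "(\<lambda>n. max_law (x n)) \<longlonglongrightarrow> (LINT w|M. indicator {w\<in>space M. Zp w = 0} w)"
  unfolding max_law_def
 proof (rule integral_dominated_convergence[where w="\<lambda>_. 1"])
  have "(\<lambda>n. exp (- (Zp w * (exp (- sqrt 2 * x n) / sqrt 2)))) \<longlonglongrightarrow> indicator {w\<in>space M. Zp w = 0} w" if "w \<in> space M" for w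
  proof (cases "Zp w = 0")
   case False
   have "((\<lambda>y. exp (- (c * (exp (- sqrt 2 * y) / sqrt 2)))) \<longlongrightarrow> 0) at_bot" if "0 < c" for c :: real
    using that by real_asymp
   from filterlim_compose[OF this assms, of "Zp w"] show ?thesis using False Zp_nonneg[of w] by simp
  qed (use that in simp)
  then show "AE w in M. (\<lambda>n. exp (- (Zp w * (exp (- sqrt 2 * x n) / sqrt 2)))) \<longlonglongrightarrow> indicator {w\<in>space M. Zp w = 0} w"
   by (rule AE_I2)
 qed auto
 then show ?thesis by (simp add: Int_absorb2)
qed

text \<open>The traveling wave \<^const>\<open>wave_sub\<close> below the front forces the derivative martingale to be
 positive with positive probability.\<close>

lemma Zp_not_AE_zero: "prob {w\<in>space M. Zp w = 0} < 1"
proof (rule ccontr)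
 assume "\<not> ?thesis"
 then have "prob {w\<in>space M. Zp w = 0} = 1" using prob_le_1[of "{w\<in>space M. Zp w = 0}"] by linarith
 then have Z0: "AE w in M. Zp w = 0" by (subst (asm) prob_eq_1) (auto elim: eventually_mono)
 \<comment> \<open>One unit beyond 1000, where \<open>wave_sub\<close> becomes positive.\<close>
 define x where "x = (1001 :: real)"
 \<comment> \<open>Equal to 1 for \<open>z \<le> 0\<close>, so its expectation tends to 1 if
   \<open>Zp\<close> vanishes; off the event \<open>?A\<close> its value at \<open>?D\<close> is a
   lower bound for \<open>?W\<close>.\<close>
 define F where "F z = 1 - min 1 (2 * max 0 z / C\<^sub>0)" for z :: real
 have F: "0 \<le> F z" "F z \<le> 1" for z using C\<^sub>0_pos by (auto simp: F_def)
 let ?g = "\<lambda>y. 1 - wave_sub y" and ?D = "\<lambda>t w. deriv_mart C\<^sub>0 (\<tau> w) (h w) t"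
 have x: "0 < wave_sub x" using ramp_fun_pos[of 1] by (simp add: wave_sub_def x_def)
 have "((\<lambda>t. \<integral>w. F (?D t w) \<partial>M) \<longlongrightarrow> (LINT w|M. F (Z w))) at_top"
 proof -
  have "continuous_map (prod_topology marked_point_topology euclideanreal) euclideanreal (F \<circ> snd)"
   unfolding F_def using C\<^sub>0_pos
   by (intro continuous_map_compose[where X'=euclideanreal] continuous_map_snd) (auto intro!: continuous_intros)
  from \<E>_lim[unfolded weakly_converges_def, rule_format, OF conjI[OF this exI[of _ 1]]] show ?thesis
   using F by simp
 qed
 moreover have "(LINT w|M. F (Z w)) = (LINT w|M. 1)"
  using Z0 by (intro integral_cong_AE) (auto simp: F_def Zp_def[abs_def] elim!: eventually_mono)
 ultimately have "((\<lambda>t. \<integral>w. F (?D t w) \<partial>M) \<longlongrightarrow> 1) at_top" by (simp add: prob_space)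
 then have ev1: "\<forall>\<^sub>F t in at_top. 1 - wave_sub x / 2 < (LINT w|M. F (?D t w))" using x by (intro order_tendstoD(1)) auto
 have "\<forall>\<^sub>F y in at_top. 1 - wave_sub x / 2 < max_law y" using x by (intro order_tendstoD(1)[OF max_law_at_top]) auto
 then obtain y where "1 - wave_sub x / 2 < max_law y" by (auto simp: eventually_at_top_linorder)
 then have ev2: "\<forall>\<^sub>F t in at_top. tail_prob t (m_centre t + y) < wave_sub x / 2"
  by (intro order_tendstoD(2)[OF tail_prob_limit]) auto
 have "\<forall>\<^sub>F t :: real in at_top. x + y \<le> 3 / (2 * sqrt 2) * ln t" by real_asymp
 \<comment> \<open>Owing to the logarithmic correction the level \<open>sqrt 2 * t - x\<close> lies
   above the maximum, up to the small probability in \<open>ev2\<close>.\<close>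
 then have ev3: "\<forall>\<^sub>F t in at_top. m_centre t + y \<le> sqrt 2 * t - x"
  using eventually_ge_at_top[of 1] by eventually_elim (auto simp: m_centre_def max_def)
 have "\<forall>\<^sub>F t :: real in at_top. False"
  using ev1 ev2 ev3 eventually_ge_at_top[of 0]
 proof eventually_elim
  case (elim t)
  note t = elim(4)
  let ?A = "{w\<in>space M. \<exists>u\<in>alive (\<tau> w) t. sqrt 2 * t - x \<le> h w t u}" and ?W = "alive_prod ?g t (x + sqrt 2 * t)"
  have W: "0 \<le> ?W w" "?W w \<le> 1" for w
   unfolding alive_prod_def by (auto intro!: prod_nonneg prod_le_1)
  note [measurable] = tail_prob_eq(1)[OF t, of "sqrt 2 * t - x"] alive_prod_measurable[OF t, of ?g "x + sqrt 2 * t"]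
  have int: "integrable M (\<lambda>w. ?W w)" "integrable M (indicator ?A :: _ \<Rightarrow> real)"
   using W by (auto intro!: integrable_bounded simp: indicator_def)
  have "(LINT w|M. F (?D t w)) \<le> (LINT w|M. ?W w + indicator ?A w)"
  proof (intro integral_le_real Bochner_Integration.integrable_add int)
   fix w assume w: "w \<in> space M"
   show "F (?D t w) \<le> ?W w + indicator ?A w"
   proof (cases "w \<in> ?A")
    case True then show ?thesis using F(2)[of "?D t w"] W(1)[of w] by simp
   next
    case False
    let ?d = "\<lambda>u. (sqrt 2 * t - h w t u) * exp (sqrt 2 * (h w t u - sqrt 2 * t))"
    \<comment> \<open>Off \<open>?A\<close> all particles satisfy
      \<open>x \<le> sqrt 2 * t - h w t u\<close>, which yields the factor 2: the sum of the wave
      values is at most twice the derivative martingale divided by \<open>C\<^sub>0\<close>.\<close>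
    have "wave_sub (x + sqrt 2 * t - h w t u) \<le> 2 * ?d u" if "u \<in> alive (\<tau> w) t" for u
    proof -
     have lt: "h w t u < sqrt 2 * t - x" using False w that by (auto simp: not_le)
     have "wave_sub (x + sqrt 2 * t - h w t u) \<le> exp (- sqrt 2 * (x + sqrt 2 * t - h w t u)) * (x + sqrt 2 * t - h w t u)"
      using wave_sub_le[of "x + sqrt 2 * t - h w t u"] lt by (simp add: x_def)
     also have "\<dots> \<le> exp (sqrt 2 * (h w t u - sqrt 2 * t)) * (2 * (sqrt 2 * t - h w t u))"
      using lt by (intro mult_mono) (auto simp: x_def algebra_simps)
     finally show ?thesis by (simp only: mult_ac)
    qed
    then have "(\<Sum>u\<in>alive (\<tau> w) t. wave_sub (x + sqrt 2 * t - h w t u)) \<le> 2 * (\<Sum>u\<in>alive (\<tau> w) t. ?d u)"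
     unfolding sum_distrib_left by (intro sum_mono) auto
    moreover have "1 - (\<Sum>u\<in>alive (\<tau> w) t. wave_sub (x + sqrt 2 * t - h w t u)) \<le> ?W w"
     unfolding alive_prod_def by (intro Weierstrass_prod_ineq) auto
    moreover have "?D t w / C\<^sub>0 = (\<Sum>u\<in>alive (\<tau> w) t. ?d u)"
     using C\<^sub>0_pos by (simp add: deriv_mart_def)
    moreover have "F (?D t w) = max 0 (1 - 2 * max 0 (?D t w / C\<^sub>0))"
     using C\<^sub>0_pos by (auto simp: F_def max_def min_def divide_simps)
    moreover have "indicator ?A w = (0 :: real)" using False by (rule indicator_simps(2))
    ultimately show ?thesis using W(1)[of w] by linarith
   qed
  qed (use W in auto)
  also have "\<dots> = kpp ?g t (x + sqrt 2 * t) + tail_prob t (sqrt 2 * t - x)"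
   using int t tail_prob_eq(1)[OF t]
   by (simp add: kpp_expectation tail_prob_eq(2)[OF t] Int_absorb2)
  also have "\<dots> \<le> (1 - wave_sub x) + tail_prob t (m_centre t + y)"
   using t elim(3) by (intro add_mono kpp_wave_sub tail_prob_antimono)
  finally show ?case using elim(1,2) by simp
 qed
 then show False by (simp add: trivial_limit_at_top_linorder)
qed

lemma Z_pos: "AE w in M. 0 < Z w"
proof -
 define p where "p = prob {w\<in>space M. Zp w = 0}"
 have "(\<lambda>n. \<integral>q. (max_law (- real n + sqrt 2 * fst q - sqrt (fst q) * snd q))\<^sup>2 \<partial>first_split_law) \<longlonglongrightarrow> (LINT q|first_split_law. p\<^sup>2)"
 proof (rule integral_dominated_convergence[where w="\<lambda>_. 1"])
  have "filterlim (\<lambda>n. - real n + c) at_bot sequentially" for c by real_asymp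
  from max_law_at_bot[OF this]
  have "(\<lambda>n. (max_law (- real n + (sqrt 2 * fst q - sqrt (fst q) * snd q)))\<^sup>2) \<longlonglongrightarrow> p\<^sup>2" for q
   unfolding p_def by (intro tendsto_power)
  then show "AE q in first_split_law. (\<lambda>n. (max_law (- real n + sqrt 2 * fst q - sqrt (fst q) * snd q))\<^sup>2) \<longlonglongrightarrow> p\<^sup>2"
   by (simp add: add_diff_eq)
 qed (auto simp: max_law_bounds power_le_one)
 then have "(\<lambda>n. max_law (- real n)) \<longlonglongrightarrow> p\<^sup>2" unfolding max_law_fixed_point[symmetric] by (simp add: split.prob_space)
 moreover have "(\<lambda>n. max_law (- real n)) \<longlonglongrightarrow> p" unfolding p_def by (rule max_law_at_bot) real_asymp
 ultimately have "p\<^sup>2 = p" by (rule LIMSEQ_unique)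
 then have "p * (p - 1) = 0" by (simp add: power2_eq_square algebra_simps)
 then have "p = 0" using Zp_not_AE_zero by (auto simp: p_def)
 then have "AE w in M. \<not> Zp w = 0" unfolding p_def by (subst (asm) prob_eq_0) auto
 then show ?thesis by eventually_elim (auto simp: Zp_def max_def split: if_splits)
qed

end

section \<open>The mean cluster size is infinite\<close>

lemma level_fun_mult:
 assumes F: "\<And>x. 0 \<le> F x" "\<And>x. F x \<le> 1" "\<And>x y. \<bar>F x - F y\<bar> \<le> \<bar>x - y\<bar>" and \<phi>: "level_fun a \<phi>"
 shows "level_fun a (\<lambda>x. F x * \<phi> x)"
proof -
 obtain L where L: "\<bar>\<phi> x - \<phi> y\<bar> \<le> L * \<bar>x - y\<bar>" for x y using \<phi> by (auto simp: level_fun_def)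
 have "\<bar>F x * \<phi> x - F y * \<phi> y\<bar> \<le> (1 + L) * \<bar>x - y\<bar>" for x y
 proof -
  have "\<bar>F x * \<phi> x - F y * \<phi> y\<bar> = \<bar>(F x - F y) * \<phi> x + F y * (\<phi> x - \<phi> y)\<bar>" by (simp add: algebra_simps)
  also have "\<dots> \<le> \<bar>F x - F y\<bar> * \<phi> x + F y * \<bar>\<phi> x - \<phi> y\<bar>"
   using F level_funD[OF \<phi>] by (intro order_trans[OF abs_triangle_ineq]) (simp add: abs_mult)
  also have "\<dots> \<le> \<bar>x - y\<bar> * 1 + 1 * (L * \<bar>x - y\<bar>)"
   using F L level_funD[OF \<phi>] by (intro add_mono mult_mono) auto
  finally show ?thesis by (simp add: algebra_simps)
 qed
 then show ?thesis using F level_funD[OF \<phi>] unfolding level_fun_def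
  by (intro conjI allI impI exI[of _ "1 + L"]) (auto intro: mult_le_one)
qed

text \<open>Test functions have to be continuous, while tail probabilities are known only to be
  monotone in the level. Averaging over a unit interval gives a Lipschitz function between
  \<open>Q\<close> and its unit shift.\<close>

lemma moving_average:
 fixes Q :: "real \<Rightarrow> real"
 assumes Q: "mono Q" "\<And>x. 0 \<le> Q x" "\<And>x. Q x \<le> 1"
 obtains F where "\<And>x. Q x \<le> F x" "\<And>x. F x \<le> Q (x + 1)" "\<And>x y. \<bar>F x - F y\<bar> \<le> \<bar>x - y\<bar>"
proof
 define F where "F x = (LINT z|lborel. Q z * indicator {x..x + 1} z)" for x
 note [measurable] = borel_measurable_mono[OF Q(1)]
 have int: "integrable lborel (\<lambda>z. c z * indicator A z)" if [measurable]: "c \<in> borel_measurable borel" "A \<in> sets borel" and "emeasure lborel A < \<infinity>" "\<And>z. 0 \<le> c z \<and> c z \<le> 1" for c :: "real \<Rightarrow> real" and A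
  using that(3,4) by (intro Bochner_Integration.integrable_bound[OF integrable_real_indicator[of A]]) (auto simp: indicator_def intro!: AE_I2)
 have "(LINT z|lborel. Q x * indicator {x..x + 1} z) \<le> F x" for x
  unfolding F_def using Q monoD[OF Q(1)] by (intro integral_mono int) (auto simp: indicator_def)
 then show "Q x \<le> F x" for x by simp
 have "F x \<le> (LINT z|lborel. Q (x + 1) * indicator {x..x + 1} z)" for x
  unfolding F_def using Q monoD[OF Q(1)] by (intro integral_mono int) (auto simp: indicator_def)
 then show "F x \<le> Q (x + 1)" for x by simp
 have le: "F x - F y \<le> \<bar>x - y\<bar>" for x y
 proof -
  define B where "B = (if x < y then {x..y} else {y + 1..x + 1})"
  have B: "integrable lborel (indicator B :: real \<Rightarrow> real)" "measure lborel B = \<bar>x - y\<bar>"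
   by (rule integrable_real_indicator) (auto simp: B_def)
  have "F x \<le> (LINT z|lborel. Q z * indicator {y..y + 1} z + indicator B z)"
   unfolding F_def using Q by (intro integral_mono Bochner_Integration.integrable_add int B(1)) (auto simp: indicator_def not_le B_def)
  also have "\<dots> = F y + \<bar>x - y\<bar>"
   unfolding F_def using Q B by (subst Bochner_Integration.integral_add) (auto intro!: int)
  finally show ?thesis by simp
 qed
 show "\<bar>F x - F y\<bar> \<le> \<bar>x - y\<bar>" for x y using le[of x y] le[of y x] by (simp add: abs_le_iff abs_minus_commute)
qed

text \<open>By Bernoulli's inequality \<open>X \<le> Y ^ N\<close>. If \<open>Y < 1 - 1 / N\<close>,
  then \<open>X \<le> exp (- 1) \<le> 1 / 2\<close> and the left side is not positive. Probabilities
  that are \<open>N\<close> times smaller are thus negligible provided that \<open>X\<close> is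
  close to 1.\<close>

lemma far_product_bound:
 fixes v w :: "'b \<Rightarrow> real" and N :: nat
 assumes B: "finite B" "A \<subseteq> B" and N: "1 \<le> N" and v: "\<And>u. 0 \<le> v u \<and> v u \<le> 1" and w: "\<And>u. u \<in> A \<Longrightarrow> w u \<le> v u / N"
 shows "(1 - 1 / N) * (1 - 2 * (1 - (\<Prod>u\<in>B. 1 - v u))) \<le> (\<Prod>u\<in>A. 1 - w u)"
proof -
 define X where "X = (\<Prod>u\<in>B. 1 - v u)"
 define Y where "Y = (\<Prod>u\<in>A. 1 - v u / N)"
 have vN: "v u / N \<le> 1" for u using v[of u] N by (simp add: divide_le_eq)
 have Y0: "0 \<le> Y" unfolding Y_def using vN by (auto intro!: prod_nonneg)
 have X1: "X \<le> 1" unfolding X_def using v by (intro prod_le_1) auto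
 have "X = (\<Prod>u\<in>A. 1 - v u) * (\<Prod>u\<in>B - A. 1 - v u)"
  unfolding X_def using B by (metis mult.commute prod.subset_diff)
 also have "\<dots> \<le> (\<Prod>u\<in>A. 1 - v u) * 1" using v by (intro mult_left_mono prod_le_1 prod_nonneg) auto
 also have "\<dots> \<le> (\<Prod>u\<in>A. (1 - v u / N) ^ N)"
 proof -
  have "1 - v u \<le> (1 - v u / N) ^ N" for u
   using Bernoulli_inequality[of "- (v u / N)" N] vN[of u] N by simp
  then show ?thesis using v by (simp add: prod_mono)
 qed
 also have "\<dots> = Y ^ N" by (simp add: Y_def prod_power_distrib)
 finally have XY: "X \<le> Y ^ N" .
 have "(1 - 1 / N) * (1 - 2 * (1 - X)) \<le> Y"
 proof (cases "Y < 1 - 1 / N")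
  case True
  then have "Y ^ N \<le> (1 - 1 / N) ^ N" using Y0 by (intro power_mono) auto
  also have "\<dots> \<le> exp (- 1)" using exp_ge_one_minus_x_over_n_power_n[of 1 N] N by simp
  also have "\<dots> \<le> 1 / 2" using exp_ge_add_one_self[of 1] by (simp add: exp_minus field_simps)
  finally have "(1 - 1 / N) * (1 - 2 * (1 - X)) \<le> (1 - 1 / N) * 0" using XY N by (intro mult_left_mono) auto
  then show ?thesis using Y0 by simp
 next
  case False
  have "(1 - 1 / N) * (1 - 2 * (1 - X)) \<le> (1 - 1 / N) * 1" using X1 N by (intro mult_left_mono) auto
  then show ?thesis using False by simp
 qed
 also have "Y \<le> (\<Prod>u\<in>A. 1 - w u)" unfolding Y_def using w vN by (intro prod_mono) force
 finally show ?thesis unfolding X_def .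
qed

context extremal_limit
begin

text \<open>The Laplace transform of an almost surely positive variable is below 1; this is the
  nondegeneracy that the contradiction in \<open>infinite_mean_cluster\<close> rests on.\<close>

lemma max_law_lt_1: "max_law x < 1"
proof (rule ccontr)
 assume "\<not> ?thesis"
 then have 1: "max_law x = 1" using max_law_bounds[of x] by simp
 let ?f = "\<lambda>w. 1 - exp (- (Zp w * (exp (- sqrt 2 * x) / sqrt 2)))"
 have i: "integrable M (\<lambda>w. exp (- (Zp w * (exp (- sqrt 2 * x) / sqrt 2))))"
  by (intro integrable_bounded) auto
 then have "(LINT w|M. ?f w) = 0" using 1 by (simp add: max_law_def prob_space)
 then have "AE w in M. ?f w = 0" using i by (subst (asm) integral_nonneg_eq_0_iff_AE) auto
 then have "AE w in M. False" using Z_pos by eventually_elim (auto simp: Zp_def)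
 then show False by simp
qed

text \<open>Since \<open>sqrt r\<close> exceeds the logarithmic correction, the level
  \<open>sqrt 2 * r - sqrt r\<close> is below \<open>m_centre r\<close>, where convergence of the
  maximum bounds the tail probability from below, as \<open>front_mass_vanishes\<close>
  requires.\<close>

lemma front_mass_small:
 assumes "0 < e" shows "\<exists>s\<ge>1. front_mass s < ennreal e"
proof -
 define c where "c = (1 - max_law 0) / 2"
 have c: "0 < c" "c < 1 - max_law 0" using max_law_lt_1[of 0] by (auto simp: c_def)
 have "\<forall>\<^sub>F r :: real in at_top. sqrt 2 * r - sqrt r \<le> sqrt 2 * r - 3 / (2 * sqrt 2) * ln r" by real_asymp
 then have "\<forall>\<^sub>F r in at_top. \<forall>y\<le>sqrt 2 * r - sqrt r. c \<le> tail_prob r y"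
  using order_tendstoD(1)[OF tail_prob_limit c(2)] eventually_ge_at_top[of 1]
 proof eventually_elim
  case (elim r)
  then have m: "sqrt 2 * r - sqrt r \<le> m_centre r + 0" by (simp add: m_centre_def max_def)
  show ?case using elim tail_prob_antimono[OF _ order_trans[OF _ m], of r] by fastforce
 qed
 then obtain r0 where "c \<le> tail_prob r y" if "r0 \<le> r" "y \<le> sqrt 2 * r - sqrt r" for r y
  by (auto simp: eventually_at_top_linorder)
 from front_mass_vanishes[OF c(1) this assms] obtain s where "0 \<le> s" "front_mass s < ennreal e" by auto
 then show ?thesis using front_mass_antimono[of s "max 1 s"] by (intro exI[of _ "max 1 s"]) (auto intro: le_less_trans)
qed

text \<open>Of the particles at time \<open>t\<close> with a descendant above \<open>m_centre (t + s) + x\<close> at time \<open>t + s\<close>,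
 those above \<open>m_centre t - A\<close> are counted by the marked process; that the others do not contribute
 is seen by comparison with the time \<open>t + 2 * s\<close>.\<close>

lemma split_near_far:
 assumes s: "1 \<le> s" and N: "1 \<le> N"
  and Fx: "\<And>\<zeta>. tail_prob s (sqrt 2 * s - 1 + x - \<zeta>) \<le> F \<zeta>" and \<phi>: "level_fun (- A - 1) (\<lambda>\<zeta>. F \<zeta> * ramp A 1 \<zeta>)"
  and dom: "\<And>z. sqrt 2 * s - 1 + x + A \<le> z \<Longrightarrow> tail_prob s z \<le> tail_prob (2 * s) (z + (sqrt 2 * s + x' - x + 1)) / real N"
 shows "1 - (LINT w|M. clamp01 (LINT p|\<E> w. clamp01 (cluster_sum (\<lambda>\<zeta>. F \<zeta> * ramp A 1 \<zeta>) p)))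
  \<le> max_law x + (1 - (1 - 1 / N) * (1 - 2 * (1 - max_law x')))"
proof -
 let ?\<phi> = "\<lambda>\<zeta>. F \<zeta> * ramp A 1 \<zeta>"
 define f where "f p = clamp01 (cluster_sum ?\<phi> p)" for p
 have tf: "test_fun (- A - 1) f"
  unfolding f_def by (rule test_fun_cluster_sum[OF \<phi> clamp01_continuous, where K=1]) (auto simp: clamp01_def)
 define c where "c = 1 - 1 / real N"
 have c: "0 \<le> c" "c \<le> 1" using N by (auto simp: c_def)
 let ?g = "\<lambda>t. 1 - tail_prob (s + t) (m_centre (s + t) + x) + (1 - c * (1 - 2 * tail_prob (2 * s + t) (m_centre (2 * s + t) + x')))"
 have lim: "(?g \<longlongrightarrow> 1 - (1 - max_law x) + (1 - c * (1 - 2 * (1 - max_law x')))) at_top"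
  by (intro tendsto_intros filterlim_compose[OF tail_prob_limit] filterlim_tendsto_add_at_top[OF tendsto_const filterlim_ident])
 have ms: "((\<lambda>t. m_centre (b + t) - m_centre t) \<longlongrightarrow> sqrt 2 * b) at_top" for b
  using filterlim_compose[OF m_centre_shift[of b] filterlim_tendsto_add_at_top[OF tendsto_const[of b] filterlim_ident]]
  by simp
 \<comment> \<open>The centring moves by \<open>sqrt 2 * s\<close> only in the limit; the slack of 1
   here and in \<open>e2\<close> gives inequalities valid for large \<open>t\<close>.\<close>
 have e1: "\<forall>\<^sub>F t in at_top. sqrt 2 * s - 1 < m_centre (s + t) - m_centre t" by (intro order_tendstoD(1)[OF ms]) simp
 have "((\<lambda>t. (m_centre (2 * s + t) - m_centre t) - (m_centre (s + t) - m_centre t)) \<longlongrightarrow> sqrt 2 * (2 * s) - sqrt 2 * s) at_top"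
  by (intro tendsto_diff ms)
 then have e2: "\<forall>\<^sub>F t in at_top. (m_centre (2 * s + t) - m_centre t) - (m_centre (s + t) - m_centre t) < sqrt 2 * s + 1"
  by (rule order_tendstoD(2)) simp
 have "\<forall>\<^sub>F t in at_top. (LINT w|M. 1 - clamp01 (LINT p|X_proc t w. f p)) \<le> ?g t"
  using e1 e2 eventually_ge_at_top[of 0]
 proof eventually_elim
  case (elim t)
  note t = elim(3)
  define y where "y = m_centre (s + t) + x"
  define y' where "y' = m_centre (2 * s + t) + x'"
  let ?W = "alive_prod (\<lambda>z. 1 - tail_prob s z) t y" and ?X = "alive_prod (\<lambda>z. 1 - tail_prob (2 * s) z) t y'"
  note [measurable] = alive_prod_measurable[OF t, of "\<lambda>z. 1 - tail_prob s z" y] alive_prod_measurable[OF t, of "\<lambda>z. 1 - tail_prob (2 * s) z" y']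
  have W: "0 \<le> ?W w" "?W w \<le> 1" "0 \<le> ?X w" "?X w \<le> 1" for w
   unfolding alive_prod_def by (auto intro!: prod_nonneg prod_le_1)
  have int: "integrable M ?W" "integrable M ?X"
   using W by (auto intro!: integrable_bounded)
  have "(LINT w|M. 1 - clamp01 (LINT p|X_proc t w. f p)) \<le> (LINT w|M. ?W w + (1 - c * (1 - 2 * (1 - ?X w))))"
  proof (intro integral_le_real)
   show "integrable M (\<lambda>w. ?W w + (1 - c * (1 - 2 * (1 - ?X w))))" using int by simp
  next
   fix w assume w: "w \<in> space M"
   have "c * (1 - 2 * (1 - ?X w)) \<le> c * 1" using c W by (intro mult_left_mono) auto
   then show "0 \<le> ?W w + (1 - c * (1 - 2 * (1 - ?X w)))" using c W(1)[of w] by linarith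
   let ?A = "alive (\<tau> w) t" and ?z = "\<lambda>u. y - h w t u"
   let ?N = "{u\<in>?A. m_centre t - A \<le> h w t u}"
   have fin: "finite ?A" by (rule finite_alive[OF w t])
   \<comment> \<open>Particles below \<open>m_centre t - A\<close>: reaching \<open>y\<close> in
     time \<open>s\<close> is at least \<open>N\<close> times less likely than reaching
     \<open>y'\<close> in time \<open>2 * s\<close>.\<close>
   have "c * (1 - 2 * (1 - ?X w)) \<le> (\<Prod>u\<in>?A - ?N. 1 - tail_prob s (?z u))"
    unfolding c_def alive_prod_def
   proof (rule far_product_bound[OF fin _ N])
    fix u assume u: "u \<in> ?A - ?N"
    then have "tail_prob s (?z u) \<le> tail_prob (2 * s) (?z u + (sqrt 2 * s + x' - x + 1)) / N"
     using elim(1) by (intro dom) (auto simp: y_def)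
    also have "\<dots> \<le> tail_prob (2 * s) (y' - h w t u) / N"
     using s elim(2) by (intro divide_right_mono tail_prob_antimono) (auto simp: y_def y'_def)
    finally show "tail_prob s (?z u) \<le> tail_prob (2 * s) (y' - h w t u) / N" .
   qed auto
   \<comment> \<open>Particles above \<open>m_centre t - A\<close>: a union bound, grouped by
     clusters with sums \<open>S\<close>. Clamping each cluster is harmless, as the total stays
     above the minimum of 1 and the sum of the \<open>S\<close>.\<close>
   moreover have "1 - clamp01 (LINT p|X_proc t w. f p) \<le> (\<Prod>u\<in>?N. 1 - tail_prob s (?z u))"
   proof -
    let ?L = "local_maxima (\<tau> w) (h w) t (r t)"
    define S where "S x = (\<Sum>v\<in>genealogical_ball (\<tau> w) t (r t) x. ?\<phi> (h w t v - m_centre t))" for x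
    have S0: "0 \<le> S x" for x unfolding S_def by (intro sum_nonneg level_funD(1)[OF \<phi>])
    have "(\<Sum>u\<in>?N. tail_prob s (?z u)) \<le> (\<Sum>u\<in>?N. ?\<phi> (h w t u - m_centre t))"
    proof (rule sum_mono)
     fix u assume u: "u \<in> ?N"
     have "tail_prob s (?z u) \<le> tail_prob s (sqrt 2 * s - 1 + x - (h w t u - m_centre t))"
      using elim(1) s by (intro tail_prob_antimono) (auto simp: y_def)
     also have "\<dots> \<le> F (h w t u - m_centre t)" by (rule Fx)
     finally show "tail_prob s (?z u) \<le> ?\<phi> (h w t u - m_centre t)" using u by (subst ramp_eq_1) auto
    qed
    also have "\<dots> \<le> (\<Sum>u\<in>?A. ?\<phi> (h w t u - m_centre t))"
     using fin level_funD(1)[OF \<phi>] by (intro sum_mono2) auto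
    also have "\<dots> \<le> (\<Sum>x\<in>?L. S x)"
     unfolding S_def by (intro sum_alive_le[OF w t r_pos[OF t]] level_funD(1)[OF \<phi>])
    finally have 1: "(\<Sum>u\<in>?N. tail_prob s (?z u)) \<le> (\<Sum>x\<in>?L. S x)" .
    have fL: "finite ?L" by (rule finite_local_maxima[OF w t])
    have 2: "(LINT p|X_proc t w. f p) = (\<Sum>x\<in>?L. clamp01 (S x))"
     unfolding X_proc_def integral_marked_process[OF w t test_fun_measurable[OF tf]]
     unfolding f_def S_def cluster_sum_cluster[OF w t level_funD(5)[OF \<phi>]] ..
    have 3: "min 1 (\<Sum>x\<in>?L. S x) \<le> (\<Sum>x\<in>?L. clamp01 (S x))"
    proof (cases "\<forall>x\<in>?L. S x \<le> 1")
     case True then show ?thesis using S0 by (auto simp: clamp01_def cong: sum.cong)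
    next
     case False
     then obtain x where "x \<in> ?L" "1 < S x" by (auto simp: not_le)
     then have "1 \<le> (\<Sum>x\<in>?L. clamp01 (S x))"
      using member_le_sum[of x ?L "\<lambda>x. clamp01 (S x)"] fL by (simp add: clamp01_def)
     then show ?thesis by simp
    qed
    have "1 - (\<Sum>u\<in>?N. tail_prob s (?z u)) \<le> (\<Prod>u\<in>?N. 1 - tail_prob s (?z u))"
     by (intro Weierstrass_prod_ineq) auto
    moreover have "0 \<le> (\<Prod>u\<in>?N. 1 - tail_prob s (?z u))" by (intro prod_nonneg) auto
    ultimately show ?thesis using 1 3 unfolding 2 clamp01_def by linarith
   qed
   moreover have "?W w = (\<Prod>u\<in>?A - ?N. 1 - tail_prob s (?z u)) * (\<Prod>u\<in>?N. 1 - tail_prob s (?z u))"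
    unfolding alive_prod_def using fin by (intro prod.subset_diff) auto
   moreover have "a + b - 1 \<le> a * b" if "a \<le> 1" "b \<le> 1" for a b :: real
    using mult_nonneg_nonneg[of "1 - a" "1 - b"] that by (simp add: algebra_simps)
   moreover have "(\<Prod>u\<in>B. 1 - tail_prob s (?z u)) \<le> 1" for B by (intro prod_le_1) auto
   ultimately show "1 - clamp01 (LINT p|X_proc t w. f p) \<le> ?W w + (1 - c * (1 - 2 * (1 - ?X w)))"
    by smt
  qed
  also have "\<dots> = kpp (\<lambda>z. 1 - tail_prob s z) t y + (1 - c * (1 - 2 * (1 - kpp (\<lambda>z. 1 - tail_prob (2 * s) z) t y')))"
   using int t by (simp add: kpp_expectation prob_space)
  also have "\<dots> = ?g t"
   using s t tail_prob_add[of s t y] tail_prob_add[of "2 * s" t y'] by (simp add: y_def y'_def)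
  finally show ?case .
 qed
 from tendsto_le[OF _ lim weak_limit_one(1)[OF tf] this]
 have "(LINT w|M. 1 - clamp01 (LINT p|\<E> w. f p)) \<le> max_law x + (1 - c * (1 - 2 * (1 - max_law x')))" by simp
 moreover have "integrable M (\<lambda>w. clamp01 (LINT p|\<E> w. f p))"
  using \<E>_integral_measurable[OF tf] by (intro integrable_bounded) (auto simp: clamp01_def)
 ultimately show ?thesis by (simp add: prob_space f_def c_def)
qed

text \<open>With a finite mean \<open>\<Lambda>\<close>, and apart from large \<open>Z\<close>, the
  near particles contribute at most a constant times \<open>\<Lambda> * front_mass s\<close>,
  whatever \<open>A\<close> is. So \<open>s\<close> can be fixed first and \<open>A\<close> may then
  be taken large enough for the far particles.\<close>

lemma infinite_mean_cluster: "(\<integral>\<^sup>+p. ennreal (level_count 0 p) \<partial>intensity) = \<infinity>"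
proof (rule ccontr)
 assume "\<not> ?thesis"
 then obtain \<Lambda> where \<Lambda>: "0 \<le> \<Lambda>" "(\<integral>\<^sup>+p. ennreal (level_count 0 p) \<partial>intensity) = ennreal \<Lambda>"
  by (cases "\<integral>\<^sup>+p. ennreal (level_count 0 p) \<partial>intensity") auto
 \<comment> \<open>Four errors of size \<open>d\<close> will occur, two from the expectation of
   \<open>?E\<close> and two from the far particles; a fifth of the gap leaves room for
   them.\<close>
 define d where "d = (1 - max_law 0) / 5"
 have d: "0 < d" using max_law_lt_1[of 0] by (simp add: d_def)
 have "(\<lambda>n. prob {w\<in>space M. real n < Z w}) \<longlonglongrightarrow> prob (\<Inter>n. {w\<in>space M. real n < Z w})"
  by (intro finite_Lim_measure_decseq decseq_SucI) auto
 moreover have "(\<Inter>n. {w\<in>space M. real n < Z w}) = {}"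
 proof (intro equals0I)
  fix w assume "w \<in> (\<Inter>n. {w\<in>space M. real n < Z w})"
  then show False using reals_Archimedean2[of "Z w"] by (auto simp: not_less dest: less_asym)
 qed
 ultimately have "(\<lambda>n. prob {w\<in>space M. real n < Z w}) \<longlonglongrightarrow> 0" by simp
 then have "\<forall>\<^sub>F n in sequentially. prob {w\<in>space M. real n < Z w} < d" using d by (rule order_tendstoD(2))
 then obtain K :: nat where K: "prob {w\<in>space M. real K < Z w} < d" by (auto simp: eventually_sequentially)
 \<comment> \<open>Makes \<open>K * exp (2 * sqrt 2) * sqrt 2 * \<Lambda> * (d / c)\<close> equal to
   \<open>(c - 1) / c * d\<close>, hence at most \<open>d\<close>; the 1 keeps \<open>c\<close>
   positive.\<close>
 define c where "c = real K * exp (2 * sqrt 2) * sqrt 2 * \<Lambda> + 1"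
 have c: "0 < c" unfolding c_def using \<Lambda>(1) by (intro add_nonneg_pos mult_nonneg_nonneg) auto
 obtain s where s: "1 \<le> s" "front_mass s < ennreal (d / c)" using front_mass_small[of "d / c"] d c by auto
 define Q where "Q \<zeta> = tail_prob s (sqrt 2 * s - 1 - \<zeta>)" for \<zeta>
 have "mono Q" unfolding Q_def using s by (auto intro!: monoI tail_prob_antimono)
 then obtain F where F: "\<And>x. Q x \<le> F x" "\<And>x. F x \<le> Q (x + 1)" "\<And>x y. \<bar>F x - F y\<bar> \<le> \<bar>x - y\<bar>"
  by (rule moving_average) (auto simp: Q_def)
 have F01: "0 \<le> F x" "F x \<le> 1" for x using F(1,2)[of x] by (auto simp: Q_def intro: order_trans[OF tail_prob_bounds(1)] order_trans[OF _ tail_prob_bounds(2)])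
 have "\<forall>\<^sub>F y in at_top. 1 - d / 2 < max_law y" using d by (intro order_tendstoD(1)[OF max_law_at_top]) auto
 then obtain x' where x': "1 - d / 2 < max_law x'" by (auto simp: eventually_at_top_linorder)
 obtain N :: nat where N: "1 / d < N" using reals_Archimedean2 by auto
 have N1: "1 \<le> N" using N d by (cases N) (auto simp: not_less divide_le_0_iff)
 obtain R where R: "\<And>z. R \<le> z \<Longrightarrow> tail_prob s z \<le> 1 / real N * tail_prob (2 * s) (z + (sqrt 2 * s + x' + 1))"
  using tail_prob_domination[of s "1 / real N" "sqrt 2 * s + x' + 1"] s N1 by auto
 define A where "A = R - (sqrt 2 * s - 1)"
 let ?\<phi> = "\<lambda>\<zeta>. F \<zeta> * ramp A 1 \<zeta>"
 have \<phi>: "level_fun (- A - 1) ?\<phi>" by (intro level_fun_mult F01 F(3) level_fun_ramp) simp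
 define f where "f p = clamp01 (cluster_sum ?\<phi> p)" for p
 have tf: "test_fun (- A - 1) f"
  unfolding f_def by (rule test_fun_cluster_sum[OF \<phi> clamp01_continuous, where K=1]) (auto simp: clamp01_def)
 have [measurable]: "F \<in> borel_measurable borel"
  using F(3) by (intro borel_measurable_continuous_onI lipschitz_on_continuous_on[OF lipschitz_onI, of _ _ 1]) (auto simp: dist_real_def)
 have "(LEB z. eexp (- sqrt 2 * z) * ennreal (?\<phi> z)) \<le> (LEB z. eexp (- sqrt 2 * z) * ennreal (Q (z + 1)))"
  using F(2) F01 by (intro nn_integral_mono mult_left_mono ennreal_leI order_trans[OF mult_left_le]) (auto simp: ramp_def)
 \<comment> \<open>The 2 is one unit of slack from \<open>split_near_far\<close> and one from
   \<open>moving_average\<close>; under the weight they cost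
   \<open>exp (2 * sqrt 2)\<close>.\<close>
 also have "\<dots> = (LEB y. eexp (- sqrt 2 * (sqrt 2 * s - 2 - y)) * ennreal (tail_prob s y))"
  unfolding Q_def by (subst nn_integral_real_affine[where c="-1" and t="sqrt 2 * s - 2"]) auto
 also have "\<dots> = (LEB y. eexp (2 * sqrt 2) * (eexp (sqrt 2 * y - 2 * s) * ennreal (tail_prob s y)))"
 proof (intro nn_integral_cong)
  fix y
  have "- sqrt 2 * (sqrt 2 * s - 2 - y) = 2 * sqrt 2 + (sqrt 2 * y - 2 * s)" by (simp add: algebra_simps)
  then show "eexp (- sqrt 2 * (sqrt 2 * s - 2 - y)) * ennreal (tail_prob s y) = eexp (2 * sqrt 2) * (eexp (sqrt 2 * y - 2 * s) * ennreal (tail_prob s y))"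
   by (simp only: exp_add ennreal_mult exp_ge_zero mult.assoc)
 qed
 also have "\<dots> = eexp (2 * sqrt 2) * front_mass s"
  unfolding front_mass_def by (intro nn_integral_cmult) measurable
 also have "\<dots> \<le> eexp (2 * sqrt 2) * ennreal (d / c)" using s(2) by (intro mult_left_mono) auto
 finally have I: "(LEB z. eexp (- sqrt 2 * z) * ennreal (?\<phi> z)) \<le> eexp (2 * sqrt 2) * ennreal (d / c)" .
 have "(\<integral>\<^sup>+p. ennreal (f p) \<partial>intensity) \<le> (\<integral>\<^sup>+p. ennreal (cluster_sum ?\<phi> p) \<partial>intensity)"
  by (intro nn_integral_mono) (auto simp: f_def clamp01_def space_intensity intro!: cluster_sum_nonneg[OF \<phi>] ennreal_leI)
 also have "\<dots> \<le> eexp (2 * sqrt 2) * ennreal (d / c) * ennreal (sqrt 2) * ennreal \<Lambda>"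
  unfolding intensity_cluster_sum[OF \<phi>] \<Lambda>(2) by (intro mult_right_mono I) auto
 also have "\<dots> = ennreal (exp (2 * sqrt 2) * (d / c) * sqrt 2 * \<Lambda>)"
  using d c \<Lambda>(1) by (simp only: ennreal_mult exp_ge_zero divide_nonneg_nonneg less_imp_le mult_nonneg_nonneg real_sqrt_ge_zero zero_le_numeral)
 finally have If: "(\<integral>\<^sup>+p. ennreal (f p) \<partial>intensity) \<le> ennreal (exp (2 * sqrt 2) * (d / c) * sqrt 2 * \<Lambda>)" .
 let ?E = "\<lambda>w. clamp01 (LINT p|\<E> w. f p)"
 have [measurable]: "?E \<in> borel_measurable M"
  using \<E>_integral_measurable[OF tf] unfolding clamp01_def by measurable
 have "ennreal (LINT w|M. ?E w) = (\<integral>\<^sup>+w. ennreal (?E w) \<partial>M)"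
  by (intro nn_integral_eq_integral[symmetric] integrable_bounded) auto
 also have "\<dots> \<le> (\<integral>\<^sup>+w. indicator {w\<in>space M. real K < Z w} w + indicator {..real K} (Z w) * (\<integral>\<^sup>+p. ennreal (f p) \<partial>\<E> w) \<partial>M)"
 proof (intro nn_integral_mono)
  fix w assume w: "w \<in> space M"
  have "(\<integral>\<^sup>+p. ennreal (f p) \<partial>\<E> w) = ennreal (LINT p|\<E> w. f p)"
   by (intro nn_integral_eq_integral test_fun_integrable[OF \<E>_marked[OF w] tf]) (simp add: f_def)
  moreover have "0 \<le> (LINT p|\<E> w. f p)" by (simp add: f_def)
  ultimately show "ennreal (?E w) \<le> indicator {w\<in>space M. real K < Z w} w + indicator {..real K} (Z w) * (\<integral>\<^sup>+p. ennreal (f p) \<partial>\<E> w)"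
   using w by (cases "real K < Z w") (auto simp: clamp01_def intro!: ennreal_leI)
 qed
 also have "\<dots> = emeasure M {w\<in>space M. real K < Z w} + (\<integral>\<^sup>+w. indicator {..real K} (Z w) * (\<integral>\<^sup>+p. ennreal (f p) \<partial>\<E> w) \<partial>M)"
 proof (subst nn_integral_add)
  have "(\<lambda>w. ennreal (LINT p|\<E> w. f p)) \<in> borel_measurable M" using \<E>_integral_measurable[OF tf] by measurable
  moreover have "(\<integral>\<^sup>+p. ennreal (f p) \<partial>\<E> w) = ennreal (LINT p|\<E> w. f p)" if "w \<in> space M" for w
   by (intro nn_integral_eq_integral test_fun_integrable[OF \<E>_marked[OF that] tf]) (simp add: f_def)
  ultimately have "(\<lambda>w. \<integral>\<^sup>+p. ennreal (f p) \<partial>\<E> w) \<in> borel_measurable M" by (simp cong: measurable_cong)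
  then show "(\<lambda>w. indicator {..real K} (Z w) * (\<integral>\<^sup>+p. ennreal (f p) \<partial>\<E> w)) \<in> borel_measurable M" by measurable
 qed auto
 also have "\<dots> \<le> ennreal d + ennreal (real K) * ennreal (exp (2 * sqrt 2) * (d / c) * sqrt 2 * \<Lambda>)"
 proof (intro add_mono order_trans[OF campbell_le[OF tf]] mult_left_mono If)
  show "emeasure M {w\<in>space M. real K < Z w} \<le> ennreal d" using K by (simp add: emeasure_eq_measure ennreal_leI)
 qed (auto simp: f_def)
 also have "\<dots> = ennreal (d + (c - 1) / c * d)"
  using d c \<Lambda>(1) by (simp add: ennreal_mult[symmetric] ennreal_plus[symmetric] c_def mult_ac del: ennreal_plus)
 also have "\<dots> \<le> ennreal (d + 1 * d)" using d c by (intro ennreal_leI add_mono mult_right_mono) auto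
 finally have "(LINT w|M. ?E w) \<le> 2 * d" using d by simp
 moreover have "1 - (LINT w|M. ?E w) \<le> max_law 0 + (1 - (1 - 1 / real N) * (1 - 2 * (1 - max_law x')))"
  unfolding f_def
 proof (rule split_near_far[OF s(1) N1 _ \<phi>])
  show "tail_prob s (sqrt 2 * s - 1 + 0 - \<zeta>) \<le> F \<zeta>" for \<zeta> using F(1)[of \<zeta>] by (simp add: Q_def)
  show "tail_prob s z \<le> tail_prob (2 * s) (z + (sqrt 2 * s + x' - 0 + 1)) / real N" if "sqrt 2 * s - 1 + 0 + A \<le> z" for z
   using R[of z] that by (simp add: A_def)
 qed
 moreover have "(1 - d) * (1 - d) \<le> (1 - 1 / real N) * (1 - 2 * (1 - max_law x'))"
 proof (intro mult_mono)
  show "1 - d \<le> 1 - 1 / real N" using N d N1 by (simp add: field_simps)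
  show "0 \<le> 1 - d" using max_law_bounds[of 0] by (simp add: d_def)
 qed (use x' N1 in auto)
 moreover have "1 - 2 * d \<le> (1 - d) * (1 - d)" by (simp add: algebra_simps)
 ultimately have "1 - 4 * d \<le> max_law 0" by linarith
 then show False using d by (simp add: d_def field_simps)
qed

end

section \<open>Few clusters carry most particles\<close>

text \<open>Allows the gap between the two sides of an inequality in \<open>good\<close> to be
  scaled and treated as the integral of a single test function.\<close>

lemma test_fun_combination:
 assumes f: "test_fun a f" and g: "test_fun b g"
 shows "test_fun (min a b) (\<lambda>p. c * (d * f p - g p))"
proof -
 obtain K L where K: "\<And>u C. C \<in> cluster_space \<Longrightarrow> \<bar>f (u, C)\<bar> \<le> K" and L: "\<And>u C. C \<in> cluster_space \<Longrightarrow> \<bar>g (u, C)\<bar> \<le> L"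
  using test_fun_bound[OF f] test_fun_bound[OF g] by blast
 have "\<bar>c * (d * f (u, C) - g (u, C))\<bar> \<le> \<bar>c\<bar> * (\<bar>d\<bar> * K + L)" if "C \<in> cluster_space" for u C
 proof -
  have "\<bar>d * f (u, C) - g (u, C)\<bar> \<le> \<bar>d\<bar> * \<bar>f (u, C)\<bar> + \<bar>g (u, C)\<bar>" using abs_triangle_ineq4[of "d * f (u, C)" "g (u, C)"] by (simp add: abs_mult)
  also have "\<dots> \<le> \<bar>d\<bar> * K + L" using K L that by (intro add_mono mult_left_mono) auto
  finally show ?thesis unfolding abs_mult by (intro mult_left_mono) auto
 qed
 then show ?thesis
  using f g test_fun_eq_0[OF f] test_fun_eq_0[OF g] unfolding test_fun_def
  by (auto intro!: continuous_map_real_mult continuous_map_diff exI[of _ "\<bar>c\<bar> * (\<bar>d\<bar> * K + L)"])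
qed

lemma level_count_ge_0 [simp]: "0 \<le> level_count v p"
 by (auto simp: level_count_def split: prod.split)

text \<open>\<open>level_count v\<close> need not be bounded, so it is not treated as a test
  function; integrability comes from the finitely many points at which it does not vanish.\<close>

lemma integrable_level_count:
 assumes X: "X \<in> marked_point_space" shows "integrable X (level_count v)"
proof -
 obtain I :: "nat set" and f where X': "X = distr (count_space I) marked_borel f" and f: "f \<in> I \<rightarrow> UNIV \<times> cluster_space"
  and fin: "finite {i\<in>I. f i \<in> {- v..} \<times> cluster_space}" by (rule marked_pointE[OF X]) blast
 have z: "level_count v (f i) = 0" if i: "i \<in> I" "f i \<notin> {- v..} \<times> cluster_space" for i
 proof -
  obtain u C where p: "f i = (u, C)" "C \<in> cluster_space" using funcset_mem[OF f i(1)] by auto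
  have "(u, C) \<notin> at_least v 1" using at_least_subset[of 1 v] i(2) p by auto
  moreover obtain n :: nat where "level_count v (u, C) = n" using level_count_nat[OF p(2)] by blast
  ultimately show ?thesis using p by (auto simp: at_least_def space_marked_borel)
 qed
 have "integrable (count_space I) (\<lambda>i. level_count v (f i))"
 proof (intro integrableI_nonneg)
  have "finite {i\<in>I. 0 < ennreal (level_count v (f i))}"
   using z by (intro finite_subset[OF _ fin]) force
  then show "(\<integral>\<^sup>+i. ennreal (level_count v (f i)) \<partial>count_space I) < \<infinity>"
   by (subst nn_integral_count_space) (auto simp: less_top)
 qed auto
 then show ?thesis unfolding X' using f by (subst integrable_distr_eq) (auto simp: space_marked_borel)
qed

lemma cluster_level_eq:
 assumes X: "X \<in> marked_point_space" and B: "B \<in> sets marked_borel"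
 shows "cluster_level X {- v..} B = ennreal (LINT p|X. level_count v p * indicator B p)"
proof -
 have "cluster_level X {- v..} B = (\<integral>\<^sup>+p. ennreal (level_count v p * indicator B p) \<partial>X)"
  unfolding cluster_level_def
 proof (intro nn_integral_cong)
  fix p assume "p \<in> space X"
  then obtain u C where p: "p = (u, C)" "C \<in> cluster_space" by (auto simp: space_marked_point[OF X])
  have "(+) u -` {- v..} = {- v - u..}" by auto
  then show "(case p of (u, C) \<Rightarrow> emeasure C ((+) u -` {- v..}) * indicator B (u, C)) = ennreal (level_count v p * indicator B p)"
   using emeasure_level_count[OF p(2), of v u] by (simp add: p(1) indicator_def)
 qed
 also have "\<dots> = ennreal (LINT p|X. level_count v p * indicator B p)"
  using B integrable_level_count[OF X] by (intro nn_integral_eq_integral integrable_real_mult_indicator) (auto simp: sets_marked_point[OF X])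
 finally show ?thesis .
qed

lemma cluster_level_UNIV:
 assumes X: "X \<in> marked_point_space" shows "cluster_level X {- v..} UNIV = ennreal (LINT p|X. level_count v p)"
proof -
 have "cluster_level X {- v..} UNIV = cluster_level X {- v..} (space marked_borel)"
  unfolding cluster_level_def by (intro nn_integral_cong) (auto simp: space_marked_point[OF X] space_marked_borel)
 also have "\<dots> = ennreal (LINT p|X. level_count v p)"
  unfolding cluster_level_eq[OF X sets.top]
  by (intro arg_cong[where f=ennreal] Bochner_Integration.integral_cong) (auto simp: space_marked_point[OF X] space_marked_borel)
 finally show ?thesis .
qed

lemma max_level_eq:
 assumes X: "X \<in> marked_point_space" and B: "B \<in> sets marked_borel"
 shows "max_level X {- v..} B = ennreal (measure X (B \<inter> {- v..} \<times> cluster_space))"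
proof -
 have "max_level X {- v..} B = (\<integral>\<^sup>+p. indicator (B \<inter> {- v..} \<times> cluster_space) p \<partial>X)"
  unfolding max_level_def by (intro nn_integral_cong) (auto simp: space_marked_point[OF X] indicator_def)
 also have "\<dots> = emeasure X (B \<inter> {- v..} \<times> cluster_space)"
  using B by (intro nn_integral_indicator) (auto simp: sets_marked_point[OF X])
 also have "\<dots> = ennreal (measure X (B \<inter> {- v..} \<times> cluster_space))"
  using marked_point_finite[OF X, of "B \<inter> {- v..} \<times> cluster_space" "- v"] B by (intro emeasure_eq_ennreal_measure) auto
 finally show ?thesis .
qed

lemma max_level_UNIV:
 assumes X: "X \<in> marked_point_space" shows "max_level X {- v..} UNIV = ennreal (measure X ({- v..} \<times> cluster_space))"
proof -
 have "max_level X {- v..} UNIV = max_level X {- v..} (space marked_borel)"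
  unfolding max_level_def by (intro nn_integral_cong) (auto simp: space_marked_point[OF X] space_marked_borel)
 then show ?thesis unfolding max_level_eq[OF X sets.top] by (simp add: space_marked_borel Times_Int_Times)
qed

lemma test_fun_count: "test_fun (- v - 1) (\<lambda>p. min (real K) (cluster_sum (ramp v 1) p))"
 by (rule test_fun_cluster_sum[OF level_fun_ramp, where K=K]) (auto intro!: continuous_intros)

lemma test_fun_large: "1 \<le> K \<Longrightarrow> test_fun (- v - 1) (\<lambda>p. clamp01 (cluster_sum (ramp v 1) p - (real K - 1)))"
 by (rule test_fun_cluster_sum[OF level_fun_ramp, where K=1 and \<Psi>="\<lambda>y. clamp01 (y - (real K - 1))"])
  (auto simp: clamp01_def intro!: continuous_intros)

lemma test_fun_ramp: "test_fun (- v - 1) (\<lambda>p. ramp v 1 (fst p))"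
 using level_funD[OF level_fun_ramp[of 1 v]] by (intro test_fun_fst[where K=1]) auto

text \<open>The continuous functionals are chosen such that a configuration satisfying the two strict
 inequalities has both properties required of \<open>G = at_least v K\<close>.\<close>

lemma good_configuration:
 assumes X: "X \<in> marked_point_space" and e: "0 < e" "e < 1" and K: "1 \<le> K"
  and U: "(LINT p|X. min (real K) (cluster_sum (ramp v 1) p)) < e * (LINT p|X. min (real K') (cluster_sum (ramp (v - 1) 1) p))"
  and S: "(LINT p|X. clamp01 (cluster_sum (ramp v 1) p - (real K - 1))) < e * (LINT p|X. ramp (v - 1) 1 (fst p))"
  and D: "D \<le> cluster_level X {- v..} UNIV"
 shows "ennreal (1 - e) \<le> cluster_level X {- v..} (at_least v K) / D"
  and "max_level X {- v..} (at_least v K) / max_level X {- v..} UNIV < ennreal e"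
proof -
 let ?G = "at_least v K"
 note sX = sets_marked_point[OF X] and spX = space_marked_point[OF X]
 note iL = integrable_level_count[OF X, of v]
 have iG: "integrable X (\<lambda>p. level_count v p * indicator ?G p)"
  by (intro integrable_real_mult_indicator iL) (simp add: sX)
 have iB: "integrable X (indicator A :: _ \<Rightarrow> real)" if "A \<in> sets marked_borel" "A \<subseteq> {- v..} \<times> cluster_space" for A
  using marked_point_finite[OF X that] that by (intro integrable_real_indicator) (auto simp: sX)
 define n g where "n = (LINT p|X. level_count v p)" and "g = (LINT p|X. level_count v p * indicator ?G p)"
 \<comment> \<open>Outside \<open>at_least v K\<close> a cluster has fewer than \<open>K\<close>
   counted particles and truncation at \<open>K\<close> does not change the count; by
   \<open>U\<close> these particles are less than an \<open>e\<close>-fraction of all.\<close>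
 have "n - g = (LINT p|X. level_count v p - level_count v p * indicator ?G p)"
  unfolding n_def g_def using iL iG by simp
 also have "\<dots> \<le> (LINT p|X. min (real K) (cluster_sum (ramp v 1) p))"
 proof (intro integral_mono Bochner_Integration.integrable_diff iL iG test_fun_integrable[OF X test_fun_count])
  fix p assume "p \<in> space X"
  then show "level_count v p - level_count v p * indicator ?G p \<le> min (real K) (cluster_sum (ramp v 1) p)"
   using level_count_bounds(1)[of "snd p" v "fst p"] cluster_sum_nonneg[OF level_fun_ramp[of 1 v], of "fst p" "snd p"]
   by (cases p) (auto simp: spX at_least_def space_marked_borel indicator_def)
 qed
 also note U
 also have "e * (LINT p|X. min (real K') (cluster_sum (ramp (v - 1) 1) p)) \<le> e * n"
  unfolding n_def using e
 proof (intro mult_left_mono integral_mono iL test_fun_integrable[OF X test_fun_count])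
  fix p assume "p \<in> space X"
  then show "min (real K') (cluster_sum (ramp (v - 1) 1) p) \<le> level_count v p"
   using level_count_bounds(2)[of "snd p" "v - 1" "fst p"] by (cases p) (auto simp: spX)
 qed auto
 finally have ng: "(1 - e) * n < g" by (simp add: algebra_simps)
 have n0: "0 \<le> n" unfolding n_def by simp
 then have g1: "0 < g" using ng e by (metis diff_gt_0_iff_gt less_eq_real_def mult_nonneg_nonneg order_le_less_trans)
 have cG: "cluster_level X {- v..} ?G = ennreal g" by (simp add: cluster_level_eq[OF X] g_def)
 \<comment> \<open>\<open>D\<close> will be the total count of the limit process, or the level
   process at time \<open>t\<close>, which may be smaller because of ties.\<close>
 have D': "D \<le> ennreal n" using D by (simp add: cluster_level_UNIV[OF X] n_def)
 show "ennreal (1 - e) \<le> cluster_level X {- v..} ?G / D"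
 proof (cases "D = 0")
  \<comment> \<open>A positive number divided by 0 is the top element of
    \<open>ennreal\<close>.\<close>
  case True
  then show ?thesis unfolding cG using g1 by (simp add: ennreal_divide_zero)
 next
  case False
  have "ennreal (1 - e) * D \<le> ennreal (1 - e) * ennreal n" by (intro mult_left_mono D') simp
  also have "\<dots> \<le> ennreal g" using ng e n0 by (simp add: ennreal_mult[symmetric] ennreal_leI)
  finally have "ennreal (1 - e) * D / D \<le> ennreal g / D" by (rule divide_right_mono_ennreal)
  moreover have "D \<noteq> \<infinity>" using D' by (auto simp: top_unique)
  ultimately show ?thesis unfolding cG using False by (simp add: ennreal_mult_divide_eq)
 qed
 have "measure X ?G = (LINT p|X. indicator ?G p)" using sX sets.sets_into_space[of ?G X] by (simp add: Int_absorb2)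
 also have "\<dots> \<le> (LINT p|X. clamp01 (cluster_sum (ramp v 1) p - (real K - 1)))"
 proof (intro integral_mono iB test_fun_integrable[OF X test_fun_large] K)
  fix p assume "p \<in> space X"
  then show "indicator ?G p \<le> clamp01 (cluster_sum (ramp v 1) p - (real K - 1))"
   using level_count_bounds(1)[of "snd p" v "fst p"] by (cases p) (auto simp: spX at_least_def indicator_def clamp01_def)
 qed (use at_least_subset[OF K] in auto)
 also note S
 also have "e * (LINT p|X. ramp (v - 1) 1 (fst p)) \<le> e * (LINT p|X. indicator ({- v..} \<times> cluster_space) p)"
 proof (intro mult_left_mono integral_mono iB test_fun_integrable[OF X test_fun_ramp])
  fix p assume "p \<in> space X"
  then show "ramp (v - 1) 1 (fst p) \<le> indicator ({- v..} \<times> cluster_space) p"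
   by (auto simp: spX ramp_def indicator_def)
 qed (use e in auto)
 also have "\<dots> = e * measure X ({- v..} \<times> cluster_space)" using spX by (simp add: Int_absorb2 Times_Int_Times)
 finally have m: "measure X ?G < e * measure X ({- v..} \<times> cluster_space)" .
 then have "0 < measure X ({- v..} \<times> cluster_space)"
  using e measure_nonneg[of X ?G] by (metis less_le_trans mult_eq_0_iff not_less zero_less_measure_iff)
 then show "max_level X {- v..} ?G / max_level X {- v..} UNIV < ennreal e"
  unfolding max_level_UNIV[OF X] max_level_eq[OF X at_least_sets] using m at_least_subset[OF K, of v] e
  by (simp add: Int_absorb2 divide_ennreal ennreal_lessI divide_less_eq)
qed

lemma min_level_count:
 assumes C: "C \<in> cluster_space"
 shows "min (real K) (level_count v (u, C)) = (\<Sum>j=1..K. indicator (at_least v j) (u, C))"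
proof -
 obtain n :: nat where n: "level_count v (u, C) = real n" using level_count_nat[OF C] by blast
 have "(\<Sum>j=1..K. indicator (at_least v j) (u, C) :: real) = (\<Sum>j=1..K. if j \<le> n then 1 else 0)"
  using C by (intro sum.cong) (auto simp: at_least_def space_marked_borel n)
 also have "\<dots> = real (card {j\<in>{1..K}. j \<le> n})" by (simp add: sum.If_cases Int_def)
 also have "{j\<in>{1..K}. j \<le> n} = {1..min K n}" by auto
 finally show ?thesis using n by (simp add: min_def)
qed

lemma level_count_sum:
 assumes C: "C \<in> cluster_space"
 shows "ennreal (level_count v (u, C)) * indicator (at_least v K) (u, C) = (\<Sum>j. indicator (at_least v (max K (Suc j))) (u, C))"
proof -
 obtain n :: nat where n: "level_count v (u, C) = real n" using level_count_nat[OF C] by blast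
 have "(\<Sum>j. indicator (at_least v (max K (Suc j))) (u, C) :: ennreal) = (\<Sum>j<n. indicator (at_least v (max K (Suc j))) (u, C))"
  using C by (intro suminf_finite) (auto simp: at_least_def space_marked_borel n)
 also have "\<dots> = (\<Sum>j<n. indicator (at_least v K) (u, C))"
  using C by (intro sum.cong) (auto simp: at_least_def space_marked_borel n indicator_def)
 finally show ?thesis by (simp add: n ennreal_of_nat_eq_real_of_nat)
qed

text \<open>Summation by layers, here for the sake of measurability: levels become series of counts
  of the sets \<open>at_least v j\<close>.\<close>

lemma cluster_level_sum:
 assumes X: "X \<in> marked_point_space"
 shows "cluster_level X {- v..} (at_least v K) = (\<Sum>j. emeasure X (at_least v (max K (Suc j))))"
  and "cluster_level X {- v..} UNIV = (\<Sum>j. emeasure X (at_least v (Suc j)))"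
proof -
 have *: "cluster_level X {- v..} (at_least v K) = (\<Sum>j. emeasure X (at_least v (max K (Suc j))))" for K
 proof -
  have "cluster_level X {- v..} (at_least v K) = (\<integral>\<^sup>+p. (\<Sum>j. indicator (at_least v (max K (Suc j))) p) \<partial>X)"
   unfolding cluster_level_def
  proof (intro nn_integral_cong)
   fix p assume "p \<in> space X"
   then obtain u C where p: "p = (u, C)" "C \<in> cluster_space" by (auto simp: space_marked_point[OF X])
   have "(+) u -` {- v..} = {- v - u..}" by auto
   then show "(case p of (u, C) \<Rightarrow> emeasure C ((+) u -` {- v..}) * indicator (at_least v K) (u, C)) = (\<Sum>j. indicator (at_least v (max K (Suc j))) p)"
    using emeasure_level_count[OF p(2), of v u] by (simp add: p(1) level_count_sum[OF p(2)])
  qed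
  also have "\<dots> = (\<Sum>j. \<integral>\<^sup>+p. indicator (at_least v (max K (Suc j))) p \<partial>X)"
   by (intro nn_integral_suminf borel_measurable_indicator) (simp add: sets_marked_point[OF X])
  finally show ?thesis by (simp add: sets_marked_point[OF X])
 qed
 show "cluster_level X {- v..} (at_least v K) = (\<Sum>j. emeasure X (at_least v (max K (Suc j))))" by (rule *)
 have "cluster_level X {- v..} UNIV = cluster_level X {- v..} (at_least v 0)"
  unfolding cluster_level_def by (intro nn_integral_cong) (auto simp: space_marked_point[OF X] at_least_def space_marked_borel)
 then show "cluster_level X {- v..} UNIV = (\<Sum>j. emeasure X (at_least v (Suc j)))" by (simp add: *)
qed

lemma max_level_emeasure:
 assumes X: "X \<in> marked_point_space" and K: "1 \<le> K"
 shows "max_level X {- v..} (at_least v K) = emeasure X (at_least v K)"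
  and "max_level X {- v..} UNIV = emeasure X ({- v..} \<times> cluster_space)"
 using max_level_eq[OF X at_least_sets] max_level_UNIV[OF X] at_least_subset[OF K, of v]
  marked_point_finite[OF X _ at_least_subset[OF K]] marked_point_finite[OF X half_space_marked order_refl]
 by (simp_all add: Int_absorb2 emeasure_eq_ennreal_measure less_top)

section \<open>Measurability of counts at finite times\<close>

context bbm
begin

text \<open>The cardinality is an integral over the countable set of labels, so measurability of
  each membership suffices.\<close>

lemma random_card_measurable:
 fixes A :: "'w \<Rightarrow> particle set"
 assumes fin: "\<And>w. w \<in> space M \<Longrightarrow> finite (A w)" and A: "\<And>x. {w\<in>space M. x \<in> A w} \<in> sets M"
 shows "(\<lambda>w. of_nat (card (A w)) :: ennreal) \<in> borel_measurable M"
proof -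
 interpret C: sigma_finite_measure "count_space (UNIV :: particle set)" by (rule sigma_finite_measure_count_space)
 have "(\<lambda>w. \<integral>\<^sup>+x. indicator (A w) x \<partial>count_space UNIV) \<in> borel_measurable M"
 proof (rule C.borel_measurable_nn_integral)
  have "(\<lambda>w. indicator {w\<in>space M. x \<in> A w} w :: ennreal) \<in> borel_measurable M" for x
   using A by (intro borel_measurable_indicator)
  then have "(\<lambda>w. indicator (A w) x :: ennreal) \<in> borel_measurable M" for x
   by (rule subst[OF measurable_cong, rotated]) (auto simp: indicator_def)
  then show "case_prod (\<lambda>w. indicator (A w) :: _ \<Rightarrow> ennreal) \<in> borel_measurable (M \<Otimes>\<^sub>M count_space UNIV)"
   by (subst measurable_pair_swap_iff, intro measurable_pair_measure_countable1) auto
 qed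
 moreover have "(\<integral>\<^sup>+x. indicator (A w) x \<partial>count_space UNIV) = of_nat (card (A w))" if "w \<in> space M" for w
  using fin[OF that] by simp
 ultimately show ?thesis by (simp cong: measurable_cong)
qed

lemma alive_sets: "{w\<in>space M. x \<in> alive (\<tau> w) t} \<in> sets M"
 by measurable

text \<open>As an infimum over a continuum of times \<open>gdist\<close> is not visibly measurable.
  For living particles it is replaced by the formula with \<open>shared_time\<close>, a finite sum
  of lifetimes; hence \<open>x\<close> is required to be alive.\<close>

lemma ball_sets:
 assumes t: "0 \<le> t" and \<rho>: "0 < \<rho>"
 shows "{w\<in>space M. x \<in> alive (\<tau> w) t \<and> y \<in> genealogical_ball (\<tau> w) t \<rho> x} \<in> sets M"
proof -
 have "{w\<in>space M. x \<in> alive (\<tau> w) t \<and> y \<in> genealogical_ball (\<tau> w) t \<rho> x} =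
  {w\<in>space M. x \<in> alive (\<tau> w) t \<and> y \<in> alive (\<tau> w) t \<and> (x = y \<or> t - shared_time (\<tau> w) x y < \<rho>)}"
 proof (intro Collect_cong conj_cong refl)
  fix w assume "w \<in> space M" "x \<in> alive (\<tau> w) t"
  then show "y \<in> genealogical_ball (\<tau> w) t \<rho> x \<longleftrightarrow> y \<in> alive (\<tau> w) t \<and> (x = y \<or> t - shared_time (\<tau> w) x y < \<rho>)"
   using gdist_same[of "\<tau> w" t x] gdist_distinct[of "\<tau> w" x t y] lifetime_pos t \<rho>
   by (cases "x = y") (auto simp: genealogical_ball_def)
 qed
 also have "\<dots> \<in> sets M" unfolding shared_time_def by measurable
 finally show ?thesis .
qed

lemma local_maxima_sets:
 assumes t: "0 \<le> t" and \<rho>: "0 < \<rho>"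
 shows "{w\<in>space M. x \<in> local_maxima (\<tau> w) (h w) t \<rho>} \<in> sets M"
proof -
 note [measurable] = ball_sets[OF t \<rho>] height_measurable[OF t]
 have "{w\<in>space M. x \<in> local_maxima (\<tau> w) (h w) t \<rho>} =
  {w\<in>space M. x \<in> alive (\<tau> w) t \<and> (\<forall>y. x \<in> alive (\<tau> w) t \<and> y \<in> genealogical_ball (\<tau> w) t \<rho> x \<longrightarrow> h w t y \<le> h w t x)}"
  by (auto simp: local_maxima_def)
 also have "\<dots> \<in> sets M" by measurable
 finally show ?thesis .
qed

lemma marked_process_emeasure:
 assumes w: "w \<in> space M" and t: "0 \<le> t" and B: "B \<in> sets marked_borel"
 shows "emeasure (marked_process (\<tau> w) (h w) t \<rho>) B =
  of_nat (card {x\<in>local_maxima (\<tau> w) (h w) t \<rho>. (h w t x - m_centre t, cluster (\<tau> w) (h w) t \<rho> x) \<in> B})"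
 unfolding marked_process_def using B finite_local_maxima[OF w t] cluster_in_space[OF w t]
 by (subst emeasure_distr_count) (auto simp: emeasure_count_space_finite space_marked_borel)

text \<open>Done by hand through cardinalities of random sets of labels, because the marked process
  at time \<open>t\<close> is not known to be a measurable map into its topological space.\<close>

lemma marked_count_measurable:
 assumes t: "0 \<le> t" and \<rho>: "0 < \<rho>"
 shows "(\<lambda>w. emeasure (marked_process (\<tau> w) (h w) t \<rho>) (at_least v j)) \<in> borel_measurable M"
  and "(\<lambda>w. emeasure (marked_process (\<tau> w) (h w) t \<rho>) ({- v..} \<times> cluster_space)) \<in> borel_measurable M"
  and "(\<lambda>w. emeasure (level_process (\<tau> w) (h w) t) {- v..}) \<in> borel_measurable M"
proof -
 note [measurable] = ball_sets[OF t \<rho>] height_measurable[OF t] local_maxima_sets[OF t \<rho>] alive_sets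
 let ?B = "\<lambda>w. genealogical_ball (\<tau> w) t \<rho>"
 have card: "(\<lambda>w. of_nat (card {y. x \<in> alive (\<tau> w) t \<and> y \<in> ?B w x \<and> - v \<le> h w t y - m_centre t}) :: ennreal) \<in> borel_measurable M" for x
 proof (rule random_card_measurable)
  show "finite {y. x \<in> alive (\<tau> w) t \<and> y \<in> ?B w x \<and> - v \<le> h w t y - m_centre t}" if "w \<in> space M" for w
   by (rule finite_subset[OF _ finite_ball[OF that t]]) auto
  fix y
  have "{w\<in>space M. y \<in> {y. x \<in> alive (\<tau> w) t \<and> y \<in> ?B w x \<and> - v \<le> h w t y - m_centre t}} =
   {w\<in>space M. (x \<in> alive (\<tau> w) t \<and> y \<in> ?B w x) \<and> - v \<le> h w t y - m_centre t}" by auto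
  also have "\<dots> \<in> sets M" by measurable
  finally show "{w\<in>space M. y \<in> {y. x \<in> alive (\<tau> w) t \<and> y \<in> ?B w x \<and> - v \<le> h w t y - m_centre t}} \<in> sets M" .
 qed
 let ?A = "\<lambda>w. {x\<in>local_maxima (\<tau> w) (h w) t \<rho>. (h w t x - m_centre t, cluster (\<tau> w) (h w) t \<rho> x) \<in> at_least v j}"
 have "(\<lambda>w. of_nat (card (?A w)) :: ennreal) \<in> borel_measurable M"
 proof (rule random_card_measurable)
  show "finite (?A w)" if "w \<in> space M" for w using finite_local_maxima[OF that t] by simp
  fix x
  have "{w\<in>space M. x \<in> ?A w} = {w\<in>space M. x \<in> local_maxima (\<tau> w) (h w) t \<rho> \<and>
   of_nat j \<le> (of_nat (card {y. x \<in> alive (\<tau> w) t \<and> y \<in> ?B w x \<and> - v \<le> h w t y - m_centre t}) :: ennreal)}"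
   using cluster_in_space[OF _ t] level_count_cluster[OF _ t]
   by (auto simp: at_least_def space_marked_borel local_maxima_def ennreal_of_nat_eq_real_of_nat)
  also have "\<dots> \<in> sets M" using card by measurable
  finally show "{w\<in>space M. x \<in> ?A w} \<in> sets M" .
 qed
 then show "(\<lambda>w. emeasure (marked_process (\<tau> w) (h w) t \<rho>) (at_least v j)) \<in> borel_measurable M"
  using marked_process_emeasure[OF _ t at_least_sets] by (simp cong: measurable_cong)
 let ?A = "\<lambda>w. {x\<in>local_maxima (\<tau> w) (h w) t \<rho>. - v \<le> h w t x - m_centre t}"
 have "(\<lambda>w. of_nat (card (?A w)) :: ennreal) \<in> borel_measurable M"
 proof (rule random_card_measurable)
  show "finite (?A w)" if "w \<in> space M" for w using finite_local_maxima[OF that t] by simp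
  show "{w\<in>space M. x \<in> ?A w} \<in> sets M" for x by simp
 qed
 moreover have "emeasure (marked_process (\<tau> w) (h w) t \<rho>) ({- v..} \<times> cluster_space) = of_nat (card (?A w))" if "w \<in> space M" for w
  unfolding marked_process_emeasure[OF that t half_space_marked] using cluster_in_space[OF that t]
  by (intro arg_cong[where f=of_nat] arg_cong[where f=card]) auto
 ultimately show "(\<lambda>w. emeasure (marked_process (\<tau> w) (h w) t \<rho>) ({- v..} \<times> cluster_space)) \<in> borel_measurable M"
  by (simp cong: measurable_cong)
 let ?A = "\<lambda>w. {x\<in>alive (\<tau> w) t. - v \<le> h w t x - m_centre t}"
 have "(\<lambda>w. of_nat (card (?A w)) :: ennreal) \<in> borel_measurable M"
 proof (rule random_card_measurable)
  show "finite (?A w)" if "w \<in> space M" for w using finite_alive[OF that t] by simp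
  show "{w\<in>space M. x \<in> ?A w} \<in> sets M" for x by simp
 qed
 moreover have "emeasure (level_process (\<tau> w) (h w) t) {- v..} = of_nat (card (?A w))" if "w \<in> space M" for w
  unfolding level_process_def using finite_alive[OF that t]
  by (subst emeasure_distr_count) (auto simp: emeasure_count_space_finite)
 ultimately show "(\<lambda>w. emeasure (level_process (\<tau> w) (h w) t) {- v..}) \<in> borel_measurable M"
  by (simp cong: measurable_cong)
qed

text \<open>Ties between local maxima make the cluster level larger than the number of particles,
  which is the harmless direction for a lower bound of the quotient.\<close>

lemma level_process_le:
 assumes w: "w \<in> space M" and t: "0 \<le> t" and \<rho>: "0 < \<rho>"
 shows "emeasure (level_process (\<tau> w) (h w) t) {- v..} \<le> cluster_level (marked_process (\<tau> w) (h w) t \<rho>) {- v..} UNIV"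
proof -
 let ?m = "m_centre t"
 note fin = finite_alive[OF w t] finite_ball[OF w t, of \<rho>]
 have s: "real (card {x\<in>A. - v \<le> h w t x - ?m}) = (\<Sum>x\<in>A. indicator {- v..} (h w t x - ?m))" if "finite A" for A
  using that by (simp add: indicator_def of_bool_def sum.If_cases Int_def)
 have "emeasure (level_process (\<tau> w) (h w) t) {- v..} = of_nat (card {x\<in>alive (\<tau> w) t. - v \<le> h w t x - ?m})"
  unfolding level_process_def using fin by (subst emeasure_distr_count) (auto simp: emeasure_count_space_finite)
 also have "\<dots> = ennreal (\<Sum>x\<in>alive (\<tau> w) t. indicator {- v..} (h w t x - ?m))"
  unfolding s[OF fin(1), symmetric] by (simp add: ennreal_of_nat_eq_real_of_nat)
 also have "\<dots> \<le> ennreal (\<Sum>x\<in>local_maxima (\<tau> w) (h w) t \<rho>. \<Sum>y\<in>genealogical_ball (\<tau> w) t \<rho> x. indicator {- v..} (h w t y - ?m))"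
  by (intro ennreal_leI sum_alive_le w t \<rho>) simp
 also have "\<dots> = cluster_level (marked_process (\<tau> w) (h w) t \<rho>) {- v..} UNIV"
  unfolding cluster_level_UNIV[OF marked_process_in_space[OF w t]] integral_marked_process[OF w t level_count_measurable]
   level_count_cluster[OF w t] s[OF fin(2)] ..
 finally show ?thesis .
qed

lemma level_process_star_eq:
 assumes w: "w \<in> space M" and t: "0 \<le> t"
 shows "emeasure (level_process_star (\<tau> w) (h w) t \<rho>) {- v..} = max_level (marked_process (\<tau> w) (h w) t \<rho>) {- v..} UNIV"
 unfolding max_level_emeasure(2)[OF marked_process_in_space[OF w t] order_refl] marked_process_emeasure[OF w t half_space_marked] level_process_star_def
 using finite_local_maxima[OF w t, of \<rho>] cluster_in_space[OF w t]
 by (subst emeasure_distr_count) (auto simp: emeasure_count_space_finite intro!: arg_cong[where f=card])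

end

section \<open>The good event and its passage to finite times\<close>

context extremal_limit
begin

text \<open>Strict inequalities between continuous functionals, hence an open condition. Truncation
  at \<open>K\<close> and \<open>K'\<close> keeps the test functions bounded; the right sides are
  taken at level \<open>v - 1\<close> so that they stay below the sharp counts at level
  \<open>v\<close>.\<close>

definition good :: "real \<Rightarrow> nat \<Rightarrow> nat \<Rightarrow> real \<Rightarrow> (real \<times> real measure) measure \<Rightarrow> bool" where
 "good e K K' v X \<longleftrightarrow>
  (LINT p|X. min (real K) (cluster_sum (ramp v 1) p)) < e * (LINT p|X. min (real K') (cluster_sum (ramp (v - 1) 1) p)) \<and>
  (LINT p|X. clamp01 (cluster_sum (ramp v 1) p - (real K - 1))) < e * (LINT p|X. ramp (v - 1) 1 (fst p))"

text \<open>First \<open>K\<close> from the decay of the rates, then \<open>K'\<close> from the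
  divergence of their sum. The factors \<open>exp (sqrt 2)\<close> and \<open>exp (- sqrt 2)\<close>
  are the price of comparing the levels \<open>v + 1\<close> and \<open>v - 1\<close> with
  \<open>v\<close>.\<close>

lemma rate_constants:
 assumes e: "0 < e"
 obtains K K' :: nat where "1 \<le> K" "exp (sqrt 2) * tail_rate K < e * (exp (- sqrt 2) / sqrt 2)"
  "exp (sqrt 2) * (\<Sum>j=1..K. tail_rate j) < e * (exp (- sqrt 2) * (\<Sum>j=1..K'. tail_rate j))"
proof -
 have "(\<lambda>j. exp (sqrt 2) * tail_rate j) \<longlonglongrightarrow> exp (sqrt 2) * 0" by (intro tendsto_intros tail_rate_vanishes)
 then have "\<forall>\<^sub>F j in sequentially. exp (sqrt 2) * tail_rate j < e * (exp (- sqrt 2) / sqrt 2)"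
  by (rule order_tendstoD(2)) (use e in simp)
 then have "\<forall>\<^sub>F j in sequentially. 1 \<le> j \<and> exp (sqrt 2) * tail_rate j < e * (exp (- sqrt 2) / sqrt 2)"
  using eventually_ge_at_top[of 1] by eventually_elim simp
 then obtain K where K: "1 \<le> K" "exp (sqrt 2) * tail_rate K < e * (exp (- sqrt 2) / sqrt 2)"
  by (auto simp: eventually_sequentially)
 define B where "B = exp (sqrt 2) * (\<Sum>j=1..K. tail_rate j) / (e * exp (- sqrt 2))"
 have "\<exists>n. B < (\<Sum>j<n. tail_rate (Suc j))"
 proof (rule ccontr)
  assume "\<not> ?thesis"
  then have "(\<Sum>j<n. ennreal (tail_rate (Suc j))) \<le> ennreal B" for n
   by (auto simp: not_less sum_ennreal intro!: ennreal_leI)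
  then have "(\<Sum>j. ennreal (tail_rate (Suc j))) \<le> ennreal B" by (intro suminf_le_const) auto
  then show False using infinite_mean_cluster level_count_intensity by (simp add: top_unique)
 qed
 then obtain n where "B < (\<Sum>j<n. tail_rate (Suc j))" by blast
 also have "\<dots> = (\<Sum>j=1..n. tail_rate j)" by (simp add: sum.atLeast1_atMost_eq)
 finally show ?thesis using K e by (intro that[of K n]) (auto simp: B_def field_simps)
qed

text \<open>The conditions on continuous functionals follow from inequalities between sharp counts
  at the levels \<open>v + 1\<close> and \<open>v - 1\<close>. Each of these is a positive signed
  combination of counts, to which \<open>count_positive\<close> applies.\<close>

lemma good_probability:
 assumes e: "0 < e" and K: "1 \<le> K" "exp (sqrt 2) * tail_rate K < e * (exp (- sqrt 2) / sqrt 2)"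
  "exp (sqrt 2) * (\<Sum>j=1..K. tail_rate j) < e * (exp (- sqrt 2) * (\<Sum>j=1..K'. tail_rate j))" and \<delta>: "0 < \<delta>"
 shows "\<forall>\<^sub>F v in at_top. 1 - \<delta> < prob {w\<in>space M. good e K K' v (\<E> w)}"
proof -
 \<comment> \<open>Two families of counts in one signed sum: the first component shifts the level
   and selects the coefficient by its sign, the second is the threshold.\<close>
 let ?I = "{(-1 :: real)} \<times> {1..K'} \<union> {1} \<times> {1..K}" and ?c = "\<lambda>i :: real \<times> nat. if fst i < 0 then e else - 1"
 let ?S1 = "\<lambda>v w. \<Sum>i\<in>?I. ?c i * measure (\<E> w) (at_least (v + fst i) (snd i))"
 have split: "(\<Sum>i\<in>?I. ?c i * f i) = e * (\<Sum>j=1..K'. f (- 1, j)) - (\<Sum>j=1..K. f (1, j))" for f :: "real \<times> nat \<Rightarrow> real"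
 proof -
  have *: "sum g ({a} \<times> A) = (\<Sum>j\<in>A. g (a, j))" for g :: "real \<times> nat \<Rightarrow> real" and a A
   by (rule sum.reindex_cong[of "Pair a"]) (auto simp: inj_on_def)
  show ?thesis by (subst sum.union_disjoint) (auto simp: * sum_distrib_left sum_negf)
 qed
 have L1: "((\<lambda>v. prob {w\<in>space M. 0 < ?S1 v w}) \<longlongrightarrow> 1) at_top"
 proof (rule count_positive[where p="\<lambda>i. exp (sqrt 2 * fst i) * tail_rate (snd i)"])
  show "countable_set (- (v + fst i) - 1) (at_least (v + fst i) (snd i))" if "i \<in> ?I" for i v
   using that by (intro countable_at_least) auto
  show "measure intensity (at_least (v + fst i) (snd i)) = exp (sqrt 2 * v) * (exp (sqrt 2 * fst i) * tail_rate (snd i))" if "i \<in> ?I" for i v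
   using that by (subst intensity_at_least) (auto simp: exp_add[symmetric] algebra_simps)
  show "0 < (\<Sum>i\<in>?I. ?c i * (exp (sqrt 2 * fst i) * tail_rate (snd i)))"
   unfolding split using K(3) by (simp add: sum_distrib_left)
 qed (auto intro: Z_pos)
 let ?A = "\<lambda>b v. if b then at_least (v + 1) K else {- (v - 1)..} \<times> cluster_space"
 let ?S2 = "\<lambda>v w. \<Sum>b\<in>UNIV. (if b then - 1 else e) * measure (\<E> w) (?A b v)"
 have L2: "((\<lambda>v. prob {w\<in>space M. 0 < ?S2 v w}) \<longlongrightarrow> 1) at_top"
 proof (rule count_positive[where p="\<lambda>b. if b then exp (sqrt 2) * tail_rate K else exp (- sqrt 2) / sqrt 2" and a="\<lambda>b v. if b then - (v + 1) - 1 else - (v - 1)"])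
  show "countable_set (if b then - (v + 1) - 1 else - (v - 1)) (?A b v)" for b v
   using countable_at_least[OF K(1), of "v + 1"] countable_half_space[of "- (v - 1)"] by simp
  show "measure intensity (?A b v) = exp (sqrt 2 * v) * (if b then exp (sqrt 2) * tail_rate K else exp (- sqrt 2) / sqrt 2)" for b v
   using intensity_at_least[OF K(1), of "v + 1"] intensity_half_space_measure[of "v - 1"]
   by (auto simp: exp_add[symmetric] algebra_simps)
  show "0 < (\<Sum>b\<in>UNIV. (if b then - 1 else e) * (if b then exp (sqrt 2) * tail_rate K else exp (- sqrt 2) / sqrt 2))"
   using K(2) by (simp add: UNIV_bool)
 qed (auto intro: Z_pos)
 have "\<forall>\<^sub>F v in at_top. 1 - \<delta> / 2 < prob {w\<in>space M. 0 < ?S1 v w}" using \<delta> by (intro order_tendstoD(1)[OF L1]) auto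
 moreover have "\<forall>\<^sub>F v in at_top. 1 - \<delta> / 2 < prob {w\<in>space M. 0 < ?S2 v w}" using \<delta> by (intro order_tendstoD(1)[OF L2]) auto
 ultimately show ?thesis
 proof eventually_elim
  case (elim v)
  let ?P = "{w\<in>space M. 0 < ?S1 v w}" and ?Q = "{w\<in>space M. 0 < ?S2 v w}"
  have "(\<lambda>w. measure (\<E> w) (at_least (v + fst i) (snd i))) \<in> borel_measurable M" if "i \<in> ?I" for i
   using that by (intro countable_setD(3)[OF countable_at_least]) auto
  then have "?S1 v \<in> borel_measurable M" by (intro borel_measurable_sum borel_measurable_times) auto
  then have P: "?P \<in> sets M" by measurable
  have "(\<lambda>w. measure (\<E> w) (?A b v)) \<in> borel_measurable M" for b
   using countable_setD(3)[OF countable_at_least[OF K(1), of "v + 1"]] countable_setD(3)[OF countable_half_space[of "- (v - 1)"]] by simp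
  then have "?S2 v \<in> borel_measurable M" by (intro borel_measurable_sum borel_measurable_times) auto
  then have Q: "?Q \<in> sets M" by measurable
  have sub: "w \<in> {w\<in>space M. good e K K' v (\<E> w)}" if "w \<in> ?P \<inter> ?Q" for w
  proof -
   have w: "w \<in> space M" using that by simp
   have X: "\<E> w \<in> marked_point_space" by (rule \<E>_marked[OF w])
   note spX = space_marked_point[OF X]
   have iA: "integrable (\<E> w) (indicator (at_least u j) :: _ \<Rightarrow> real)" if "1 \<le> j" for u j
    using marked_point_finite[OF X at_least_sets at_least_subset[OF that]] by (intro integrable_real_indicator) (auto simp: sets_marked_point[OF X])
   have mA: "(LINT p|\<E> w. indicator (at_least u j) p) = measure (\<E> w) (at_least u j)" for u j
    using sets.sets_into_space[of "at_least u j" "\<E> w"] by (simp add: sets_marked_point[OF X] Int_absorb2)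
   have sA: "(LINT p|\<E> w. (\<Sum>j=1..k. indicator (at_least u j) p)) = (\<Sum>j=1..k. measure (\<E> w) (at_least u j))" for u k
    unfolding mA[symmetric] by (intro Bochner_Integration.integral_sum iA) auto
   have isA: "integrable (\<E> w) (\<lambda>p. \<Sum>j=1..k. indicator (at_least u j) p :: real)" for u k
    by (intro Bochner_Integration.integrable_sum iA) auto
   have "(LINT p|\<E> w. min (real K) (cluster_sum (ramp v 1) p)) \<le> (\<Sum>j=1..K. measure (\<E> w) (at_least (v + 1) j))"
    unfolding sA[symmetric]
   proof (intro integral_mono test_fun_integrable[OF X test_fun_count] isA)
    fix p assume "p \<in> space (\<E> w)"
    then obtain u C where p: "p = (u, C)" "C \<in> cluster_space" by (auto simp: spX)
    show "min (real K) (cluster_sum (ramp v 1) p) \<le> (\<Sum>j=1..K. indicator (at_least (v + 1) j) p)"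
     unfolding p(1) min_level_count[OF p(2), symmetric] using level_count_bounds(2)[OF p(2), of v u] by auto
   qed
   also have "\<dots> < e * (\<Sum>j=1..K'. measure (\<E> w) (at_least (v - 1) j))"
    using that unfolding split by simp
   also have "\<dots> \<le> e * (LINT p|\<E> w. min (real K') (cluster_sum (ramp (v - 1) 1) p))"
    unfolding sA[symmetric]
   proof (intro mult_left_mono integral_mono test_fun_integrable[OF X test_fun_count] isA)
    fix p assume "p \<in> space (\<E> w)"
    then obtain u C where p: "p = (u, C)" "C \<in> cluster_space" by (auto simp: spX)
    show "(\<Sum>j=1..K'. indicator (at_least (v - 1) j) p) \<le> min (real K') (cluster_sum (ramp (v - 1) 1) p)"
     unfolding p(1) min_level_count[OF p(2), symmetric] using level_count_bounds(1)[OF p(2), of "v - 1" u] by auto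
   qed (use e in auto)
   finally have 1: "(LINT p|\<E> w. min (real K) (cluster_sum (ramp v 1) p)) < e * (LINT p|\<E> w. min (real K') (cluster_sum (ramp (v - 1) 1) p))" .
   have "(LINT p|\<E> w. clamp01 (cluster_sum (ramp v 1) p - (real K - 1))) \<le> (LINT p|\<E> w. indicator (at_least (v + 1) K) p)"
   proof (intro integral_mono test_fun_integrable[OF X test_fun_large] iA K)
    fix p assume "p \<in> space (\<E> w)"
    then obtain u C where p: "p = (u, C)" "C \<in> cluster_space" by (auto simp: spX)
    obtain n :: nat where "level_count (v + 1) (u, C) = real n" using level_count_nat[OF p(2)] by blast
    then show "clamp01 (cluster_sum (ramp v 1) p - (real K - 1)) \<le> indicator (at_least (v + 1) K) p"
     using p level_count_bounds(2)[OF p(2), of v u] by (auto simp: at_least_def space_marked_borel clamp01_def indicator_def)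
   qed
   also have "\<dots> < e * measure (\<E> w) ({- (v - 1)..} \<times> cluster_space)"
    unfolding mA using that by (simp add: UNIV_bool)
   also have "measure (\<E> w) ({- (v - 1)..} \<times> cluster_space) = (LINT p|\<E> w. indicator ({- (v - 1)..} \<times> cluster_space) p)"
    using spX by (simp add: Int_absorb2 Times_Int_Times)
   also have "e * \<dots> \<le> e * (LINT p|\<E> w. ramp (v - 1) 1 (fst p))"
   proof (intro mult_left_mono integral_mono test_fun_integrable[OF X test_fun_ramp] integrable_real_indicator)
    show "emeasure (\<E> w) ({- (v - 1)..} \<times> cluster_space) < \<infinity>" by (rule marked_point_finite[OF X half_space_marked order_refl])
    show "indicator ({- (v - 1)..} \<times> cluster_space) p \<le> ramp (v - 1) 1 (fst p)" for p :: "real \<times> real measure"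
     by (auto simp: indicator_def ramp_def)
   qed (use e in \<open>auto simp: sets_marked_point[OF X]\<close>)
   finally show ?thesis using 1 w by (simp add: good_def)
  qed
  have "prob ?P + prob ?Q - 1 \<le> prob (?P \<inter> ?Q)"
  proof -
   have "prob (?P \<union> ?Q) = prob ?P + prob ?Q - prob (?P \<inter> ?Q)" by (intro measure_Un3) (use P Q in \<open>simp_all only: fmeasurable_eq_sets\<close>)
   then show ?thesis using prob_le_1[of "?P \<union> ?Q"] by linarith
  qed
  also have "\<dots> \<le> prob {w\<in>space M. good e K K' v (\<E> w)}"
  proof (rule finite_measure_mono)
   show "?P \<inter> ?Q \<subseteq> {w\<in>space M. good e K K' v (\<E> w)}" using sub by blast
   show "{w\<in>space M. good e K K' v (\<E> w)} \<in> sets M"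
    unfolding good_def using \<E>_integral_measurable[OF test_fun_count] \<E>_integral_measurable[OF test_fun_large[OF K(1)]] \<E>_integral_measurable[OF test_fun_ramp]
    by measurable
  qed
  finally show ?case using elim by linarith
 qed
qed

text \<open>The indicator of the open event is the limit from below of products of
  \<open>clamp01\<close>, applied to \<open>k\<close> times the two gaps. Each product is a
  continuous functional, so its expectation carries over to large \<open>t\<close>. Quantifying over
  measurable \<open>S\<close> that contain the event avoids its measurability at time
  \<open>t\<close>.\<close>

lemma good_transfer:
 assumes K: "1 \<le> K" and c: "c < prob {w\<in>space M. good e K K' v (\<E> w)}"
 shows "\<forall>\<^sub>F t in at_top. \<forall>S\<in>sets M. (\<forall>w\<in>space M. good e K K' v (X_proc t w) \<longrightarrow> w \<in> S) \<longrightarrow> c < prob S"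
proof -
 let ?U = "\<lambda>p. min (real K) (cluster_sum (ramp v 1) p)" and ?L = "\<lambda>p. min (real K') (cluster_sum (ramp (v - 1) 1) p)"
  and ?S = "\<lambda>p. clamp01 (cluster_sum (ramp v 1) p - (real K - 1))" and ?P = "\<lambda>p :: real \<times> real measure. ramp (v - 1) 1 (fst p)"
 note tf = test_fun_count[of v K] test_fun_count[of "v - 1" K'] test_fun_large[OF K, of v] test_fun_ramp[of "v - 1"]
 let ?f = "\<lambda>(k :: nat) p. real k * (e * ?L p - ?U p)" and ?g = "\<lambda>(k :: nat) p. real k * (e * ?P p - ?S p)"
 have int: "(LINT p|X. ?f k p) = real k * (e * integral\<^sup>L X ?L - integral\<^sup>L X ?U)" "(LINT p|X. ?g k p) = real k * (e * integral\<^sup>L X ?P - integral\<^sup>L X ?S)"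
  if "X \<in> marked_point_space" for X k
  using tf[THEN test_fun_integrable[OF that]] by simp_all
 note [measurable] = tf[THEN \<E>_integral_measurable]
 have z: "clamp01 (real k * a) = 0" if "\<not> 0 < a" for k a
  using that mult_nonneg_nonpos[of "real k" a] by (auto simp: clamp01_def)
 let ?G = "{w\<in>space M. good e K K' v (\<E> w)}"
 let ?i = "\<lambda>k w. clamp01 (LINT p|\<E> w. ?f k p) * clamp01 (LINT p|\<E> w. ?g k p)"
 have G: "?G \<in> sets M" unfolding good_def by measurable
 have "(\<lambda>k. \<integral>w. ?i k w \<partial>M) \<longlonglongrightarrow> (LINT w|M. indicator ?G w)"
 proof (rule integral_dominated_convergence[where w="\<lambda>_. 1"])
  have cl: "(\<lambda>k. clamp01 (real k * a)) \<longlonglongrightarrow> (if 0 < a then 1 else 0)" for a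
  proof (cases "0 < a")
   case True
   have "\<forall>\<^sub>F k in sequentially. 1 / a \<le> real k"
    using eventually_ge_at_top[of "nat \<lceil>1 / a\<rceil>"] by eventually_elim linarith
   then have "\<forall>\<^sub>F k in sequentially. 1 = clamp01 (real k * a)"
    using True by (auto elim!: eventually_mono simp: clamp01_def field_simps)
   then show ?thesis using True by (simp add: Lim_transform_eventually[OF tendsto_const])
  next
   case False
   then show ?thesis by (simp add: z)
  qed
  show "AE w in M. (\<lambda>k. ?i k w) \<longlonglongrightarrow> indicator ?G w"
  proof (rule AE_I2)
   fix w assume w: "w \<in> space M"
   have "indicator ?G w = (if 0 < e * (LINT p|\<E> w. ?L p) - (LINT p|\<E> w. ?U p) then 1 else 0) * (if 0 < e * (LINT p|\<E> w. ?P p) - (LINT p|\<E> w. ?S p) then 1 else (0 :: real))"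
    using w by (simp add: indicator_def good_def)
   then show "(\<lambda>k. ?i k w) \<longlonglongrightarrow> indicator ?G w"
    unfolding int[OF \<E>_marked[OF w]] by (simp only:) (intro tendsto_mult cl)
  qed
  have "(\<lambda>w. \<integral>p. ?f k p \<partial>\<E> w) \<in> borel_measurable M" "(\<lambda>w. \<integral>p. ?g k p \<partial>\<E> w) \<in> borel_measurable M" for k
   by (rule \<E>_integral_measurable[OF test_fun_combination[OF tf(2,1)]] \<E>_integral_measurable[OF test_fun_combination[OF tf(4,3)]])+
  then show "(\<lambda>w. ?i k w) \<in> borel_measurable M" for k unfolding clamp01_def by measurable
 qed (use G in \<open>auto simp: abs_mult intro!: mult_le_one\<close>)
 then have "(\<lambda>k. \<integral>w. ?i k w \<partial>M) \<longlonglongrightarrow> prob ?G" by (simp add: Int_absorb2)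
 then have "\<forall>\<^sub>F k in sequentially. c < (LINT w|M. ?i k w)" using c by (rule order_tendstoD(1))
 then obtain k where "c < (LINT w|M. ?i k w)" by (auto simp: eventually_sequentially)
 then have "\<forall>\<^sub>F t in at_top. c < (LINT w|M. clamp01 (LINT p|X_proc t w. ?f k p) * clamp01 (LINT p|X_proc t w. ?g k p))"
  by (rule order_tendstoD(1)[OF weak_limit_marked[OF test_fun_combination[OF tf(2,1)] test_fun_combination[OF tf(4,3)]]])
 then show ?thesis using eventually_ge_at_top[of 0]
 proof (eventually_elim, intro ballI impI)
  fix t S assume el: "c < (LINT w|M. clamp01 (LINT p|X_proc t w. ?f k p) * clamp01 (LINT p|X_proc t w. ?g k p))" "0 \<le> t"
   and S: "S \<in> sets M" "\<forall>w\<in>space M. good e K K' v (X_proc t w) \<longrightarrow> w \<in> S"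
  have "(LINT w|M. clamp01 (LINT p|X_proc t w. ?f k p) * clamp01 (LINT p|X_proc t w. ?g k p)) \<le> prob S"
  proof (rule integral_le_prob[OF S(1)])
   fix w assume w: "w \<in> space M"
   have X: "X_proc t w \<in> marked_point_space" unfolding X_proc_def by (rule marked_process_in_space[OF w el(2)])
   show "clamp01 (LINT p|X_proc t w. ?f k p) * clamp01 (LINT p|X_proc t w. ?g k p) \<le> indicator S w"
   proof (cases "good e K K' v (X_proc t w)")
    case True then show ?thesis using S(2) w by (simp add: mult_le_one)
   next
    case False
    have "clamp01 (LINT p|X_proc t w. ?f k p) = 0 \<or> clamp01 (LINT p|X_proc t w. ?g k p) = 0"
     unfolding int[OF X] using False by (auto simp: good_def intro!: z)
    then show ?thesis by auto
   qed
  qed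
  then show "c < prob S" using el(1) by simp
 qed
qed

lemma clusters_dominate:
 assumes \<epsilon>: "0 < \<epsilon>"
 shows "\<forall>\<^sub>F v in at_top. \<exists>G\<in>sets marked_borel.
  measure M {w\<in>space M.
   cluster_level (\<E> w) {-v..} G / cluster_level (\<E> w) {-v..} UNIV \<ge> ennreal (1 - \<epsilon>) \<and>
   max_level (\<E> w) {-v..} G / max_level (\<E> w) {-v..} UNIV < ennreal \<epsilon>} \<ge> 1 - \<epsilon> \<and>
  (\<forall>\<^sub>F t in at_top. measure M {w\<in>space M.
   cluster_level (marked_process (\<tau> w) (h w) t (r t)) {-v..} G / emeasure (level_process (\<tau> w) (h w) t) {-v..} \<ge> ennreal (1 - \<epsilon>) \<and>
   max_level (marked_process (\<tau> w) (h w) t (r t)) {-v..} G / emeasure (level_process_star (\<tau> w) (h w) t (r t)) {-v..} < ennreal \<epsilon>} \<ge> 1 - \<epsilon>)"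
proof -
 \<comment> \<open>\<open>good_configuration\<close> needs \<open>e < 1\<close>, and a smaller
   tolerance only strengthens the claim.\<close>
 define e where "e = min \<epsilon> (1 / 2)"
 have e: "0 < e" "e < 1" "e \<le> \<epsilon>" using \<epsilon> by (auto simp: e_def)
 obtain K K' :: nat where K: "1 \<le> K" "exp (sqrt 2) * tail_rate K < e * (exp (- sqrt 2) / sqrt 2)"
  "exp (sqrt 2) * (\<Sum>j=1..K. tail_rate j) < e * (exp (- sqrt 2) * (\<Sum>j=1..K'. tail_rate j))"
  by (rule rate_constants[OF e(1)])
 have le: "ennreal (1 - \<epsilon>) \<le> ennreal (1 - e)" "ennreal e \<le> ennreal \<epsilon>" using e by (auto intro: ennreal_leI)
 show ?thesis using good_probability[OF e(1) K \<epsilon>]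
 proof eventually_elim
  case (elim v)
  let ?G = "at_least v K"
  show ?case
  proof (intro bexI[of _ ?G] conjI at_least_sets)
   let ?S = "{w\<in>space M.
    cluster_level (\<E> w) {-v..} ?G / cluster_level (\<E> w) {-v..} UNIV \<ge> ennreal (1 - \<epsilon>) \<and>
    max_level (\<E> w) {-v..} ?G / max_level (\<E> w) {-v..} UNIV < ennreal \<epsilon>}"
   have "(\<lambda>w. emeasure (\<E> w) A) \<in> borel_measurable M" if "countable_set a A" for a A
   proof -
    note [measurable] = countable_setD(3)[OF that]
    have "(\<lambda>w. ennreal (measure (\<E> w) A)) \<in> borel_measurable M" by measurable
    moreover have "ennreal (measure (\<E> w) A) = emeasure (\<E> w) A" if w: "w \<in> space M" for w
     using marked_point_finite[OF \<E>_marked[OF w] countable_setD(1,2)[OF \<open>countable_set a A\<close>]] by (simp add: emeasure_eq_ennreal_measure less_top)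
    ultimately show ?thesis by (simp cong: measurable_cong)
   qed
   note m [measurable] = this[OF countable_at_least[OF K(1)]] this[OF countable_half_space] this[OF countable_at_least[of "max k (Suc j)" for k j]]
   \<comment> \<open>Written with series of counts, the event is visibly measurable, as the
     monotonicity of the probability requires.\<close>
   have "?S = {w\<in>space M.
    (\<Sum>j. emeasure (\<E> w) (at_least v (max K (Suc j)))) / (\<Sum>j. emeasure (\<E> w) (at_least v (max 0 (Suc j)))) \<ge> ennreal (1 - \<epsilon>) \<and>
    emeasure (\<E> w) ?G / emeasure (\<E> w) ({- v..} \<times> cluster_space) < ennreal \<epsilon>}"
    using cluster_level_sum[OF \<E>_marked] max_level_emeasure[OF \<E>_marked K(1)] by (intro Collect_cong conj_cong refl) simp_all
   also have "\<dots> \<in> sets M" by measurable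
   finally have "prob {w\<in>space M. good e K K' v (\<E> w)} \<le> prob ?S"
    using le good_configuration[OF \<E>_marked e(1,2) K(1) _ _ order_refl, of _ v K']
    by (intro finite_measure_mono) (auto simp: good_def intro: order_trans less_le_trans)
   then show "1 - \<epsilon> \<le> prob ?S" using elim by simp
   show "\<forall>\<^sub>F t in at_top. 1 - \<epsilon> \<le> prob {w\<in>space M.
    cluster_level (marked_process (\<tau> w) (h w) t (r t)) {-v..} ?G / emeasure (level_process (\<tau> w) (h w) t) {-v..} \<ge> ennreal (1 - \<epsilon>) \<and>
    max_level (marked_process (\<tau> w) (h w) t (r t)) {-v..} ?G / emeasure (level_process_star (\<tau> w) (h w) t (r t)) {-v..} < ennreal \<epsilon>}"
    using good_transfer[OF K(1) elim] eventually_ge_at_top[of 0]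
   proof eventually_elim
    case (elim t)
    let ?X = "\<lambda>w. marked_process (\<tau> w) (h w) t (r t)"
    let ?S = "{w\<in>space M. cluster_level (?X w) {-v..} ?G / emeasure (level_process (\<tau> w) (h w) t) {-v..} \<ge> ennreal (1 - \<epsilon>) \<and>
     max_level (?X w) {-v..} ?G / emeasure (level_process_star (\<tau> w) (h w) t (r t)) {-v..} < ennreal \<epsilon>}"
    note r = r_pos[OF elim(2)] and X = marked_process_in_space[OF _ elim(2)]
    note [measurable] = marked_count_measurable[OF elim(2) r]
    have "?S = {w\<in>space M.
     (\<Sum>j. emeasure (?X w) (at_least v (max K (Suc j)))) / emeasure (level_process (\<tau> w) (h w) t) {-v..} \<ge> ennreal (1 - \<epsilon>) \<and>
     emeasure (?X w) ?G / emeasure (?X w) ({- v..} \<times> cluster_space) < ennreal \<epsilon>}"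
     using cluster_level_sum(1)[OF X] max_level_emeasure[OF X K(1)] level_process_star_eq[OF _ elim(2)]
     by (intro Collect_cong conj_cong refl) simp_all
    also have "\<dots> \<in> sets M" by measurable
    finally have "?S \<in> sets M" .
    moreover have "w \<in> ?S" if "w \<in> space M" "good e K K' v (X_proc t w)" for w
     using that le good_configuration[OF X[OF that(1)] e(1,2) K(1) _ _ level_process_le[OF that(1) elim(2) r], of v K']
     by (auto simp: good_def X_proc_def level_process_star_eq[OF that(1) elim(2)] intro: order_trans less_le_trans)
    ultimately show ?case using elim(1) by (intro less_imp_le) blast
   qed
  qed
 qed
qed

end

theorem corollary1p3:
  fixes M :: "'w measure"
    and \<tau> :: "'w \<Rightarrow> particle \<Rightarrow> real"
    and h :: "'w \<Rightarrow> real \<Rightarrow> particle \<Rightarrow> real"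
    and r :: "real \<Rightarrow> real"
    and C\<^sub>0 \<epsilon> :: real
    and Z :: "'w \<Rightarrow> real"
    and \<nu> :: "real measure measure"
    and \<E> :: "'w \<Rightarrow> (real \<times> real measure) measure"
  assumes bbm: "branching_brownian_motion M \<tau> h"
    and r_pos: "\<And>t. t \<ge> 0 \<Longrightarrow> r t > 0"
    and r_lim: "filterlim r at_top at_top"
    and t_minus_r_lim: "filterlim (\<lambda>t. t - r t) at_top at_top"
    and C\<^sub>0_pos: "C\<^sub>0 > 0"
    and Z_meas: "Z \<in> borel_measurable M"
    and Z_lim: "AE \<omega> in M. ((\<lambda>t. deriv_mart C\<^sub>0 (\<tau> \<omega>) (h \<omega>) t) \<longlongrightarrow> Z \<omega>) at_top"
    and \<nu>_prob: "prob_space \<nu>"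
    and \<nu>_sets: "sets \<nu> = sets cluster_borel"
    and \<E>_meas: "\<E> \<in> measurable M (borel_of_topology marked_point_topology)"
    and \<E>_poisson: "conditionally_poisson_process M (vimage_algebra (space M) Z borel) marked_borel
                      \<E> (\<lambda>\<omega>. limit_intensity \<nu> (Z \<omega>))"
    and \<E>_lim: "weakly_converges M (prod_topology marked_point_topology euclideanreal)
                  (\<lambda>t \<omega>. (marked_process (\<tau> \<omega>) (h \<omega>) t (r t), deriv_mart C\<^sub>0 (\<tau> \<omega>) (h \<omega>) t))
                  (\<lambda>\<omega>. (\<E> \<omega>, Z \<omega>))"
    and \<epsilon>_pos: "\<epsilon> > 0"
  shows "\<forall>\<^sub>F v in at_top. \<exists>G\<in>sets marked_borel.
           measure M {\<omega>\<in>space M.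
               cluster_level (\<E> \<omega>) {-v..} G / cluster_level (\<E> \<omega>) {-v..} UNIV \<ge> ennreal (1 - \<epsilon>) \<and>
               max_level (\<E> \<omega>) {-v..} G / max_level (\<E> \<omega>) {-v..} UNIV < ennreal \<epsilon>} \<ge> 1 - \<epsilon> \<and>
           (\<forall>\<^sub>F t in at_top.
             measure M {\<omega>\<in>space M.
               cluster_level (marked_process (\<tau> \<omega>) (h \<omega>) t (r t)) {-v..} G
                 / emeasure (level_process (\<tau> \<omega>) (h \<omega>) t) {-v..} \<ge> ennreal (1 - \<epsilon>) \<and>
               max_level (marked_process (\<tau> \<omega>) (h \<omega>) t (r t)) {-v..} G
                 / emeasure (level_process_star (\<tau> \<omega>) (h \<omega>) t (r t)) {-v..} < ennreal \<epsilon>} \<ge> 1 - \<epsilon>)"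
proof -
  interpret extremal_limit M \<tau> h r C\<^sub>0 Z \<nu> \<E>
    using assms by (intro extremal_limit.intro bbm.intro extremal_limit_axioms.intro)
  show ?thesis by (rule clusters_dominate[OF \<epsilon>_pos])
qed

end
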